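(* Let $s>3$. Consider the Hamiltonian $H=\Lambda+G$, where $$\Lambda=\sum_{j\in\mathbb{Z}_*}j|q_j|^2,\qquad G=\frac{1}{4\pi}\sum_{\substack{j,k,l,m\in\mathbb{Z}_*\\ j-k+l-m=0}}q_j\bar q_kq_l\bar q_m ,$$ and let $\Psi$ be the symplectic transformation, defined in a neighborhood of the origin, which puts $H$ into complete Birkhoff normal form of order four (specified in the context). There exists a real analytic symplectic coordinate transformation $\Phi$ defined in a neighborhood of the origin of $\ell^2_s$ such that $$H\circ\Psi\circ\Phi=\Lambda+B+K+\tilde R,$$ where $$B=-\frac{1}{4\pi}\sum_{j\in\mathbb{Z}_*}|q_j|^4+\frac{1}{2\pi}\Big(\sum_{j\in\mathbb{Z}_*}|q_j|^2\Big)^2,\qquad K=-\frac{1}{8\pi^2}\sum_{\substack{j,k\in\mathbb{Z}_*\\ j\ne k}}\frac{2j-k}{(j-k)^2}|q_j|^4|q_k|^2,$$ and $\tilde R$ is of order at least $8$ in $(q,\bar q)$ with $$\|X_{\tilde R}\|_{s-1}=O(\|q\|_s^7).$$ Moreover, $\tilde R$ is of the form $$\tilde R=\sum_{r\ge 4}\ \sum_{(j_1,\dots,j_{2r})\in\mathcal{M}_r}\tilde c(j_1,\dots,j_{2r})\,q_{j_1}\bar q_{j_2}\cdots q_{j_{2r-1}}\bar q_{j_{2r}}$$ with coefficients satisfying $$|\tilde c(j_1,\dots,j_{2r})|<\tilde C^r\Big(\frac{j_2^*j_3^*\cdots j_{2r}^*}{j_1^*}\Big)^{5/2},$$ where $\tilde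 C>0$ is a constant.
   Context: $\mathbb{Z}_*=\mathbb{Z}\setminus\{0\}$. For $s\ge 0$, $\ell^2_s$ is the Hilbert space of complex sequences $q=(q_j)_{j\in\mathbb{Z}_*}$ with $\|q\|_s^2=\sum_{j\in\mathbb{Z}_*}|q_j|^2|j|^{2s}<\infty$. The symplectic structure is $-\mathrm{i}\sum_{j\in\mathbb{Z}_*}j^{-1}\,dq_j\wedge d\bar q_j$. The Hamiltonian vector field of a function $F$ of $(q,\bar q)$ is $$X_F=-\mathrm{i}\sum_{j\in\mathbb{Z}_*}j\Big(\frac{\partial F}{\partial\bar q_j}\frac{\partial}{\partial q_j}-\frac{\partial F}{\partial q_j}\frac{\partial}{\partial\bar q_j}\Big),$$ so that the equations of motion are $\dot q_j=-\mathrm{i}j\,\partial F/\partial\bar q_j$, and the Poisson bracket is $$\{H,F\}=-\mathrm{i}\sum_{j\in\mathbb{Z}_*}j\Big(\frac{\partial H}{\partial q_j}\frac{\partial F}{\partial\bar q_j}-\frac{\partial H}{\partial\bar q_j}\frac{\partial F}{\partial q_j}\Big).$$ For a real-valued $F$, $\|X_F\|_{s-1}$ denotes the $\ell^2_{s-1}$-norm of the sequence of $q_j$-components $(-\mathrm{i}j\,\partial F/\partial\bar q_j)_{j\in\mathbb{Z}_*}$ (the $\bar q_j$-components are their complex conjugates), and $O(\cdot)$ is as $q\to0$ in $\ell^2_s$. For $r\geq 1$, $\mathcal{M}_r=\{(j_1,\dots,j_{2r})\in\mathbb{Z}_*^{2r}: j_1-j_2+\cdots+j_{2r-1}-j_{2r}=0\}$,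 and $j_1^*\ge j_2^*\ge\cdots\ge j_{2r}^*$ denotes the decreasing rearrangement (with multiplicity) of $|j_1|,|j_2|,\dots,|j_{2r}|$. The transformation $\Psi$: let $\Delta=\{(j,k,l,m)\in\mathbb{Z}_*^4: j-k+l-m=0,\ j\ne k,\ j\ne m\}$ and $$F=\frac{\mathrm{i}}{4\pi}\sum_{(j,k,l,m)\in\Delta}\frac{1}{j^2-k^2+l^2-m^2}\,q_j\bar q_kq_l\bar q_m .$$ Then $\Psi=X_F^1$ is the time-$1$ map of the flow of the Hamiltonian vector field $X_F$, defined in a neighborhood of the origin; it transforms $H$ into $H\circ\Psi=\Lambda+B+R$ with $R$ of order at least $6$. *)

theory Defs
  imports "HOL-Analysis.Analysis" "HOL-Library.Function_Algebras" "HOL-Library.Landau_Symbols"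
begin

section \<open>The spaces of sequences\<close>

definition Zstar :: "int set" where
  "Zstar = UNIV - {0}"

text \<open>A sequence indexed by the nonzero integers is a function on all integers that
  vanishes at 0. Sums, differences and the zero sequence are the pointwise ones of
  \<^theory>\<open>HOL-Library.Function_Algebras\<close>.\<close>

type_synonym cseq = "int \<Rightarrow> complex"

definition ell2 :: "real \<Rightarrow> cseq set" where
  "ell2 s = {q. q 0 = 0 \<and>
     (\<lambda>j. (cmod (q j))\<^sup>2 * \<bar>real_of_int j\<bar> powr (2 * s)) summable_on Zstar}"

definition ell2_norm :: "real \<Rightarrow> cseq \<Rightarrow> real" where
  "ell2_norm s q = sqrt (\<Sum>\<^sub>\<infinity>j\<in>Zstar. (cmod (q j))\<^sup>2 * \<bar>real_of_int j\<bar> powr (2 * s))"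

definition rscale :: "real \<Rightarrow> cseq \<Rightarrow> cseq" where
  "rscale c q = (\<lambda>j. of_real c * q j)"

definition ell2_top :: "real \<Rightarrow> cseq topology" where
  "ell2_top s = Metric_space.mtopology (ell2 s) (\<lambda>p q. ell2_norm s (p - q))"

lemma ell2_add_aux:
  assumes "x \<in> ell2 s" "y \<in> ell2 s"
  shows "x + y \<in> ell2 s \<and> ell2_norm s (x + y) \<le> ell2_norm s x + ell2_norm s y"
proof -
  define w where "w = (\<lambda>j::int. \<bar>real_of_int j\<bar> powr s)"
  define g where "g = (\<lambda>(q::cseq) j. (cmod (q j))\<^sup>2 * \<bar>real_of_int j\<bar> powr (2 * s))"
  have geq: "g q j = (cmod (q j) * w j)\<^sup>2" for q j
    unfolding g_def w_def by (simp add: power_mult_distrib power2_eq_square powr_add[symmetric])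
  have norm: "ell2_norm s q = sqrt (infsum (g q) Zstar)" for q
    unfolding ell2_norm_def g_def ..
  have sx: "g x summable_on Zstar" and sy: "g y summable_on Zstar"
    using assms by (auto simp: ell2_def g_def)
  have nn: "ell2_norm s q \<ge> 0" for q
    unfolding norm by (auto intro!: infsum_nonneg simp: geq)
  have part: "L2_set (\<lambda>j. cmod (q j) * w j) F \<le> ell2_norm s q"
    if "g q summable_on Zstar" "finite F" "F \<subseteq> Zstar" for q F
    unfolding L2_set_def norm real_sqrt_le_iff geq[symmetric]
    by (rule finite_sum_le_infsum) (use that in \<open>auto simp: geq\<close>)
  have bound: "sum (g (x + y)) F \<le> (ell2_norm s x + ell2_norm s y)\<^sup>2"
    if F: "finite F" "F \<subseteq> Zstar" for F
  proof -
    have "L2_set (\<lambda>j. cmod ((x + y) j) * w j) F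
        \<le> L2_set (\<lambda>j. cmod (x j) * w j + cmod (y j) * w j) F"
      by (rule L2_set_mono)
         (auto simp: w_def distrib_right[symmetric] norm_triangle_ineq intro!: mult_right_mono)
    also have "\<dots> \<le> L2_set (\<lambda>j. cmod (x j) * w j) F + L2_set (\<lambda>j. cmod (y j) * w j) F"
      by (rule L2_set_triangle_ineq)
    also have "\<dots> \<le> ell2_norm s x + ell2_norm s y"
      using part[OF sx F] part[OF sy F] by linarith
    finally have *: "L2_set (\<lambda>j. cmod ((x + y) j) * w j) F \<le> ell2_norm s x + ell2_norm s y" .
    have "sum (g (x + y)) F = (L2_set (\<lambda>j. cmod ((x + y) j) * w j) F)\<^sup>2"
      by (simp add: L2_set_def geq sum_nonneg)
    also have "\<dots> \<le> (ell2_norm s x + ell2_norm s y)\<^sup>2"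
      by (rule power_mono[OF *]) (rule L2_set_nonneg)
    finally show ?thesis .
  qed
  have sxy: "g (x + y) summable_on Zstar"
  proof (rule nonneg_bdd_above_summable_on)
    show "bdd_above (sum (g (x + y)) ` {F. F \<subseteq> Zstar \<and> finite F})"
      by (rule bdd_aboveI2[OF bound]) auto
  qed (simp add: geq)
  have "infsum (g (x + y)) Zstar \<le> (ell2_norm s x + ell2_norm s y)\<^sup>2"
    by (rule infsum_le_finite_sums[OF sxy]) (rule bound)
  then have "ell2_norm s (x + y) \<le> ell2_norm s x + ell2_norm s y"
    unfolding norm[of "x + y"] using nn[of x] nn[of y] by (intro real_le_lsqrt) auto
  moreover have "x + y \<in> ell2 s"
    using sxy assms by (auto simp: ell2_def g_def)
  ultimately show ?thesis by blast
qed

lemma ell2_metric: "Metric_space (ell2 s) (\<lambda>p q. ell2_norm s (p - q))"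
proof
  have neg: "- q \<in> ell2 s" if "q \<in> ell2 s" for q
    using that by (auto simp: ell2_def)
  have diff: "p - q \<in> ell2 s" if "p \<in> ell2 s" "q \<in> ell2 s" for p q
    using ell2_add_aux[of p s "- q"] that neg by simp
  fix x y z :: cseq
  show "0 \<le> ell2_norm s (x - y)"
    by (auto simp: ell2_norm_def intro!: infsum_nonneg)
  show "ell2_norm s (x - y) = ell2_norm s (y - x)"
    by (simp add: ell2_norm_def norm_minus_commute)
  {
    assume x: "x \<in> ell2 s" and y: "y \<in> ell2 s"
    show "ell2_norm s (x - y) = 0 \<longleftrightarrow> x = y"
    proof
      assume 0: "ell2_norm s (x - y) = 0"
      have "(cmod ((x - y) j))\<^sup>2 * \<bar>real_of_int j\<bar> powr (2 * s) = 0" if "j \<in> Zstar" for j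
        by (rule nonneg_infsum_le_0D[where A = Zstar])
           (use 0 that diff[OF x y] in \<open>auto simp: ell2_norm_def ell2_def\<close>)
      then have "x j = y j" for j
        using x y by (cases "j = 0") (auto simp: ell2_def Zstar_def)
      then show "x = y" by auto
    qed (simp add: ell2_norm_def)
    assume z: "z \<in> ell2 s"
    show "ell2_norm s (x - z) \<le> ell2_norm s (x - y) + ell2_norm s (y - z)"
      using ell2_add_aux[OF diff[OF x y] diff[OF y z]] by simp
  }
qed

section \<open>Real analytic symplectic coordinate transformations\<close>

text \<open>A bounded family of real multilinear maps: the value of \<open>a\<close> on a list of length \<open>n\<close> is an
  \<open>n\<close>-linear map, whose norm is at most \<open>C * \<rho> ^ n\<close>.\<close>

definition multilinear_family :: "real \<Rightarrow> (cseq list \<Rightarrow> cseq) \<Rightarrow> bool" where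
  "multilinear_family s a \<longleftrightarrow>
     (\<forall>vs\<in>lists (ell2 s). a vs \<in> ell2 s) \<and>
     (\<forall>xs\<in>lists (ell2 s). \<forall>ys\<in>lists (ell2 s). \<forall>v\<in>ell2 s. \<forall>w\<in>ell2 s.
        a (xs @ (v + w) # ys) = a (xs @ v # ys) + a (xs @ w # ys)) \<and>
     (\<forall>xs\<in>lists (ell2 s). \<forall>ys\<in>lists (ell2 s). \<forall>v\<in>ell2 s. \<forall>c.
        a (xs @ rscale c v # ys) = rscale c (a (xs @ v # ys))) \<and>
     (\<exists>C \<rho>. \<forall>vs\<in>lists (ell2 s).
        ell2_norm s (a vs) \<le> C * \<rho> ^ length vs * prod_list (map (ell2_norm s) vs))"

definition real_analytic_ell2 :: "real \<Rightarrow> (cseq \<Rightarrow> cseq) \<Rightarrow> cseq set \<Rightarrow> bool" where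
  "real_analytic_ell2 s f U \<longleftrightarrow>
     (\<forall>p\<in>U. \<exists>a \<delta>. multilinear_family s a \<and> \<delta> > 0 \<and>
        (\<forall>h\<in>ell2 s. ell2_norm s h < \<delta> \<longrightarrow>
           limitin (ell2_top s) (\<lambda>N. \<Sum>n<N. a (replicate n h)) (f (p + h)) sequentially))"

definition has_derivative_ell2 ::
    "real \<Rightarrow> (cseq \<Rightarrow> cseq) \<Rightarrow> (cseq \<Rightarrow> cseq) \<Rightarrow> cseq \<Rightarrow> bool" where
  "has_derivative_ell2 s f D p \<longleftrightarrow>
     (\<forall>v\<in>ell2 s. D v \<in> ell2 s) \<and>
     (\<forall>v\<in>ell2 s. \<forall>w\<in>ell2 s. D (v + w) = D v + D w) \<and>
     (\<forall>v\<in>ell2 s. \<forall>c. D (rscale c v) = rscale c (D v)) \<and>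
     (\<exists>C. \<forall>v\<in>ell2 s. ell2_norm s (D v) \<le> C * ell2_norm s v) \<and>
     limitin (ell2_top s) (\<lambda>h. rscale (1 / ell2_norm s h) (f (p + h) - f p - D h)) 0
       (atin (ell2_top s) 0)"

text \<open>The two-form \<open>-\<i> \<Sum>\<^sub>j j\<inverse> dq\<^sub>j \<and> d(cnj q\<^sub>j)\<close> evaluated at two tangent vectors.\<close>

definition symplectic_form :: "cseq \<Rightarrow> cseq \<Rightarrow> complex" where
  "symplectic_form v w =
     - \<i> * (\<Sum>\<^sub>\<infinity>j\<in>Zstar. (v j * cnj (w j) - w j * cnj (v j)) / of_int j)"

definition symplectic_on :: "real \<Rightarrow> (cseq \<Rightarrow> cseq) \<Rightarrow> cseq set \<Rightarrow> bool" where
  "symplectic_on s f U \<longleftrightarrow>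
     (\<forall>p\<in>U. \<exists>D. has_derivative_ell2 s f D p \<and>
        (\<forall>v\<in>ell2 s. \<forall>w\<in>ell2 s. symplectic_form (D v) (D w) = symplectic_form v w))"

text \<open>As usual for normal form transformations, a coordinate transformation near the origin
  fixes the origin.\<close>

definition analytic_symplectic_transformation ::
    "real \<Rightarrow> cseq set \<Rightarrow> (cseq \<Rightarrow> cseq) \<Rightarrow> bool" where
  "analytic_symplectic_transformation s U \<Phi> \<longleftrightarrow>
     openin (ell2_top s) U \<and> 0 \<in> U \<and> \<Phi> 0 = 0 \<and>
     inj_on \<Phi> U \<and> openin (ell2_top s) (\<Phi> ` U) \<and>
     real_analytic_ell2 s \<Phi> U \<and> real_analytic_ell2 s (inv_into U \<Phi>) (\<Phi> ` U) \<and>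
     symplectic_on s \<Phi> U"

section \<open>Hamiltonian vector fields and their flows\<close>

text \<open>With \<open>q\<^sub>j = x\<^sub>j + \<i> y\<^sub>j\<close>, the derivatives with respect to \<open>x\<^sub>j\<close> and \<open>y\<^sub>j\<close>.\<close>

definition dx :: "(cseq \<Rightarrow> complex) \<Rightarrow> int \<Rightarrow> cseq \<Rightarrow> complex" where
  "dx F j q = vector_derivative (\<lambda>t::real. F (q(j := q j + of_real t))) (at 0)"

definition dy :: "(cseq \<Rightarrow> complex) \<Rightarrow> int \<Rightarrow> cseq \<Rightarrow> complex" where
  "dy F j q = vector_derivative (\<lambda>t::real. F (q(j := q j + \<i> * of_real t))) (at 0)"

definition has_partials :: "(cseq \<Rightarrow> complex) \<Rightarrow> cseq \<Rightarrow> bool" where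
  "has_partials F q \<longleftrightarrow> (\<forall>j\<in>Zstar.
     (\<lambda>t::real. F (q(j := q j + of_real t))) differentiable (at 0) \<and>
     (\<lambda>t::real. F (q(j := q j + \<i> * of_real t))) differentiable (at 0))"

definition dqbar :: "(cseq \<Rightarrow> complex) \<Rightarrow> int \<Rightarrow> cseq \<Rightarrow> complex" where
  "dqbar F j q = (dx F j q + \<i> * dy F j q) / 2"

definition ham_vf :: "(cseq \<Rightarrow> complex) \<Rightarrow> cseq \<Rightarrow> cseq" where
  "ham_vf F q = (\<lambda>j. - \<i> * of_int j * dqbar F j q)"

definition integral_curve ::
    "real \<Rightarrow> (cseq \<Rightarrow> cseq) \<Rightarrow> real \<Rightarrow> (real \<Rightarrow> cseq) \<Rightarrow> bool" where
  "integral_curve s X T \<gamma> \<longleftrightarrow>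
     (\<forall>t\<in>{0..T}. \<gamma> t \<in> ell2 s \<and>
        limitin (ell2_top s) (\<lambda>u. rscale (1 / (u - t)) (\<gamma> u - \<gamma> t)) (X (\<gamma> t))
          (at t within {0..T}))"

definition flows_to :: "real \<Rightarrow> (cseq \<Rightarrow> cseq) \<Rightarrow> real \<Rightarrow> cseq \<Rightarrow> cseq \<Rightarrow> bool" where
  "flows_to s X T p p' \<longleftrightarrow> (\<exists>\<gamma>. integral_curve s X T \<gamma> \<and> \<gamma> 0 = p \<and> \<gamma> T = p')"

definition flow_domain :: "real \<Rightarrow> (cseq \<Rightarrow> cseq) \<Rightarrow> real \<Rightarrow> cseq set" where
  "flow_domain s X T = {p. \<exists>!p'. flows_to s X T p p'}"

definition flow_map :: "real \<Rightarrow> (cseq \<Rightarrow> cseq) \<Rightarrow> real \<Rightarrow> cseq \<Rightarrow> cseq" where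
  "flow_map s X T p = (THE p'. flows_to s X T p p')"

section \<open>The Hamiltonian and its normal form\<close>

definition Lam :: "cseq \<Rightarrow> complex" where
  "Lam q = (\<Sum>\<^sub>\<infinity>j\<in>Zstar. of_int j * of_real ((cmod (q j))\<^sup>2))"

definition G :: "cseq \<Rightarrow> complex" where
  "G q = 1 / (4 * of_real pi) *
     (\<Sum>\<^sub>\<infinity>(j, k, l, m)\<in>{(j, k, l, m). j \<in> Zstar \<and> k \<in> Zstar \<and> l \<in> Zstar \<and> m \<in> Zstar \<and>
          j - k + l - m = 0}.
        q j * cnj (q k) * q l * cnj (q m))"

definition H :: "cseq \<Rightarrow> complex" where
  "H q = Lam q + G q"

definition Delta :: "(int \<times> int \<times> int \<times> int) set" where
  "Delta = {(j, k, l, m). j \<in> Zstar \<and> k \<in> Zstar \<and> l \<in> Zstar \<and> m \<in> Zstar \<and>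
     j - k + l - m = 0 \<and> j \<noteq> k \<and> j \<noteq> m}"

definition F4 :: "cseq \<Rightarrow> complex" where
  "F4 q = \<i> / (4 * of_real pi) *
     (\<Sum>\<^sub>\<infinity>(j, k, l, m)\<in>Delta.
        1 / of_int (j\<^sup>2 - k\<^sup>2 + l\<^sup>2 - m\<^sup>2) * (q j * cnj (q k) * q l * cnj (q m)))"

definition Psi_domain :: "real \<Rightarrow> cseq set" where
  "Psi_domain s = flow_domain s (ham_vf F4) 1"

definition Psi :: "real \<Rightarrow> cseq \<Rightarrow> cseq" where
  "Psi s = flow_map s (ham_vf F4) 1"

definition B :: "cseq \<Rightarrow> complex" where
  "B q = - (1 / (4 * of_real pi)) * (\<Sum>\<^sub>\<infinity>j\<in>Zstar. of_real (cmod (q j) ^ 4)) +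
     1 / (2 * of_real pi) * (\<Sum>\<^sub>\<infinity>j\<in>Zstar. of_real ((cmod (q j))\<^sup>2))\<^sup>2"

definition K :: "cseq \<Rightarrow> complex" where
  "K q = - (1 / (8 * (of_real pi)\<^sup>2)) *
     (\<Sum>\<^sub>\<infinity>(j, k)\<in>{(j, k). j \<in> Zstar \<and> k \<in> Zstar \<and> j \<noteq> k}.
        of_int (2 * j - k) / of_int ((j - k)\<^sup>2) *
        of_real (cmod (q j) ^ 4 * (cmod (q k))\<^sup>2))"

text \<open>Multi-indices \<open>(j\<^sub>1, \<dots>, j\<^sub>2\<^sub>r)\<close> are lists; as list positions start at 0, the odd-numbered
  entries of the tuple are those at even positions.\<close>

definition M :: "nat \<Rightarrow> int list set" where
  "M r = {js. length js = 2 * r \<and> set js \<subseteq> Zstar \<and> (\<Sum>i<2 * r. (- 1) ^ i * js ! i) = 0}"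

definition monomial :: "int list \<Rightarrow> cseq \<Rightarrow> complex" where
  "monomial js q = (\<Prod>i<length js. if even i then q (js ! i) else cnj (q (js ! i)))"

definition jstar :: "int list \<Rightarrow> int list" where
  "jstar js = rev (sort (map abs js))"

definition jstar_ratio :: "int list \<Rightarrow> real" where
  "jstar_ratio js = of_int (prod_list (tl (jstar js))) / of_int (hd (jstar js))"

end

theory Submission
  imports Defs
begin

text \<open>All functions are power series with coefficients indexed by integer lists \<open>js\<close>. Let
  \<open>W = (\<Prod>\<bar>j\<bar>) / (max \<bar>j\<bar>)\<^sup>2\<close>. Coefficients bounded by \<open>A * \<rho> ^ length js * W\<^sup>2\<close> form a class that is
  stable under Lie derivatives along vector fields whose coefficient in the component \<open>n\<close> is at most a constant
  times \<open>(\<bar>n\<bar> * W)\<^sup>2\<close>, and the same bound makes such a field a bounded polynomial map of \<open>\<ell>\<^sup>2\<^sub>s\<close>, so that its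
  flow is that of an ordinary differential equation and composition with it is a convergent Lie series. As
  \<open>W \<ge> 1 / (2 * r)\<close> on \<open>M r\<close>, the bound by \<open>W\<^sup>2\<close> yields the one by \<open>W powr (5 / 2)\<close>.

  \<open>\<Phi>\<close> is the time-one map of the field that solves the homological equation for the terms of order six of
  \<open>H \<circ> \<Psi>\<close>. Its divisor is \<open>\<Omega> = a\<^sub>1\<^sup>2 + a\<^sub>2\<^sup>2 + a\<^sub>3\<^sup>2 - b\<^sub>1\<^sup>2 - b\<^sub>2\<^sup>2 - b\<^sub>3\<^sup>2\<close>. Where \<open>\<Omega> = 0\<close>, the
  symmetrised coefficient vanishes unless \<open>a\<close> and \<open>b\<close> are permutations of the same \<open>(j, j, k)\<close>, which leaves
  exactly \<open>K\<close>; elsewhere it is small enough, compared with \<open>\<Omega>\<close>, for the quotient to satisfy the bound on fields.\<close>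


section \<open>The Hilbert space of square summable sequences\<close>

text \<open>The symplectic form puts a factor \<open>j\<close> before the gradient, so
  \<open>Lam\<close> turns \<open>q j\<close> with frequency \<open>j\<^sup>2\<close> and the
  divisors are differences of squares. The same factor is the main obstacle: coefficients of size
  \<open>W\<^sup>2\<close> have a gradient that stays in \<open>ell2 s\<close>, but a vector field
  that loses one power of \<open>j\<close>. A generator can be flowed in \<open>ell2 s\<close> only
  if its coefficients beat the class by one power of the largest index, and the divisor has to
  supply that power. If the two largest indices lie on the same side, \<open>Om\<close> is quadratic
  in them; if they are distinct and on opposite sides, it is at least linear for large indices. If
  they are equal and on opposite sides, \<open>Om\<close> does not see them, and the gain comes from
  a cancellation inside \<open>Sg\<close> that only symmetrisation reveals. The exponent 2 of
  \<open>W\<close> fits substitution: replacing an index \<open>n\<close> by a block of indices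
  produces \<open>n ^ 4\<close>, two powers from the coefficient and two from the field, and this is
  the fourth power of one elementary inequality between maxima. Coefficients are otherwise left
  unsymmetric, since only values of forms on the diagonal matter.\<close>

lemma square_summable_add:
  fixes f g :: "'a \<Rightarrow> 'b::real_inner"
  assumes "(\<lambda>j. (norm (f j))\<^sup>2) summable_on A" "(\<lambda>j. (norm (g j))\<^sup>2) summable_on A"
  shows "(\<lambda>j. (norm (f j + g j))\<^sup>2) summable_on A"
proof (rule summable_on_comparison_test)
  show "(\<lambda>j. 2 * (norm (f j))\<^sup>2 + 2 * (norm (g j))\<^sup>2) summable_on A"
    by (intro summable_on_add summable_on_cmult_right assms)
  show "(norm (f j + g j))\<^sup>2 \<le> 2 * (norm (f j))\<^sup>2 + 2 * (norm (g j))\<^sup>2" for j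
  proof -
    have "0 \<le> (norm (f j - g j))\<^sup>2"
      by simp
    then show ?thesis
      by (simp add: power2_norm_eq_inner inner_simps inner_commute)
  qed
qed simp

lemma summable_on_inner:
  fixes f g :: "'a \<Rightarrow> 'b::real_inner"
  assumes "(\<lambda>j. (norm (f j))\<^sup>2) summable_on A" "(\<lambda>j. (norm (g j))\<^sup>2) summable_on A"
  shows "(\<lambda>j. inner (f j) (g j)) summable_on A"
proof -
  have "(\<lambda>j. 1/2 * ((norm (f j + g j))\<^sup>2 + (-1) * ((norm (f j))\<^sup>2 + (norm (g j))\<^sup>2))) summable_on A"
    by (intro summable_on_add summable_on_cmult_right assms square_summable_add)
  moreover have "1/2 * ((norm (f j + g j))\<^sup>2 + (-1) * ((norm (f j))\<^sup>2 + (norm (g j))\<^sup>2))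
      = inner (f j) (g j)" for j
    by (simp add: power2_norm_eq_inner inner_simps inner_commute)
  ultimately show ?thesis
    by simp
qed

text \<open>A type of its own gives access to derivatives, integrals and fixed points in normed
  spaces. The sets \<open>ell2 s\<close> for all \<open>s\<close> are isometric copies of it by
  \<open>emb\<close>.\<close>

typedef l2 = "{f :: int \<Rightarrow> complex. f 0 = 0 \<and> (\<lambda>j. (cmod (f j))\<^sup>2) summable_on UNIV}"
  morphisms coord Abs_l2
  by (rule exI[of _ "\<lambda>_. 0"]) simp

setup_lifting type_definition_l2

lemma coord_0 [simp]: "coord x 0 = 0"
  using coord[of x] by simp

lemma coord_summable: "(\<lambda>j. (cmod (coord x j))\<^sup>2) summable_on UNIV"
  using coord[of x] by simp

lemma l2_eqI: "(\<And>j. coord x j = coord y j) \<Longrightarrow> x = y"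
  by (metis coord_inject ext)

instantiation l2 :: real_inner
begin

lift_definition zero_l2 :: l2 is "\<lambda>_. 0" by simp

lift_definition plus_l2 :: "l2 \<Rightarrow> l2 \<Rightarrow> l2" is "\<lambda>f g j. f j + g j"
  by (auto intro: square_summable_add)

lift_definition uminus_l2 :: "l2 \<Rightarrow> l2" is "\<lambda>f j. - f j"
  by simp

lift_definition minus_l2 :: "l2 \<Rightarrow> l2 \<Rightarrow> l2" is "\<lambda>f g j. f j - g j"
proof -
  fix f g :: "int \<Rightarrow> complex"
  assume "f 0 = 0 \<and> (\<lambda>j. (cmod (f j))\<^sup>2) summable_on UNIV"
    and "g 0 = 0 \<and> (\<lambda>j. (cmod (g j))\<^sup>2) summable_on UNIV"
  then show "f 0 - g 0 = 0 \<and> (\<lambda>j. (cmod (f j - g j))\<^sup>2) summable_on UNIV"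
    using square_summable_add[of f UNIV "\<lambda>j. - g j"] by auto
qed

lift_definition scaleR_l2 :: "real \<Rightarrow> l2 \<Rightarrow> l2" is "\<lambda>c f j. c *\<^sub>R f j"
  by (auto simp: power_mult_distrib intro!: summable_on_cmult_right)

definition inner_l2 :: "l2 \<Rightarrow> l2 \<Rightarrow> real" where
  "inner_l2 x y = (\<Sum>\<^sub>\<infinity>j. inner (coord x j) (coord y j))"

definition norm_l2 :: "l2 \<Rightarrow> real" where "norm_l2 x = sqrt (inner x x)"
definition sgn_l2 :: "l2 \<Rightarrow> l2" where "sgn_l2 x = inverse (norm x) *\<^sub>R x"
definition dist_l2 :: "l2 \<Rightarrow> l2 \<Rightarrow> real" where "dist_l2 x y = norm (x - y)"
definition uniformity_l2 :: "(l2 \<times> l2) filter" where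
  "uniformity_l2 = (INF e\<in>{0<..}. principal {(x, y). dist x y < e})"
definition open_l2 :: "l2 set \<Rightarrow> bool" where
  "open_l2 U \<longleftrightarrow> (\<forall>x\<in>U. eventually (\<lambda>(x', y). x' = x \<longrightarrow> y \<in> U) uniformity)"

instance
proof
  fix x y z :: l2 and a b r :: real
  show "x + y + z = x + (y + z)" "x + y = y + x" "0 + x = x" "- x + x = 0" "x - y = x + - y"
    by (transfer; simp add: fun_eq_iff)+
  show "a *\<^sub>R (x + y) = a *\<^sub>R x + a *\<^sub>R y" "(a + b) *\<^sub>R x = a *\<^sub>R x + b *\<^sub>R x"
    "a *\<^sub>R b *\<^sub>R x = (a * b) *\<^sub>R x" "1 *\<^sub>R x = x"
    by (transfer; simp add: fun_eq_iff algebra_simps)+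
  show "sgn x = inverse (norm x) *\<^sub>R x" by (rule sgn_l2_def)
  show "dist x y = norm (x - y)" by (rule dist_l2_def)
  show "uniformity = (INF e\<in>{0<..}. principal {(x::l2, y). dist x y < e})"
    by (rule uniformity_l2_def)
  show "open U = (\<forall>x\<in>U. eventually (\<lambda>(x', y). x' = x \<longrightarrow> y \<in> U) uniformity)" for U :: "l2 set"
    by (rule open_l2_def)
  have s: "(\<lambda>j. inner (coord x j) (coord y j)) summable_on UNIV" for x y
    by (intro summable_on_inner coord_summable)
  show "inner x y = inner y x"
    by (simp add: inner_l2_def inner_commute)
  show "inner (x + y) z = inner x z + inner y z"
    by (simp add: inner_l2_def plus_l2.rep_eq inner_add_left infsum_add s)
  show "inner (r *\<^sub>R x) y = r * inner x y"
    by (simp add: inner_l2_def scaleR_l2.rep_eq infsum_cmult_right s)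
  show "0 \<le> inner x x"
    by (simp add: inner_l2_def infsum_nonneg)
  show "inner x x = 0 \<longleftrightarrow> x = 0"
  proof
    assume "inner x x = 0"
    then have "inner (coord x j) (coord x j) = 0" for j
      by (intro nonneg_infsum_le_0D[where A = UNIV]) (use s in \<open>auto simp: inner_l2_def\<close>)
    then show "x = 0"
      by (intro l2_eqI) (simp add: zero_l2.rep_eq)
  qed (simp add: inner_l2_def zero_l2.rep_eq)
  show "norm x = sqrt (inner x x)" by (rule norm_l2_def)
qed

end

lemma coord_simps [simp]:
  "coord 0 j = 0" "coord (x + y) j = coord x j + coord y j" "coord (x - y) j = coord x j - coord y j"
  "coord (- x) j = - coord x j" "coord (r *\<^sub>R x) j = r *\<^sub>R coord x j"
  by (simp_all add: zero_l2.rep_eq plus_l2.rep_eq minus_l2.rep_eq uminus_l2.rep_eq scaleR_l2.rep_eq)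

lemma norm_l2_eq: "norm x = sqrt (\<Sum>\<^sub>\<infinity>j. (cmod (coord x j))\<^sup>2)"
  by (simp add: norm_l2_def inner_l2_def power2_norm_eq_inner)

lemma norm_l2_sq: "(norm x)\<^sup>2 = (\<Sum>\<^sub>\<infinity>j. (cmod (coord x j))\<^sup>2)"
  unfolding norm_l2_eq by (rule real_sqrt_pow2) (simp add: infsum_nonneg)

lemma sum_coord_le: "finite F \<Longrightarrow> (\<Sum>j\<in>F. (cmod (coord x j))\<^sup>2) \<le> (norm x)\<^sup>2"
  unfolding norm_l2_sq by (rule finite_sum_le_infsum) (auto simp: coord_summable)

lemma coord_le_norm: "cmod (coord x j) \<le> norm x"
  by (rule power2_le_imp_le) (use sum_coord_le[of "{j}" x] in simp_all)

text \<open>Bounds on finite partial sums survive coordinatewise limits; so this is how limits are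
  placed in the space, for completeness and again for \<open>Xmap\<close>.\<close>

lemma l2_of_coords:
  assumes "f 0 = 0" "0 \<le> D" "\<And>F. finite F \<Longrightarrow> (\<Sum>j\<in>F. (cmod (f j))\<^sup>2) \<le> D\<^sup>2"
  shows "\<exists>x. coord x = f \<and> norm x \<le> D"
proof -
  have s: "(\<lambda>j. (cmod (f j))\<^sup>2) summable_on UNIV"
    by (rule nonneg_bounded_partial_sums_imp_summable_on[where C = "D\<^sup>2"])
      (use assms in \<open>auto intro!: eventually_finite_subsets_at_top_weakI\<close>)
  then have c: "coord (Abs_l2 f) = f"
    by (simp add: Abs_l2_inverse assms)
  have "(norm (Abs_l2 f))\<^sup>2 \<le> D\<^sup>2"
    unfolding norm_l2_sq c by (rule infsum_le_finite_sums[OF s]) (use assms in auto)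
  then have "norm (Abs_l2 f) \<le> D"
    by (rule power2_le_imp_le) (use assms in auto)
  with c show ?thesis by blast
qed

instance l2 :: complete_space
proof
  fix X :: "nat \<Rightarrow> l2"
  assume X: "Cauchy X"
  have "Cauchy (\<lambda>n. coord (X n) j)" for j
    unfolding Cauchy_def
  proof (intro allI impI)
    fix e :: real assume "e > 0"
    then obtain N where N: "dist (X m) (X n) < e" if "m \<ge> N" "n \<ge> N" for m n
      using X unfolding Cauchy_def by blast
    have "dist (coord (X m) j) (coord (X n) j) < e" if "m \<ge> N" "n \<ge> N" for m n
      using coord_le_norm[of "X m - X n" j] N[OF that] by (simp add: dist_norm)
    then show "\<exists>M. \<forall>m\<ge>M. \<forall>n\<ge>M. dist (coord (X m) j) (coord (X n) j) < e" by blast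
  qed
  then have lim: "(\<lambda>n. coord (X n) j) \<longlonglongrightarrow> lim (\<lambda>n. coord (X n) j)" for j
    by (simp add: Cauchy_convergent convergent_LIMSEQ_iff[symmetric])
  define f where "f j = lim (\<lambda>n. coord (X n) j)" for j
  \<comment> \<open>Only the difference between a late member and the coordinatewise limit is
    bounded. Membership of the limit then follows by subtraction.\<close>
  have tail: "\<exists>x. coord x = (\<lambda>j. coord (X m) j - f j) \<and> norm x \<le> e"
    if "e > 0" and N: "\<And>n. n \<ge> N \<Longrightarrow> dist (X m) (X n) < e" for e m N
  proof (rule l2_of_coords)
    show "coord (X m) 0 - f 0 = 0"
      unfolding f_def by (simp add: limI)
    show "0 \<le> e" using that by simp
    fix F :: "int set" assume F: "finite F"
    have "(\<lambda>n. \<Sum>j\<in>F. (cmod (coord (X m) j - coord (X n) j))\<^sup>2)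
        \<longlonglongrightarrow> (\<Sum>j\<in>F. (cmod (coord (X m) j - f j))\<^sup>2)"
      unfolding f_def by (intro tendsto_intros lim)
    moreover have "(\<Sum>j\<in>F. (cmod (coord (X m) j - coord (X n) j))\<^sup>2) \<le> e\<^sup>2" if "n \<ge> N" for n
    proof -
      have "(\<Sum>j\<in>F. (cmod (coord (X m - X n) j))\<^sup>2) \<le> (norm (X m - X n))\<^sup>2"
        by (rule sum_coord_le[OF F])
      also have "\<dots> \<le> e\<^sup>2"
        using N[OF that] by (intro power_mono) (auto simp: dist_norm)
      finally show ?thesis by simp
    qed
    ultimately show "(\<Sum>j\<in>F. (cmod (coord (X m) j - f j))\<^sup>2) \<le> e\<^sup>2"
      by (intro tendsto_upperbound[where F = sequentially])
        (auto simp: eventually_sequentially)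
  qed
  obtain N1 where N1: "dist (X m) (X n) < 1" if "m \<ge> N1" "n \<ge> N1" for m n
    using X unfolding Cauchy_def by (metis zero_less_one)
  obtain x1 where x1: "coord x1 = (\<lambda>j. coord (X N1) j - f j)"
    using tail[of 1 N1 N1] N1 by auto
  define L where "L = X N1 - x1"
  have L: "coord L j = f j" for j
    by (simp add: L_def x1)
  have "X \<longlonglongrightarrow> L"
    unfolding LIMSEQ_iff
  proof (intro allI impI)
    fix r :: real assume "r > 0"
    then obtain N where N: "dist (X m) (X n) < r / 2" if "m \<ge> N" "n \<ge> N" for m n
      using X unfolding Cauchy_def by (metis half_gt_zero)
    have "norm (X n - L) < r" if n: "n \<ge> N" for n
    proof -
      obtain x where x: "coord x = (\<lambda>j. coord (X n) j - f j)" "norm x \<le> r / 2"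
        using tail[of "r / 2" N n] N[OF n] \<open>r > 0\<close> by auto
      then have "X n - L = x"
        by (intro l2_eqI) (simp add: L)
      with x \<open>r > 0\<close> show ?thesis by simp
    qed
    then show "\<exists>no. \<forall>n\<ge>no. norm (X n - L) < r" by blast
  qed
  then show "convergent X" by (auto simp: convergent_def)
qed

subsection \<open>The isometry with the weighted spaces\<close>

text \<open>An isometry of \<open>l2\<close> onto \<open>ell2 s\<close>. At the index 0 the power is
  0, in agreement with the convention that sequences vanish there.\<close>

definition emb :: "real \<Rightarrow> l2 \<Rightarrow> cseq" where
  "emb s x = (\<lambda>j. coord x j * of_real (\<bar>real_of_int j\<bar> powr (- s)))"

definition unemb :: "real \<Rightarrow> cseq \<Rightarrow> l2" where
  "unemb s q = Abs_l2 (\<lambda>j. q j * of_real (\<bar>real_of_int j\<bar> powr s))"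

lemma emb_0 [simp]: "emb s x 0 = 0"
  by (simp add: emb_def)

lemma emb_simps:
  "emb s 0 = 0" "emb s (x + y) = emb s x + emb s y" "emb s (x - y) = emb s x - emb s y"
  "emb s (- x) = - emb s x" "emb s (r *\<^sub>R x) = rscale r (emb s x)"
  by (auto simp: emb_def rscale_def fun_eq_iff algebra_simps scaleR_conv_of_real)

lemma powr_weight: "j \<noteq> 0 \<Longrightarrow> \<bar>real_of_int j\<bar> powr (2 * s) = (\<bar>real_of_int j\<bar> powr s)\<^sup>2"
  by (simp add: power2_eq_square powr_add[symmetric])

lemma weighted_summable_iff:
  assumes "q 0 = 0"
  shows "(\<lambda>j. (cmod (q j))\<^sup>2 * \<bar>real_of_int j\<bar> powr (2 * s)) summable_on Zstar \<longleftrightarrow>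
    (\<lambda>j. (cmod (q j * of_real (\<bar>real_of_int j\<bar> powr s)))\<^sup>2) summable_on UNIV"
  by (rule summable_on_cong_neutral)
    (auto simp: Zstar_def assms norm_mult power_mult_distrib powr_weight)

lemma weighted_infsum:
  assumes "q 0 = 0"
  shows "(\<Sum>\<^sub>\<infinity>j\<in>Zstar. (cmod (q j))\<^sup>2 * \<bar>real_of_int j\<bar> powr (2 * s)) =
    (\<Sum>\<^sub>\<infinity>j. (cmod (q j * of_real (\<bar>real_of_int j\<bar> powr s)))\<^sup>2)"
  by (rule infsum_cong_neutral)
    (auto simp: Zstar_def assms norm_mult power_mult_distrib powr_weight)

lemma coord_unemb: "q \<in> ell2 s \<Longrightarrow> coord (unemb s q) j = q j * of_real (\<bar>real_of_int j\<bar> powr s)"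
  unfolding unemb_def
  by (subst Abs_l2_inverse) (auto simp: ell2_def weighted_summable_iff[symmetric])

lemma emb_unemb [simp]: "q \<in> ell2 s \<Longrightarrow> emb s (unemb s q) = q"
proof
  fix j assume q: "q \<in> ell2 s"
  then show "emb s (unemb s q) j = q j"
    by (cases "j = 0")
      (auto simp: emb_def coord_unemb ell2_def mult.assoc powr_add[symmetric] simp flip: of_real_mult)
qed

lemma emb_times_weight: "emb s x j * of_real (\<bar>real_of_int j\<bar> powr s) = coord x j"
  by (cases "j = 0") (auto simp: emb_def mult.assoc powr_add[symmetric] simp flip: of_real_mult)

lemma emb_in_ell2 [simp]: "emb s x \<in> ell2 s"
  unfolding ell2_def by (simp add: weighted_summable_iff emb_times_weight coord_summable)

lemma ell2_norm_emb [simp]: "ell2_norm s (emb s x) = norm x"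
  unfolding ell2_norm_def norm_l2_eq by (simp add: weighted_infsum emb_times_weight)

lemma unemb_emb [simp]: "unemb s (emb s x) = x"
  by (rule l2_eqI) (simp add: coord_unemb emb_times_weight)

lemma norm_unemb: "q \<in> ell2 s \<Longrightarrow> norm (unemb s q) = ell2_norm s q"
  using ell2_norm_emb[of s "unemb s q"] by simp

lemma emb_inject [simp]: "emb s x = emb s y \<longleftrightarrow> x = y"
  by (metis unemb_emb)

lemma ell2_eq_range_emb: "ell2 s = range (emb s)"
  by (auto intro: emb_unemb[symmetric])


instance l2 :: banach ..

section \<open>Multilinear maps on lists\<close>

abbreviation norms :: "'a::real_normed_vector list \<Rightarrow> real" where
  "norms vs \<equiv> prod_list (map norm vs)"

text \<open>One function on lists stands for maps of every degree, and \<open>mlin n\<close> looks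
  at lists of length \<open>n\<close> only; inserting values into slots is then list surgery.
  Linearity is over the reals because conjugated slots are not complex linear.\<close>

definition mlin :: "nat \<Rightarrow> ('a::real_normed_vector list \<Rightarrow> 'b::real_normed_vector) \<Rightarrow> real \<Rightarrow> bool" where
  "mlin n a C \<longleftrightarrow> 0 \<le> C \<and>
     (\<forall>xs ys. length xs + length ys + 1 = n \<longrightarrow> linear (\<lambda>v. a (xs @ v # ys))) \<and>
     (\<forall>vs. length vs = n \<longrightarrow> norm (a vs) \<le> C * norms vs)"

lemma norms_nonneg [simp]: "0 \<le> norms vs"
  by (induction vs) auto

lemma norms_replicate [simp]: "norms (replicate n v) = norm v ^ n"
  by (induction n) auto

lemma mlin_nonneg: "mlin n a C \<Longrightarrow> 0 \<le> C"
  by (simp add: mlin_def)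

lemma mlin_linear: "mlin n a C \<Longrightarrow> length xs + length ys + 1 = n \<Longrightarrow> linear (\<lambda>v. a (xs @ v # ys))"
  by (simp add: mlin_def)

lemma mlin_bound: "mlin n a C \<Longrightarrow> length vs = n \<Longrightarrow> norm (a vs) \<le> C * norms vs"
  by (simp add: mlin_def)

lemma mlin_mono: "mlin n a C \<Longrightarrow> C \<le> D \<Longrightarrow> mlin n a D"
  unfolding mlin_def
  by (auto intro: order_trans[OF _ mult_right_mono[OF _ norms_nonneg]])

lemma mlin_cong:
  assumes "\<And>vs. length vs = n \<Longrightarrow> a vs = a' vs"
  shows "mlin n a C \<longleftrightarrow> mlin n a' C"
  unfolding mlin_def by (intro conj_cong refl all_cong imp_cong arg_cong[where f = linear] ext)
    (auto simp: assms)

lemma mlin_Cons: "mlin (Suc n) a C \<Longrightarrow> mlin n (\<lambda>vs. a (v # vs)) (C * norm v)"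
  unfolding mlin_def
proof (safe, goal_cases)
  case (2 xs ys)
  then have "linear (\<lambda>w. a ((v # xs) @ w # ys))"
    by (metis add_Suc length_Cons Suc_eq_plus1)
  then show ?case by simp
next
  case (3 vs)
  then have "norm (a (v # vs)) \<le> C * norms (v # vs)"
    by (metis length_Cons)
  then show ?case by (simp add: mult.assoc)
qed auto

lemma mlin_prepend:
  "mlin (length us + n) a C \<Longrightarrow> mlin n (\<lambda>vs. a (us @ vs)) (C * norms us)"
proof (induction us arbitrary: a C)
  case (Cons u us)
  have "mlin (length us + n) (\<lambda>vs. a (u # vs)) (C * norm u)"
    using Cons.prems by (intro mlin_Cons) simp
  from Cons.IH[OF this] show ?case by (simp add: mult.assoc)
qed simp

lemma mlin_scale: "mlin n a C \<Longrightarrow> mlin n (\<lambda>vs. r *\<^sub>R a vs) (\<bar>r\<bar> * C)"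
  unfolding mlin_def
  by (auto intro!: linear_compose_scale_right mult_left_mono simp: mult.assoc)

lemma mlin_hd: "mlin 1 hd 1"
  unfolding mlin_def
proof (safe, goal_cases)
  case (2 xs ys)
  then show ?case by (simp add: linear_id[unfolded id_def])
next
  case (3 vs)
  then show ?case by (cases vs) auto
qed simp

text \<open>One slot changes per induction step:
  \<open>a (f # fs) = a ((f - l) # fs) + a (l # fs)\<close>, where the norm bound controls the first
  summand and the induction hypothesis the second.\<close>

lemma mlin_tendsto:
  assumes "list_all2 (\<lambda>f l. (f \<longlongrightarrow> l) F) fs ls" "mlin (length fs) a C"
  shows "((\<lambda>t. a (map (\<lambda>f. f t) fs)) \<longlongrightarrow> a ls) F"
  using assms
proof (induction arbitrary: a C rule: list_all2_induct)
  case (Cons f fs l ls)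
  have lin: "linear (\<lambda>v. a (v # xs))" if "length xs = length fs" for xs
    using mlin_linear[OF Cons.prems, of "[]" xs] that by simp
  have "((\<lambda>t. norms (map (\<lambda>f. f t) fs)) \<longlongrightarrow> norms ls) F"
    using Cons.hyps(2) by (induction rule: list_all2_induct) (auto intro!: tendsto_intros)
  then have "((\<lambda>t. C * (norm (f t - l) * norms (map (\<lambda>f. f t) fs))) \<longlongrightarrow> C * (norm (l - l) * norms ls)) F"
    by (intro tendsto_intros Cons.hyps)
  then have "((\<lambda>t. C * (norm (f t - l) * norms (map (\<lambda>f. f t) fs))) \<longlongrightarrow> 0) F"
    by simp
  then have "((\<lambda>t. a ((f t - l) # map (\<lambda>f. f t) fs)) \<longlongrightarrow> 0) F"
    using mlin_bound[OF Cons.prems, of "(f t - l) # map (\<lambda>f. f t) fs" for t]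
    by (elim Lim_null_comparison[rotated]) (auto intro!: always_eventually)
  moreover have "((\<lambda>t. a (l # map (\<lambda>f. f t) fs)) \<longlongrightarrow> a (l # ls)) F"
    using Cons.IH[of "\<lambda>vs. a (l # vs)" "C * norm l"] Cons.prems by (simp add: mlin_Cons)
  ultimately have "((\<lambda>t. a ((f t - l) # map (\<lambda>f. f t) fs) + a (l # map (\<lambda>f. f t) fs)) \<longlongrightarrow> 0 + a (l # ls)) F"
    by (rule tendsto_add)
  then show ?case
    by (simp add: linear_diff[OF lin])
qed simp

section \<open>Derivatives and Taylor estimates of multilinear maps on the diagonal\<close>

lemma has_vector_derivative_within_quotient:
  "(f has_vector_derivative d) (at t within S) \<longleftrightarrow>
    ((\<lambda>u. (1 / (u - t)) *\<^sub>R (f u - f t)) \<longlongrightarrow> d) (at t within S)"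
  for f :: "real \<Rightarrow> 'a::real_normed_vector"
proof -
  have "((\<lambda>u. (f u - f t - (u - t) *\<^sub>R d) /\<^sub>R norm (u - t)) \<longlongrightarrow> 0) (at t within S) \<longleftrightarrow>
      ((\<lambda>u. (1 / (u - t)) *\<^sub>R (f u - f t) - d) \<longlongrightarrow> 0) (at t within S)"
  proof (subst (1 2) tendsto_norm_zero_iff[symmetric], rule filterlim_cong[OF refl refl])
    show "\<forall>\<^sub>F u in at t within S. norm ((f u - f t - (u - t) *\<^sub>R d) /\<^sub>R norm (u - t)) =
        norm ((1 / (u - t)) *\<^sub>R (f u - f t) - d)"
      unfolding eventually_at_filter
    proof (intro always_eventually allI impI)
      fix u assume "u \<noteq> t"
      then have "(1 / (u - t)) *\<^sub>R (f u - f t) - d = (1 / (u - t)) *\<^sub>R (f u - f t - (u - t) *\<^sub>R d)"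
        by (simp add: scaleR_diff_right)
      then show "norm ((f u - f t - (u - t) *\<^sub>R d) /\<^sub>R norm (u - t)) =
          norm ((1 / (u - t)) *\<^sub>R (f u - f t) - d)"
        by (simp add: divide_inverse_commute)
    qed
  qed
  then show ?thesis
    unfolding has_vector_derivative_def has_derivative_within
    by (simp add: bounded_linear_scaleR_left divide_inverse Lim_null[where l = d] diff_diff_eq)
qed

lemma mlin_has_vector_derivative:
  assumes "list_all2 (\<lambda>f d. (f has_vector_derivative d) (at t within S)) fs ds" "mlin (length fs) a C"
  shows "((\<lambda>t. a (map (\<lambda>f. f t) fs)) has_vector_derivative
    (\<Sum>i<length fs. a (map (\<lambda>f. f t) (take i fs) @ ds ! i # map (\<lambda>f. f t) (drop (Suc i) fs)))) (at t within S)"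
  using assms
proof (induction arbitrary: a C rule: list_all2_induct)
  case (Cons f fs d ds)
  have lin: "linear (\<lambda>v. a (v # xs))" if "length xs = length fs" for xs
    using mlin_linear[OF Cons.prems, of "[]" xs] that by simp
  have IH: "((\<lambda>u. a (f t # map (\<lambda>f. f u) fs)) has_vector_derivative
      (\<Sum>i<length fs. a (f t # map (\<lambda>f. f t) (take i fs) @ ds ! i # map (\<lambda>f. f t) (drop (Suc i) fs))))
      (at t within S)"
    using Cons.IH[of "\<lambda>vs. a (f t # vs)" "C * norm (f t)"] Cons.prems by (simp add: mlin_Cons)
  have cont: "list_all2 (\<lambda>f l. (f \<longlongrightarrow> l) (at t within S)) fs (map (\<lambda>f. f t) fs)"
    using Cons.hyps(2)
    by (induction rule: list_all2_induct)
      (auto dest: has_vector_derivative_continuous simp: continuous_within)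
  have "((\<lambda>u. a (map (\<lambda>f. f u) ((\<lambda>u. (1 / (u - t)) *\<^sub>R (f u - f t)) # fs))) \<longlongrightarrow>
      a (d # map (\<lambda>f. f t) fs)) (at t within S)"
    using Cons.hyps(1) cont Cons.prems
    by (intro mlin_tendsto[where C = C]) (auto simp: has_vector_derivative_within_quotient)
  then have "((\<lambda>u. a ((f u - f t) # map (\<lambda>f. f u) fs)) has_vector_derivative
      a (d # map (\<lambda>f. f t) fs)) (at t within S)"
    by (simp add: has_vector_derivative_within_quotient linear_cmul[OF lin] linear_0[OF lin])
  from has_vector_derivative_add[OF this IH]
  show ?case
    by (simp add: linear_diff[OF lin] sum.lessThan_Suc_shift del: sum.lessThan_Suc)
qed simp

text \<open>Derivative at \<open>x\<close> in direction \<open>v\<close> of the homogeneous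
  polynomial that \<open>a\<close> induces on the diagonal. As \<open>a\<close> need not be
  symmetric, the slots are summed instead of counted by a factor \<open>n\<close>.\<close>

definition diag_deriv :: "('a list \<Rightarrow> 'b::comm_monoid_add) \<Rightarrow> nat \<Rightarrow> 'a \<Rightarrow> 'a \<Rightarrow> 'b" where
  "diag_deriv a n x v = (\<Sum>i<n. a (replicate i x @ v # replicate (n - Suc i) x))"

lemma mlin_diag_has_vector_derivative:
  assumes "(x has_vector_derivative v) (at t within S)" "mlin n a C"
  shows "((\<lambda>t. a (replicate n (x t))) has_vector_derivative diag_deriv a n (x t) v) (at t within S)"
proof -
  have "((\<lambda>t. a (map (\<lambda>f. f t) (replicate n x))) has_vector_derivative
    (\<Sum>i<length (replicate n x). a (map (\<lambda>f. f t) (take i (replicate n x)) @ replicate n v ! i #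
      map (\<lambda>f. f t) (drop (Suc i) (replicate n x))))) (at t within S)"
    using assms by (intro mlin_has_vector_derivative[where C = C]) (auto simp: list_all2_conv_all_nth)
  then show ?thesis
    by (simp add: diag_deriv_def min_def)
qed

lemma mlin_telescope:
  assumes "length us = n" "length vs = n" "mlin n a C"
  shows "a us - a vs = (\<Sum>i<n. a (take i vs @ (us ! i - vs ! i) # drop (Suc i) us))"
  using assms
proof (induction n arbitrary: us vs a C)
  case (Suc n)
  obtain u us' v vs' where *: "us = u # us'" "vs = v # vs'" "length us' = n" "length vs' = n"
    using Suc.prems by (cases us; cases vs) auto
  have lin: "linear (\<lambda>v. a (v # us'))"
    using mlin_linear[OF Suc.prems(3), of "[]" us'] * by simp
  have "a us - a vs = a ((u - v) # us') + (a (v # us') - a (v # vs'))"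
    by (simp add: * linear_diff[OF lin])
  also have "a (v # us') - a (v # vs') = (\<Sum>i<n. a (v # (take i vs' @ (us' ! i - vs' ! i) # drop (Suc i) us')))"
    by (rule Suc.IH[of us' vs' "\<lambda>vs. a (v # vs)" "C * norm v"]) (use * Suc.prems in \<open>auto intro: mlin_Cons\<close>)
  finally show ?case
    by (simp add: * sum.lessThan_Suc_shift del: sum.lessThan_Suc)
qed simp

lemma mlin_diag_diff:
  assumes "mlin n a C"
  shows "a (replicate n u) - a (replicate n v) =
    (\<Sum>i<n. a (replicate i v @ (u - v) # replicate (n - Suc i) u))"
  using mlin_telescope[of "replicate n u" n "replicate n v" a C] assms by (simp add: min_def)

lemma mlin_slot_bound:
  assumes "mlin n a C" "i < n" "norm u \<le> r" "norm v \<le> r"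
  shows "norm (a (replicate i v @ w # replicate (n - Suc i) u)) \<le> C * r ^ (n - 1) * norm w"
proof -
  have "norm (a (replicate i v @ w # replicate (n - Suc i) u))
      \<le> C * (norm v ^ i * (norm w * norm u ^ (n - Suc i)))"
    using mlin_bound[OF assms(1), of "replicate i v @ w # replicate (n - Suc i) u"] assms by simp
  also have "\<dots> \<le> C * (r ^ i * (norm w * r ^ (n - Suc i)))"
    using assms mlin_nonneg[OF assms(1)] order_trans[OF norm_ge_zero assms(3)]
    by (intro mult_mono power_mono) auto
  also have "\<dots> = C * r ^ (i + (n - Suc i)) * norm w"
    by (simp add: power_add mult_ac)
  finally show ?thesis using assms(2) by simp
qed

lemma mlin_diag_lipschitz:
  assumes "mlin n a C" "norm u \<le> r" "norm v \<le> r"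
  shows "norm (a (replicate n u) - a (replicate n v)) \<le> n * C * r ^ (n - 1) * norm (u - v)"
proof -
  have "norm (a (replicate n u) - a (replicate n v))
      \<le> (\<Sum>i<n. norm (a (replicate i v @ (u - v) # replicate (n - Suc i) u)))"
    unfolding mlin_diag_diff[OF assms(1)] by (rule norm_sum)
  also have "\<dots> \<le> (\<Sum>i<n. C * r ^ (n - 1) * norm (u - v))"
    by (intro sum_mono mlin_slot_bound assms) auto
  finally show ?thesis by simp
qed

text \<open>Telescoping twice: each of the \<open>n\<close> slots of the first difference leaves at
  most \<open>n\<close> slots in which \<open>u\<close> is still to be exchanged for
  \<open>v\<close>.\<close>

lemma mlin_diag_quadratic:
  assumes a: "mlin n a C" and u: "norm u \<le> r" "norm v \<le> r"
  shows "norm (a (replicate n u) - a (replicate n v) - diag_deriv a n v (u - v))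
    \<le> n * n * C * r ^ (n - 2) * (norm (u - v))\<^sup>2"
proof -
  have r: "0 \<le> r" using u(1) norm_ge_zero order_trans by blast
  have C: "0 \<le> C" using a by (rule mlin_nonneg)
  have "norm (a (replicate i v @ (u - v) # replicate (n - Suc i) u)
      - a (replicate i v @ (u - v) # replicate (n - Suc i) v)) \<le> n * C * r ^ (n - 2) * (norm (u - v))\<^sup>2"
    if i: "i < n" for i
  proof (cases "Suc i = n")
    case False
    let ?a = "\<lambda>vs. a ((replicate i v @ [u - v]) @ vs)"
    have "mlin (n - Suc i) ?a (C * norms (replicate i v @ [u - v]))"
      by (rule mlin_prepend) (use a i in simp)
    then have "norm (?a (replicate (n - Suc i) u) - ?a (replicate (n - Suc i) v))
      \<le> (n - Suc i) * (C * norms (replicate i v @ [u - v])) * r ^ (n - Suc i - 1) * norm (u - v)"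
      by (rule mlin_diag_lipschitz) (use u in auto)
    also have "\<dots> = (n - Suc i) * (C * (norm v ^ i * r ^ (n - Suc i - 1)) * (norm (u - v))\<^sup>2)"
      by (simp add: power2_eq_square)
    also have "\<dots> \<le> n * (C * (r ^ i * r ^ (n - Suc i - 1)) * (norm (u - v))\<^sup>2)"
      using u r C by (intro mult_mono mult_right_mono mult_left_mono power_mono mult_nonneg_nonneg) auto
    also have "r ^ i * r ^ (n - Suc i - 1) = r ^ (n - 2)"
      using False i by (simp flip: power_add)
    finally show ?thesis by (simp add: mult.assoc)
  qed (use r C in auto)
  then have "(\<Sum>i<n. norm (a (replicate i v @ (u - v) # replicate (n - Suc i) u)
      - a (replicate i v @ (u - v) # replicate (n - Suc i) v))) \<le> (\<Sum>i<n. n * C * r ^ (n - 2) * (norm (u - v))\<^sup>2)"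
    by (intro sum_mono) auto
  then show ?thesis
    unfolding mlin_diag_diff[OF a] diag_deriv_def sum_subtractf[symmetric]
    by (intro order_trans[OF norm_sum]) (simp add: mult.assoc)
qed

subsection \<open>Substituting a multilinear map into the slots of another\<close>

text \<open>The Lie derivative on multilinear maps: on the diagonal it differentiates
  \<open>a\<close> along the field given by \<open>A\<close>. The bound
  \<open>length vs + 1 - b\<close> is the degree of \<open>a\<close>.\<close>

definition subst :: "nat \<Rightarrow> ('a list \<Rightarrow> 'a) \<Rightarrow> ('a list \<Rightarrow> 'b::comm_monoid_add) \<Rightarrow> 'a list \<Rightarrow> 'b" where
  "subst b A a vs = (\<Sum>i<length vs + 1 - b. a (take i vs @ A (take b (drop i vs)) # drop (i + b) vs))"

lemma subst_replicate:
  assumes "1 \<le> b"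
  shows "subst b A a (replicate (n + b - 1) x) = diag_deriv a n x (A (replicate b x))"
  using assms unfolding subst_def diag_deriv_def
  by (intro sum.cong) (auto simp: min_def)

lemma mlin_subst:
  assumes a: "mlin n a C" and A: "mlin b A D" and b: "1 \<le> b"
  shows "mlin (n + b - 1) (subst b A a) (n * C * D)"
  unfolding mlin_def
proof (intro conjI allI impI)
  have C: "0 \<le> C" and D: "0 \<le> D"
    using a A by (auto dest: mlin_nonneg)
  then show "0 \<le> n * C * D" by simp
  fix vs :: "'a list" assume vs: "length vs = n + b - 1"
  have "norm (a (take i vs @ A (take b (drop i vs)) # drop (i + b) vs)) \<le> C * D * norms vs" if i: "i < n" for i
  proof -
    have "norm (a (take i vs @ A (take b (drop i vs)) # drop (i + b) vs))
        \<le> C * (norms (take i vs) * (norm (A (take b (drop i vs))) * norms (drop (i + b) vs)))"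
      using mlin_bound[OF a, of "take i vs @ A (take b (drop i vs)) # drop (i + b) vs"] vs i b by simp
    also have "\<dots> \<le> C * (norms (take i vs) * ((D * norms (take b (drop i vs))) * norms (drop (i + b) vs)))"
      using vs i b C by (intro mult_left_mono mult_right_mono mlin_bound[OF A]) auto
    also have "\<dots> = C * D * norms (take i vs @ take b (drop i vs) @ drop b (drop i vs))"
      by (simp add: add.commute)
    also have "take i vs @ take b (drop i vs) @ drop b (drop i vs) = vs"
      by (metis append_take_drop_id)
    finally show ?thesis .
  qed
  then have "(\<Sum>i<n. norm (a (take i vs @ A (take b (drop i vs)) # drop (i + b) vs))) \<le> (\<Sum>i<n. C * D * norms vs)"
    by (intro sum_mono) auto
  then show "norm (subst b A a vs) \<le> n * C * D * norms vs"
    unfolding subst_def using vs b by (intro order_trans[OF norm_sum]) (simp add: mult.assoc)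
next
  fix zs ys :: "'a list" assume len: "length zs + length ys + 1 = n + b - 1"
  show "linear (\<lambda>v. subst b A a (zs @ v # ys))"
  proof -
    have N: "length (zs @ v # ys) + 1 - b = n" for v
      using len b by simp
    show ?thesis
      unfolding subst_def N
  proof (rule linear_compose_sum, safe)
    fix i assume i: "i < n"
    \<comment> \<open>The varying argument stands before, inside or behind the block that
      \<open>A\<close> consumes.\<close>
    consider "length zs < i" | "i \<le> length zs" "length zs < i + b" | "i + b \<le> length zs"
      by linarith
    then show "linear (\<lambda>v. a (take i (zs @ v # ys) @ A (take b (drop i (zs @ v # ys))) # drop (i + b) (zs @ v # ys)))"
    proof cases
      case 1
      then obtain k where k: "i = Suc (length zs + k)"
        using less_imp_Suc_add by blast
      have "linear (\<lambda>v. a (zs @ v # (take k ys @ A (take b (drop k ys)) # drop (k + b) ys)))"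
        by (rule mlin_linear[OF a]) (use len i b k in auto)
      then show ?thesis by (simp add: k)
    next
      case 2
      then obtain k where k: "length zs = i + k" "k < b"
        by (metis add_less_cancel_left le_iff_add)
      have "linear (\<lambda>w. a (take i zs @ w # drop (b - Suc k) ys))"
        by (rule mlin_linear[OF a]) (use len i b k in auto)
      moreover have "linear (\<lambda>v. A (drop i zs @ v # take (b - Suc k) ys))"
        by (rule mlin_linear[OF A]) (use len i b k in auto)
      ultimately have "linear ((\<lambda>w. a (take i zs @ w # drop (b - Suc k) ys)) \<circ> (\<lambda>v. A (drop i zs @ v # take (b - Suc k) ys)))"
        by (intro linear_compose)
      moreover have "b - k = Suc (b - Suc k)" using k by simp
      ultimately show ?thesis
        using k by (simp add: o_def)
    next
      case 3
      have "linear (\<lambda>v. a ((take i zs @ A (take b (drop i zs)) # drop (i + b) zs) @ v # ys))"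
        by (rule mlin_linear[OF a]) (use len i b 3 in auto)
      then show ?thesis using 3 by simp
    qed
  qed
  qed
qed

text \<open>Each step multiplies by the current degree, which is at most the final one; the
  resulting \<open>k\<close>-th power is of a size that \<open>1 / fact k\<close> can
  absorb.\<close>

lemma mlin_subst_funpow:
  assumes a: "mlin n a C" and A: "mlin b A D" and b: "1 \<le> b"
  shows "mlin (n + k * (b - 1)) ((subst b A ^^ k) a) (C * D ^ k * real (n + k * (b - 1)) ^ k)"
proof (induction k)
  case (Suc k)
  have C: "0 \<le> C" and D: "0 \<le> D"
    using a A by (auto dest: mlin_nonneg)
  have "mlin (n + k * (b - 1) + b - 1) (subst b A ((subst b A ^^ k) a))
      (real (n + k * (b - 1)) * (C * D ^ k * real (n + k * (b - 1)) ^ k) * D)"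
    by (rule mlin_subst[OF Suc A b])
  moreover have "n + k * (b - 1) + b - 1 = n + Suc k * (b - 1)"
    using b by simp
  moreover have "real (n + k * (b - 1)) * (C * D ^ k * real (n + k * (b - 1)) ^ k) * D
      \<le> C * D ^ Suc k * real (n + Suc k * (b - 1)) ^ Suc k"
  proof -
    have "real (n + k * (b - 1)) * (C * D ^ k * real (n + k * (b - 1)) ^ k) * D
        = C * D ^ Suc k * real (n + k * (b - 1)) ^ Suc k"
      by simp
    also have "\<dots> \<le> C * D ^ Suc k * real (n + Suc k * (b - 1)) ^ Suc k"
      using C D by (intro mult_left_mono power_mono) auto
    finally show ?thesis .
  qed
  ultimately show ?case
    by (auto intro: mlin_mono)
qed (use a in simp)

lemma power_div_fact_le_exp: "0 \<le> x \<Longrightarrow> x ^ k / fact k \<le> exp (x::real)"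
proof -
  assume x: "0 \<le> x"
  have "(\<lambda>k. x ^ k / fact k) sums exp x"
    using exp_converges[of x] by (simp add: divide_inverse mult.commute)
  then have "(\<Sum>i\<in>{k}. x ^ i / fact i) \<le> exp x"
    using x by (intro sum_le_suminf[of _ "{k}", THEN order_trans]) (auto simp: sums_iff)
  then show ?thesis by simp
qed

text \<open>With \<open>N = n + k * (b - 1)\<close>, the bound
  \<open>N ^ k / fact k \<le> exp N\<close> turns the growing number of slots into a factor
  \<open>exp (b - 1)\<close> per step, so that a small radius gives geometric decay in
  \<open>k\<close>.\<close>

lemma norm_subst_funpow_le:
  assumes a: "mlin n a C" and A: "mlin b A D" and b: "1 \<le> b" and x: "norm x \<le> r"
    and r: "D * exp b * r ^ (b - 1) \<le> q"
  shows "norm ((subst b A ^^ k) a (replicate (n + k * (b - 1)) x)) / fact k \<le> C * (exp 1 * r) ^ n * q ^ k"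
proof -
  have C: "0 \<le> C" and D: "0 \<le> D"
    using a A by (auto dest: mlin_nonneg)
  have r0: "0 \<le> r" using x norm_ge_zero order_trans by blast
  let ?N = "n + k * (b - 1)"
  have "norm ((subst b A ^^ k) a (replicate ?N x)) / fact k
      \<le> (C * D ^ k * real ?N ^ k * norm x ^ ?N) / fact k"
    using mlin_bound[OF mlin_subst_funpow[OF a A b], of "replicate ?N x"] by (intro divide_right_mono) auto
  also have "\<dots> = C * D ^ k * (real ?N ^ k / fact k) * norm x ^ ?N"
    by simp
  also have "\<dots> \<le> C * D ^ k * exp ?N * r ^ ?N"
    using C D r0 x by (intro mult_mono mult_left_mono power_div_fact_le_exp power_mono mult_nonneg_nonneg) auto
  also have "exp (real ?N) = exp 1 ^ n * exp (real (b - 1)) ^ k"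
    by (simp add: exp_add exp_of_nat_mult[symmetric] mult.commute)
  also have "C * D ^ k * (exp 1 ^ n * exp (real (b - 1)) ^ k) * r ^ ?N
      = C * (exp 1 * r) ^ n * (D * exp (real (b - 1)) * r ^ (b - 1)) ^ k"
    by (simp add: power_mult_distrib power_add mult_ac flip: power_mult)
  also have "\<dots> \<le> C * (exp 1 * r) ^ n * q ^ k"
  proof (intro mult_left_mono power_mono)
    have "D * exp (real (b - 1)) * r ^ (b - 1) \<le> D * exp b * r ^ (b - 1)"
      using D r0 by (intro mult_right_mono mult_left_mono) auto
    with r show "D * exp (real (b - 1)) * r ^ (b - 1) \<le> q" by linarith
  qed (use C D r0 in auto)
  finally show ?thesis .
qed

text \<open>Both sides are derivatives of the same function on the diagonal. Through this lemma a
  homological equation that holds on the diagonal only can still be fed into the Lie series.\<close>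

lemma diag_deriv_cong_diag:
  assumes a: "mlin n a C" "mlin n a' C'" and eq: "\<And>x. a (replicate n x) = a' (replicate n x)"
  shows "diag_deriv a n x v = diag_deriv a' n x v"
proof -
  have *: "((\<lambda>t. x + t *\<^sub>R v) has_vector_derivative v) (at 0)"
    by (auto intro!: derivative_eq_intros)
  from mlin_diag_has_vector_derivative[OF * a(1)] mlin_diag_has_vector_derivative[OF * a(2)]
  show ?thesis
    unfolding eq using vector_derivative_unique_at by fastforce
qed

lemma subst_funpow_cong_diag:
  assumes a: "mlin n a C" "mlin n a' C'" and A: "mlin b A D" and b: "1 \<le> b"
    and eq: "\<And>x. a (replicate n x) = a' (replicate n x)"
  shows "(subst b A ^^ k) a (replicate (n + k * (b - 1)) x) = (subst b A ^^ k) a' (replicate (n + k * (b - 1)) x)"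
proof (induction k arbitrary: x)
  case (Suc k)
  have *: "n + Suc k * (b - 1) = (n + k * (b - 1)) + b - 1"
    using b by simp
  show ?case
    by (simp only: * funpow.simps o_apply subst_replicate[OF b]
        diag_deriv_cong_diag[OF mlin_subst_funpow[OF a(1) A b] mlin_subst_funpow[OF a(2) A b] Suc])
qed (use eq in simp)


section \<open>Flows of homogeneous polynomial vector fields\<close>

text \<open>The ball of radius \<open>r\<close> is invariant up to time one: \<open>p\<close> uses
  half of the radius, and the integral of a field with Lipschitz constant 1/2 at most the other
  half.\<close>

lemma picard_exists:
  fixes X :: "'a::banach \<Rightarrow> 'a"
  assumes lip: "\<And>u v. norm u \<le> r \<Longrightarrow> norm v \<le> r \<Longrightarrow> norm (X u - X v) \<le> 1/2 * norm (u - v)"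
    and X0: "X 0 = 0" and p: "norm p \<le> r / 2"
  shows "\<exists>x. x 0 = p \<and> (\<forall>t\<in>{0..1}. norm (x t) \<le> r \<and>
    (x has_vector_derivative X (x t)) (at t within {0..1}))"
proof -
  have r: "0 \<le> r"
    using p norm_ge_zero[of p] by linarith
  define S :: "(real \<Rightarrow>\<^sub>C 'a) set" where "S = PiC UNIV (\<lambda>_. cball 0 r)"
  have S: "f \<in> S \<longleftrightarrow> (\<forall>t. norm (apply_bcontfun f t) \<le> r)" for f
    by (simp add: S_def mem_PiC_iff Pi_iff)
  have contX: "continuous_on (cball 0 r) X"
    by (rule lipschitz_on_continuous_on[of "1/2"], rule lipschitz_onI) (use lip in \<open>auto simp: dist_norm\<close>)
  \<comment> \<open>Clamping the time to the unit interval lets the iteration act on bounded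
    continuous functions on the whole line.\<close>
  define cl where "cl t = max 0 (min 1 t)" for t :: real
  have cl: "cl t \<in> {0..1}" for t by (auto simp: cl_def)
  define P where "P f t = p + integral {0..cl t} (\<lambda>s. X (apply_bcontfun f s))" for f t
  have cont: "continuous_on T (\<lambda>s. X (apply_bcontfun f s))" if "f \<in> S" for f T
    by (rule continuous_on_compose2[OF contX]) (use that S in auto)
  have bnd: "norm (X u) \<le> r / 2" if "norm u \<le> r" for u
    using lip[of u 0] that r by (simp add: X0)
  have Pn: "norm (P f t) \<le> r" if f: "f \<in> S" for f t
  proof -
    have "norm (integral {0..cl t} (\<lambda>s. X (apply_bcontfun f s))) \<le> r / 2 * (cl t - 0)"
      by (rule integral_bound) (use cl cont f S bnd in auto)
    also have "\<dots> \<le> r / 2 * 1"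
      using cl[of t] r by (intro mult_left_mono) auto
    finally have "norm (P f t) \<le> norm p + r / 2"
      unfolding P_def by (intro norm_triangle_le) simp
    with p show ?thesis by simp
  qed
  have Pcont: "continuous_on T (P f)" if f: "f \<in> S" for f T
  proof -
    have "continuous_on {0..1} (\<lambda>u. integral {0..u} (\<lambda>s. X (apply_bcontfun f s)))"
      by (intro indefinite_integral_continuous_1 integrable_continuous_real cont f)
    moreover have "continuous_on T cl"
      unfolding cl_def by (intro continuous_intros)
    ultimately show ?thesis
      unfolding P_def using cl
      by (intro continuous_on_add continuous_on_const) (auto intro: continuous_on_compose2)
  qed
  have PB: "apply_bcontfun (Bcontfun (P f)) = P f" if "f \<in> S" for f
    by (rule Bcontfun_inverse, rule bcontfun_normI[OF Pcont Pn]) (use that in auto)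
  have "\<exists>!f\<in>S. Bcontfun (P f) = f"
  proof (rule Banach_fix[of _ "1/2"])
    show "complete S"
      unfolding complete_eq_closed S_def by (rule closed_PiC) auto
    show "S \<noteq> {}"
      using r S[of "const_bcontfun 0"] by (auto simp: const_bcontfun.rep_eq)
    show "(\<lambda>f. Bcontfun (P f)) ` S \<subseteq> S"
      using PB Pn by (auto simp: S)
    fix f g assume f: "f \<in> S" and g: "g \<in> S"
    show "dist (Bcontfun (P f)) (Bcontfun (P g)) \<le> 1 / 2 * dist f g"
    proof (rule dist_bound)
      fix t
      have "norm (integral {0..cl t} (\<lambda>s. X (apply_bcontfun f s) - X (apply_bcontfun g s)))
          \<le> 1 / 2 * dist f g * (cl t - 0)"
      proof (rule integral_bound)
        fix s
        have "norm (X (apply_bcontfun f s) - X (apply_bcontfun g s))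
            \<le> 1/2 * dist (apply_bcontfun f s) (apply_bcontfun g s)"
          unfolding dist_norm by (rule lip) (use f g S in auto)
        also have "\<dots> \<le> 1/2 * dist f g"
          by (intro mult_left_mono dist_bounded) auto
        finally show "norm (X (apply_bcontfun f s) - X (apply_bcontfun g s)) \<le> 1 / 2 * dist f g" .
      qed (use cl in \<open>auto intro!: continuous_intros cont f g\<close>)
      also have "\<dots> \<le> 1 / 2 * dist f g * 1"
        using cl[of t] by (intro mult_left_mono) auto
      also have "integral {0..cl t} (\<lambda>s. X (apply_bcontfun f s) - X (apply_bcontfun g s)) = P f t - P g t"
        unfolding P_def
        by (simp add: Henstock_Kurzweil_Integration.integral_diff integrable_continuous_real cont f g)
      finally show "dist (apply_bcontfun (Bcontfun (P f)) t) (apply_bcontfun (Bcontfun (P g)) t)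
          \<le> 1 / 2 * dist f g"
        by (simp add: PB f g dist_norm)
    qed
  qed auto
  then obtain f where f: "f \<in> S" "Bcontfun (P f) = f" by blast
  define x where "x = apply_bcontfun f"
  have x: "x t = P f t" for t
    using PB[OF f(1)] f(2) by (simp add: x_def)
  have "(x has_vector_derivative X (x t)) (at t within {0..1})" if t: "t \<in> {0..1}" for t
  proof -
    have "((\<lambda>u. p + integral {0..u} (\<lambda>s. X (x s))) has_vector_derivative X (x t)) (at t within {0..1})"
      using integral_has_vector_derivative[OF cont[OF f(1)] t]
      unfolding x_def by (auto intro!: derivative_eq_intros)
    moreover have "p + integral {0..u} (\<lambda>s. X (x s)) = x u" if "u \<in> {0..1}" for u
      using that x[of u] by (simp add: P_def cl_def x_def)
    ultimately show ?thesis
      using t has_vector_derivative_transform[of t "{0..1}" x "\<lambda>u. p + integral {0..u} (\<lambda>s. X (x s))"]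
      by auto
  qed
  moreover have "x 0 = p"
    using x[of 0] by (simp add: P_def cl_def)
  moreover have "norm (x t) \<le> r" for t
    using Pn[OF f(1)] x by simp
  ultimately show ?thesis by blast
qed

text \<open>In an inner product space the squared norm is differentiable, so
  \<open>exp (- 2 * L * u) * inner (d u) (d u)\<close> is seen to decrease from the sign of its
  derivative and the Cauchy-Schwarz inequality.\<close>

lemma gronwall:
  fixes x y :: "real \<Rightarrow> 'a::real_inner"
  assumes x: "\<And>t. t \<in> {0..1} \<Longrightarrow> (x has_vector_derivative x' t) (at t within {0..1})"
    and y: "\<And>t. t \<in> {0..1} \<Longrightarrow> (y has_vector_derivative y' t) (at t within {0..1})"
    and lip: "\<And>t. t \<in> {0..1} \<Longrightarrow> norm (x' t - y' t) \<le> L * norm (x t - y t)"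
    and t: "t \<in> {0..1}"
  shows "norm (x t - y t) \<le> exp (L * t) * norm (x 0 - y 0)"
proof -
  define d where "d u = x u - y u" for u
  define d' where "d' u = x' u - y' u" for u
  have d: "(d has_vector_derivative d' u) (at u within {0..1})" if "u \<in> {0..1}" for u
    unfolding d_def d'_def by (intro has_vector_derivative_diff x y that)
  define g where "g u = exp (- 2 * L * u) * inner (d u) (d u)" for u
  have g: "(g has_real_derivative exp (- 2 * L * u) * (2 * inner (d u) (d' u) - 2 * L * inner (d u) (d u)))
      (at u within {0..1})" if "u \<in> {0..1}" for u
  proof -
    have "((\<lambda>u. inner (d u) (d u)) has_real_derivative 2 * inner (d u) (d' u)) (at u within {0..1})"
      using bounded_bilinear.has_vector_derivative[OF bounded_bilinear_inner d d, OF that that]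
      by (simp add: has_real_derivative_iff_has_vector_derivative inner_commute)
    then show ?thesis
      unfolding g_def by (auto intro!: derivative_eq_intros simp: algebra_simps)
  qed
  have "g 0 \<ge> g t"
  proof (rule DERIV_nonpos_imp_decreasing_open[where f = g])
    show "0 \<le> t" using t by simp
    show "continuous_on {0..t} g"
      using DERIV_continuous_on[OF g] t by (auto intro: continuous_on_subset)
    fix u assume u: "0 < u" "u < t"
    then have "u \<in> {0..1}" "at u within {0..1} = at u"
      using t by (auto simp: at_within_Icc_at)
    moreover have "inner (d u) (d' u) \<le> L * inner (d u) (d u)"
    proof -
      have "inner (d u) (d' u) \<le> norm (d u) * norm (d' u)"
        by (rule norm_cauchy_schwarz)
      also have "\<dots> \<le> norm (d u) * (L * norm (d u))"
        using lip[of u] \<open>u \<in> _\<close> by (intro mult_left_mono) (auto simp: d_def d'_def)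
      also have "\<dots> = L * inner (d u) (d u)"
        by (simp flip: power2_norm_eq_inner add: power2_eq_square)
      finally show ?thesis .
    qed
    then have "exp (- 2 * L * u) * (2 * inner (d u) (d' u) - 2 * L * inner (d u) (d u)) \<le> 0"
      by (intro mult_nonneg_nonpos) auto
    ultimately show "\<exists>z. DERIV g u :> z \<and> z \<le> 0"
      using g[of u] by auto
  qed
  then have "exp (2 * L * t) * (exp (- 2 * L * t) * (norm (d t))\<^sup>2) \<le> exp (2 * L * t) * (norm (d 0))\<^sup>2"
    by (intro mult_left_mono) (auto simp: g_def power2_norm_eq_inner)
  then have "(norm (d t))\<^sup>2 \<le> exp (2 * L * t) * (norm (d 0))\<^sup>2"
    by (simp add: mult.assoc[symmetric] exp_add[symmetric])
  also have "\<dots> = (exp (L * t) * norm (d 0))\<^sup>2"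
    by (simp add: power_mult_distrib exp_double[symmetric] mult.assoc)
  finally have "(norm (d t))\<^sup>2 \<le> (exp (L * t) * norm (d 0))\<^sup>2" .
  then have "norm (d t) \<le> exp (L * t) * norm (d 0)"
    by (rule power2_le_imp_le) auto
  then show ?thesis by (simp add: d_def)
qed

definition sol :: "nat \<Rightarrow> ('a::real_normed_vector list \<Rightarrow> 'a) \<Rightarrow> (real \<Rightarrow> 'a) \<Rightarrow> bool" where
  "sol b A x \<longleftrightarrow>
    (\<forall>t\<in>{0..1}. (x has_vector_derivative A (replicate b (x t))) (at t within {0..1}))"

text \<open>Since \<open>b \<le> exp b\<close>, the inequality makes the field a contraction with
  constant 1/2; it also makes the Lie series converge with ratio 1/2. One radius serves
  both.\<close>

definition flow_radius :: "nat \<Rightarrow> ('a::real_normed_vector list \<Rightarrow> 'a) \<Rightarrow> real \<Rightarrow> real \<Rightarrow> bool" where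
  "flow_radius b A D r \<longleftrightarrow> mlin b A D \<and> 2 \<le> b \<and> 0 < r \<and> D * exp b * r ^ (b - 1) \<le> 1 / 2"

lemma sol_deriv: "sol b A x \<Longrightarrow> t \<in> {0..1} \<Longrightarrow>
    (x has_vector_derivative A (replicate b (x t))) (at t within {0..1})"
  by (simp add: sol_def)

lemma sol_continuous: "sol b A x \<Longrightarrow> continuous_on {0..1} x"
  unfolding sol_def by (auto intro: continuous_on_vector_derivative)

text \<open>Any two solutions are bounded on the compact interval, so some Lipschitz constant is
  valid along both. This is uniqueness among all curves, as \<open>flow_domain\<close> asks for
  it.\<close>

lemma sol_unique:
  fixes x y :: "real \<Rightarrow> 'a::real_inner"
  assumes A: "mlin b A D" and x: "sol b A x" and y: "sol b A y" and 0: "x 0 = y 0" and t: "t \<in> {0..1}"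
  shows "x t = y t"
proof -
  have "compact (x ` {0..1} \<union> y ` {0..1})"
    using x y by (intro compact_Un compact_continuous_image sol_continuous) auto
  then obtain r where r: "\<And>z. z \<in> x ` {0..1} \<union> y ` {0..1} \<Longrightarrow> norm z \<le> r"
    using compact_imp_bounded bounded_iff by metis
  have "norm (x t - y t) \<le> exp ((b * D * r ^ (b - 1)) * t) * norm (x 0 - y 0)"
    using r
    by (intro gronwall[where x' = "\<lambda>t. A (replicate b (x t))" and y' = "\<lambda>t. A (replicate b (y t))"]
        sol_deriv[OF x] sol_deriv[OF y] mlin_diag_lipschitz[OF A] t) auto
  with 0 show ?thesis by simp
qed

lemma flow_radius_lipschitz:
  assumes "flow_radius b A D r" "norm u \<le> r" "norm v \<le> r"
  shows "norm (A (replicate b u) - A (replicate b v)) \<le> 1/2 * norm (u - v)"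
proof -
  have D: "0 \<le> D" and r: "0 < r"
    using assms(1) by (auto simp: flow_radius_def dest: mlin_nonneg)
  have "norm (A (replicate b u) - A (replicate b v)) \<le> b * D * r ^ (b - 1) * norm (u - v)"
    using assms by (intro mlin_diag_lipschitz) (auto simp: flow_radius_def)
  also have "\<dots> \<le> (D * exp b * r ^ (b - 1)) * norm (u - v)"
  proof (rule mult_right_mono)
    have "real b \<le> exp b"
      using exp_ge_add_one_self[of "real b"] by linarith
    then have "D * r ^ (b - 1) * b \<le> D * r ^ (b - 1) * exp b"
      using D r by (intro mult_left_mono) auto
    then show "b * D * r ^ (b - 1) \<le> D * exp b * r ^ (b - 1)"
      by (simp add: mult_ac)
  qed auto
  also have "\<dots> \<le> 1/2 * norm (u - v)"
    using assms(1) by (intro mult_right_mono) (auto simp: flow_radius_def)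
  finally show ?thesis .
qed

lemma exp_half_le_2: "exp (1/2::real) \<le> 2"
  using exp_bound[of "1/2"] by (simp add: power2_eq_square)

lemma sol_lipschitz:
  fixes x y :: "real \<Rightarrow> 'a::real_inner"
  assumes fr: "flow_radius b A D r" and x: "sol b A x" and y: "sol b A y"
    and le: "\<And>t. t \<in> {0..1} \<Longrightarrow> norm (x t) \<le> r" "\<And>t. t \<in> {0..1} \<Longrightarrow> norm (y t) \<le> r"
    and t: "t \<in> {0..1}"
  shows "norm (x t - y t) \<le> 2 * norm (x 0 - y 0)"
proof -
  have "norm (x t - y t) \<le> exp (1/2 * t) * norm (x 0 - y 0)"
    by (intro gronwall[where x' = "\<lambda>t. A (replicate b (x t))" and y' = "\<lambda>t. A (replicate b (y t))"]
        sol_deriv[OF x] sol_deriv[OF y] flow_radius_lipschitz[OF fr] le t)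
  also have "\<dots> \<le> 2 * norm (x 0 - y 0)"
    using t by (intro mult_right_mono order_trans[OF _ exp_half_le_2]) auto
  finally show ?thesis .
qed

lemma mlin_diag_0: "mlin n a C \<Longrightarrow> 1 \<le> n \<Longrightarrow> a (replicate n 0) = 0"
  using mlin_bound[of n a C "replicate n 0"] by (simp add: power_0_left)

definition flow_curve :: "nat \<Rightarrow> ('a::real_normed_vector list \<Rightarrow> 'a) \<Rightarrow> 'a \<Rightarrow> real \<Rightarrow> 'a" where
  "flow_curve b A p = (SOME x. sol b A x \<and> x 0 = p)"

abbreviation time1 :: "nat \<Rightarrow> ('a::real_normed_vector list \<Rightarrow> 'a) \<Rightarrow> 'a \<Rightarrow> 'a" where
  "time1 b A p \<equiv> flow_curve b A p 1"

lemma sol_0: "mlin b A D \<Longrightarrow> 2 \<le> b \<Longrightarrow> sol b A (\<lambda>_. 0)"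
  by (simp add: sol_def mlin_diag_0)

lemma flow_curve_ex:
  fixes A :: "'a::{real_inner, banach} list \<Rightarrow> 'a"
  assumes fr: "flow_radius b A D r" and p: "norm p \<le> r / 2"
  shows "\<exists>x. sol b A x \<and> x 0 = p \<and> (\<forall>t\<in>{0..1}. norm (x t) \<le> r)"
proof -
  have "A (replicate b 0) = 0"
    using fr by (auto simp: flow_radius_def intro: mlin_diag_0)
  from picard_exists[where X = "\<lambda>x. A (replicate b x)", OF flow_radius_lipschitz[OF fr] this p]
  show ?thesis by (auto simp: sol_def)
qed

lemma flow_curve:
  fixes A :: "'a::{real_inner, banach} list \<Rightarrow> 'a"
  assumes fr: "flow_radius b A D r" and p: "norm p \<le> r / 2"
  shows flow_curve_sol: "sol b A (flow_curve b A p)" and flow_curve_0: "flow_curve b A p 0 = p"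
    and flow_curve_eq: "\<And>x t. sol b A x \<Longrightarrow> x 0 = p \<Longrightarrow> t \<in> {0..1} \<Longrightarrow> x t = flow_curve b A p t"
    and flow_curve_le: "\<And>t. t \<in> {0..1} \<Longrightarrow> norm (flow_curve b A p t) \<le> r"
    and flow_curve_norm: "\<And>t. t \<in> {0..1} \<Longrightarrow> norm (flow_curve b A p t) \<le> 2 * norm p"
proof -
  obtain x where x: "sol b A x" "x 0 = p" "\<And>t. t \<in> {0..1} \<Longrightarrow> norm (x t) \<le> r"
    using flow_curve_ex[OF fr p] by blast
  then have s: "sol b A (flow_curve b A p) \<and> flow_curve b A p 0 = p"
    unfolding flow_curve_def by (intro someI2_ex[where Q = "\<lambda>x. sol b A x \<and> x 0 = p"]) auto
  then show "sol b A (flow_curve b A p)" "flow_curve b A p 0 = p" by auto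
  have A: "mlin b A D" "2 \<le> b" "0 < r" using fr by (auto simp: flow_radius_def)
  show eq: "y t = flow_curve b A p t" if "sol b A y" "y 0 = p" "t \<in> {0..1}" for y t
    by (rule sol_unique[OF A(1)]) (use that s in auto)
  show le: "norm (flow_curve b A p t) \<le> r" if "t \<in> {0..1}" for t
    using x eq[OF x(1,2)] that by metis
  \<comment> \<open>Comparison with the zero solution.\<close>
  show "norm (flow_curve b A p t) \<le> 2 * norm p" if t: "t \<in> {0..1}" for t
    using sol_lipschitz[where x = "flow_curve b A p", OF fr _ sol_0[OF A(1,2)] le _ t] s A(3) by simp
qed

lemma flow_curve_lipschitz:
  fixes A :: "'a::{real_inner, banach} list \<Rightarrow> 'a"
  assumes fr: "flow_radius b A D r" and p: "norm p \<le> r / 2" "norm p' \<le> r / 2" and t: "t \<in> {0..1}"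
  shows "norm (flow_curve b A p t - flow_curve b A p' t) \<le> 2 * norm (p - p')"
proof -
  show ?thesis
    using sol_lipschitz[OF fr flow_curve_sol[OF fr p(1)] flow_curve_sol[OF fr p(2)]
        flow_curve_le[OF fr p(1)] flow_curve_le[OF fr p(2)] t]
    by (simp add: flow_curve_0[OF fr p(1)] flow_curve_0[OF fr p(2)])
qed

lemma flow_radius_uminus: "flow_radius b A D r \<Longrightarrow> flow_radius b (\<lambda>vs. - A vs) D r"
  using mlin_scale[of b A D "-1"] by (auto simp: flow_radius_def)

lemma sol_reverse:
  assumes "sol b A x"
  shows "sol b (\<lambda>vs. - A vs) (\<lambda>t. x (1 - t))"
  unfolding sol_def
proof
  fix t :: real assume t: "t \<in> {0..1}"
  have "((\<lambda>t. 1 - t) has_vector_derivative -1) (at t within {0..1})"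
    by (auto intro!: derivative_eq_intros)
  moreover have "(x has_vector_derivative A (replicate b (x (1 - t)))) (at (1 - t) within (\<lambda>t. 1 - t) ` {0..1})"
    using sol_deriv[OF assms, of "1 - t"] t by (simp add: image_diff_atLeastAtMost)
  ultimately have "((x \<circ> (\<lambda>t. 1 - t)) has_vector_derivative (-1) *\<^sub>R A (replicate b (x (1 - t)))) (at t within {0..1})"
    by (rule vector_diff_chain_within)
  then show "((\<lambda>t. x (1 - t)) has_vector_derivative - A (replicate b (x (1 - t)))) (at t within {0..1})"
    by (simp add: o_def)
qed

text \<open>The time-reversed orbit solves the negated field. The radius \<open>r / 4\<close> is
  chosen because a flow can double the norm and the image must again lie within
  \<open>r / 2\<close>.\<close>

lemma time1_inverse:
  fixes A :: "'a::{real_inner, banach} list \<Rightarrow> 'a"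
  assumes fr: "flow_radius b A D r" and p: "norm p \<le> r / 4"
  shows "time1 b (\<lambda>vs. - A vs) (time1 b A p) = p"
proof -
  have r: "0 < r" using fr by (simp add: flow_radius_def)
  then have p2: "norm p \<le> r / 2" using p by simp
  have n: "norm (time1 b A p) \<le> r / 2"
    using flow_curve_norm[OF fr p2, of 1] p by simp
  have "(\<lambda>t. flow_curve b A p (1 - t)) 1 = time1 b (\<lambda>vs. - A vs) (time1 b A p)"
    by (rule flow_curve_eq[OF flow_radius_uminus[OF fr] n sol_reverse[OF flow_curve_sol[OF fr p2]]]) auto
  then show ?thesis
    using flow_curve_0[OF fr p2] by simp
qed

subsection \<open>The Lie series\<close>

lemma subst_funpow_has_vector_derivative:
  assumes a: "mlin n a C" and A: "mlin b A D" and b: "1 \<le> b"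
    and x: "(x has_vector_derivative A (replicate b (x t))) (at t within S)"
  shows "((\<lambda>t. (subst b A ^^ k) a (replicate (n + k * (b - 1)) (x t))) has_vector_derivative
    (subst b A ^^ Suc k) a (replicate (n + Suc k * (b - 1)) (x t))) (at t within S)"
proof -
  have "n + Suc k * (b - 1) = n + k * (b - 1) + b - 1"
    using b by simp
  then show ?thesis
    using mlin_diag_has_vector_derivative[OF x mlin_subst_funpow[OF a A b, of k]]
    by (simp only: funpow.simps o_apply subst_replicate[OF b])
qed

text \<open>Along the orbit the \<open>k\<close>-th time derivative of the diagonal value of
  \<open>a\<close> is the \<open>k\<close>-fold substitution. The series is therefore Taylor's
  series at time 0, evaluated at time 1.\<close>

lemma lie_series:
  fixes A :: "'a::{real_inner, banach} list \<Rightarrow> 'a" and a :: "'a list \<Rightarrow> 'b::banach"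
  assumes fr: "flow_radius b A D r" and a: "mlin n a C" and p: "norm p \<le> r / 2"
  shows "(\<lambda>k. (1 / fact k) *\<^sub>R (subst b A ^^ k) a (replicate (n + k * (b - 1)) p))
    sums a (replicate n (time1 b A p))"
proof -
  have A: "mlin b A D" and b: "1 \<le> b" and r: "0 < r" and rb: "D * exp b * r ^ (b - 1) \<le> 1/2"
    using fr by (auto simp: flow_radius_def)
  let ?x = "flow_curve b A p"
  define Df where "Df k t = (subst b A ^^ k) a (replicate (n + k * (b - 1)) (?x t))" for k t
  have D: "(Df k has_vector_derivative Df (Suc k) t) (at t within {0..1})" if "0 \<le> t" "t \<le> 1" for k t
    unfolding Df_def
    by (rule subst_funpow_has_vector_derivative[OF a A b]) (use that sol_deriv[OF flow_curve_sol[OF fr p]] in auto)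
  define cst where "cst = C * (exp 1 * r) ^ n"
  have bound: "norm (Df k t) / fact k \<le> cst * (1/2) ^ k" if "t \<in> {0..1}" for k t
    unfolding Df_def cst_def
    by (rule norm_subst_funpow_le[OF a A b flow_curve_le[OF fr p that] rb])
  have cst: "0 \<le> cst"
    unfolding cst_def using mlin_nonneg[OF a] r by auto
  have rem: "norm (a (replicate n (time1 b A p)) - (\<Sum>i<Suc k. (1 / fact i) *\<^sub>R (subst b A ^^ i) a (replicate (n + i * (b - 1)) p)))
      \<le> cst * (1/2) ^ Suc k * Suc k" for k
  proof -
    define f where "f t = ((1 - t) ^ k / fact k) *\<^sub>R Df (Suc k) t" for t
    have T: "Df 0 1 = (\<Sum>i<Suc k. ((1 - 0) ^ i / fact i) *\<^sub>R Df i 0) + integral {0..1} f"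
      unfolding f_def using Taylor_integral[of "Suc k" Df "Df 0" 0 1] D by simp
    have "norm (integral {0..1} f) \<le> cst * (1/2) ^ Suc k * Suc k * (1 - 0)"
    proof (rule integral_bound)
      show "continuous_on {0..1} f"
        unfolding f_def using D
        by (intro continuous_intros continuous_on_vector_derivative) auto
      fix t :: real assume t: "t \<in> {0..1}"
      \<comment> \<open>Writing \<open>1 / fact k\<close> as \<open>Suc k / fact (Suc k)\<close>
        makes the bound for the derivative of order \<open>Suc k\<close> applicable. The extra
        factor \<open>Suc k\<close> is harmless against the geometric decay.\<close>
      have "norm (f t) = (1 - t) ^ k * (norm (Df (Suc k) t) / fact (Suc k) * Suc k)"
        unfolding f_def using t by simp
      also have "\<dots> \<le> 1 * (cst * (1/2) ^ Suc k * Suc k)"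
        using t cst by (intro mult_mono bound mult_right_mono power_le_one) auto
      finally show "norm (f t) \<le> cst * (1/2) ^ Suc k * Suc k" by simp
    qed auto
    with T show ?thesis
      by (simp add: Df_def flow_curve_0[OF fr p] del: power_Suc of_nat_Suc sum.lessThan_Suc)
  qed
  have "(\<lambda>k. cst * ((1/2) ^ Suc k * Suc k)) \<longlonglongrightarrow> cst * 0"
  proof (intro tendsto_mult_left LIMSEQ_Suc[of "\<lambda>k. (1/2::real) ^ k * real k"])
    show "(\<lambda>k. (1/2::real) ^ k * real k) \<longlonglongrightarrow> 0"
      using powser_times_n_limit_0[of "1/2::real"] by (simp add: mult.commute)
  qed
  then have "(\<lambda>k. cst * (1/2) ^ Suc k * Suc k) \<longlonglongrightarrow> 0"
    by (simp add: mult.assoc)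
  then have "(\<lambda>k. a (replicate n (time1 b A p)) - (\<Sum>i<Suc k. (1 / fact i) *\<^sub>R (subst b A ^^ i) a (replicate (n + i * (b - 1)) p))) \<longlonglongrightarrow> 0"
    by (rule Lim_null_comparison[rotated]) (intro always_eventually allI rem)
  then have "(\<lambda>k. \<Sum>i<Suc k. (1 / fact i) *\<^sub>R (subst b A ^^ i) a (replicate (n + i * (b - 1)) p)) \<longlonglongrightarrow> a (replicate n (time1 b A p))"
    by (rule Lim_transform2[OF tendsto_const])
  then show ?thesis
    unfolding sums_def by (subst (asm) filterlim_sequentially_Suc)
qed


section \<open>Power series of multilinear maps\<close>

text \<open>An unconditionally convergent family may be grouped by any index. Later groupings are by
  length, by number of free slots, by component and by contracted list.\<close>

lemma has_sum_fibers:
  fixes f :: "'a \<Rightarrow> 'b::banach"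
  assumes "(f has_sum S) A"
  shows "((\<lambda>y. \<Sum>\<^sub>\<infinity>x\<in>{x\<in>A. \<phi> x = y}. f x) has_sum S) UNIV"
proof (rule has_sum_SigmaD[where f = "f \<circ> snd" and B = "\<lambda>y. {x\<in>A. \<phi> x = y}"])
  show "((f \<circ> snd) has_sum S) (SIGMA y:UNIV. {x\<in>A. \<phi> x = y})"
  proof -
    have "inj_on (\<lambda>x. (\<phi> x, x)) A" by (auto simp: inj_on_def)
    moreover have "(SIGMA y:UNIV. {x\<in>A. \<phi> x = y}) = (\<lambda>x. (\<phi> x, x)) ` A" by auto
    ultimately show ?thesis
      using assms by (simp add: has_sum_reindex o_def)
  qed
  have "f summable_on {x\<in>A. \<phi> x = y}" for y
    by (rule summable_on_subset_banach[OF has_sum_imp_summable[OF assms]]) auto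
  then show "((\<lambda>x. (f \<circ> snd) (y, x)) has_sum (\<Sum>\<^sub>\<infinity>x\<in>{x\<in>A. \<phi> x = y}. f x)) {x\<in>A. \<phi> x = y}" for y
    by simp
qed

text \<open>A boolean list is a word that marks which slots receive the arguments and which receive
  \<open>p\<close>. Summing over words takes the place of binomial coefficients, because the maps
  are not symmetric.\<close>

fun fill :: "'a \<Rightarrow> bool list \<Rightarrow> 'a list \<Rightarrow> 'a list" where
  "fill p [] vs = []"
| "fill p (True # bs) vs = hd vs # fill p bs (tl vs)"
| "fill p (False # bs) vs = p # fill p bs vs"

abbreviation trues :: "bool list \<Rightarrow> nat" where
  "trues bs \<equiv> count_list bs True"

lemma length_fill [simp]: "length (fill p bs vs) = length bs"
  by (induction p bs vs rule: fill.induct) auto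

lemma fill_slot:
  "trues bs = length xs + length ys + 1 \<Longrightarrow>
    \<exists>us ws. length us + length ws + 1 = length bs \<and> (\<forall>v. fill p bs (xs @ v # ys) = us @ v # ws)"
proof (induction bs arbitrary: xs)
  case (Cons c bs)
  show ?case
  proof (cases c)
    case False
    with Cons.IH[of xs] Cons.prems obtain us ws where "length us + length ws + 1 = length bs"
      "\<forall>v. fill p bs (xs @ v # ys) = us @ v # ws"
      by auto
    then show ?thesis using False by (intro exI[of _ "p # us"] exI[of _ ws]) auto
  next
    case True
    show ?thesis
    proof (cases xs)
      case Nil
      then show ?thesis using True by (intro exI[of _ "[]"] exI[of _ "fill p bs ys"]) auto
    next
      case (Cons x xs')
      with Cons.IH[of xs'] Cons.prems True obtain us ws where "length us + length ws + 1 = length bs"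
        "\<forall>v. fill p bs (xs' @ v # ys) = us @ v # ws"
        by auto
      then show ?thesis using True Cons by (intro exI[of _ "x # us"] exI[of _ ws]) auto
    qed
  qed
qed simp

lemma norms_fill_le:
  assumes "norm p \<le> r" "0 < r"
  shows "trues bs = length vs \<Longrightarrow> norms (fill p bs vs) \<le> r ^ length bs / r ^ length vs * norms vs"
proof (induction bs arbitrary: vs)
  case (Cons c bs)
  show ?case
  proof (cases c)
    case True
    with Cons.prems obtain v vs' where "vs = v # vs'" "trues bs = length vs'"
      by (cases vs) auto
    then show ?thesis
      using mult_left_mono[OF Cons.IH, of vs' "norm v"] True assms by (simp add: mult_ac)
  next
    case False
    then have "norms (fill p (c # bs) vs) \<le> r * (r ^ length bs / r ^ length vs * norms vs)"
      using Cons.IH[of vs] Cons.prems assms by (auto intro!: mult_mono simp del: times_divide_eq_right)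
    then show ?thesis by (simp add: mult.assoc)
  qed
qed simp

lemma mlin_expand:
  assumes "mlin n a C"
  shows "a (replicate n (p + h)) = (\<Sum>bs | length bs = n. a (fill p bs (replicate (trues bs) h)))"
  using assms
proof (induction n arbitrary: a C)
  case (Suc n)
  let ?S = "{bs :: bool list. length bs = n}"
  have fin: "finite ?S"
    using finite_lists_length_eq[of "UNIV :: bool set" n] by simp
  have "{bs :: bool list. length bs = Suc n} = (Cons True) ` ?S \<union> (Cons False) ` ?S"
    by (auto simp: length_Suc_conv)
  then have "(\<Sum>bs | length bs = Suc n. a (fill p bs (replicate (trues bs) h))) =
     (\<Sum>bs\<in>Cons True ` ?S. a (fill p bs (replicate (trues bs) h))) +
     (\<Sum>bs\<in>Cons False ` ?S. a (fill p bs (replicate (trues bs) h)))"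
    by (simp only:) (rule sum.union_disjoint, use fin in auto)
  also have "\<dots> = (\<Sum>bs\<in>?S. a (h # fill p bs (replicate (trues bs) h))) +
     (\<Sum>bs\<in>?S. a (p # fill p bs (replicate (trues bs) h)))"
    by (simp add: sum.reindex)
  also have "\<dots> = a (h # replicate n (p + h)) + a (p # replicate n (p + h))"
    using Suc.IH[OF mlin_Cons[OF Suc.prems]] by simp
  also have "\<dots> = a ((h + p) # replicate n (p + h))"
    using linear_add[OF mlin_linear[OF Suc.prems, of "[]" "replicate n (p + h)"]] by simp
  finally show ?case by (simp add: add.commute)
qed simp

lemma sum_one_true:
  "(\<Sum>bs | trues bs = Suc 0 \<and> length bs = n. a (fill p bs [h])) = diag_deriv a n p h"
proof (induction n arbitrary: a)
  case (Suc n)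
  let ?S = "{bs. trues bs = Suc 0 \<and> length bs = n}"
  have fin: "finite ?S"
    by (rule finite_subset[OF _ finite_lists_length_eq[of "UNIV :: bool set" n]]) auto
  have 0: "trues bs = 0 \<longleftrightarrow> bs = replicate (length bs) False" for bs
    by (induction bs) auto
  have "{bs. trues bs = Suc 0 \<and> length bs = Suc n} = insert (True # replicate n False) (Cons False ` ?S)"
    by (force simp: length_Suc_conv 0 image_iff split: if_splits)
  moreover have "fill p (replicate m False) vs = replicate m p" for m vs
    by (induction m) auto
  ultimately have "(\<Sum>bs | trues bs = Suc 0 \<and> length bs = Suc n. a (fill p bs [h])) =
      a (h # replicate n p) + (\<Sum>bs\<in>?S. a (p # fill p bs [h]))"
    using fin by (simp add: sum.reindex image_iff)
  then show ?case
    by (simp add: Suc.IH[of "\<lambda>vs. a (p # vs)"] diag_deriv_def sum.lessThan_Suc_shift del: sum.lessThan_Suc)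
qed (auto simp: diag_deriv_def intro!: sum.neutral)

text \<open>There are \<open>2 ^ k\<close> words of length \<open>k\<close>; hence the factor 2 in
  the radius conditions for recentring.\<close>

lemma summable_on_power_length_bool:
  assumes "0 \<le> x" "2 * x < (1::real)"
  shows "(\<lambda>bs :: bool list. x ^ length bs) summable_on UNIV"
proof (rule nonneg_bounded_partial_sums_imp_summable_on[where C = "1 / (1 - 2 * x)"])
  show "\<forall>\<^sub>F F in finite_subsets_at_top UNIV. (\<Sum>bs\<in>F. x ^ length (bs :: bool list)) \<le> 1 / (1 - 2 * x)"
  proof (intro eventually_finite_subsets_at_top_weakI)
    fix F :: "bool list set" assume F: "finite F"
    let ?S = "\<lambda>k. {bs :: bool list. length bs = k}"
    have S: "finite (?S k)" "card (?S k) = 2 ^ k" for k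
      using finite_lists_length_eq[of "UNIV :: bool set" k] card_lists_length_eq[of "UNIV :: bool set" k]
      by simp_all
    define m where "m = Max (insert 0 (length ` F))"
    have "F \<subseteq> (\<Union>k\<in>{..m}. ?S k)"
      using F by (auto simp: m_def)
    then have "(\<Sum>bs\<in>F. x ^ length bs) \<le> (\<Sum>bs\<in>(\<Union>k\<in>{..m}. ?S k). x ^ length bs)"
      using assms S by (intro sum_mono2) auto
    also have "\<dots> = (\<Sum>k\<le>m. \<Sum>bs\<in>?S k. x ^ length bs)"
      using S by (intro sum.UNION_disjoint) auto
    also have "\<dots> = (\<Sum>k\<le>m. (2 * x) ^ k)"
      by (simp add: S power_mult_distrib)
    also have "\<dots> \<le> (\<Sum>k. (2 * x) ^ k)"
      using assms by (intro sum_le_suminf summable_geometric) (simp_all del: power_mult_distrib)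
    also have "\<dots> = 1 / (1 - 2 * x)"
      using assms by (intro suminf_geometric) auto
    finally show "(\<Sum>bs\<in>F. x ^ length bs) \<le> 1 / (1 - 2 * x)" .
  qed
qed (use assms in auto)

text \<open>The Taylor coefficients at \<open>p\<close> of the power series with coefficients
  \<open>a\<close>: the part of degree \<open>n\<close> collects all words with exactly
  \<open>n\<close> free slots, of any length.\<close>

definition recenter :: "('a list \<Rightarrow> 'b::{topological_space, comm_monoid_add, t2_space}) \<Rightarrow> 'a \<Rightarrow> 'a list \<Rightarrow> 'b" where
  "recenter a p vs = (\<Sum>\<^sub>\<infinity>bs\<in>{bs. trues bs = length vs}. a (fill p bs vs))"

context
  fixes a :: "'a::real_normed_vector list \<Rightarrow> 'b::banach" and C \<sigma> r :: real and p :: 'a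
  assumes a: "\<And>n. mlin n a (C * \<sigma> ^ n)" and \<sigma>: "0 \<le> \<sigma>" and r: "0 < r" "2 * (\<sigma> * r) < 1"
    and p: "norm p \<le> r"
begin

lemma recenter_C: "0 \<le> C"
  using mlin_nonneg[OF a[of 0]] by simp

lemma recenter_term_le:
  assumes "trues bs = length vs"
  shows "norm (a (fill p bs vs)) \<le> (\<sigma> * r) ^ length bs * (C * norms vs / r ^ length vs)"
proof -
  have "norm (a (fill p bs vs)) \<le> C * \<sigma> ^ length bs * norms (fill p bs vs)"
    by (rule mlin_bound[OF a]) simp
  also have "\<dots> \<le> C * \<sigma> ^ length bs * (r ^ length bs / r ^ length vs * norms vs)"
    using norms_fill_le[OF p r(1) assms] recenter_C \<sigma> by (intro mult_left_mono) auto
  finally show ?thesis by (simp add: power_mult_distrib mult_ac)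
qed

lemma recenter_weights: "(\<lambda>bs :: bool list. (\<sigma> * r) ^ length bs) summable_on S"
  by (rule summable_on_subset_banach[OF summable_on_power_length_bool]) (use \<sigma> r in auto)

lemma recenter_abs_summable:
  assumes "\<And>bs. bs \<in> S \<Longrightarrow> trues bs = length vs"
  shows "(\<lambda>bs. norm (a (fill p bs vs))) summable_on S"
  by (rule summable_on_comparison_test[OF summable_on_cmult_left[OF recenter_weights,
          where c = "C * norms vs / r ^ length vs"]])
    (use assms recenter_term_le[of _ vs] in auto)

lemma recenter_summable:
  "(\<And>bs. bs \<in> S \<Longrightarrow> trues bs = length vs) \<Longrightarrow> (\<lambda>bs. a (fill p bs vs)) summable_on S"
  by (rule abs_summable_summable[OF recenter_abs_summable])

lemma mlin_recenter:
  "mlin n (recenter a p) (C * (\<Sum>\<^sub>\<infinity>bs :: bool list. (\<sigma> * r) ^ length bs) * (1 / r) ^ n)"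
  unfolding mlin_def
proof (intro conjI allI impI)
  show "0 \<le> C * (\<Sum>\<^sub>\<infinity>bs :: bool list. (\<sigma> * r) ^ length bs) * (1 / r) ^ n"
    using recenter_C \<sigma> r by (intro mult_nonneg_nonneg infsum_nonneg) auto
  fix vs :: "'a list" assume vs: "length vs = n"
  have nn: "0 \<le> C * norms vs / r ^ length vs"
    using recenter_C r by simp
  have "norm (recenter a p vs) \<le> (\<Sum>\<^sub>\<infinity>bs\<in>{bs. trues bs = length vs}. (\<sigma> * r) ^ length bs * (C * norms vs / r ^ length vs))"
    unfolding recenter_def
    by (rule norm_infsum_le[OF has_sum_infsum has_sum_infsum])
      (use recenter_term_le[of _ vs] in \<open>auto intro!: recenter_summable summable_on_cmult_left recenter_weights simp del: times_divide_eq_right\<close>)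
  also have "\<dots> \<le> (\<Sum>\<^sub>\<infinity>bs :: bool list. (\<sigma> * r) ^ length bs * (C * norms vs / r ^ length vs))"
    by (rule infsum_mono2[OF summable_on_cmult_left[OF recenter_weights] summable_on_cmult_left[OF recenter_weights]])
      (use nn \<sigma> r in \<open>auto intro!: mult_nonneg_nonneg simp del: times_divide_eq_right\<close>)
  also have "\<dots> = C * (\<Sum>\<^sub>\<infinity>bs :: bool list. (\<sigma> * r) ^ length bs) * (1 / r) ^ n * norms vs"
    by (subst infsum_cmult_left[OF recenter_weights]) (simp add: vs power_divide)
  finally show "norm (recenter a p vs) \<le> C * (\<Sum>\<^sub>\<infinity>bs :: bool list. (\<sigma> * r) ^ length bs) * (1 / r) ^ n * norms vs" .
next
  fix xs ys :: "'a list" assume len: "length xs + length ys + 1 = n"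
  have lin: "linear (\<lambda>v. a (fill p bs (xs @ v # ys)))" if bs: "trues bs = n" for bs
  proof -
    obtain us ws where "length us + length ws + 1 = length bs" "\<And>v. fill p bs (xs @ v # ys) = us @ v # ws"
      using fill_slot[of bs xs ys p] bs len by auto
    then show ?thesis using mlin_linear[OF a] by simp
  qed
  show "linear (\<lambda>v. recenter a p (xs @ v # ys))"
  proof (rule linearI)
    fix u v :: 'a and c :: real
    have n: "length (xs @ w # ys) = n" for w using len by simp
    show "recenter a p (xs @ (u + v) # ys) = recenter a p (xs @ u # ys) + recenter a p (xs @ v # ys)"
      unfolding recenter_def n using n
      by (subst infsum_add[symmetric])
        (auto intro!: recenter_summable infsum_cong linear_add[OF lin])
    show "recenter a p (xs @ (c *\<^sub>R v) # ys) = c *\<^sub>R recenter a p (xs @ v # ys)"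
      unfolding recenter_def n
      by (subst infsum_scaleR_right[symmetric]) (auto intro!: infsum_cong linear_cmul[OF lin])
  qed
qed

text \<open>One absolutely summable family over words, grouped once by length and once by the number
  of free slots.\<close>

lemma recenter_sums:
  assumes h: "norm h \<le> r"
  obtains y where "(\<lambda>n. a (replicate n (p + h))) sums y" "(\<lambda>n. recenter a p (replicate n h)) sums y"
proof -
  define g where "g bs = a (fill p bs (replicate (trues bs) h))" for bs
  have "norm (g bs) \<le> (\<sigma> * r) ^ length bs * C" for bs
  proof -
    have "norm (g bs) \<le> (\<sigma> * r) ^ length bs * (C * norm h ^ trues bs / r ^ trues bs)"
      unfolding g_def using recenter_term_le[of bs "replicate (trues bs) h"] by simp
    also have "\<dots> \<le> (\<sigma> * r) ^ length bs * (C * r ^ trues bs / r ^ trues bs)"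
      using h r \<sigma> recenter_C by (intro mult_left_mono divide_right_mono power_mono) auto
    finally show ?thesis using r by simp
  qed
  then have "g summable_on UNIV"
    by (intro abs_summable_summable[OF summable_on_comparison_test[OF summable_on_cmult_left[OF recenter_weights]]]) auto
  then have g: "(g has_sum infsum g UNIV) UNIV" by simp
  have "a (replicate n (p + h)) = infsum g {bs. length bs = n}" for n
    using mlin_expand[OF a] finite_lists_length_eq[of "UNIV :: bool set" n] by (simp add: g_def)
  then have "(\<lambda>n. a (replicate n (p + h))) sums infsum g UNIV"
    using has_sum_imp_sums[OF has_sum_fibers[OF g, of length]] by simp
  moreover have "recenter a p (replicate n h) = infsum g {bs. trues bs = n}" for n
    unfolding recenter_def g_def by (auto intro!: infsum_cong)
  then have "(\<lambda>n. recenter a p (replicate n h)) sums infsum g UNIV"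
    using has_sum_imp_sums[OF has_sum_fibers[OF g, of trues]] by simp
  ultimately show ?thesis using that by blast
qed

lemma recenter_linear_sums: "(\<lambda>n. diag_deriv a n p h) sums recenter a p [h]"
proof -
  have fin: "finite {bs. trues bs = Suc 0 \<and> length bs = n}" for n
    by (rule finite_subset[OF _ finite_lists_length_eq[of "UNIV :: bool set" n]]) auto
  let ?g = "\<lambda>bs. a (fill p bs [h])"
  have "?g summable_on {bs. trues bs = 1}"
    by (rule recenter_summable) simp
  then have "(?g has_sum recenter a p [h]) {bs. trues bs = 1}"
    unfolding recenter_def by simp
  from has_sum_imp_sums[OF has_sum_fibers[OF this, of length]]
  show ?thesis
    by (simp add: sum_one_true fin)
qed

end

lemma has_derivative_quadratic:
  fixes f :: "'a::real_normed_vector \<Rightarrow> 'b::real_normed_vector"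
  assumes D: "bounded_linear D" and r: "0 < r"
    and le: "\<And>h. norm h < r \<Longrightarrow> norm (f (p + h) - f p - D h) \<le> c * (norm h)\<^sup>2"
  shows "(f has_derivative D) (at p)"
  unfolding has_derivative_at
proof (intro conjI D)
  have lim: "((\<lambda>h::'a. c * norm h) \<longlongrightarrow> 0) (at 0)"
    using tendsto_mult_left[OF tendsto_norm[OF tendsto_ident_at[of "0::'a" UNIV]], of c] by simp
  show "(\<lambda>h. norm (f (p + h) - f p - D h) / norm h) \<midarrow>0\<rightarrow> 0"
  proof (rule Lim_null_comparison[OF _ lim])
    show "\<forall>\<^sub>F h in at 0. norm (norm (f (p + h) - f p - D h) / norm h) \<le> c * norm h"
      unfolding eventually_at
    proof (intro exI[of _ r] conjI ballI impI r)
      fix h :: 'a assume "h \<noteq> 0 \<and> dist h 0 < r"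
      then show "norm (norm (f (p + h) - f p - D h) / norm h) \<le> c * norm h"
        using le[of h] by (simp add: divide_le_eq power2_eq_square mult.assoc)
    qed
  qed
qed

text \<open>After recentring at \<open>p\<close> the terms of degree at least two form a geometric
  series of size \<open>(norm h)\<^sup>2\<close>, with ratio below 1/2 for
  \<open>norm h < r / 2\<close>.\<close>

lemma power_series_has_derivative:
  fixes a :: "'a::real_normed_vector list \<Rightarrow> 'b::banach"
  assumes a: "\<And>n. mlin n a (C * \<sigma> ^ n)" and \<sigma>: "0 \<le> \<sigma>" and r: "0 < r" "2 * (\<sigma> * r) < 1"
    and p: "norm p < r" and f: "\<And>x. norm x < r \<Longrightarrow> (\<lambda>n. a (replicate n x)) sums f x"
  shows "(f has_derivative (\<lambda>h. recenter a p [h])) (at p)"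
proof -
  have p': "norm p \<le> r" using p by simp
  note re = a \<sigma> r p'
  define b where "b = recenter a p"
  define Z where "Z = C * (\<Sum>\<^sub>\<infinity>bs :: bool list. (\<sigma> * r) ^ length bs)"
  have b: "mlin n b (Z * (1 / r) ^ n)" for n
    unfolding b_def Z_def by (rule mlin_recenter[OF re])
  have fb: "(\<lambda>n. b (replicate n h)) sums f (p + h)" if h: "norm h < r - norm p" for h
  proof -
    have "norm h \<le> r" "norm (p + h) < r"
      using h norm_triangle_ineq[of p h] norm_ge_zero[of p] by linarith+
    then show ?thesis
      using recenter_sums[OF re, of h] f[of "p + h"] unfolding b_def by (metis sums_unique2)
  qed
  show ?thesis
    unfolding b_def[symmetric]
  proof (rule has_derivative_quadratic[where r = "min (r / 2) (r - norm p)" and c = "2 * Z * (1 / r)\<^sup>2"])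
    have "linear (\<lambda>v. b [v])"
      using mlin_linear[OF b, of "[]" "[]"] by simp
    then show "bounded_linear (\<lambda>h. b [h])"
      using mlin_bound[OF b, of "[_]" 1]
      by (intro bounded_linear.intro bounded_linear_axioms.intro exI[of _ "Z * (1 / r)"]) (auto simp: mult.commute)
    show "0 < min (r / 2) (r - norm p)" using r p by simp
    fix h :: 'a assume "norm h < min (r / 2) (r - norm p)"
    then have h: "norm h < r - norm p" "norm h / r < 1 / 2"
      using r by (auto simp: divide_less_eq)
    have b0: "b [] = f p"
    proof -
      have "(\<lambda>n. b (replicate n 0)) sums b []"
      proof -
        have "b (replicate n 0) = (if n = 0 then b [] else 0)" for n
          using mlin_diag_0[OF b[of n]] by (cases n) auto
        then show ?thesis using sums_single[of 0 "\<lambda>_. b []"] by simp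
      qed
      then show ?thesis
        using fb[of 0] p sums_unique2 by fastforce
    qed
    have Z0: "0 \<le> Z" using mlin_nonneg[OF b[of 0]] by simp
    have "(\<lambda>n. b (replicate (n + 2) h)) sums (f (p + h) - (\<Sum>i<2. b (replicate i h)))"
      using fb[OF h(1)] by (rule sums_split_initial_segment)
    then have *: "(\<lambda>n. b (replicate (n + 2) h)) sums (f (p + h) - f p - b [h])"
      by (simp add: numeral_2_eq_2 b0 diff_diff_eq)
    have geo: "(\<lambda>n. Z * (norm h / r) ^ 2 * (1/2) ^ n) sums (Z * (norm h / r) ^ 2 * 2)"
      using sums_mult[OF geometric_sums[of "1/2::real"], of "Z * (norm h / r) ^ 2"] by simp
    have "norm (b (replicate (n + 2) h)) \<le> Z * (norm h / r) ^ 2 * (1/2) ^ n" for n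
    proof -
      have "norm (b (replicate (n + 2) h)) \<le> Z * (1 / r) ^ (n + 2) * norm h ^ (n + 2)"
        using mlin_bound[OF b, of "replicate (n + 2) h"] by simp
      also have "\<dots> = Z * (norm h / r) ^ 2 * (norm h / r) ^ n"
        by (simp add: power_divide power_add power2_eq_square)
      also have "\<dots> \<le> Z * (norm h / r) ^ 2 * (1/2) ^ n"
        using h Z0 r by (intro mult_left_mono power_mono) auto
      finally show ?thesis .
    qed
    then have "norm (f (p + h) - f p - b [h]) \<le> Z * (norm h / r) ^ 2 * 2"
      using * geo by (metis (no_types, lifting) norm_sums_le sums_summable summable_comparison_test'
          norm_suminf_le sums_unique)
    then show "norm (f (p + h) - f p - b [h]) \<le> 2 * Z * (1 / r)\<^sup>2 * (norm h)\<^sup>2"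
      by (simp add: power_divide mult_ac)
  qed
qed

subsection \<open>Analyticity of time-one maps\<close>

text \<open>The Lie series of the identity, of which \<open>hd\<close> is the version on lists of
  length one. It has terms in the degrees \<open>1 + k * (b - 1)\<close> only.\<close>

definition lie_family :: "nat \<Rightarrow> ('a::real_normed_vector list \<Rightarrow> 'a) \<Rightarrow> 'a list \<Rightarrow> 'a" where
  "lie_family b A vs = (if \<exists>k. length vs = 1 + k * (b - 1)
     then (1 / fact ((length vs - 1) div (b - 1))) *\<^sub>R (subst b A ^^ ((length vs - 1) div (b - 1))) hd vs
     else 0)"

lemma lie_family_eq:
  "2 \<le> b \<Longrightarrow> length vs = 1 + k * (b - 1) \<Longrightarrow> lie_family b A vs = (1 / fact k) *\<^sub>R (subst b A ^^ k) hd vs"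
  by (auto simp: lie_family_def)

lemma mlin_zero: "0 \<le> C \<Longrightarrow> mlin n (\<lambda>_. 0) C"
  by (simp add: mlin_def linear_zero)

lemma mlin_lie_family:
  assumes A: "mlin b A D" and b: "2 \<le> b"
  shows "mlin n (lie_family b A) (1 * (exp 1 * max 1 D) ^ n)"
proof (cases "\<exists>k. n = 1 + k * (b - 1)")
  case True
  then obtain k where k: "n = 1 + k * (b - 1)" by blast
  have "mlin n (\<lambda>vs. (1 / fact k) *\<^sub>R (subst b A ^^ k) hd vs) (\<bar>1 / fact k\<bar> * (1 * D ^ k * real n ^ k))"
    unfolding k using b by (intro mlin_scale mlin_subst_funpow mlin_hd A) auto
  moreover have "\<bar>1 / fact k\<bar> * (1 * D ^ k * real n ^ k) \<le> 1 * (exp 1 * max 1 D) ^ n"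
  proof -
    have D: "0 \<le> D" using A by (rule mlin_nonneg)
    have kn: "k \<le> n"
      unfolding k using b by (cases "b - 1") auto
    have "\<bar>1 / fact k\<bar> * (1 * D ^ k * real n ^ k) = D ^ k * (real n ^ k / fact k)"
      by simp
    also have "\<dots> \<le> max 1 D ^ n * exp (real n)"
      using D kn by (intro mult_mono power_div_fact_le_exp order_trans[OF power_mono[of D "max 1 D"] power_increasing]) auto
    finally show ?thesis
      by (simp add: power_mult_distrib exp_of_nat_mult[symmetric] mult.commute)
  qed
  ultimately have "mlin n (\<lambda>vs. (1 / fact k) *\<^sub>R (subst b A ^^ k) hd vs) (1 * (exp 1 * max 1 D) ^ n)"
    by (rule mlin_mono)
  then show ?thesis
    by (subst mlin_cong[where a' = "\<lambda>vs. (1 / fact k) *\<^sub>R (subst b A ^^ k) hd vs"])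
      (use b k in \<open>auto intro: lie_family_eq\<close>)
next
  case False
  then show ?thesis
    by (subst mlin_cong[where a' = "\<lambda>_. 0"]) (auto simp: lie_family_def intro!: mlin_zero)
qed

lemma lie_family_sums:
  fixes A :: "'a::{real_inner, banach} list \<Rightarrow> 'a"
  assumes fr: "flow_radius b A D r" and p: "norm p \<le> r / 2"
  shows "(\<lambda>n. lie_family b A (replicate n p)) sums time1 b A p"
proof -
  have b: "2 \<le> b" using fr by (simp add: flow_radius_def)
  have "(\<lambda>k. lie_family b A (replicate (1 + k * (b - 1)) p)) sums time1 b A p"
    using lie_series[OF fr mlin_hd p] b by (simp add: lie_family_eq)
  moreover have "strict_mono (\<lambda>k. 1 + k * (b - 1))"
    using b by (auto intro!: strict_monoI)
  moreover have "lie_family b A (replicate n p) = 0" if "n \<notin> range (\<lambda>k. 1 + k * (b - 1))" for n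
    using that by (auto simp: lie_family_def)
  ultimately show ?thesis
    by (subst (asm) sums_mono_reindex)
qed

lemma time1_has_derivative:
  fixes A :: "'a::{real_inner, banach} list \<Rightarrow> 'a"
  assumes fr: "flow_radius b A D r"
  obtains r' where "0 < r'" "r' \<le> r"
    "\<And>p. norm p < r' \<Longrightarrow> (time1 b A has_derivative (\<lambda>h. recenter (lie_family b A) p [h])) (at p)"
    "2 * ((exp 1 * max 1 D) * r') < 1"
proof -
  define \<sigma> where "\<sigma> = exp 1 * max 1 D"
  have \<sigma>: "0 < \<sigma>" by (auto simp: \<sigma>_def)
  have r: "0 < r" and A: "mlin b A D" "2 \<le> b" using fr by (auto simp: flow_radius_def)
  define r' where "r' = min (r / 2) (1 / (4 * \<sigma>))"
  have r': "0 < r'" "r' \<le> r / 2" using r \<sigma> by (auto simp: r'_def)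
  have "\<sigma> * r' \<le> \<sigma> * (1 / (4 * \<sigma>))"
    using \<sigma> by (intro mult_left_mono) (auto simp: r'_def)
  then have s: "2 * (\<sigma> * r') < 1" using \<sigma> by simp
  have "(time1 b A has_derivative (\<lambda>h. recenter (lie_family b A) p [h])) (at p)" if "norm p < r'" for p
    by (rule power_series_has_derivative[where C = 1 and \<sigma> = \<sigma> and r = r'])
      (use that r' s \<sigma> mlin_lie_family[OF A] lie_family_sums[OF fr] in \<open>auto simp: \<sigma>_def\<close>)
  then show ?thesis
    using that[of r'] r' s r by (auto simp: \<sigma>_def)
qed

subsection \<open>Preservation of a symplectic form\<close>

lemma has_derivative_imp_directional:
  assumes "(f has_derivative D) (at p)"
  shows "((\<lambda>e. f (p + e *\<^sub>R u)) has_vector_derivative D u) (at 0 within S)"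
proof -
  have "((\<lambda>e. p + e *\<^sub>R u) has_derivative (\<lambda>e. e *\<^sub>R u)) (at 0 within S)"
    by (auto intro!: derivative_eq_intros)
  then have "((\<lambda>e. f (p + e *\<^sub>R u)) has_derivative (\<lambda>e. D (e *\<^sub>R u))) (at 0 within S)"
    using has_derivative_compose[of "\<lambda>e. p + e *\<^sub>R u" "\<lambda>e. e *\<^sub>R u" 0 S f D] assms by simp
  then show ?thesis
    unfolding has_vector_derivative_def
    using linear_cmul[OF has_derivative_linear[OF assms]] by simp
qed

text \<open>If \<open>\<delta>\<^sub>1, \<delta>\<^sub>2\<close> are the differences of nearby orbits at distance \<open>O(e)\<close>, then by the invariance
  of \<open>\<omega>\<close> under the linearised field the time derivative of \<open>\<omega> \<delta>\<^sub>1 \<delta>\<^sub>2\<close> is \<open>O(e\<^sup>3)\<close>; so no variational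
  equation is needed.\<close>

lemma time1_preserves_form:
  fixes A :: "'a::{real_inner, banach} list \<Rightarrow> 'a" and \<omega> :: "'a \<Rightarrow> 'a \<Rightarrow> real"
  assumes fr: "flow_radius b A D r" and \<omega>: "bounded_bilinear \<omega>"
    and anti: "\<And>x u w. \<omega> (diag_deriv A b x u) w + \<omega> u (diag_deriv A b x w) = 0"
    and deriv: "(time1 b A has_derivative T) (at p)" and p: "norm p < r / 2"
  shows "\<omega> (T u) (T w) = \<omega> u w"
proof -
  interpret bounded_bilinear \<omega> by (rule \<omega>)
  obtain k where k: "0 < k" "\<And>x y. norm (\<omega> x y) \<le> norm x * norm y * k"
    using pos_bounded by blast
  have A: "mlin b A D" and r: "0 < r" using fr by (auto simp: flow_radius_def)
  define c where "c = real b * real b * D * r ^ (b - 2)"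
  have c: "0 \<le> c" unfolding c_def using mlin_nonneg[OF A] r by auto
  define c3 where "c3 = k * c * (8 * (norm u)\<^sup>2 * norm w + 8 * norm u * (norm w)\<^sup>2)"
  let ?f = "flow_curve b A"
  have key: "\<bar>\<omega> ((1 / e) *\<^sub>R (?f (p + e *\<^sub>R u) 1 - ?f p 1)) ((1 / e) *\<^sub>R (?f (p + e *\<^sub>R w) 1 - ?f p 1)) - \<omega> u w\<bar>
      \<le> c3 * e" if e: "0 < e" "norm (p + e *\<^sub>R u) \<le> r / 2" "norm (p + e *\<^sub>R w) \<le> r / 2" for e
  proof -
    have pr: "norm p \<le> r / 2" using p by simp
    define d where "d v t = ?f (p + e *\<^sub>R v) t - ?f p t" for v t
    define X where "X v t = A (replicate b (?f (p + e *\<^sub>R v) t)) - A (replicate b (?f p t))" for v t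
    define R where "R v t = X v t - diag_deriv A b (?f p t) (d v t)" for v t
    have dd: "(d v has_vector_derivative X v t) (at t within {0..1})"
      if "norm (p + e *\<^sub>R v) \<le> r / 2" "t \<in> {0..1}" for v t
      unfolding d_def X_def
      by (intro has_vector_derivative_diff sol_deriv flow_curve_sol[OF fr] that pr)
    have dn: "norm (d v t) \<le> 2 * e * norm v"
      if "norm (p + e *\<^sub>R v) \<le> r / 2" "t \<in> {0..1}" for v t
      using flow_curve_lipschitz[OF fr that(1) pr that(2)] e by (simp add: d_def)
    have Rn: "norm (R v t) \<le> c * (2 * e * norm v)\<^sup>2"
      if "norm (p + e *\<^sub>R v) \<le> r / 2" "t \<in> {0..1}" for v t
    proof -
      have "norm (R v t) \<le> c * (norm (d v t))\<^sup>2"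
        unfolding R_def X_def d_def c_def
        by (rule mlin_diag_quadratic[OF A flow_curve_le[OF fr that(1,2)] flow_curve_le[OF fr pr that(2)]])
      also have "\<dots> \<le> c * (2 * e * norm v)\<^sup>2"
        using dn[OF that] c by (intro mult_left_mono power_mono) auto
      finally show ?thesis .
    qed
    define \<phi> where "\<phi> t = \<omega> (d u t) (d w t)" for t
    have \<phi>: "(\<phi> has_vector_derivative \<omega> (d u t) (X w t) + \<omega> (X u t) (d w t)) (at t within {0..1})"
      if "t \<in> {0..1}" for t
      unfolding \<phi>_def by (intro has_vector_derivative dd that e)
    then have "\<exists>t\<in>{0<..<1}. \<phi> 1 - \<phi> 0 = (1 - 0) *\<^sub>R (\<omega> (d u t) (X w t) + \<omega> (X u t) (d w t))"
      by (intro mvt_simple[where f' = "\<lambda>t x. x *\<^sub>R (\<omega> (d u t) (X w t) + \<omega> (X u t) (d w t))"])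
        (auto simp: has_vector_derivative_def)
    then obtain t where t: "t \<in> {0..1}" "\<phi> 1 - \<phi> 0 = \<omega> (d u t) (X w t) + \<omega> (X u t) (d w t)"
      by (auto intro!: that less_imp_le)
    have "\<omega> (d u t) (X w t) + \<omega> (X u t) (d w t) = \<omega> (d u t) (R w t) + \<omega> (R u t) (d w t)"
      using anti[of "?f p t" "d u t" "d w t"] by (simp add: R_def diff_left diff_right)
    also have "\<bar>\<dots>\<bar> \<le> norm (d u t) * norm (R w t) * k + norm (R u t) * norm (d w t) * k"
      using k(2)[of "d u t" "R w t"] k(2)[of "R u t" "d w t"] by simp
    also have "\<dots> \<le> (2 * e * norm u) * (c * (2 * e * norm w)\<^sup>2) * k + (c * (2 * e * norm u)\<^sup>2) * (2 * e * norm w) * k"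
      using e t k(1) c by (intro add_mono mult_mono dn Rn) auto
    also have "\<dots> = e\<^sup>2 * (c3 * e)"
      unfolding c3_def by (simp add: power2_eq_square algebra_simps)
    finally have "\<bar>\<phi> 1 - \<phi> 0\<bar> \<le> e\<^sup>2 * (c3 * e)"
      using t by simp
    moreover have "\<phi> 0 = e\<^sup>2 * \<omega> u w"
      unfolding \<phi>_def d_def
      by (simp add: flow_curve_0[OF fr e(2)] flow_curve_0[OF fr e(3)] flow_curve_0[OF fr pr] scaleR_left scaleR_right power2_eq_square)
    moreover have "\<phi> 1 = e\<^sup>2 * \<omega> ((1 / e) *\<^sub>R (?f (p + e *\<^sub>R u) 1 - ?f p 1)) ((1 / e) *\<^sub>R (?f (p + e *\<^sub>R w) 1 - ?f p 1))"
      unfolding \<phi>_def d_def using e by (simp add: scaleR_left scaleR_right power2_eq_square del: scaleR_cancel_left)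
    ultimately have "e\<^sup>2 * \<bar>\<omega> ((1 / e) *\<^sub>R (?f (p + e *\<^sub>R u) 1 - ?f p 1)) ((1 / e) *\<^sub>R (?f (p + e *\<^sub>R w) 1 - ?f p 1)) - \<omega> u w\<bar>
        \<le> e\<^sup>2 * (c3 * e)"
      by (simp add: right_diff_distrib[symmetric] abs_mult)
    then show ?thesis using e by (simp add: mult_le_cancel_left)
  qed
  have ev: "\<forall>\<^sub>F e in at_right 0. norm (p + e *\<^sub>R v) \<le> r / 2" for v
  proof -
    have "((\<lambda>e. norm (p + e *\<^sub>R v)) \<longlongrightarrow> norm (p + 0 *\<^sub>R v)) (at_right 0)"
      by (intro tendsto_intros)
    then have "\<forall>\<^sub>F e in at_right 0. norm (p + e *\<^sub>R v) < r / 2"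
      using p by (intro order_tendstoD) auto
    then show ?thesis by eventually_elim simp
  qed
  have lim: "((\<lambda>e. (1 / e) *\<^sub>R (?f (p + e *\<^sub>R v) 1 - ?f p 1)) \<longlongrightarrow> T v) (at_right 0)" for v
    using has_derivative_imp_directional[OF deriv, of v "{0<..}"]
    by (simp add: has_vector_derivative_within_quotient)
  have "((\<lambda>e. \<omega> ((1 / e) *\<^sub>R (?f (p + e *\<^sub>R u) 1 - ?f p 1)) ((1 / e) *\<^sub>R (?f (p + e *\<^sub>R w) 1 - ?f p 1)) - \<omega> u w)
      \<longlongrightarrow> \<omega> (T u) (T w) - \<omega> u w) (at_right 0)"
    by (intro tendsto_diff tendsto tendsto_const lim)
  moreover have "((\<lambda>e. \<omega> ((1 / e) *\<^sub>R (?f (p + e *\<^sub>R u) 1 - ?f p 1)) ((1 / e) *\<^sub>R (?f (p + e *\<^sub>R w) 1 - ?f p 1)) - \<omega> u w)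
      \<longlongrightarrow> 0) (at_right 0)"
  proof (rule Lim_null_comparison)
    show "\<forall>\<^sub>F e in at_right 0. norm (\<omega> ((1 / e) *\<^sub>R (?f (p + e *\<^sub>R u) 1 - ?f p 1)) ((1 / e) *\<^sub>R (?f (p + e *\<^sub>R w) 1 - ?f p 1)) - \<omega> u w)
        \<le> c3 * e"
      using ev[of u] ev[of w] eventually_at_right_less[of 0]
      by eventually_elim (use key in auto)
    have "((\<lambda>e. c3 * e) \<longlongrightarrow> c3 * 0) (at_right 0)"
      by (intro tendsto_intros)
    then show "((\<lambda>e. c3 * e) \<longlongrightarrow> 0) (at_right 0)" by simp
  qed
  ultimately show ?thesis
    using tendsto_unique[OF trivial_limit_at_right_real] by fastforce
qed


section \<open>Forms and vector fields given by coefficients\<close>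

text \<open>The total momentum. For odd length it is the component to which a monomial of a field
  contributes; for even length its vanishing is the selection rule of the Hamiltonian.\<close>

fun altsum :: "int list \<Rightarrow> int" where
  "altsum [] = 0"
| "altsum (j # js) = j - altsum js"

text \<open>The nested conjugations of \<open>mon\<close> produce the alternating product of the \<open>q\<close> and the \<open>cnj q\<close>.\<close>

fun mon :: "int list \<Rightarrow> cseq list \<Rightarrow> complex" where
  "mon [] vs = 1"
| "mon (j # js) vs = hd vs j * cnj (mon js (tl vs))"

fun prodl :: "(int \<Rightarrow> real) list \<Rightarrow> int list \<Rightarrow> real" where
  "prodl [] js = 1"
| "prodl (f # fs) js = f (hd js) * prodl fs (tl js)"

fun mx :: "int list \<Rightarrow> real" where
  "mx [] = 0"
| "mx (j # js) = max \<bar>real_of_int j\<bar> (mx js)"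

abbreviation pr :: "int list \<Rightarrow> real" where
  "pr js \<equiv> prod_list (map (\<lambda>j. \<bar>real_of_int j\<bar>) js)"

abbreviation ilists :: "nat \<Rightarrow> int list set" where
  "ilists m \<equiv> {js. length js = m}"

lemma mx_nonneg [simp]: "0 \<le> mx js"
  by (induction js) auto

lemma pr_nonneg [simp]: "0 \<le> pr js"
  by (induction js) auto

lemma mx_append: "mx (xs @ ys) = max (mx xs) (mx ys)"
  by (induction xs) auto

lemma le_mx: "j \<in> set js \<Longrightarrow> \<bar>real_of_int j\<bar> \<le> mx js"
  by (induction js) auto

lemma mx_attained: "js \<noteq> [] \<Longrightarrow> \<exists>us j ws. js = us @ j # ws \<and> mx js = \<bar>real_of_int j\<bar>"
proof (induction js)
  case (Cons i js)
  show ?case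
  proof (cases "mx js \<le> \<bar>real_of_int i\<bar>")
    case True
    then show ?thesis by (intro exI[of _ "[]"]) auto
  next
    case False
    then have "js \<noteq> []" by auto
    with Cons.IH obtain us j ws where "js = us @ j # ws" "mx js = \<bar>real_of_int j\<bar>" by blast
    with False show ?thesis by (intro exI[of _ "i # us"]) auto
  qed
qed simp

lemma abs_altsum_le: "\<bar>real_of_int (altsum js)\<bar> \<le> length js * mx js"
proof (induction js)
  case (Cons j js)
  have "\<bar>real_of_int (altsum (j # js))\<bar> \<le> \<bar>real_of_int j\<bar> + \<bar>real_of_int (altsum js)\<bar>"
    by simp
  also have "\<dots> \<le> mx (j # js) + length js * mx (j # js)"
    using Cons by (intro add_mono order_trans[OF Cons mult_left_mono]) auto
  finally show ?case by (simp add: algebra_simps)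
qed simp

lemma altsum_append: "altsum (xs @ ys) = altsum xs + (- 1) ^ length xs * altsum ys"
  by (induction xs) auto

lemma mx_ge_1: "js \<noteq> [] \<Longrightarrow> 0 \<notin> set js \<Longrightarrow> 1 \<le> mx js"
  by (cases js) auto

lemma pr_ge_1: "0 \<notin> set js \<Longrightarrow> 1 \<le> pr js"
proof (induction js)
  case (Cons j js)
  then have "1 * 1 \<le> \<bar>real_of_int j\<bar> * pr js"
    by (intro mult_mono) auto
  then show ?case by simp
qed simp

lemma prodl_nonneg: "(\<And>f j. f \<in> set fs \<Longrightarrow> 0 \<le> f j) \<Longrightarrow> 0 \<le> prodl fs js"
  by (induction fs js rule: prodl.induct) auto

lemma prodl_append: "length xs = length fs \<Longrightarrow> prodl (fs @ gs) (xs @ ys) = prodl fs xs * prodl gs ys"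
  by (induction fs arbitrary: xs) (auto simp: length_Suc_conv)

lemma norm_mon: "length js = length vs \<Longrightarrow> norm (mon js vs) = prodl (map (\<lambda>v j. cmod (v j)) vs) js"
  by (induction vs arbitrary: js) (auto simp: norm_mult length_Suc_conv)

lemma prodl_mult_pr: "length js = length fs \<Longrightarrow>
    (pr js)\<^sup>2 * prodl fs js = prodl (map (\<lambda>f j. (real_of_int j)\<^sup>2 * f j) fs) js"
  by (induction fs arbitrary: js) (auto simp: length_Suc_conv power_mult_distrib mult_ac)

lemma mon_append: "length xs = length us \<Longrightarrow>
    mon (xs @ ys) (us @ vs) = mon xs us * (if even (length xs) then mon ys vs else cnj (mon ys vs))"
  by (induction us arbitrary: xs) (auto simp: length_Suc_conv)

lemma mon_slot: "length xs = length us \<Longrightarrow>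
    mon (xs @ j # ys) (us @ v # vs) =
      mon xs us * (if even (length xs) then v j * cnj (mon ys vs) else cnj (v j) * mon ys vs)"
  by (simp add: mon_append)

lemma has_sum_product:
  fixes f :: "'a \<Rightarrow> real" and g :: "'b \<Rightarrow> real"
  assumes f: "(f has_sum a) A" and g: "(g has_sum b) A'"
    and nn: "\<And>x. x \<in> A \<Longrightarrow> 0 \<le> f x" "\<And>y. y \<in> A' \<Longrightarrow> 0 \<le> g y"
  shows "((\<lambda>(x, y). f x * g y) has_sum a * b) (A \<times> A')"
proof (rule has_sum_SigmaI)
  show "((\<lambda>y. case (x, y) of (x, y) \<Rightarrow> f x * g y) has_sum f x * b) A'" for x
    using has_sum_cmult_right[OF g] by simp
  show "((\<lambda>x. f x * b) has_sum a * b) A"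
    by (rule has_sum_cmult_left[OF f])
  show "(\<lambda>(x, y). f x * g y) summable_on A \<times> A'"
    using nn by (intro summable_on_SigmaI[OF _ has_sum_imp_summable[OF has_sum_cmult_left[OF f]]])
      (auto intro: has_sum_cmult_right[OF g])
qed

lemma prodl_has_sum:
  assumes "\<And>f. f \<in> set fs \<Longrightarrow> f summable_on UNIV" "\<And>f j. f \<in> set fs \<Longrightarrow> 0 \<le> f j"
  shows "(prodl fs has_sum (\<Prod>f\<leftarrow>fs. infsum f UNIV)) (ilists (length fs))"
  using assms
proof (induction fs)
  case (Cons f fs)
  have "((\<lambda>(j, js). f j * prodl fs js) has_sum (infsum f UNIV * (\<Prod>f\<leftarrow>fs. infsum f UNIV))) (UNIV \<times> ilists (length fs))"
    using Cons by (intro has_sum_product) (auto intro!: prodl_nonneg)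
  also have "?this \<longleftrightarrow> (prodl (f # fs) has_sum (\<Prod>f\<leftarrow>f # fs. infsum f UNIV)) (ilists (length (f # fs)))"
    by (rule has_sum_reindex_bij_witness[of _ "\<lambda>js. (hd js, tl js)" "\<lambda>(j, js). j # js"])
      (auto simp: length_Suc_conv)
  finally show ?case .
qed (simp add: has_sum_finite_iff)

subsection \<open>Weighted summability of square summable sequences\<close>

lemma summable_on_int_powr:
  assumes "a < -1"
  shows "(\<lambda>j::int. \<bar>real_of_int j\<bar> powr a) summable_on UNIV"
proof -
  have n: "(\<lambda>n::nat. real n powr a) summable_on UNIV"
    using assms by (intro summable_nonneg_imp_summable_on) (auto simp: summable_real_powr_iff)
  have "(\<lambda>j::int. \<bar>real_of_int j\<bar> powr a) summable_on range int"
    using n by (subst summable_on_reindex) (auto simp: o_def)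
  moreover have "(\<lambda>j::int. \<bar>real_of_int j\<bar> powr a) summable_on range (\<lambda>n. - int n)"
    using n by (subst summable_on_reindex) (auto simp: o_def inj_on_def)
  ultimately have "(\<lambda>j::int. \<bar>real_of_int j\<bar> powr a) summable_on (range int \<union> range (\<lambda>n. - int n))"
    by (rule summable_on_union)
  moreover have "range int \<union> range (\<lambda>n. - int n) = UNIV"
  proof -
    have "j \<in> range int \<union> range (\<lambda>n. - int n)" for j :: int
      by (cases "0 \<le> j") (auto simp: image_iff intro: exI[of _ "nat j"] exI[of _ "nat (- j)"])
    then show ?thesis by auto
  qed
  ultimately show ?thesis by simp
qed

text \<open>The Cauchy-Schwarz constant for summing \<open>wsq\<close>, that is
  \<open>j\<^sup>2 * cmod (q j)\<close>, over all \<open>j\<close>; the series converges as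
  \<open>2 * (2 - s) < -1\<close>. The added 1 makes powers of the constant increase with the
  exponent.\<close>

definition emb_const :: "real \<Rightarrow> real" where
  "emb_const s = sqrt (\<Sum>\<^sub>\<infinity>j::int. \<bar>real_of_int j\<bar> powr (2 * (2 - s))) + 1"

lemma emb_const_ge_1: "1 \<le> emb_const s"
  by (simp add: emb_const_def infsum_nonneg)

abbreviation wsq :: "real \<Rightarrow> l2 \<Rightarrow> int \<Rightarrow> real" where
  "wsq s x j \<equiv> (real_of_int j)\<^sup>2 * cmod (emb s x j)"

lemma wsq_summable:
  assumes s: "3 < s"
  shows "wsq s x summable_on UNIV" and "infsum (wsq s x) UNIV \<le> emb_const s * norm x"
proof -
  have eq: "wsq s x j = \<bar>real_of_int j\<bar> powr (2 - s) * cmod (coord x j)" for j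
    by (cases "j = 0") (auto simp: emb_def norm_mult norm_divide powr_diff powr_minus_divide)
  have S: "(\<lambda>j::int. \<bar>real_of_int j\<bar> powr (2 * (2 - s))) summable_on UNIV"
    using s by (intro summable_on_int_powr) auto
  have bound: "(\<Sum>j\<in>F. wsq s x j) \<le> emb_const s * norm x" if F: "finite F" for F
  proof -
    have "(\<Sum>j\<in>F. \<bar>real_of_int j\<bar> powr (2 - s) * cmod (coord x j))\<^sup>2 \<le>
        (\<Sum>j\<in>F. (\<bar>real_of_int j\<bar> powr (2 - s))\<^sup>2) * (\<Sum>j\<in>F. (cmod (coord x j))\<^sup>2)"
      by (rule Cauchy_Schwarz_ineq_sum)
    also have "\<dots> \<le> (\<Sum>\<^sub>\<infinity>j::int. \<bar>real_of_int j\<bar> powr (2 * (2 - s))) * (norm x)\<^sup>2"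
    proof (intro mult_mono sum_coord_le F sum_nonneg infsum_nonneg)
      have "(\<Sum>j\<in>F. (\<bar>real_of_int j\<bar> powr (2 - s))\<^sup>2) = (\<Sum>j\<in>F. \<bar>real_of_int j\<bar> powr (2 * (2 - s)))"
        by (intro sum.cong) (auto simp: power2_eq_square powr_add[symmetric])
      also have "\<dots> \<le> (\<Sum>\<^sub>\<infinity>j::int. \<bar>real_of_int j\<bar> powr (2 * (2 - s)))"
        by (rule finite_sum_le_infsum[OF S F]) auto
      finally show "(\<Sum>j\<in>F. (\<bar>real_of_int j\<bar> powr (2 - s))\<^sup>2) \<le> (\<Sum>\<^sub>\<infinity>j::int. \<bar>real_of_int j\<bar> powr (2 * (2 - s)))" .
    qed auto
    also have "\<dots> = ((emb_const s - 1) * norm x)\<^sup>2"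
      by (simp add: emb_const_def power_mult_distrib infsum_nonneg)
    finally have "(\<Sum>j\<in>F. \<bar>real_of_int j\<bar> powr (2 - s) * cmod (coord x j)) \<le> (emb_const s - 1) * norm x"
      by (rule power2_le_imp_le) (use emb_const_ge_1[of s] in auto)
    also have "\<dots> \<le> emb_const s * norm x"
      by (intro mult_right_mono) auto
    finally show ?thesis by (simp add: eq)
  qed
  show summ: "wsq s x summable_on UNIV"
    by (rule nonneg_bounded_partial_sums_imp_summable_on[where C = "emb_const s * norm x"])
      (auto intro!: eventually_finite_subsets_at_top_weakI bound)
  show "infsum (wsq s x) UNIV \<le> emb_const s * norm x"
    by (rule infsum_le_finite_sums[OF summ]) (auto intro: bound)
qed

lemma prodl_wsq:
  assumes s: "3 < s"
  shows "prodl (map (wsq s) vs) summable_on ilists (length vs)"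
    and "infsum (prodl (map (wsq s) vs)) (ilists (length vs)) \<le> emb_const s ^ length vs * norms vs"
proof -
  have h: "(prodl (map (wsq s) vs) has_sum (\<Prod>f\<leftarrow>map (wsq s) vs. infsum f UNIV)) (ilists (length (map (wsq s) vs)))"
    by (rule prodl_has_sum) (auto simp: wsq_summable[OF s])
  then show "prodl (map (wsq s) vs) summable_on ilists (length vs)"
    by (auto dest: has_sum_imp_summable)
  have "(\<Prod>f\<leftarrow>map (wsq s) vs. infsum f UNIV) \<le> emb_const s ^ length vs * norms vs"
  proof (induction vs)
    case (Cons x vs)
    have "(\<Prod>f\<leftarrow>map (wsq s) (x # vs). infsum f UNIV) \<le> (emb_const s * norm x) * (emb_const s ^ length vs * norms vs)"
      using Cons emb_const_ge_1[of s] wsq_summable[OF s]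
      by (auto intro!: mult_mono prod_list_nonneg infsum_nonneg)
    then show ?case by (simp add: mult_ac)
  qed simp
  with h show "infsum (prodl (map (wsq s) vs)) (ilists (length vs)) \<le> emb_const s ^ length vs * norms vs"
    by (simp add: infsumI)
qed

lemma norm_mon_emb:
  assumes "length js = length vs"
  shows "(pr js)\<^sup>2 * norm (mon js (map (emb s) vs)) = prodl (map (wsq s) vs) js"
  using assms by (simp add: norm_mon prodl_mult_pr o_def)

subsection \<open>Forms\<close>

definition form :: "real \<Rightarrow> (int list \<Rightarrow> complex) \<Rightarrow> l2 list \<Rightarrow> complex" where
  "form s c vs = (\<Sum>\<^sub>\<infinity>js\<in>ilists (length vs). c js * mon js (map (emb s) vs))"

text \<open>The weakest bound in use: a weight \<open>j\<^sup>2\<close> per slot is just what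
  \<open>wsq\<close> can sum, so forms converge absolutely. The coefficients \<open>hL\<close>
  satisfy it although they are not in \<open>gclass\<close>.\<close>

definition crude :: "nat \<Rightarrow> real \<Rightarrow> (int list \<Rightarrow> complex) \<Rightarrow> bool" where
  "crude m E c \<longleftrightarrow> 0 \<le> E \<and> (\<forall>js. length js = m \<longrightarrow> norm (c js) \<le> E * (pr js)\<^sup>2)"

lemma crude_term_le:
  assumes "crude m E c" "length js = m" "length vs = m"
  shows "norm (c js * mon js (map (emb s) vs)) \<le> E * prodl (map (wsq s) vs) js"
proof -
  have "norm (c js * mon js (map (emb s) vs)) \<le> E * (pr js)\<^sup>2 * norm (mon js (map (emb s) vs))"
    unfolding norm_mult using assms by (intro mult_right_mono) (auto simp: crude_def)
  then show ?thesis using norm_mon_emb[of js vs s] assms by (simp add: mult.assoc)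
qed

lemma form_abs_summable:
  assumes s: "3 < s" and c: "crude m E c" and vs: "length vs = m"
  shows "(\<lambda>js. norm (c js * mon js (map (emb s) vs))) summable_on ilists m"
  unfolding vs[symmetric]
  by (rule summable_on_comparison_test[OF summable_on_cmult_right[OF prodl_wsq(1)[OF s], where c = E]])
    (use vs crude_term_le[OF c] in auto)

lemma form_summable:
  assumes s: "3 < s" and c: "crude m E c" and vs: "length vs = m"
  shows "(\<lambda>js. c js * mon js (map (emb s) vs)) summable_on ilists m"
  by (rule abs_summable_summable[OF form_abs_summable[OF assms]])

lemma form_infsum_norm_le:
  assumes s: "3 < s" and c: "crude m E c" and vs: "length vs = m"
  shows "(\<Sum>\<^sub>\<infinity>js\<in>ilists m. norm (c js * mon js (map (emb s) vs))) \<le> E * emb_const s ^ m * norms vs"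
proof -
  have "(\<Sum>\<^sub>\<infinity>js\<in>ilists m. norm (c js * mon js (map (emb s) vs))) \<le> (\<Sum>\<^sub>\<infinity>js\<in>ilists m. E * prodl (map (wsq s) vs) js)"
    using vs crude_term_le[OF c] prodl_wsq(1)[OF s, of vs]
    by (intro infsum_mono form_abs_summable[OF assms] summable_on_cmult_right) auto
  also have "\<dots> = E * infsum (prodl (map (wsq s) vs)) (ilists m)"
    using prodl_wsq(1)[OF s, of vs] vs by (intro infsum_cmult_right) auto
  also have "\<dots> \<le> E * (emb_const s ^ m * norms vs)"
    using prodl_wsq(2)[OF s, of vs] vs c by (intro mult_left_mono) (auto simp: crude_def)
  finally show ?thesis by (simp add: mult.assoc)
qed

lemma split_at_slot:
  assumes "length js = length xs + length ys + 1"
  obtains ps j qs where "js = ps @ j # qs" "length ps = length xs" "length qs = length ys"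
proof
  show "js = take (length xs) js @ js ! length xs # drop (Suc (length xs)) js"
    by (rule id_take_nth_drop) (use assms in simp)
qed (use assms in auto)

lemma mon_emb_add: "length js = length xs + length ys + 1 \<Longrightarrow>
    mon js (map (emb s) (xs @ (v + w) # ys)) = mon js (map (emb s) (xs @ v # ys)) + mon js (map (emb s) (xs @ w # ys))"
  by (erule split_at_slot) (simp add: mon_slot emb_simps algebra_simps)

lemma mon_emb_scaleR: "length js = length xs + length ys + 1 \<Longrightarrow>
    mon js (map (emb s) (xs @ (r *\<^sub>R v) # ys)) = r *\<^sub>R mon js (map (emb s) (xs @ v # ys))"
  by (erule split_at_slot) (simp add: mon_slot emb_simps rscale_def scaleR_conv_of_real)

lemma mlin_form:
  assumes s: "3 < s" and c: "crude m E c"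
  shows "mlin m (form s c) (E * emb_const s ^ m)"
  unfolding mlin_def
proof (intro conjI allI impI)
  show "0 \<le> E * emb_const s ^ m"
    using c emb_const_ge_1[of s] by (auto simp: crude_def)
  fix vs :: "l2 list" assume vs: "length vs = m"
  have "norm (form s c vs) \<le> (\<Sum>\<^sub>\<infinity>js\<in>ilists m. norm (c js * mon js (map (emb s) vs)))"
    unfolding form_def vs by (rule norm_infsum_bound[OF form_abs_summable[OF s c vs]])
  also have "\<dots> \<le> E * emb_const s ^ m * norms vs"
    by (rule form_infsum_norm_le[OF s c vs])
  finally show "norm (form s c vs) \<le> E * emb_const s ^ m * norms vs" .
next
  fix xs ys :: "l2 list" assume len: "length xs + length ys + 1 = m"
  show "linear (\<lambda>v. form s c (xs @ v # ys))"
  proof (rule linearI)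
    fix u v :: l2 and r :: real
    have n: "length (xs @ w # ys) = m" for w using len by simp
    show "form s c (xs @ (u + v) # ys) = form s c (xs @ u # ys) + form s c (xs @ v # ys)"
      unfolding form_def n using len
      by (subst infsum_add[symmetric, OF form_summable[OF s c n] form_summable[OF s c n]])
        (auto intro!: infsum_cong simp del: map_append list.map simp: mon_emb_add distrib_left)
    show "form s c (xs @ (r *\<^sub>R v) # ys) = r *\<^sub>R form s c (xs @ v # ys)"
      unfolding form_def n using len
      by (subst infsum_scaleR_right[symmetric])
        (auto intro!: infsum_cong simp del: map_append list.map simp: mon_emb_scaleR)
  qed
qed


subsection \<open>Vector fields\<close>

text \<open>A kernel \<open>\<xi>\<close> is the coefficient family of a vector field of degree \<open>b\<close>: the monomial with index \<open>js\<close>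
  contributes to the component \<open>altsum js\<close>.\<close>

definition kernel :: "nat \<Rightarrow> real \<Rightarrow> (int list \<Rightarrow> complex) \<Rightarrow> bool" where
  "kernel b E \<xi> \<longleftrightarrow> 1 \<le> b \<and> 0 \<le> E \<and> (\<forall>js. length js = b \<longrightarrow> (0 \<in> set js \<longrightarrow> \<xi> js = 0) \<and>
     norm (\<xi> js) * mx js ^ 4 \<le> E * (real_of_int (altsum js) * pr js)\<^sup>2)"

lemma kernel_zero: "kernel b E \<xi> \<Longrightarrow> length js = b \<Longrightarrow> 0 \<in> set js \<Longrightarrow> \<xi> js = 0"
  by (auto simp: kernel_def)

lemma kernel_altsum_zero:
  assumes "kernel b E \<xi>" "length js = b" "altsum js = 0"
  shows "\<xi> js = 0"
proof (cases "0 \<in> set js")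
  case False
  with assms have "1 \<le> mx js" "norm (\<xi> js) * mx js ^ 4 \<le> 0"
    by (auto simp: kernel_def intro!: mx_ge_1)
  then show ?thesis
    by (simp add: mult_le_0_iff)
qed (use assms in \<open>auto intro: kernel_zero\<close>)

text \<open>Since \<open>altsum js\<close> is at most \<open>b * mx js\<close> in absolute value,
  powers of the two can be traded. The first form frees the largest index of its weight in
  \<open>pr js\<close>, as \<open>Xmap\<close> requires; the second supplies the square of the
  contracted index in \<open>crude_Top\<close>.\<close>

lemma kernel_bound:
  assumes k: "kernel b E \<xi>" and len: "length js = b" and nz: "0 \<notin> set js"
  shows "norm (\<xi> js) * (mx js)\<^sup>2 \<le> E * (real b)\<^sup>2 * (pr js)\<^sup>2"
    and "norm (\<xi> js) * (real_of_int (altsum js))\<^sup>2 \<le> E * real b ^ 4 * (pr js)\<^sup>2"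
proof -
  have b: "1 \<le> b" and E: "0 \<le> E" and
    le: "norm (\<xi> js) * mx js ^ 4 \<le> E * (real_of_int (altsum js) * pr js)\<^sup>2"
    using k len by (auto simp: kernel_def)
  have m: "1 \<le> mx js" using len b nz by (intro mx_ge_1) auto
  have a: "(real_of_int (altsum js))\<^sup>2 \<le> (real b)\<^sup>2 * (mx js)\<^sup>2"
    using power_mono[OF abs_altsum_le[of js], of 2] len by (simp add: power_mult_distrib)
  have "norm (\<xi> js) * mx js ^ 4 \<le> E * (real_of_int (altsum js))\<^sup>2 * (pr js)\<^sup>2"
    using le by (simp add: power_mult_distrib mult.assoc)
  also have "\<dots> \<le> E * ((real b)\<^sup>2 * (mx js)\<^sup>2) * (pr js)\<^sup>2"
    using E a by (intro mult_right_mono mult_left_mono) auto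
  finally have "(norm (\<xi> js) * (mx js)\<^sup>2) * (mx js)\<^sup>2 \<le> (E * (real b)\<^sup>2 * (pr js)\<^sup>2) * (mx js)\<^sup>2"
    by (simp add: power_numeral_reduce mult_ac)
  then show *: "norm (\<xi> js) * (mx js)\<^sup>2 \<le> E * (real b)\<^sup>2 * (pr js)\<^sup>2"
    by (rule mult_right_le_imp_le) (use m in auto)
  have "norm (\<xi> js) * (real_of_int (altsum js))\<^sup>2 \<le> norm (\<xi> js) * ((real b)\<^sup>2 * (mx js)\<^sup>2)"
    by (rule mult_left_mono[OF a]) auto
  also have "\<dots> \<le> (real b)\<^sup>2 * (E * (real b)\<^sup>2 * (pr js)\<^sup>2)"
    using mult_left_mono[OF *, of "(real b)\<^sup>2"] by (simp add: mult_ac)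
  finally show "norm (\<xi> js) * (real_of_int (altsum js))\<^sup>2 \<le> E * real b ^ 4 * (pr js)\<^sup>2"
    by (simp add: power_numeral_reduce mult_ac)
qed

lemma kernel_crude:
  assumes k: "kernel b E \<xi>"
  shows "crude b (E * (real b)\<^sup>2) \<xi>"
  unfolding crude_def
proof (intro conjI allI impI)
  show "0 \<le> E * (real b)\<^sup>2" using k by (auto simp: kernel_def)
  fix js :: "int list" assume len: "length js = b"
  show "norm (\<xi> js) \<le> E * (real b)\<^sup>2 * (pr js)\<^sup>2"
  proof (cases "0 \<in> set js")
    case False
    then have "1 \<le> mx js" using len k by (intro mx_ge_1) (auto simp: kernel_def)
    then have "norm (\<xi> js) * 1 \<le> norm (\<xi> js) * (mx js)\<^sup>2"
      by (intro mult_left_mono one_le_power) auto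
    with kernel_bound(1)[OF k len False] show ?thesis by simp
  qed (use k kernel_zero[OF k len] in \<open>auto simp: kernel_def\<close>)
qed

text \<open>The factors of Young's inequality: slot \<open>k\<close> carries a square summable
  sequence, the others carry summable ones.\<close>

abbreviation young_factors :: "real \<Rightarrow> l2 list \<Rightarrow> nat \<Rightarrow> (int \<Rightarrow> real) list" where
  "young_factors s vs k \<equiv> (map (wsq s) vs)[k := (\<lambda>j. cmod (coord (vs ! k) j))]"

text \<open>The weight \<open>\<bar>altsum js\<bar> powr s\<close> is put on the slot of the largest
  index, the very slot from which the kernel bound removes the weight \<open>j\<^sup>2\<close>.
  Which slot this is depends on \<open>js\<close>, hence the sum over all \<open>k\<close>.\<close>

lemma kernel_term_le:
  assumes k: "kernel b E \<xi>" and s: "0 \<le> s" and len: "length js = b" "length vs = b"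
  shows "\<bar>real_of_int (altsum js)\<bar> powr s * norm (\<xi> js * mon js (map (emb s) vs))
    \<le> E * (real b)\<^sup>2 * b powr s * (\<Sum>k<b. prodl (young_factors s vs k) js)"
proof -
  have b: "1 \<le> b" and E: "0 \<le> E" using k by (auto simp: kernel_def)
  have nn: "0 \<le> prodl (young_factors s vs k) js" for k
    by (rule prodl_nonneg) (auto dest!: set_update_subset_insert[THEN subsetD])
  show ?thesis
  proof (cases "0 \<in> set js")
    case True
    then show ?thesis using kernel_zero[OF k len(1)] E nn by (auto intro!: mult_nonneg_nonneg sum_nonneg)
  next
    case False
    have "js \<noteq> []" using len b by auto
    then obtain us j ws where js: "js = us @ j # ws" and m: "mx js = \<bar>real_of_int j\<bar>"
      using mx_attained by blast
    define n where "n = length us"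
    have n: "n < b" using js len by (simp add: n_def)
    obtain xs x ys where vs: "vs = xs @ x # ys" "length xs = length us" "length ys = length ws"
      using id_take_nth_drop[of n vs] n len js by (intro that[of "take n vs" "vs ! n" "drop (Suc n) vs"]) (auto simp: n_def)
    have j: "j \<noteq> 0" using False js by auto
    have P: "prodl (young_factors s vs n) js = prodl (map (wsq s) xs) us * (cmod (coord x j) * prodl (map (wsq s) ys) ws)"
      using vs js by (simp add: n_def prodl_append list_update_append nth_append)
    have "norm (\<xi> js) * (real_of_int j)\<^sup>2 \<le> (E * (real b)\<^sup>2 * ((pr us)\<^sup>2 * (pr ws)\<^sup>2)) * (real_of_int j)\<^sup>2"
      using kernel_bound(1)[OF k len(1) False, unfolded m] by (simp add: js power_mult_distrib mult_ac)
    then have \<xi>: "norm (\<xi> js) \<le> E * (real b)\<^sup>2 * ((pr us)\<^sup>2 * (pr ws)\<^sup>2)"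
      by (rule mult_right_le_imp_le) (use j in auto)
    have a: "\<bar>real_of_int (altsum js)\<bar> powr s \<le> b powr s * \<bar>real_of_int j\<bar> powr s"
      using abs_altsum_le[of js] s len m by (subst powr_mult[symmetric]) (auto intro!: powr_mono2)
    have M: "norm (mon js (map (emb s) vs)) = norm (mon us (map (emb s) xs)) * (cmod (emb s x j) * norm (mon ws (map (emb s) ys)))"
      unfolding js vs using vs by (simp add: mon_slot norm_mult)
    have "\<bar>real_of_int (altsum js)\<bar> powr s * norm (\<xi> js * mon js (map (emb s) vs))
        = \<bar>real_of_int (altsum js)\<bar> powr s * norm (\<xi> js) * norm (mon js (map (emb s) vs))"
      by (simp add: norm_mult)
    also have "\<dots> \<le> (b powr s * \<bar>real_of_int j\<bar> powr s) * (E * (real b)\<^sup>2 * ((pr us)\<^sup>2 * (pr ws)\<^sup>2)) * norm (mon js (map (emb s) vs))"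
      by (intro mult_right_mono mult_mono a \<xi>) auto
    also have "\<dots> = E * (real b)\<^sup>2 * b powr s * (((pr us)\<^sup>2 * norm (mon us (map (emb s) xs))) *
        ((\<bar>real_of_int j\<bar> powr s * cmod (emb s x j)) * ((pr ws)\<^sup>2 * norm (mon ws (map (emb s) ys)))))"
      by (simp add: M mult_ac)
    also have "\<bar>real_of_int j\<bar> powr s * cmod (emb s x j) = cmod (coord x j)"
      unfolding emb_times_weight[of s x j, symmetric] by (simp add: norm_mult)
    also have "((pr us)\<^sup>2 * norm (mon us (map (emb s) xs))) * (cmod (coord x j) * ((pr ws)\<^sup>2 * norm (mon ws (map (emb s) ys))))
        = prodl (young_factors s vs n) js"
      unfolding P using vs by (simp add: norm_mon_emb)
    also have "E * (real b)\<^sup>2 * b powr s * prodl (young_factors s vs n) js \<le> E * (real b)\<^sup>2 * b powr s * (\<Sum>k<b. prodl (young_factors s vs k) js)"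
      using n nn E by (intro mult_left_mono member_le_sum) auto
    finally show ?thesis .
  qed
qed

text \<open>Young's inequality for a convolution, from the Cauchy-Schwarz inequality with weight
  \<open>Q\<close>, the product over the slots other than \<open>k\<close>. Finite sets suffice
  because the bound is uniform.\<close>

lemma young_finite:
  assumes s: "3 < s" and S: "finite S" and F: "finite F" "F \<subseteq> ilists (length vs)" and k: "k < length vs"
  shows "(\<Sum>n\<in>S. (\<Sum>js | js \<in> F \<and> altsum js = n. prodl (young_factors s vs k) js)\<^sup>2)
    \<le> (emb_const s ^ length vs * norms vs)\<^sup>2"
proof -
  define xs x ys where "xs = take k vs" and "x = vs ! k" and "ys = drop (Suc k) vs"
  have vs: "vs = xs @ x # ys"
    unfolding xs_def x_def ys_def using k by (rule id_take_nth_drop)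
  have lx: "length xs = k" using k by (simp add: xs_def)
  define del where "del js = take k js @ drop (Suc k) js" for js :: "int list"
  define Q where "Q js = prodl (map (wsq s) (xs @ ys)) (del js)" for js
  define y where "y js = cmod (coord x (js ! k))" for js
  have split: "\<exists>us j ws. js = us @ j # ws \<and> length us = length xs \<and> length ws = length ys" if "js \<in> F" for js
  proof -
    have "length js = length xs + length ys + 1" using F that vs by auto
    then show ?thesis by (rule split_at_slot) blast
  qed
  have P: "prodl (young_factors s vs k) js = y js * Q js" if js: "js \<in> F" for js
  proof -
    obtain us j ws where "js = us @ j # ws" "length us = length xs" "length ws = length ys"
      using split[OF js] by blast
    then show ?thesis
      by (simp add: vs lx Q_def y_def del_def prodl_append list_update_append nth_append)
  qed
  have Q0: "0 \<le> Q js" for js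
    unfolding Q_def by (rule prodl_nonneg) auto
  define Z where "Z = (\<Prod>f\<leftarrow>map (wsq s) (xs @ ys). infsum f UNIV)"
  have Z: "(prodl (map (wsq s) (xs @ ys)) has_sum Z) (ilists (length (map (wsq s) (xs @ ys))))"
    unfolding Z_def by (rule prodl_has_sum) (auto simp: wsq_summable[OF s])
  have Z0: "0 \<le> Z"
    unfolding Z_def by (rule prod_list_nonneg) (auto intro!: infsum_nonneg)
  have ZQ: "(\<Sum>js | js \<in> F \<and> altsum js = n. Q js) \<le> Z" for n
  proof -
    let ?Fn = "{js. js \<in> F \<and> altsum js = n}"
    \<comment> \<open>On a fibre of \<open>altsum\<close> the deleted index is determined by the
      remaining ones.\<close>
    have inj: "inj_on del ?Fn"
    proof (rule inj_onI)
      fix js js' assume a: "js \<in> ?Fn" "js' \<in> ?Fn" "del js = del js'"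
      obtain us j ws where js: "js = us @ j # ws" "length us = length xs" "length ws = length ys"
        using split a by blast
      obtain us' j' ws' where js': "js' = us' @ j' # ws'" "length us' = length xs" "length ws' = length ys"
        using split a by blast
      have "us = us'" "ws = ws'"
        using a(3) js js' lx by (auto simp: del_def)
      then show "js = js'"
        using a js js' by (auto simp: altsum_append)
    qed
    have "(\<Sum>js\<in>?Fn. Q js) = (\<Sum>zs\<in>del ` ?Fn. prodl (map (wsq s) (xs @ ys)) zs)"
      by (simp add: sum.reindex[OF inj] Q_def)
    also have "\<dots> \<le> Z"
    proof (rule finite_sum_le_has_sum[OF Z])
      show "del ` ?Fn \<subseteq> ilists (length (map (wsq s) (xs @ ys)))"
        using F vs lx by (auto simp: del_def)
    qed (use F in \<open>auto intro!: prodl_nonneg\<close>)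
    finally show ?thesis .
  qed
  have ZY: "(\<Sum>js\<in>F. (y js)\<^sup>2 * Q js) \<le> (norm x)\<^sup>2 * Z"
  proof -
    define gs where "gs = map (wsq s) xs @ (\<lambda>j. (cmod (coord x j))\<^sup>2) # map (wsq s) ys"
    have "(prodl gs has_sum (\<Prod>f\<leftarrow>gs. infsum f UNIV)) (ilists (length gs))"
      by (rule prodl_has_sum) (auto simp: gs_def wsq_summable[OF s] coord_summable)
    also have "(\<Prod>f\<leftarrow>gs. infsum f UNIV) = (norm x)\<^sup>2 * Z"
      by (simp add: gs_def Z_def norm_l2_sq mult_ac)
    finally have "(\<Sum>js\<in>F. prodl gs js) \<le> (norm x)\<^sup>2 * Z"
      using F vs by (intro finite_sum_le_has_sum[where A = "ilists (length gs)"]) (auto simp: gs_def intro!: prodl_nonneg)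
    moreover have "prodl gs js = (y js)\<^sup>2 * Q js" if js: "js \<in> F" for js
    proof -
      obtain us j ws where "js = us @ j # ws" "length us = length xs" "length ws = length ys"
        using split[OF js] by blast
      then show ?thesis
        by (simp add: gs_def lx Q_def y_def del_def prodl_append nth_append)
    qed
    ultimately show ?thesis by simp
  qed
  have "(\<Sum>n\<in>S. (\<Sum>js | js \<in> F \<and> altsum js = n. prodl (young_factors s vs k) js)\<^sup>2)
      \<le> (\<Sum>n\<in>S. (\<Sum>js | js \<in> F \<and> altsum js = n. (y js)\<^sup>2 * Q js) * Z)"
  proof (rule sum_mono)
    fix n
    have "(\<Sum>js | js \<in> F \<and> altsum js = n. prodl (young_factors s vs k) js)\<^sup>2
        = (\<Sum>js | js \<in> F \<and> altsum js = n. (y js * sqrt (Q js)) * sqrt (Q js))\<^sup>2"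
      using Q0 by (intro arg_cong[where f = "\<lambda>u. u\<^sup>2"] sum.cong) (auto simp: P mult.assoc)
    also have "\<dots> \<le> (\<Sum>js | js \<in> F \<and> altsum js = n. (y js * sqrt (Q js))\<^sup>2) * (\<Sum>js | js \<in> F \<and> altsum js = n. (sqrt (Q js))\<^sup>2)"
      by (rule Cauchy_Schwarz_ineq_sum)
    also have "\<dots> = (\<Sum>js | js \<in> F \<and> altsum js = n. (y js)\<^sup>2 * Q js) * (\<Sum>js | js \<in> F \<and> altsum js = n. Q js)"
      using Q0 by (simp add: power_mult_distrib)
    also have "\<dots> \<le> (\<Sum>js | js \<in> F \<and> altsum js = n. (y js)\<^sup>2 * Q js) * Z"
      using Q0 by (intro mult_left_mono ZQ sum_nonneg) auto
    finally show "(\<Sum>js | js \<in> F \<and> altsum js = n. prodl (young_factors s vs k) js)\<^sup>2 \<le> (\<Sum>js | js \<in> F \<and> altsum js = n. (y js)\<^sup>2 * Q js) * Z" .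
  qed
  also have "\<dots> = (\<Sum>n\<in>S. \<Sum>js | js \<in> F \<and> altsum js = n. (y js)\<^sup>2 * Q js) * Z"
    by (simp add: sum_distrib_right)
  also have "(\<Sum>n\<in>S. \<Sum>js | js \<in> F \<and> altsum js = n. (y js)\<^sup>2 * Q js) = (\<Sum>js | js \<in> F \<and> altsum js \<in> S. (y js)\<^sup>2 * Q js)"
  proof -
    have "{x \<in> F. altsum x \<in> S \<and> altsum x = n} = {js. js \<in> F \<and> altsum js = n}" if "n \<in> S" for n
      using that by auto
    then show ?thesis
      using S F sum.group[of "{js. js \<in> F \<and> altsum js \<in> S}" S altsum "\<lambda>js. (y js)\<^sup>2 * Q js"]
      by (simp add: image_subset_iff cong: sum.cong)
  qed
  also have "\<dots> * Z \<le> ((norm x)\<^sup>2 * Z) * Z"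
    using Z0 Q0 F by (intro mult_right_mono order_trans[OF sum_mono2 ZY]) auto
  also have "\<dots> = (norm x * Z)\<^sup>2"
    by (simp add: power2_eq_square)
  also have "\<dots> \<le> (emb_const s ^ length vs * norms vs)\<^sup>2"
  proof (rule power_mono)
    have "Z = infsum (prodl (map (wsq s) (xs @ ys))) (ilists (length (xs @ ys)))"
      using infsumI[OF Z] by simp
    also have "\<dots> \<le> emb_const s ^ length (xs @ ys) * norms (xs @ ys)"
      by (rule prodl_wsq(2)[OF s])
    finally have "norm x * Z \<le> norm x * (emb_const s ^ length (xs @ ys) * norms (xs @ ys))"
      by (rule mult_left_mono) auto
    also have "\<dots> \<le> (emb_const s * norm x) * (emb_const s ^ length (xs @ ys) * norms (xs @ ys))"
      using emb_const_ge_1[of s] by (intro mult_right_mono mult_le_cancel_right1[THEN iffD2]) (auto intro!: mult_nonneg_nonneg)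
    finally show "norm x * Z \<le> emb_const s ^ length vs * norms vs"
      by (simp add: vs mult_ac power_add)
  qed (use Z0 in auto)
  finally show ?thesis .
qed

definition Xmap :: "real \<Rightarrow> (int list \<Rightarrow> complex) \<Rightarrow> l2 list \<Rightarrow> l2" where
  "Xmap s \<xi> vs = unemb s (\<lambda>n. \<Sum>\<^sub>\<infinity>js\<in>{js. length js = length vs \<and> altsum js = n}. \<xi> js * mon js (map (emb s) vs))"

definition kconst :: "real \<Rightarrow> nat \<Rightarrow> real \<Rightarrow> real" where
  "kconst s b E = E * (real b)\<^sup>2 * b powr s * b * emb_const s ^ b"

lemma sum_square_le: "(\<Sum>k<n. f k)\<^sup>2 \<le> real n * (\<Sum>k<n. (f k :: real)\<^sup>2)"
  using Cauchy_Schwarz_ineq_sum[of f "\<lambda>_. 1" "{..<n}"] by (simp add: mult.commute)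

text \<open>The norm is estimated for finitely many lists and finitely many components at a time,
  where sums may be exchanged freely, and the bound is then carried to the limit.\<close>

lemma Xmap:
  assumes s: "3 < s" and \<xi>: "kernel b E \<xi>" and vs: "length vs = b"
  shows emb_Xmap: "emb s (Xmap s \<xi> vs) n =
      (\<Sum>\<^sub>\<infinity>js\<in>{js. length js = b \<and> altsum js = n}. \<xi> js * mon js (map (emb s) vs))"
    and norm_Xmap: "norm (Xmap s \<xi> vs) \<le> kconst s b E * norms vs"
proof -
  define g where "g js = \<xi> js * mon js (map (emb s) vs)" for js
  define Y where "Y n = infsum g {js. length js = b \<and> altsum js = n}" for n
  have gs: "g summable_on ilists b"
    unfolding g_def by (rule form_summable[OF s kernel_crude[OF \<xi>] vs])
  have E: "0 \<le> E" and b: "1 \<le> b" using \<xi> by (auto simp: kernel_def)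
  have s0: "0 \<le> s" using s by simp
  define c0 where "c0 = E * (real b)\<^sup>2 * b powr s"
  have c0: "0 \<le> c0" using E by (simp add: c0_def)
  have lim: "((\<lambda>F. \<Sum>js | js \<in> F \<and> altsum js = n. g js) \<longlongrightarrow> Y n) (finite_subsets_at_top (ilists b))" for n
  proof -
    have "((\<lambda>js. if altsum js = n then g js else 0) has_sum Y n) (ilists b)"
    proof -
      have "(g has_sum Y n) {js. length js = b \<and> altsum js = n}"
        unfolding Y_def by (rule has_sum_infsum[OF summable_on_subset_banach[OF gs]]) auto
      then show ?thesis
        by (subst (asm) has_sum_cong_neutral[where T = "ilists b" and g = "\<lambda>js. if altsum js = n then g js else 0"]) auto
    qed
    then have "(sum (\<lambda>js. if altsum js = n then g js else 0) \<longlongrightarrow> Y n) (finite_subsets_at_top (ilists b))"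
      by (simp add: has_sum_def)
    then show ?thesis
    proof (rule Lim_transform_eventually)
      show "\<forall>\<^sub>F F in finite_subsets_at_top (ilists b). sum (\<lambda>js. if altsum js = n then g js else 0) F = (\<Sum>js | js \<in> F \<and> altsum js = n. g js)"
        by (intro eventually_finite_subsets_at_top_weakI) (simp add: sum.If_cases Int_def)
    qed
  qed
  have "\<exists>x. coord x = (\<lambda>n. Y n * of_real (\<bar>real_of_int n\<bar> powr s)) \<and> norm x \<le> kconst s b E * norms vs"
  proof (rule l2_of_coords)
    show "Y 0 * of_real (\<bar>real_of_int 0\<bar> powr s) = 0" by simp
    show "0 \<le> kconst s b E * norms vs"
      using E emb_const_ge_1[of s] by (auto simp: kconst_def intro!: mult_nonneg_nonneg)
    fix S :: "int set" assume S: "finite S"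
    have "((\<lambda>F. \<Sum>n\<in>S. (cmod ((\<Sum>js | js \<in> F \<and> altsum js = n. g js) * of_real (\<bar>real_of_int n\<bar> powr s)))\<^sup>2)
        \<longlongrightarrow> (\<Sum>n\<in>S. (cmod (Y n * of_real (\<bar>real_of_int n\<bar> powr s)))\<^sup>2)) (finite_subsets_at_top (ilists b))"
      by (intro tendsto_intros lim)
    moreover have "\<forall>\<^sub>F F in finite_subsets_at_top (ilists b).
      (\<Sum>n\<in>S. (cmod ((\<Sum>js | js \<in> F \<and> altsum js = n. g js) * of_real (\<bar>real_of_int n\<bar> powr s)))\<^sup>2) \<le> (kconst s b E * norms vs)\<^sup>2"
    proof (rule eventually_finite_subsets_at_top_weakI)
      fix F assume F: "finite F" "F \<subseteq> ilists b"
      let ?P = "\<lambda>k n. \<Sum>js | js \<in> F \<and> altsum js = n. prodl (young_factors s vs k) js"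
      have "(cmod ((\<Sum>js | js \<in> F \<and> altsum js = n. g js) * of_real (\<bar>real_of_int n\<bar> powr s)))\<^sup>2
          \<le> c0\<^sup>2 * (real b * (\<Sum>k<b. (?P k n)\<^sup>2))" for n
      proof -
        have "cmod ((\<Sum>js | js \<in> F \<and> altsum js = n. g js) * of_real (\<bar>real_of_int n\<bar> powr s))
            = cmod (\<Sum>js | js \<in> F \<and> altsum js = n. of_real (\<bar>real_of_int (altsum js)\<bar> powr s) * g js)"
          unfolding sum_distrib_right by (intro arg_cong[where f = cmod] sum.cong) (auto simp: mult.commute)
        also have "\<dots> \<le> (\<Sum>js | js \<in> F \<and> altsum js = n. \<bar>real_of_int (altsum js)\<bar> powr s * norm (g js))"
          by (rule order_trans[OF norm_sum]) (simp add: norm_mult)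
        also have "\<dots> \<le> (\<Sum>js | js \<in> F \<and> altsum js = n. c0 * (\<Sum>k<b. prodl (young_factors s vs k) js))"
          unfolding g_def c0_def using F by (intro sum_mono kernel_term_le[OF \<xi> s0 _ vs]) (simp add: subset_iff)
        also have "\<dots> = c0 * (\<Sum>k<b. ?P k n)"
          by (subst sum.swap) (simp add: sum_distrib_left)
        finally have "(cmod ((\<Sum>js | js \<in> F \<and> altsum js = n. g js) * of_real (\<bar>real_of_int n\<bar> powr s)))\<^sup>2 \<le> (c0 * (\<Sum>k<b. ?P k n))\<^sup>2"
          by (rule power_mono) auto
        also have "\<dots> \<le> c0\<^sup>2 * (real b * (\<Sum>k<b. (?P k n)\<^sup>2))"
          unfolding power_mult_distrib by (intro mult_left_mono sum_square_le) auto
        finally show ?thesis .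
      qed
      then have "(\<Sum>n\<in>S. (cmod ((\<Sum>js | js \<in> F \<and> altsum js = n. g js) * of_real (\<bar>real_of_int n\<bar> powr s)))\<^sup>2)
          \<le> (\<Sum>n\<in>S. c0\<^sup>2 * (real b * (\<Sum>k<b. (?P k n)\<^sup>2)))"
        by (rule sum_mono)
      also have "\<dots> = c0\<^sup>2 * (real b * (\<Sum>k<b. \<Sum>n\<in>S. (?P k n)\<^sup>2))"
        unfolding sum_distrib_left[symmetric] by (subst sum.swap) (rule refl)
      also have "\<dots> \<le> c0\<^sup>2 * (real b * (\<Sum>k<b. (emb_const s ^ b * norms vs)\<^sup>2))"
        using young_finite[OF s S F(1)] F vs by (intro mult_left_mono sum_mono) auto
      also have "\<dots> = (kconst s b E * norms vs)\<^sup>2"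
        by (simp add: kconst_def c0_def power_mult_distrib power2_eq_square mult_ac)
      finally show "(\<Sum>n\<in>S. (cmod ((\<Sum>js | js \<in> F \<and> altsum js = n. g js) * of_real (\<bar>real_of_int n\<bar> powr s)))\<^sup>2) \<le> (kconst s b E * norms vs)\<^sup>2" .
    qed
    ultimately show "(\<Sum>n\<in>S. (cmod (Y n * of_real (\<bar>real_of_int n\<bar> powr s)))\<^sup>2) \<le> (kconst s b E * norms vs)\<^sup>2"
      by (rule tendsto_upperbound) auto
  qed
  then obtain x where x: "coord x = (\<lambda>n. Y n * of_real (\<bar>real_of_int n\<bar> powr s))" "norm x \<le> kconst s b E * norms vs"
    by blast
  \<comment> \<open>A kernel has no component 0, as membership in \<open>ell2 s\<close> demands;
    \<open>emb\<close> would otherwise erase it.\<close>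
  have "Y 0 = 0"
    unfolding Y_def g_def using kernel_altsum_zero[OF \<xi>] by (intro infsum_0) auto
  then have e: "emb s x n = Y n" for n
    by (cases "n = 0") (auto simp: emb_def x mult.assoc powr_add[symmetric] simp flip: of_real_mult)
  then have "Xmap s \<xi> vs = x"
    unfolding Xmap_def vs g_def[symmetric] Y_def[symmetric] using unemb_emb[of s x] by (metis ext)
  then show "emb s (Xmap s \<xi> vs) n = infsum (\<lambda>js. \<xi> js * mon js (map (emb s) vs)) {js. length js = b \<and> altsum js = n}"
    "norm (Xmap s \<xi> vs) \<le> kconst s b E * norms vs"
    using e x unfolding g_def[symmetric] by (auto simp: Y_def)
qed

lemma mlin_Xmap:
  assumes s: "3 < s" and \<xi>: "kernel b E \<xi>"
  shows "mlin b (Xmap s \<xi>) (kconst s b E)"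
  unfolding mlin_def
proof (intro conjI allI impI)
  show "0 \<le> kconst s b E"
    using \<xi> emb_const_ge_1[of s] by (auto simp: kconst_def kernel_def intro!: mult_nonneg_nonneg)
  show "norm (Xmap s \<xi> vs) \<le> kconst s b E * norms vs" if "length vs = b" for vs
    by (rule norm_Xmap[OF s \<xi> that])
  fix xs ys :: "l2 list" assume len: "length xs + length ys + 1 = b"
  have S: "(\<lambda>js. \<xi> js * mon js (map (emb s) (xs @ w # ys))) summable_on {js. length js = b \<and> altsum js = n}" for w n
    using len by (intro summable_on_subset_banach[OF form_summable[OF s kernel_crude[OF \<xi>]]]) auto
  show "linear (\<lambda>v. Xmap s \<xi> (xs @ v # ys))"
  proof (rule linearI)
    fix u v :: l2 and r :: real
    have n: "length (xs @ w # ys) = b" for w using len by simp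
    have "emb s (Xmap s \<xi> (xs @ (u + v) # ys)) n = emb s (Xmap s \<xi> (xs @ u # ys)) n + emb s (Xmap s \<xi> (xs @ v # ys)) n" for n
      unfolding emb_Xmap[OF s \<xi> n] using len
      by (subst infsum_add[symmetric, OF S S])
        (auto intro!: infsum_cong simp del: map_append list.map simp: mon_emb_add distrib_left)
    then have "emb s (Xmap s \<xi> (xs @ (u + v) # ys)) = emb s (Xmap s \<xi> (xs @ u # ys) + Xmap s \<xi> (xs @ v # ys))"
      by (auto simp: emb_simps)
    then show "Xmap s \<xi> (xs @ (u + v) # ys) = Xmap s \<xi> (xs @ u # ys) + Xmap s \<xi> (xs @ v # ys)"
      by simp
    have "emb s (Xmap s \<xi> (xs @ (r *\<^sub>R v) # ys)) n = r *\<^sub>R emb s (Xmap s \<xi> (xs @ v # ys)) n" for n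
      unfolding emb_Xmap[OF s \<xi> n] using len
      by (subst infsum_scaleR_right[symmetric])
        (auto intro!: infsum_cong simp del: map_append list.map simp: mon_emb_scaleR)
    then have "emb s (Xmap s \<xi> (xs @ (r *\<^sub>R v) # ys)) = emb s (r *\<^sub>R Xmap s \<xi> (xs @ v # ys))"
      by (auto simp: emb_simps rscale_def scaleR_conv_of_real)
    then show "Xmap s \<xi> (xs @ (r *\<^sub>R v) # ys) = r *\<^sub>R Xmap s \<xi> (xs @ v # ys)"
      by simp
  qed
qed


section \<open>Lie derivatives on coefficients\<close>

text \<open>\<open>Top b \<xi>\<close> is the Lie derivative along the vector field with kernel \<open>\<xi>\<close>, acting on coefficients.\<close>

definition Top :: "nat \<Rightarrow> (int list \<Rightarrow> real) \<Rightarrow> (int list \<Rightarrow> complex) \<Rightarrow> int list \<Rightarrow> complex" where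
  "Top b \<xi> c js = (\<Sum>i<length js + 1 - b. c (take i js @ altsum (take b (drop i js)) # drop (i + b) js) *
     of_real (\<xi> (take b (drop i js))))"

text \<open>With real coefficients one kernel serves slots of both parities: in a conjugated slot
  the field enters through its complex conjugate.\<close>

abbreviation rker :: "nat \<Rightarrow> real \<Rightarrow> (int list \<Rightarrow> real) \<Rightarrow> bool" where
  "rker b E \<xi> \<equiv> kernel b E (\<lambda>js. of_real (\<xi> js))"

abbreviation rX :: "real \<Rightarrow> (int list \<Rightarrow> real) \<Rightarrow> l2 list \<Rightarrow> l2" where
  "rX s \<xi> \<equiv> Xmap s (\<lambda>js. of_real (\<xi> js))"

text \<open>The bound by \<open>W\<^sup>2\<close> with the division cleared. Nonzero coefficients
  have nonempty lists without 0, for which \<open>mx js\<close> is at least 1.\<close>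

definition wbd :: "real \<Rightarrow> (int list \<Rightarrow> complex) \<Rightarrow> int list \<Rightarrow> bool" where
  "wbd E c js \<longleftrightarrow> (js = [] \<or> 0 \<in> set js \<longrightarrow> c js = 0) \<and> norm (c js) * mx js ^ 4 \<le> E * (pr js)\<^sup>2"

lemma list_split3:
  assumes "length js = m + b - 1" "i < m" "1 \<le> b"
  obtains p bs q where "js = p @ bs @ q" "length p = i" "length bs = b" "length q = m - Suc i"
    "take i js = p" "take b (drop i js) = bs" "drop (i + b) js = q"
proof
  have "drop i js = take b (drop i js) @ drop (i + b) js"
    by (metis add.commute append_take_drop_id drop_drop)
  then show "js = take i js @ take b (drop i js) @ drop (i + b) js"
    by (metis append_take_drop_id)
qed (use assms in auto)

text \<open>In the bound for \<open>c\<close> the contracted index costs its square, and the second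
  part of \<open>kernel_bound\<close> pays for it.\<close>

lemma crude_Top:
  assumes \<xi>: "rker b E \<xi>" and c: "crude m D c"
  shows "crude (m + b - 1) (m * (D * (E * real b ^ 4))) (Top b \<xi> c)"
    and "length js = m + b - 1 \<Longrightarrow> i < m \<Longrightarrow>
      norm (c (take i js @ altsum (take b (drop i js)) # drop (i + b) js) * complex_of_real (\<xi> (take b (drop i js))))
        \<le> D * (E * real b ^ 4) * (pr js)\<^sup>2"
proof -
  have b: "1 \<le> b" and E: "0 \<le> E" using \<xi> by (auto simp: kernel_def)
  have D: "0 \<le> D" using c by (auto simp: crude_def)
  show *: "norm (c (take i js @ altsum (take b (drop i js)) # drop (i + b) js) * complex_of_real (\<xi> (take b (drop i js))))
      \<le> D * (E * real b ^ 4) * (pr js)\<^sup>2" if js: "length js = m + b - 1" and i: "i < m" for i and js :: "int list"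
  proof -
    obtain p bs q where split: "js = p @ bs @ q" "length p = i" "length bs = b" "length q = m - Suc i"
      "take i js = p" "take b (drop i js) = bs" "drop (i + b) js = q"
      using list_split3[OF js i b] by blast
    show ?thesis
    proof (cases "0 \<in> set bs")
      case True
      then have "\<xi> bs = 0" using kernel_zero[OF \<xi>, of bs] split by simp
      then show ?thesis using split D E by simp
    next
      case False
      have "norm (c (p @ altsum bs # q)) \<le> D * (pr (p @ altsum bs # q))\<^sup>2"
      proof -
        have "length (p @ altsum bs # q) = m" using split i by simp
        then show ?thesis using c unfolding crude_def by blast
      qed
      then have "norm (c (p @ altsum bs # q)) * norm (complex_of_real (\<xi> bs)) \<le> D * (pr (p @ altsum bs # q))\<^sup>2 * norm (complex_of_real (\<xi> bs))"
        by (rule mult_right_mono) auto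
      also have "\<dots> = D * ((pr p)\<^sup>2 * (pr q)\<^sup>2) * (norm (complex_of_real (\<xi> bs)) * (real_of_int (altsum bs))\<^sup>2)"
        by (simp add: power_mult_distrib mult_ac)
      also have "\<dots> \<le> D * ((pr p)\<^sup>2 * (pr q)\<^sup>2) * (E * real b ^ 4 * (pr bs)\<^sup>2)"
        using D kernel_bound(2)[OF \<xi> split(3) False] by (intro mult_left_mono) auto
      finally show ?thesis
        unfolding norm_mult split(5-7) by (simp add: split(1) power_mult_distrib mult_ac)
    qed
  qed
  show "crude (m + b - 1) (m * (D * (E * real b ^ 4))) (Top b \<xi> c)"
    unfolding crude_def
  proof (intro conjI allI impI)
    fix js :: "int list" assume js: "length js = m + b - 1"
    then have m: "length js + 1 - b = m" using b by simp
    have "norm (Top b \<xi> c js) \<le> (\<Sum>i<m. D * (E * real b ^ 4) * (pr js)\<^sup>2)"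
      unfolding Top_def m by (rule order_trans[OF norm_sum sum_mono]) (use * js in auto)
    then show "norm (Top b \<xi> c js) \<le> m * (D * (E * real b ^ 4)) * (pr js)\<^sup>2" by simp
  qed (use D E in auto)
qed

text \<open>The long lists are grouped by the list that arises when the block is contracted to its
  \<open>altsum\<close>; each fibre sums to one component of the field. For odd \<open>b\<close> the
  contraction keeps the parity of the slots behind the block, and a block at an odd position is
  conjugated as a whole.\<close>

lemma form_slot:
  assumes s: "3 < s" and b: "odd b" and \<xi>: "rker b E \<xi>" and c: "crude m D c"
    and len: "length us = i" "length ws = b" "m = i + 1 + length zs"
  shows "((\<lambda>js. c (take i js @ altsum (take b (drop i js)) # drop (i + b) js) * complex_of_real (\<xi> (take b (drop i js)))
      * mon js (map (emb s) (us @ ws @ zs))) has_sum form s c (us @ rX s \<xi> ws # zs)) (ilists (m + b - 1))"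
proof -
  have b1: "1 \<le> b" and E: "0 \<le> E" using \<xi> by (auto simp: kernel_def)
  have D: "0 \<le> D" using c by (auto simp: crude_def)
  define c' where "c' js = c (take i js @ altsum (take b (drop i js)) # drop (i + b) js) * complex_of_real (\<xi> (take b (drop i js)))" for js
  define g where "g js = c' js * mon js (map (emb s) (us @ ws @ zs))" for js
  define \<psi> where "\<psi> js = take i js @ altsum (take b (drop i js)) # drop (i + b) js" for js
  let ?N = "m + b - 1"
  have "crude ?N (D * (E * real b ^ 4)) c'"
    unfolding crude_def c'_def using crude_Top(2)[OF \<xi> c] D E len by auto
  then have "g summable_on ilists ?N"
    unfolding g_def by (rule form_summable[OF s]) (use len in auto)
  then have "(g has_sum infsum g (ilists ?N)) (ilists ?N)" by simp
  from has_sum_fibers[OF this, of \<psi>]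
  have "((\<lambda>ks. infsum g {js \<in> ilists ?N. \<psi> js = ks}) has_sum infsum g (ilists ?N)) UNIV" .
  also have "?this \<longleftrightarrow> ((\<lambda>ks. c ks * mon ks (map (emb s) (us @ rX s \<xi> ws # zs))) has_sum infsum g (ilists ?N)) (ilists m)"
  proof (rule has_sum_cong_neutral)
    fix ks :: "int list" assume "ks \<in> UNIV - ilists m"
    then have "{js \<in> ilists ?N. \<psi> js = ks} = {}"
      using len b1 by (auto simp: \<psi>_def)
    then show "infsum g {js \<in> ilists ?N. \<psi> js = ks} = 0" by (simp only: infsum_empty)
  next
    fix ks :: "int list" assume "ks \<in> UNIV \<inter> ilists m"
    then have "length ks = length us + length zs + 1" using len by simp
    then obtain p n q where ks: "ks = p @ n # q" "length p = length us" "length q = length zs"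
      by (rule split_at_slot)
    have "inj_on (\<lambda>bs. p @ bs @ q) S" for S :: "int list set" by (auto intro: inj_onI)
    moreover have "{js \<in> ilists ?N. \<psi> js = ks} = (\<lambda>bs. p @ bs @ q) ` {bs. length bs = b \<and> altsum bs = n}"
    proof (intro equalityI subsetI)
      fix js assume js: "js \<in> {js \<in> ilists ?N. \<psi> js = ks}"
      then obtain p' bs q' where split: "js = p' @ bs @ q'" "length p' = i" "length bs = b" "length q' = m - Suc i"
        "take i js = p'" "take b (drop i js) = bs" "drop (i + b) js = q'"
        using list_split3[of js m b i] b1 len by auto
      then have "p' @ altsum bs # q' = p @ n # q"
        using js ks by (simp add: \<psi>_def)
      then have "p' = p" "altsum bs = n" "q' = q"
        using split ks len by (auto simp: append_eq_append_conv)
      then show "js \<in> (\<lambda>bs. p @ bs @ q) ` {bs. length bs = b \<and> altsum bs = n}"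
        using split by auto
    qed (use ks len b1 in \<open>auto simp: \<psi>_def\<close>)
    ultimately have "infsum g {js \<in> ilists ?N. \<psi> js = ks} =
        (\<Sum>\<^sub>\<infinity>bs\<in>{bs. length bs = b \<and> altsum bs = n}. g (p @ bs @ q))"
      by (simp only:) (rule infsum_reindex[unfolded o_def])
    also have "\<dots> = (\<Sum>\<^sub>\<infinity>bs\<in>{bs. length bs = b \<and> altsum bs = n}.
        (c ks * (mon p (map (emb s) us) * (if even i then cnj (mon q (map (emb s) zs)) else mon q (map (emb s) zs)))) *
        (if even i then complex_of_real (\<xi> bs) * mon bs (map (emb s) ws) else cnj (complex_of_real (\<xi> bs) * mon bs (map (emb s) ws))))"
    proof (rule infsum_cong)
      fix bs :: "int list" assume bs: "bs \<in> {bs. length bs = b \<and> altsum bs = n}"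
      have "c' (p @ bs @ q) = c ks * complex_of_real (\<xi> bs)"
        using bs ks len by (auto simp: c'_def)
      then show "g (p @ bs @ q) = (c ks * (mon p (map (emb s) us) * (if even i then cnj (mon q (map (emb s) zs)) else mon q (map (emb s) zs)))) *
        (if even i then complex_of_real (\<xi> bs) * mon bs (map (emb s) ws) else cnj (complex_of_real (\<xi> bs) * mon bs (map (emb s) ws)))"
        using bs ks len b by (auto simp: g_def mon_append)
    qed
    also have "\<dots> = (c ks * (mon p (map (emb s) us) * (if even i then cnj (mon q (map (emb s) zs)) else mon q (map (emb s) zs)))) *
        (if even i then emb s (rX s \<xi> ws) n else cnj (emb s (rX s \<xi> ws) n))"
      by (subst infsum_cmult_right') (simp add: emb_Xmap[OF s \<xi> len(2)] flip: infsum_cnj)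
    also have "\<dots> = c ks * mon ks (map (emb s) (us @ rX s \<xi> ws # zs))"
      using ks len by (simp add: mon_slot)
    finally show "infsum g {js \<in> ilists ?N. \<psi> js = ks} = c ks * mon ks (map (emb s) (us @ rX s \<xi> ws # zs))" .
  qed auto
  finally have "form s c (us @ rX s \<xi> ws # zs) = infsum g (ilists ?N)"
    unfolding form_def using len by (simp add: infsumI)
  then show ?thesis
    using \<open>(g has_sum infsum g (ilists ?N)) (ilists ?N)\<close> by (simp add: g_def[abs_def] c'_def)
qed

lemma has_sum_finite_sum:
  fixes f :: "'i \<Rightarrow> 'a \<Rightarrow> 'b::topological_comm_monoid_add"
  assumes "finite I" "\<And>i. i \<in> I \<Longrightarrow> (f i has_sum S i) A"
  shows "((\<lambda>x. \<Sum>i\<in>I. f i x) has_sum (\<Sum>i\<in>I. S i)) A"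
  using assms by (induction I rule: finite_induct) (auto intro!: has_sum_add)

lemma form_Top:
  assumes s: "3 < s" and b: "odd b" and \<xi>: "rker b E \<xi>" and c: "crude m D c"
    and vs: "length vs = m + b - 1"
  shows "form s (Top b \<xi> c) vs = subst b (rX s \<xi>) (form s c) vs"
proof -
  have b1: "1 \<le> b" using \<xi> by (auto simp: kernel_def)
  have m: "length vs + 1 - b = m" using vs b1 by simp
  have "((\<lambda>js. c (take i js @ altsum (take b (drop i js)) # drop (i + b) js) * complex_of_real (\<xi> (take b (drop i js)))
      * mon js (map (emb s) vs)) has_sum form s c (take i vs @ rX s \<xi> (take b (drop i vs)) # drop (i + b) vs)) (ilists (m + b - 1))"
    if i: "i < m" for i
  proof -
    have "take i vs @ take b (drop i vs) @ drop (i + b) vs = vs"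
      by (metis add.commute append_take_drop_id drop_drop)
    moreover have "length (take i vs) = i" "length (take b (drop i vs)) = b" "m = i + 1 + length (drop (i + b) vs)"
      using vs i b1 by auto
    ultimately show ?thesis
      using form_slot[OF s b \<xi> c, of "take i vs" i "take b (drop i vs)" "drop (i + b) vs"] by simp
  qed
  then have "((\<lambda>js. \<Sum>i<m. c (take i js @ altsum (take b (drop i js)) # drop (i + b) js) * complex_of_real (\<xi> (take b (drop i js)))
      * mon js (map (emb s) vs)) has_sum (\<Sum>i<m. form s c (take i vs @ rX s \<xi> (take b (drop i vs)) # drop (i + b) vs))) (ilists (m + b - 1))"
    by (intro has_sum_finite_sum) auto
  also have "?this \<longleftrightarrow> ((\<lambda>js. Top b \<xi> c js * mon js (map (emb s) vs)) has_sum subst b (rX s \<xi>) (form s c) vs) (ilists (m + b - 1))"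
    unfolding subst_def m using b1
    by (intro has_sum_cong) (auto simp: Top_def sum_distrib_right)
  finally show ?thesis
    unfolding form_def vs by (rule infsumI)
qed

lemma wbd_nonneg_cases: "wbd E c js \<Longrightarrow> js = [] \<or> 0 \<in> set js \<Longrightarrow> c js = 0"
  by (auto simp: wbd_def)

lemma wbd_mono: "wbd E c js \<Longrightarrow> E \<le> E' \<Longrightarrow> wbd E' c js"
  unfolding wbd_def by (meson mult_right_mono order_trans zero_le_power2)

lemma wbd_crude:
  assumes "wbd E c js" "0 \<le> E"
  shows "norm (c js) \<le> E * (pr js)\<^sup>2"
proof (cases "js = [] \<or> 0 \<in> set js")
  case False
  then have "1 \<le> mx js" by (intro mx_ge_1) auto
  then have "norm (c js) * 1 \<le> norm (c js) * mx js ^ 4"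
    by (intro mult_left_mono one_le_power) auto
  with assms show ?thesis by (simp add: wbd_def)
qed (use assms in \<open>auto simp: wbd_def\<close>)

text \<open>Stability of the class under substitution. The bounds for \<open>c\<close> and \<xi>
  together contribute \<open>n ^ 4\<close> for the contracted index \<open>n\<close>, and the fourth
  power of \<open>geo\<close> converts the two separate maxima into the maximum of the whole list at
  exactly this price.\<close>

lemma wbd_term:
  assumes \<xi>: "rker b E \<xi>" and js: "js = p @ bs @ q" "length bs = b" and c: "wbd D c (p @ altsum bs # q)" and D: "0 \<le> D"
  shows "0 \<in> set js \<Longrightarrow> c (p @ altsum bs # q) * complex_of_real (\<xi> bs) = 0"
    and "norm (c (p @ altsum bs # q) * complex_of_real (\<xi> bs)) * mx js ^ 4 \<le> real b ^ 4 * E * D * (pr js)\<^sup>2"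
proof -
  have b: "1 \<le> b" and E: "0 \<le> E" using \<xi> by (auto simp: kernel_def)
  show z: "c (p @ altsum bs # q) * complex_of_real (\<xi> bs) = 0" if "0 \<in> set js"
    using that js c kernel_zero[OF \<xi> js(2)] by (auto simp: wbd_def)
  define n where "n = \<bar>real_of_int (altsum bs)\<bar>"
  define P where "P = max (mx p) (mx q)"
  show "norm (c (p @ altsum bs # q) * complex_of_real (\<xi> bs)) * mx js ^ 4 \<le> real b ^ 4 * E * D * (pr js)\<^sup>2"
  proof (cases "altsum bs = 0")
    case True
    then have "\<xi> bs = 0" using kernel_altsum_zero[OF \<xi> js(2)] by simp
    then show ?thesis using E D by simp
  next
    case False
    then have n: "0 < n" by (simp add: n_def)
    have c1: "norm (c (p @ altsum bs # q)) * max P n ^ 4 \<le> D * (n\<^sup>2 * ((pr p)\<^sup>2 * (pr q)\<^sup>2))"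
      using c by (simp add: wbd_def mx_append P_def n_def power_mult_distrib max.assoc max.commute max.left_commute mult_ac)
    have x1: "norm (complex_of_real (\<xi> bs)) * mx bs ^ 4 \<le> E * (n\<^sup>2 * (pr bs)\<^sup>2)"
      using \<xi> js by (simp add: kernel_def n_def power_mult_distrib)
    have nb: "n \<le> b * mx bs"
      using abs_altsum_le[of bs] js by (simp add: n_def)
    \<comment> \<open>If the block contains the largest index, \<open>n\<close> is absorbed by
      \<open>max P n\<close>; otherwise \<open>P\<close> is the maximum and \<open>n\<close> is at
      most \<open>b\<close> times the maximum of the block.\<close>
    have geo: "n * mx js \<le> b * (max P n * mx bs)"
    proof (cases "P \<le> mx bs")
      case True
      then have "mx js = mx bs" using js by (auto simp: mx_append P_def)
      then have "n * mx js \<le> 1 * (max P n * mx bs)" by (auto intro!: mult_right_mono)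
      also have "\<dots> \<le> b * (max P n * mx bs)"
        using b n by (intro mult_right_mono) auto
      finally show ?thesis .
    next
      case False
      then have "mx js = P" using js by (auto simp: mx_append P_def)
      then have "n * mx js \<le> (b * mx bs) * max P n"
        using nb n by (intro mult_mono) (auto simp: P_def le_max_iff_disj)
      then show ?thesis by (simp add: mult_ac)
    qed
    let ?w = "norm (c (p @ altsum bs # q) * complex_of_real (\<xi> bs))"
    have "(?w * mx js ^ 4) * n ^ 4 = ?w * (n * mx js) ^ 4"
      by (simp add: power_mult_distrib)
    also have "\<dots> \<le> ?w * (b * (max P n * mx bs)) ^ 4"
      using geo n by (intro mult_left_mono power_mono) auto
    also have "\<dots> = real b ^ 4 * ((norm (c (p @ altsum bs # q)) * max P n ^ 4) * (norm (complex_of_real (\<xi> bs)) * mx bs ^ 4))"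
      by (simp add: norm_mult power_mult_distrib)
    also have "\<dots> \<le> real b ^ 4 * ((D * (n\<^sup>2 * ((pr p)\<^sup>2 * (pr q)\<^sup>2))) * (E * (n\<^sup>2 * (pr bs)\<^sup>2)))"
      using D by (intro mult_left_mono mult_mono c1 x1) auto
    also have "\<dots> = (real b ^ 4 * E * D * (pr js)\<^sup>2) * n ^ 4"
      by (simp add: js power_mult_distrib power_numeral_reduce mult_ac)
    finally show ?thesis
      by (rule mult_right_le_imp_le) (use n in auto)
  qed
qed

lemma wbd_Top:
  assumes \<xi>: "rker b E \<xi>" and c: "\<And>ks. length ks = length js + 1 - b \<Longrightarrow> wbd D c ks" and D: "0 \<le> D"
  shows "wbd (length js * (real b ^ 4 * E * D)) (Top b \<xi> c) js"
proof -
  have b: "1 \<le> b" and E: "0 \<le> E" using \<xi> by (auto simp: kernel_def)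
  define m where "m = length js + 1 - b"
  define t where "t i = c (take i js @ altsum (take b (drop i js)) # drop (i + b) js) * complex_of_real (\<xi> (take b (drop i js)))" for i
  have t: "(0 \<in> set js \<longrightarrow> t i = 0) \<and> norm (t i) * mx js ^ 4 \<le> real b ^ 4 * E * D * (pr js)\<^sup>2" if i: "i < m" for i
  proof -
    have js: "length js = m + b - 1" using i b by (simp add: m_def)
    obtain p bs q where split: "js = p @ bs @ q" "length p = i" "length bs = b" "length q = m - Suc i"
      "take i js = p" "take b (drop i js) = bs" "drop (i + b) js = q"
      using list_split3[OF js i b] by blast
    have "wbd D c (p @ altsum bs # q)"
      by (rule c) (use split i b in \<open>auto simp: m_def\<close>)
    from wbd_term[OF \<xi> split(1,3) this D] show ?thesis
      unfolding t_def split(5-7) by blast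
  qed
  have T: "Top b \<xi> c js = (\<Sum>i<m. t i)"
    by (simp add: Top_def m_def t_def)
  have "norm (Top b \<xi> c js) * mx js ^ 4 \<le> (\<Sum>i<m. norm (t i)) * mx js ^ 4"
    unfolding T by (intro mult_right_mono norm_sum) auto
  also have "\<dots> = (\<Sum>i<m. norm (t i) * mx js ^ 4)"
    by (simp add: sum_distrib_right)
  also have "\<dots> \<le> (\<Sum>i<m. real b ^ 4 * E * D * (pr js)\<^sup>2)"
    using t by (intro sum_mono) auto
  also have "\<dots> = real m * (real b ^ 4 * E * D * (pr js)\<^sup>2)" by simp
  also have "\<dots> \<le> length js * (real b ^ 4 * E * D * (pr js)\<^sup>2)"
    using E D b by (intro mult_right_mono mult_nonneg_nonneg) (auto simp: m_def)
  finally have "norm (Top b \<xi> c js) * mx js ^ 4 \<le> length js * (real b ^ 4 * E * D) * (pr js)\<^sup>2"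
    by (simp add: mult.assoc)
  moreover have "Top b \<xi> c js = 0" if "js = [] \<or> 0 \<in> set js"
  proof -
    have "\<forall>i<m. t i = 0" using that b t by (auto simp: m_def)
    then show ?thesis by (simp add: T)
  qed
  ultimately show ?thesis unfolding wbd_def by blast
qed

definition gclass :: "real \<Rightarrow> real \<Rightarrow> (int list \<Rightarrow> complex) \<Rightarrow> bool" where
  "gclass A \<rho> c \<longleftrightarrow> 0 \<le> A \<and> 1 \<le> \<rho> \<and> (\<forall>js. wbd (A * \<rho> ^ length js) c js)"

lemma gclass_crude: "gclass A \<rho> c \<Longrightarrow> crude m (A * \<rho> ^ m) c"
  unfolding crude_def gclass_def by (auto intro: wbd_crude)

text \<open>Every application is charged with the final number of slots. The result is a
  \<open>k\<close>-th power in \<open>length js\<close>, which the factorial weights of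
  \<open>Elie\<close> sum to an exponential of the length.\<close>

lemma wbd_Top_funpow:
  assumes \<xi>: "rker b E \<xi>" and c: "gclass A \<rho> c"
  shows "wbd (A * \<rho> ^ length js * (real b ^ 4 * E * length js) ^ k) ((Top b \<xi> ^^ k) c) js"
proof (induction k arbitrary: js)
  case 0
  then show ?case using c by (simp add: gclass_def)
next
  case (Suc k)
  have b: "1 \<le> b" and E: "0 \<le> E" using \<xi> by (auto simp: kernel_def)
  have A: "0 \<le> A" "1 \<le> \<rho>" using c by (auto simp: gclass_def)
  let ?D = "A * \<rho> ^ length js * (real b ^ 4 * E * length js) ^ k"
  have "wbd (length js * (real b ^ 4 * E * ?D)) (Top b \<xi> ((Top b \<xi> ^^ k) c)) js"
  proof (rule wbd_Top[OF \<xi>])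
    fix ks :: "int list" assume ks: "length ks = length js + 1 - b"
    show "wbd ?D ((Top b \<xi> ^^ k) c) ks"
    proof (rule wbd_mono[OF Suc])
      show "A * \<rho> ^ length ks * (real b ^ 4 * E * length ks) ^ k \<le> ?D"
        using A E b ks by (intro mult_mono mult_left_mono power_mono power_increasing mult_nonneg_nonneg) auto
    qed
  qed (use A E in auto)
  then show ?case by (simp add: mult_ac)
qed

lemma Top_funpow_short: "2 \<le> b \<Longrightarrow> length js < k * (b - 1) \<Longrightarrow> (Top b \<xi> ^^ k) c js = 0"
proof (induction k arbitrary: js)
  case (Suc k)
  show ?case
    unfolding funpow.simps o_apply Top_def[of b \<xi> "(Top b \<xi> ^^ k) c" js]
  proof (intro sum.neutral ballI, unfold mult_eq_0_iff, rule disjI1, rule Suc.IH[OF Suc.prems(1)])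
    fix i assume i: "i \<in> {..<length js + 1 - b}"
    then have "length (take i js @ altsum (take b (drop i js)) # drop (i + b) js) = length js + 1 - b"
      using Suc.prems(1) by auto
    then show "length (take i js @ altsum (take b (drop i js)) # drop (i + b) js) < k * (b - 1)"
      using i Suc.prems by auto
  qed
qed simp

lemma subst_cong:
  assumes "\<And>ws. length ws = length vs + 1 - b \<Longrightarrow> a ws = a' ws" "1 \<le> b"
  shows "subst b A a vs = subst b A a' vs"
  unfolding subst_def using assms by (intro sum.cong refl) auto

lemma form_Top_funpow:
  assumes s: "3 < s" and b: "odd b" and \<xi>: "rker b E \<xi>" and c: "gclass A \<rho> c"
  shows "length vs = m + k * (b - 1) \<Longrightarrow>
    form s ((Top b \<xi> ^^ k) c) vs = (subst b (rX s \<xi>) ^^ k) (form s c) vs"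
proof (induction k arbitrary: vs)
  case (Suc k)
  have b1: "1 \<le> b" using \<xi> by (auto simp: kernel_def)
  have len: "length vs = (m + k * (b - 1)) + b - 1" using Suc.prems b1 by simp
  let ?D = "A * \<rho> ^ (m + k * (b - 1)) * (real b ^ 4 * E * real (m + k * (b - 1))) ^ k"
  have "0 \<le> ?D" using \<xi> c by (auto simp: gclass_def kernel_def)
  then have cr: "crude (m + k * (b - 1)) ?D ((Top b \<xi> ^^ k) c)"
    unfolding crude_def
  proof (intro conjI allI impI)
    fix js :: "int list" assume js: "length js = m + k * (b - 1)"
    show "norm ((Top b \<xi> ^^ k) c js) \<le> ?D * (pr js)\<^sup>2"
      using wbd_crude[OF wbd_Top_funpow[OF \<xi> c, of js k]] \<open>0 \<le> ?D\<close> unfolding js by blast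
  qed
  have "form s ((Top b \<xi> ^^ Suc k) c) vs = subst b (rX s \<xi>) (form s ((Top b \<xi> ^^ k) c)) vs"
    using form_Top[OF s b \<xi> cr len] by simp
  also have "\<dots> = subst b (rX s \<xi>) ((subst b (rX s \<xi>) ^^ k) (form s c)) vs"
    by (rule subst_cong[OF Suc.IH b1]) (use len b1 in auto)
  finally show ?case by simp
qed simp


section \<open>Power series in infinitely many variables\<close>

lemma summable_on_lengths:
  fixes f :: "'a list \<Rightarrow> real"
  assumes f: "\<And>js. 0 \<le> f js" and m: "\<And>m. f summable_on {js. length js = m}"
    and le: "\<And>m. infsum f {js. length js = m} \<le> g m" and g: "summable g"
  shows "f summable_on UNIV"
proof (rule nonneg_bounded_partial_sums_imp_summable_on[where C = "suminf g"])
  show "\<forall>\<^sub>F F in finite_subsets_at_top UNIV. sum f F \<le> suminf g"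
  proof (rule eventually_finite_subsets_at_top_weakI)
    fix F :: "'a list set" assume F: "finite F"
    have g0: "0 \<le> g m" for m
      using le[of m] infsum_nonneg[of "{js. length js = m}" f] f by (meson order_trans)
    have "sum f F = (\<Sum>m\<in>length ` F. sum f {js \<in> F. length js = m})"
      using F by (intro sum.group[symmetric]) auto
    also have "\<dots> \<le> (\<Sum>m\<in>length ` F. g m)"
      using F f by (intro sum_mono order_trans[OF finite_sum_le_infsum[OF m] le]) auto
    also have "\<dots> \<le> suminf g"
      using F g g0 by (intro sum_le_suminf) auto
    finally show "sum f F \<le> suminf g" .
  qed
qed (use f in auto)

definition Fsum :: "real \<Rightarrow> (int list \<Rightarrow> complex) \<Rightarrow> l2 \<Rightarrow> complex" where
  "Fsum s c x = (\<Sum>\<^sub>\<infinity>js. c js * mon js (replicate (length js) (emb s x)))"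

abbreviation monw :: "real \<Rightarrow> l2 \<Rightarrow> int list \<Rightarrow> real" where
  "monw s x js \<equiv> (pr js)\<^sup>2 * norm (mon js (replicate (length js) (emb s x)))"

lemma monw_ilists:
  assumes s: "3 < s"
  shows "monw s x summable_on ilists m" "infsum (monw s x) (ilists m) \<le> (emb_const s * norm x) ^ m"
proof -
  have eq: "monw s x js = prodl (map (wsq s) (replicate m x)) js" if "js \<in> ilists m" for js
    using norm_mon_emb[of js "replicate m x" s] that by simp
  have "monw s x summable_on ilists m \<longleftrightarrow> prodl (map (wsq s) (replicate m x)) summable_on ilists m"
    by (rule summable_on_cong) (rule eq)
  then show "monw s x summable_on ilists m"
    using prodl_wsq(1)[OF s, of "replicate m x"] by simp
  have "infsum (monw s x) (ilists m) = infsum (prodl (map (wsq s) (replicate m x))) (ilists m)"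
    by (rule infsum_cong) (rule eq)
  then show "infsum (monw s x) (ilists m) \<le> (emb_const s * norm x) ^ m"
    using prodl_wsq(2)[OF s, of "replicate m x"] by (simp add: power_mult_distrib)
qed

lemma monw_summable:
  assumes s: "3 < s" and y: "0 \<le> y" "y * (emb_const s * norm x) < 1"
  shows "(\<lambda>js. y ^ length js * monw s x js) summable_on UNIV"
proof (rule summable_on_lengths[where g = "\<lambda>m. (y * (emb_const s * norm x)) ^ m"])
  have *: "(\<lambda>js. y ^ length js * monw s x js) summable_on ilists m \<longleftrightarrow> (\<lambda>js. y ^ m * monw s x js) summable_on ilists m" for m
    by (rule summable_on_cong) auto
  then show "(\<lambda>js. y ^ length js * monw s x js) summable_on ilists m" for m
    using summable_on_cmult_right[OF monw_ilists(1)[OF s]] by simp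
  have "infsum (\<lambda>js. y ^ length js * monw s x js) (ilists m) = infsum (\<lambda>js. y ^ m * monw s x js) (ilists m)" for m
    by (rule infsum_cong) auto
  also have "\<dots>m = y ^ m * infsum (monw s x) (ilists m)" for m
    by (rule infsum_cmult_right[OF monw_ilists(1)[OF s]])
  finally show "infsum (\<lambda>js. y ^ length js * monw s x js) (ilists m) \<le> (y * (emb_const s * norm x)) ^ m" for m
    using mult_left_mono[OF monw_ilists(2)[OF s, of x m], of "y ^ m"] y by (simp add: power_mult_distrib)
  show "summable (\<lambda>m. (y * (emb_const s * norm x)) ^ m)"
    using y emb_const_ge_1[of s] by (intro summable_geometric) (simp add: abs_mult)
qed (use y in auto)

lemma gclass_term_le:
  assumes "gclass A \<rho> c"
  shows "norm (c js * mon js (replicate (length js) (emb s x))) \<le> A * (\<rho> ^ length js * monw s x js)"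
proof -
  have "norm (c js) * norm (mon js (replicate (length js) (emb s x))) \<le> (A * \<rho> ^ length js * (pr js)\<^sup>2) * norm (mon js (replicate (length js) (emb s x)))"
    using gclass_crude[OF assms, of "length js"] by (intro mult_right_mono) (auto simp: crude_def)
  then show ?thesis by (simp add: norm_mult mult_ac)
qed

lemma Fsum_abs_summable:
  assumes s: "3 < s" and c: "gclass A \<rho> c" and x: "\<rho> * (emb_const s * norm x) < 1"
  shows "(\<lambda>js. norm (c js * mon js (replicate (length js) (emb s x)))) summable_on UNIV"
proof (rule summable_on_comparison_test)
  show "(\<lambda>js. A * (\<rho> ^ length js * monw s x js)) summable_on UNIV"
    using c x by (intro summable_on_cmult_right monw_summable[OF s]) (auto simp: gclass_def)
qed (use gclass_term_le[OF c] in auto)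

lemma Fsum_has_sum:
  assumes s: "3 < s" and c: "gclass A \<rho> c" and x: "\<rho> * (emb_const s * norm x) < 1"
  shows "((\<lambda>js. c js * mon js (replicate (length js) (emb s x))) has_sum Fsum s c x) UNIV"
  unfolding Fsum_def by (rule has_sum_infsum[OF abs_summable_summable[OF Fsum_abs_summable[OF assms]]])

lemma Fsum_forms:
  assumes s: "3 < s" and c: "gclass A \<rho> c" and x: "\<rho> * (emb_const s * norm x) < 1"
  shows "((\<lambda>m. form s c (replicate m x)) has_sum Fsum s c x) UNIV"
proof -
  have "(\<Sum>\<^sub>\<infinity>js\<in>{js \<in> UNIV. length js = m}. c js * mon js (replicate (length js) (emb s x))) = form s c (replicate m x)" for m
    unfolding form_def by (rule infsum_cong_neutral) auto
  then show ?thesis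
    using has_sum_fibers[OF Fsum_has_sum[OF assms], of length] by simp
qed

text \<open>A Lie series on coefficients. For \<open>b \<ge> 2\<close> each application of
  \<open>Top\<close> lengthens lists, so cutting the sum at \<open>length js\<close> loses nothing.
  The weights are \<open>1 / fact k\<close> for composition with the flow and
  \<open>1 / fact (Suc k)\<close> when the first derivative has already been taken.\<close>

definition Elie :: "(nat \<Rightarrow> real) \<Rightarrow> nat \<Rightarrow> (int list \<Rightarrow> real) \<Rightarrow> (int list \<Rightarrow> complex) \<Rightarrow> int list \<Rightarrow> complex" where
  "Elie w b \<xi> c js = (\<Sum>k\<le>length js. of_real (w k) * (Top b \<xi> ^^ k) c js)"

lemma sum_le_exp:
  assumes "0 \<le> (x::real)" "\<And>k. \<bar>w k\<bar> \<le> 1 / fact k"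
  shows "(\<Sum>k\<le>n. \<bar>w k\<bar> * x ^ k) \<le> exp x"
proof -
  have "(\<lambda>k. x ^ k / fact k) sums exp x"
    using exp_converges[of x] by (simp add: divide_inverse mult.commute)
  moreover have "(\<Sum>k\<le>n. \<bar>w k\<bar> * x ^ k) \<le> (\<Sum>k\<le>n. x ^ k / fact k)"
    using assms by (intro sum_mono) (metis mult.commute mult_left_mono times_divide_eq_right mult.right_neutral zero_le_power)
  ultimately show ?thesis
    using assms(1) sum_le_suminf[of "\<lambda>k. x ^ k / fact k" "{..n}"] by (auto simp: sums_iff)
qed

text \<open>The sum over \<open>k\<close> is at most an exponential that is linear in
  \<open>length js\<close>, hence a geometric factor: only \<rho> changes.\<close>

lemma gclass_Elie:
  assumes \<xi>: "rker b E \<xi>" and c: "gclass A \<rho> c" and w: "\<And>k. \<bar>w k\<bar> \<le> 1 / fact k"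
  shows "gclass A (\<rho> * exp (real b ^ 4 * E)) (Elie w b \<xi> c)"
  unfolding gclass_def
proof (intro conjI allI)
  have A: "0 \<le> A" "1 \<le> \<rho>" and E: "0 \<le> E" using c \<xi> by (auto simp: gclass_def kernel_def)
  then show "0 \<le> A" by simp
  have "1 * 1 \<le> \<rho> * exp (real b ^ 4 * E)"
    using A E by (intro mult_mono) auto
  then show "1 \<le> \<rho> * exp (real b ^ 4 * E)" by simp
  fix js :: "int list"
  let ?x = "real b ^ 4 * E * length js"
  note T = wbd_Top_funpow[OF \<xi> c, of js]
  have "norm (Elie w b \<xi> c js) * mx js ^ 4 \<le> (\<Sum>k\<le>length js. \<bar>w k\<bar> * norm ((Top b \<xi> ^^ k) c js)) * mx js ^ 4"
    unfolding Elie_def by (intro mult_right_mono order_trans[OF norm_sum]) (auto simp: norm_mult)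
  also have "\<dots> = (\<Sum>k\<le>length js. \<bar>w k\<bar> * (norm ((Top b \<xi> ^^ k) c js) * mx js ^ 4))"
    by (simp add: sum_distrib_right mult.assoc)
  also have "\<dots> \<le> (\<Sum>k\<le>length js. \<bar>w k\<bar> * (A * \<rho> ^ length js * ?x ^ k * (pr js)\<^sup>2))"
    using T by (intro sum_mono mult_left_mono) (auto simp: wbd_def)
  also have "\<dots> = A * \<rho> ^ length js * (pr js)\<^sup>2 * (\<Sum>k\<le>length js. \<bar>w k\<bar> * ?x ^ k)"
    by (simp add: sum_distrib_left mult_ac)
  also have "\<dots> \<le> A * \<rho> ^ length js * (pr js)\<^sup>2 * exp ?x"
    using A E by (intro mult_left_mono sum_le_exp w) auto
  also have "\<dots> = A * (\<rho> * exp (real b ^ 4 * E)) ^ length js * (pr js)\<^sup>2"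
    by (simp add: power_mult_distrib exp_of_nat_mult[symmetric] mult_ac)
  finally have "norm (Elie w b \<xi> c js) * mx js ^ 4 \<le> A * (\<rho> * exp (real b ^ 4 * E)) ^ length js * (pr js)\<^sup>2" .
  moreover have "Elie w b \<xi> c js = 0" if "js = [] \<or> 0 \<in> set js"
    using T that by (auto simp: Elie_def wbd_def)
  ultimately show "wbd (A * (\<rho> * exp (real b ^ 4 * E)) ^ length js) (Elie w b \<xi> c) js"
    unfolding wbd_def by blast
qed

text \<open>The double family over lists and orders \<open>k\<close> is absolutely summable: the
  inner sums are exponential series, the outer sum is geometric. Summed over \<open>k\<close> first
  it gives \<open>Fsum\<close>; grouped by length and \<open>k\<close> it gives the terms of the Lie
  series.\<close>

lemma Elie_has_sum:
  assumes s: "3 < s" and b: "odd b" "3 \<le> b" and \<xi>: "rker b E \<xi>" and c: "gclass A \<rho> c"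
    and w: "\<And>k. \<bar>w k\<bar> \<le> 1 / fact k"
    and x: "\<rho> * exp (real b ^ 4 * E) * (emb_const s * norm x) < 1"
  shows "((\<lambda>(m, k). w k *\<^sub>R (subst b (rX s \<xi>) ^^ k) (form s c) (replicate (m + k * (b - 1)) x))
    has_sum Fsum s (Elie w b \<xi> c) x) UNIV"
proof -
  have A: "0 \<le> A" "1 \<le> \<rho>" and E: "0 \<le> E" using c \<xi> by (auto simp: gclass_def kernel_def)
  define \<kappa> where "\<kappa> = real b ^ 4 * E"
  have \<kappa>: "0 \<le> \<kappa>" using E by (simp add: \<kappa>_def)
  define mn where "mn js = mon js (replicate (length js) (emb s x))" for js
  define t where "t = (\<lambda>(js, k). of_real (w k) * (Top b \<xi> ^^ k) c js * mn js)"
  define u where "u = (\<lambda>(js, k). A * \<rho> ^ length js * ((\<kappa> * length js) ^ k / fact k) * monw s x js)"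
  have tu: "norm (t z) \<le> u z" for z
  proof -
    obtain js k where z: "z = (js, k)" by (cases z)
    have "norm (t z) = \<bar>w k\<bar> * norm ((Top b \<xi> ^^ k) c js) * norm (mn js)"
      by (simp add: t_def z norm_mult)
    also have "\<dots> \<le> (1 / fact k) * (A * \<rho> ^ length js * (\<kappa> * length js) ^ k * (pr js)\<^sup>2) * norm (mn js)"
      unfolding \<kappa>_def using A E
      by (intro mult_right_mono mult_mono w wbd_crude[OF wbd_Top_funpow[OF \<xi> c]] mult_nonneg_nonneg) auto
    finally show ?thesis by (simp add: u_def z mn_def mult_ac)
  qed
  have inner: "((\<lambda>k. u (js, k)) has_sum A * ((\<rho> * exp \<kappa>) ^ length js * monw s x js)) UNIV" for js
  proof -
    have "(\<lambda>k. (\<kappa> * length js) ^ k / fact k) sums exp (\<kappa> * length js)"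
      using exp_converges[of "\<kappa> * length js"] by (simp add: divide_inverse mult.commute)
    then have "((\<lambda>k. (\<kappa> * length js) ^ k / fact k) has_sum exp (\<kappa> * length js)) UNIV"
      by (rule sums_nonneg_imp_has_sum) (use \<kappa> in auto)
    from has_sum_cmult_left[OF has_sum_cmult_right[OF this, of "A * \<rho> ^ length js"], of "monw s x js"]
    show ?thesis
      by (simp add: u_def power_mult_distrib exp_of_nat_mult[symmetric] mult_ac)
  qed
  have "(\<lambda>js. A * ((\<rho> * exp \<kappa>) ^ length js * monw s x js)) summable_on UNIV"
    using x A by (intro summable_on_cmult_right monw_summable[OF s]) (auto simp: \<kappa>_def)
  then have "u summable_on UNIV \<times> UNIV"
    using A \<kappa> by (intro summable_on_SigmaI[OF inner]) (auto simp: u_def)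
  then have tabs: "(\<lambda>z. norm (t z)) summable_on UNIV"
    unfolding UNIV_Times_UNIV by (rule summable_on_comparison_test) (use tu in auto)
  then have tsum: "(t has_sum infsum t UNIV) UNIV"
    by (rule has_sum_infsum[OF abs_summable_summable])
  have "((\<lambda>js. Elie w b \<xi> c js * mn js) has_sum infsum t UNIV) UNIV"
  proof (rule has_sum_SigmaD[where f = t and B = "\<lambda>_. UNIV"])
    show "(t has_sum infsum t UNIV) (UNIV \<times> UNIV)" using tsum by simp
    fix js :: "int list"
    have "((\<lambda>k. t (js, k)) has_sum (\<Sum>k\<le>length js. t (js, k))) {..length js}"
      by simp
    also have "(\<Sum>k\<le>length js. t (js, k)) = Elie w b \<xi> c js * mn js"
      by (simp add: t_def Elie_def sum_distrib_right)
    also have "((\<lambda>k. t (js, k)) has_sum Elie w b \<xi> c js * mn js) {..length js} \<longleftrightarrow>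
        ((\<lambda>k. t (js, k)) has_sum Elie w b \<xi> c js * mn js) UNIV"
    proof (rule has_sum_cong_neutral)
      fix k assume "k \<in> UNIV - {..length js}"
      then have "length js < k * 1" by simp
      also have "\<dots> \<le> k * (b - 1)" using b by (intro mult_left_mono) auto
      finally show "t (js, k) = 0" using b by (simp add: t_def Top_funpow_short)
    qed auto
    finally show "((\<lambda>k. t (js, k)) has_sum Elie w b \<xi> c js * mn js) UNIV" .
  qed
  then have S: "infsum t UNIV = Fsum s (Elie w b \<xi> c) x"
    unfolding Fsum_def mn_def by (simp add: infsumI)
  have "((\<lambda>y. \<Sum>\<^sub>\<infinity>z\<in>{z \<in> UNIV. (length (fst z), snd z) = y}. t z) has_sum infsum t UNIV) UNIV"
    by (rule has_sum_fibers[OF tsum])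
  also have "?this \<longleftrightarrow> ((\<lambda>(n, k). w k *\<^sub>R form s ((Top b \<xi> ^^ k) c) (replicate n x)) has_sum infsum t UNIV) UNIV"
  proof (rule has_sum_cong)
    fix y :: "nat \<times> nat"
    obtain n k where y: "y = (n, k)" by (cases y)
    have "(\<Sum>\<^sub>\<infinity>z\<in>{z \<in> UNIV. (length (fst z), snd z) = y}. t z) = (\<Sum>\<^sub>\<infinity>js\<in>ilists n. t (js, k))"
      by (rule infsum_reindex_bij_witness[of _ "\<lambda>js. (js, k)" fst]) (auto simp: y)
    also have "\<dots> = (\<Sum>\<^sub>\<infinity>js\<in>ilists n. w k *\<^sub>R ((Top b \<xi> ^^ k) c js * mn js))"
      by (intro infsum_cong) (simp add: t_def scaleR_conv_of_real mult.assoc)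
    also have "\<dots> = w k *\<^sub>R form s ((Top b \<xi> ^^ k) c) (replicate n x)"
      unfolding form_def by (subst infsum_scaleR_right) (auto intro!: infsum_cong arg_cong[where f = "scaleR _"] simp: mn_def)
    finally show "(\<Sum>\<^sub>\<infinity>z\<in>{z \<in> UNIV. (length (fst z), snd z) = y}. t z) = (case y of (n, k) \<Rightarrow> w k *\<^sub>R form s ((Top b \<xi> ^^ k) c) (replicate n x))"
      by (simp add: y)
  qed
  also have "\<dots> \<longleftrightarrow> ((\<lambda>(n, k). w k *\<^sub>R form s ((Top b \<xi> ^^ k) c) (replicate n x)) has_sum infsum t UNIV) {(n, k). k * (b - 1) \<le> n}"
  proof (rule has_sum_cong_neutral)
    fix y :: "nat \<times> nat" assume "y \<in> UNIV - {(n, k). k * (b - 1) \<le> n}"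
    then obtain n k where y: "y = (n, k)" "n < k * (b - 1)" by (cases y) auto
    have "form s ((Top b \<xi> ^^ k) c) (replicate n x) = 0"
      unfolding form_def using y b by (intro infsum_0) (auto simp: Top_funpow_short)
    then show "(case y of (n, k) \<Rightarrow> w k *\<^sub>R form s ((Top b \<xi> ^^ k) c) (replicate n x)) = 0"
      by (simp add: y)
  qed auto
  finally have *: "((\<lambda>(n, k). w k *\<^sub>R form s ((Top b \<xi> ^^ k) c) (replicate n x)) has_sum infsum t UNIV) {(n, k). k * (b - 1) \<le> n}" .
  have FT: "form s ((Top b \<xi> ^^ k) c) (replicate n x) = (subst b (rX s \<xi>) ^^ k) (form s c) (replicate n x)"
    if "k * (b - 1) \<le> n" for n k
    by (rule form_Top_funpow[OF s b(1) \<xi> c, where m = "n - k * (b - 1)"]) (use that in simp)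
  \<comment> \<open>From the degree \<open>n\<close> of the result back to the degree
    \<open>m = n - k * (b - 1)\<close> of the form that is differentiated.\<close>
  have "((\<lambda>(n, k). w k *\<^sub>R form s ((Top b \<xi> ^^ k) c) (replicate n x)) has_sum infsum t UNIV) {(n, k). k * (b - 1) \<le> n}
    \<longleftrightarrow> ((\<lambda>(m, k). w k *\<^sub>R (subst b (rX s \<xi>) ^^ k) (form s c) (replicate (m + k * (b - 1)) x)) has_sum infsum t UNIV) UNIV"
    by (rule has_sum_reindex_bij_witness[of _ "\<lambda>(m, k). (m + k * (b - 1), k)" "\<lambda>(n, k). (n - k * (b - 1), k)"])
      (auto simp: FT)
  with * show ?thesis by (simp add: S)
qed

lemma rX_flow_radius:
  assumes s: "3 < s" and b: "3 \<le> b" and \<xi>: "rker b E \<xi>"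
  shows "\<exists>r>0. flow_radius b (rX s \<xi>) (kconst s b E) r"
proof -
  let ?D = "kconst s b E"
  have m: "mlin b (rX s \<xi>) ?D" by (rule mlin_Xmap[OF s \<xi>])
  then have D: "0 \<le> ?D" by (rule mlin_nonneg)
  define r where "r = 1 / (2 * (?D * exp b + 1))"
  have p: "0 < ?D * exp b + 1" using D by (intro add_nonneg_pos mult_nonneg_nonneg) auto
  have r: "0 < r" "r \<le> 1" using p D by (auto simp: r_def)
  have "?D * exp b * r ^ (b - 1) \<le> ?D * exp b * r ^ 1"
    using D r b by (intro mult_left_mono power_decreasing mult_nonneg_nonneg) auto
  also have "\<dots> \<le> (?D * exp b + 1) * r"
    using r by (simp add: algebra_simps)
  also have "\<dots> = 1 / 2"
    using p by (simp add: r_def)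
  finally show ?thesis
    using m r b by (auto simp: flow_radius_def)
qed

text \<open>Summing over \<open>k\<close> for fixed degree gives the form at the image point by
  \<open>lie_series\<close>, and summing over the degrees gives \<open>Fsum\<close> there. The
  factor 2 in the smallness condition allows for the norm of the image point.\<close>

lemma Fsum_time1:
  assumes s: "3 < s" and b: "odd b" "3 \<le> b" and \<xi>: "rker b E \<xi>" and c: "gclass A \<rho> c"
    and fr: "flow_radius b (rX s \<xi>) D r" and xr: "norm x \<le> r / 2"
    and x: "\<rho> * exp (real b ^ 4 * E) * (emb_const s * (2 * norm x)) < 1"
  shows "Fsum s c (time1 b (rX s \<xi>) x) = Fsum s (Elie (\<lambda>k. 1 / fact k) b \<xi> c) x"
proof -
  have A: "0 \<le> A" "1 \<le> \<rho>" and E: "0 \<le> E" using c \<xi> by (auto simp: gclass_def kernel_def)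
  have e: "1 \<le> emb_const s" by (rule emb_const_ge_1)
  have "\<rho> * exp (real b ^ 4 * E) * (emb_const s * norm x) \<le> \<rho> * exp (real b ^ 4 * E) * (emb_const s * (2 * norm x))"
    using A e by (intro mult_left_mono) auto
  with x have x1: "\<rho> * exp (real b ^ 4 * E) * (emb_const s * norm x) < 1" by simp
  let ?t = "\<lambda>(m, k). (1 / fact k) *\<^sub>R (subst b (rX s \<xi>) ^^ k) (form s c) (replicate (m + k * (b - 1)) x)"
  have S: "(?t has_sum Fsum s (Elie (\<lambda>k. 1 / fact k) b \<xi> c) x) (UNIV \<times> UNIV)"
    using Elie_has_sum[OF s b \<xi> c _ x1, of "\<lambda>k. 1 / fact k"] by simp
  have "((\<lambda>m. form s c (replicate m (time1 b (rX s \<xi>) x))) has_sum Fsum s (Elie (\<lambda>k. 1 / fact k) b \<xi> c) x) UNIV"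
  proof (rule has_sum_SigmaD[OF S])
    fix m :: nat
    have "(\<lambda>k. ?t (m, k)) summable_on UNIV"
      using summable_on_SigmaD1[of "\<lambda>m k. ?t (m, k)" UNIV "\<lambda>_. UNIV" m] has_sum_imp_summable[OF S] by simp
    then have h: "((\<lambda>k. ?t (m, k)) has_sum infsum (\<lambda>k. ?t (m, k)) UNIV) UNIV"
      by (rule has_sum_infsum)
    have "(\<lambda>k. ?t (m, k)) sums form s c (replicate m (time1 b (rX s \<xi>) x))"
      using lie_series[OF fr mlin_form[OF s gclass_crude[OF c]] xr, of m] by simp
    with h show "((\<lambda>k. ?t (m, k)) has_sum form s c (replicate m (time1 b (rX s \<xi>) x))) UNIV"
      using sums_unique2[OF has_sum_imp_sums[OF h]] by simp
  qed
  moreover have "((\<lambda>m. form s c (replicate m (time1 b (rX s \<xi>) x))) has_sum Fsum s c (time1 b (rX s \<xi>) x)) UNIV"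
  proof (rule Fsum_forms[OF s c])
    have "norm (time1 b (rX s \<xi>) x) \<le> 2 * norm x"
      by (rule flow_curve_norm[OF fr xr]) simp
    then have "\<rho> * (emb_const s * norm (time1 b (rX s \<xi>) x)) \<le> \<rho> * 1 * (emb_const s * (2 * norm x))"
      using A e by (simp add: mult_left_mono)
    also have "\<dots> \<le> \<rho> * exp (real b ^ 4 * E) * (emb_const s * (2 * norm x))"
      using A e E by (intro mult_right_mono mult_left_mono) auto
    also note x
    finally show "\<rho> * (emb_const s * norm (time1 b (rX s \<xi>) x)) < 1" .
  qed
  ultimately show ?thesis
    by (rule has_sum_unique[symmetric])
qed

text \<open>The free Hamiltonian \<open>h\<close> is not in the weighted class, only its Lie derivative is; hence the weights
  \<open>1 / (k + 1)!\<close>.\<close>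

lemma form_time1_shifted:
  assumes s: "3 < s" and b: "odd b" "3 \<le> b" and \<xi>: "rker b E \<xi>" and c: "gclass A \<rho> c"
    and fr: "flow_radius b (rX s \<xi>) D r" and xr: "norm x \<le> r / 2"
    and x: "\<rho> * exp (real b ^ 4 * E) * (emb_const s * norm x) < 1"
    and supp: "\<And>js. length js \<noteq> n + b - 1 \<Longrightarrow> c js = 0"
    and h: "mlin n h C" and eq: "\<And>y. subst b (rX s \<xi>) h (replicate (n + b - 1) y) = form s c (replicate (n + b - 1) y)"
  shows "h (replicate n (time1 b (rX s \<xi>) x)) = h (replicate n x) + Fsum s (Elie (\<lambda>k. 1 / fact (Suc k)) b \<xi> c) x"
proof -
  let ?X = "rX s \<xi>"
  have X: "mlin b ?X D" and b1: "1 \<le> b" using fr by (auto simp: flow_radius_def)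
  let ?t = "\<lambda>(m, k). (1 / fact (Suc k)) *\<^sub>R (subst b ?X ^^ k) (form s c) (replicate (m + k * (b - 1)) x)"
  have w: "\<bar>1 / fact (Suc k)\<bar> \<le> (1 / fact k :: real)" for k
    by (simp add: divide_simps)
  have S: "(?t has_sum Fsum s (Elie (\<lambda>k. 1 / fact (Suc k)) b \<xi> c) x) UNIV"
    using Elie_has_sum[OF s b \<xi> c w x] by simp
  have "form s c ws = 0" if "length ws \<noteq> n + b - 1" for ws
    unfolding form_def using supp that by (intro infsum_0) auto
  then have z: "(subst b ?X ^^ k) (form s c) ws = 0" if "length ws \<noteq> (n + b - 1) + k * (b - 1)" for k ws
    using that
  proof (induction k arbitrary: ws)
    case (Suc k)
    show ?case
      unfolding funpow.simps o_apply subst_def[of b ?X "(subst b ?X ^^ k) (form s c)"]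
    proof (intro sum.neutral ballI Suc.IH[OF Suc.prems(1)])
      fix i assume "i \<in> {..<length ws + 1 - b}"
      then show "length (take i ws @ ?X (take b (drop i ws)) # drop (i + b) ws) \<noteq> n + b - 1 + k * (b - 1)"
        using Suc.prems(2) b1 by auto
    qed auto
  qed auto
  have "(?t has_sum Fsum s (Elie (\<lambda>k. 1 / fact (Suc k)) b \<xi> c) x) (range (\<lambda>k. (n + b - 1, k)))"
    using S by (subst has_sum_cong_neutral[where T = UNIV and g = ?t])
      (auto simp: z image_iff)
  then have "((\<lambda>k. ?t (n + b - 1, k)) has_sum Fsum s (Elie (\<lambda>k. 1 / fact (Suc k)) b \<xi> c) x) UNIV"
    by (subst (asm) has_sum_reindex) (auto simp: o_def inj_on_def)
  then have "(\<lambda>k. ?t (n + b - 1, k)) sums Fsum s (Elie (\<lambda>k. 1 / fact (Suc k)) b \<xi> c) x"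
    by (rule has_sum_imp_sums)
  moreover have "?t (n + b - 1, k) = (1 / fact (Suc k)) *\<^sub>R (subst b ?X ^^ Suc k) h (replicate (n + Suc k * (b - 1)) x)" for k
  proof -
    have len: "n + b - 1 + k * (b - 1) = n + Suc k * (b - 1)" using b1 by simp
    have "(subst b ?X ^^ k) (form s c) (replicate (n + b - 1 + k * (b - 1)) x) = (subst b ?X ^^ k) (subst b ?X h) (replicate (n + b - 1 + k * (b - 1)) x)"
      by (rule subst_funpow_cong_diag[OF mlin_form[OF s gclass_crude[OF c]] mlin_subst[OF h X b1] X b1]) (rule eq[symmetric])
    then show ?thesis
      unfolding len[symmetric] by (simp only: prod.case funpow_Suc_right o_apply)
  qed
  moreover have "(\<lambda>k. (1 / fact (Suc k)) *\<^sub>R (subst b ?X ^^ Suc k) h (replicate (n + Suc k * (b - 1)) x))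
      sums (h (replicate n (time1 b ?X x)) - h (replicate n x))"
    using lie_series[OF fr h xr] by (subst sums_Suc_iff) simp
  ultimately show ?thesis
    using sums_unique2 by fastforce
qed


section \<open>Hamiltonian vector fields\<close>

definition uvec :: "real \<Rightarrow> complex \<Rightarrow> int \<Rightarrow> l2" where
  "uvec s z j = unemb s (\<lambda>i. if i = j then z else 0)"

lemma emb_uvec: "j \<noteq> 0 \<Longrightarrow> emb s (uvec s z j) = (\<lambda>i. if i = j then z else 0)"
proof -
  assume j: "j \<noteq> 0"
  have "(\<lambda>i. (cmod (if i = j then z else 0))\<^sup>2 * \<bar>real_of_int i\<bar> powr (2 * s)) summable_on Zstar \<longleftrightarrow>
      (\<lambda>i. (cmod (if i = j then z else 0))\<^sup>2 * \<bar>real_of_int i\<bar> powr (2 * s)) summable_on {j}"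
    using j by (intro summable_on_cong_neutral) (auto simp: Zstar_def)
  then show ?thesis
    unfolding uvec_def using j by (intro emb_unemb) (auto simp: ell2_def)
qed

lemma emb_uvec_shift: "j \<noteq> 0 \<Longrightarrow> (emb s p)(j := emb s p j + z * of_real t) = emb s (p + t *\<^sub>R uvec s z j)"
  by (auto simp: emb_simps emb_uvec rscale_def fun_eq_iff)

lemma partials_from_directional:
  assumes f: "\<And>v. ((\<lambda>t. f (emb s (p + t *\<^sub>R v))) has_vector_derivative D v) (at 0)"
  shows "has_partials f (emb s p)"
    and "j \<in> Zstar \<Longrightarrow> dqbar f j (emb s p) = (D (uvec s 1 j) + \<i> * D (uvec s \<i> j)) / 2"
proof -
  have *: "((\<lambda>t. f ((emb s p)(j := emb s p j + z * of_real t))) has_vector_derivative D (uvec s z j)) (at 0)"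
    if "j \<in> Zstar" for j z
    using f[of "uvec s z j"] that by (simp add: emb_uvec_shift Zstar_def)
  show "has_partials f (emb s p)"
    unfolding has_partials_def
    using *[of _ 1] *[of _ \<i>] by (auto intro: differentiableI_vector)
  assume j: "j \<in> Zstar"
  show "dqbar f j (emb s p) = (D (uvec s 1 j) + \<i> * D (uvec s \<i> j)) / 2"
    unfolding dqbar_def dx_def dy_def
    using *[OF j, of 1] *[OF j, of \<i>] by (simp add: vector_derivative_at)
qed

definition hamcoef :: "(int list \<Rightarrow> complex) \<Rightarrow> bool" where
  "hamcoef c \<longleftrightarrow> (\<forall>js. c js \<noteq> 0 \<longrightarrow> even (length js) \<and> altsum js = 0)"

text \<open>Coefficients of the derivative with respect to \<open>cnj (q n)\<close>: the odd
  positions are the conjugated slots. After removal of slot \<open>i\<close> the list is rotated,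
  not merely closed up, because only the rotation restores the alternation of plain and conjugated
  slots.\<close>

definition gker :: "(int list \<Rightarrow> complex) \<Rightarrow> nat \<Rightarrow> int list \<Rightarrow> complex" where
  "gker c n js = (\<Sum>i | i < n \<and> odd i. c (drop (n - Suc i) js @ altsum js # take (n - Suc i) js))"

text \<open>The gradient of a Hamiltonian in the class is a bounded field on \<open>ell2 s\<close>;
  the further factor \<open>j\<close> in \<open>ham_vf\<close> is what lowers \<open>s\<close> to
  \<open>s - 1\<close>.\<close>

lemma kernel_gker:
  assumes c: "\<And>js. length js = n \<Longrightarrow> wbd E c js" and n: "2 \<le> n" and E: "0 \<le> E"
  shows "kernel (n - 1) (n * E) (gker c n)"
  unfolding kernel_def
proof (intro conjI allI impI)
  show "1 \<le> n - 1" "0 \<le> n * E" using n E by auto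
  fix js :: "int list" assume js: "length js = n - 1"
  let ?ks = "\<lambda>i. drop (n - Suc i) js @ altsum js # take (n - Suc i) js"
  have w: "wbd E c (?ks i)" if "i < n" for i
    by (rule c) (use js n that in auto)
  have set: "set (?ks i) = insert (altsum js) (set js)" for i
    by (metis Un_commute Un_insert_right append_take_drop_id list.simps(15) set_append)
  have pr: "pr (?ks i) = \<bar>real_of_int (altsum js)\<bar> * pr js" for i
  proof -
    have "pr js = pr (take (n - Suc i) js) * pr (drop (n - Suc i) js)"
      by (metis append_take_drop_id map_append prod_list.append)
    then show ?thesis by simp
  qed
  have mx: "mx js \<le> mx (?ks i)" for i
  proof -
    have "mx js = max (mx (take (n - Suc i) js)) (mx (drop (n - Suc i) js))"
      by (metis append_take_drop_id mx_append)
    then show ?thesis by (auto simp: mx_append max_def)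
  qed
  show "gker c n js = 0" if "0 \<in> set js"
    unfolding gker_def by (intro sum.neutral ballI wbd_nonneg_cases[OF w]) (use that set in auto)
  have "norm (c (?ks i)) * mx js ^ 4 \<le> E * (real_of_int (altsum js) * pr js)\<^sup>2" if "i < n" for i
  proof -
    have "norm (c (?ks i)) * mx js ^ 4 \<le> norm (c (?ks i)) * mx (?ks i) ^ 4"
      using mx by (intro mult_left_mono power_mono) auto
    also have "\<dots> \<le> E * (pr (?ks i))\<^sup>2"
      using w[OF that] by (simp only: wbd_def)
    finally show ?thesis by (simp only: pr power_mult_distrib power2_abs)
  qed
  then have "(\<Sum>i | i < n \<and> odd i. norm (c (?ks i)) * mx js ^ 4) \<le> (\<Sum>i | i < n \<and> odd i. E * (real_of_int (altsum js) * pr js)\<^sup>2)"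
    by (intro sum_mono) auto
  also have "\<dots> \<le> (\<Sum>i<n. E * (real_of_int (altsum js) * pr js)\<^sup>2)"
    using E by (intro sum_mono2) auto
  finally have "(\<Sum>i | i < n \<and> odd i. norm (c (?ks i))) * mx js ^ 4 \<le> n * E * (real_of_int (altsum js) * pr js)\<^sup>2"
    by (simp add: sum_distrib_right)
  moreover have "norm (gker c n js) * mx js ^ 4 \<le> (\<Sum>i | i < n \<and> odd i. norm (c (?ks i))) * mx js ^ 4"
    unfolding gker_def by (intro mult_right_mono norm_sum) auto
  ultimately show "norm (gker c n js) * mx js ^ 4 \<le> n * E * (real_of_int (altsum js) * pr js)\<^sup>2" by linarith
qed

lemma form_uvec_slot:
  assumes s: "3 < s" and c: "hamcoef c" and cr: "crude n E c" and n: "even n" and i: "i < n" and j: "j \<in> Zstar"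
  shows "form s c (replicate i p @ uvec s \<i> j # replicate (n - Suc i) p) =
      (if even i then \<i> else - \<i>) * form s c (replicate i p @ uvec s 1 j # replicate (n - Suc i) p)"
    and "odd i \<Longrightarrow> ((\<lambda>js. c (drop (n - Suc i) js @ altsum js # take (n - Suc i) js) * mon js (map (emb s) (replicate (n - 1) p)))
      has_sum form s c (replicate i p @ uvec s 1 j # replicate (n - Suc i) p)) {js. length js = n - 1 \<and> altsum js = j}"
proof -
  have j0: "j \<noteq> 0" using j by (simp add: Zstar_def)
  let ?v = "\<lambda>z. replicate i p @ uvec s z j # replicate (n - Suc i) p"
  have len: "length (?v z) = n" for z using i by simp
  have "mon js (map (emb s) (?v \<i>)) = (if even i then \<i> else - \<i>) * mon js (map (emb s) (?v 1))" if js: "length js = n" for js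
  proof -
    have "length js = length (replicate i p) + length (replicate (n - Suc i) p) + 1" using js i by simp
    then show ?thesis
      by (rule split_at_slot) (simp add: mon_slot emb_uvec[OF j0])
  qed
  then have "form s c (?v \<i>) = (\<Sum>\<^sub>\<infinity>js\<in>ilists n. (if even i then \<i> else - \<i>) * (c js * mon js (map (emb s) (?v 1))))"
    unfolding form_def len by (intro infsum_cong) auto
  then show "form s c (?v \<i>) = (if even i then \<i> else - \<i>) * form s c (?v 1)"
    unfolding form_def len by (simp only: infsum_cmult_right')
  assume oi: "odd i"
  define q where "q = emb s p"
  have "((\<lambda>js. c js * mon js (map (emb s) (?v 1))) has_sum form s c (?v 1)) (ilists n)"
    unfolding form_def len by (rule has_sum_infsum[OF form_summable[OF s cr len]])
  also have "?this \<longleftrightarrow> ((\<lambda>js. c js * mon js (map (emb s) (?v 1))) has_sum form s c (?v 1)) {js. length js = n \<and> js ! i = j \<and> altsum js = 0}"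
  proof (rule has_sum_cong_neutral)
    fix js assume js: "js \<in> ilists n - {js. length js = n \<and> js ! i = j \<and> altsum js = 0}"
    show "c js * mon js (map (emb s) (?v 1)) = 0"
    proof (cases "altsum js = 0")
      case True
      then have ne: "js ! i \<noteq> j" using js by auto
      have "length js = length (replicate i p) + length (replicate (n - Suc i) p) + 1" using js i by simp
      then obtain ps k qs where ks: "js = ps @ k # qs" "length ps = length (replicate i p)" "length qs = length (replicate (n - Suc i) p)"
        by (rule split_at_slot)
      then have "k \<noteq> j" using ne by (auto simp: nth_append)
      then show ?thesis using ks by (simp add: mon_slot emb_uvec[OF j0])
    qed (use c in \<open>auto simp: hamcoef_def\<close>)
  qed auto
  also have "\<dots> \<longleftrightarrow> ((\<lambda>js. c (drop (n - Suc i) js @ altsum js # take (n - Suc i) js) * mon js (map (emb s) (replicate (n - 1) p)))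
      has_sum form s c (?v 1)) {js. length js = n - 1 \<and> altsum js = j}"
  proof (rule has_sum_reindex_bij_witness[of _ "\<lambda>js. drop (n - Suc i) js @ j # take (n - Suc i) js" "\<lambda>js. drop (Suc i) js @ take i js"])
    fix js assume a: "js \<in> {js. length js = n \<and> js ! i = j \<and> altsum js = 0}"
    then have "length js = length (replicate i p) + length (replicate (n - Suc i) p) + 1" using i by simp
    then obtain ps k qs where "js = ps @ k # qs" "length ps = length (replicate i p)" "length qs = length (replicate (n - Suc i) p)"
      by (rule split_at_slot)
    then have js: "js = ps @ j # qs" "length ps = i" "length qs = n - Suc i"
      using a by (auto simp: nth_append)
    have ev: "even (n - Suc i)" using n oi i by simp
    have alt: "altsum (qs @ ps) = j"
      using a js oi ev by (simp add: altsum_append)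
    show "drop (n - Suc i) (drop (Suc i) js @ take i js) @ j # take (n - Suc i) (drop (Suc i) js @ take i js) = js"
      using js by simp
    show "drop (Suc i) js @ take i js \<in> {js. length js = n - 1 \<and> altsum js = j}"
      using js alt i by simp
    have "replicate (n - 1) q = replicate (n - Suc i) q @ replicate i q"
      using i by (simp flip: replicate_add)
    then have "mon (qs @ ps) (replicate (n - 1) q) = mon qs (replicate (n - Suc i) q) * mon ps (replicate i q)"
      using js ev by (simp add: mon_append)
    then show "c (drop (n - Suc i) (drop (Suc i) js @ take i js) @ altsum (drop (Suc i) js @ take i js) # take (n - Suc i) (drop (Suc i) js @ take i js)) *
        mon (drop (Suc i) js @ take i js) (map (emb s) (replicate (n - 1) p)) = c js * mon js (map (emb s) (?v 1))"
      using js alt oi by (simp add: mon_slot emb_uvec[OF j0] map_replicate q_def)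
  next
    fix js assume a: "js \<in> {js. length js = n - 1 \<and> altsum js = j}"
    have ev: "even (n - Suc i)" using n oi i by simp
    have e: "even (length (take (n - Suc i) js))" "odd (length (drop (n - Suc i) js))"
      using a ev oi i n by auto
    show "drop (Suc i) (drop (n - Suc i) js @ j # take (n - Suc i) js) @ take i (drop (n - Suc i) js @ j # take (n - Suc i) js) = js"
      using a i by simp
    have "altsum js = altsum (take (n - Suc i) js) + altsum (drop (n - Suc i) js)"
      using altsum_append[of "take (n - Suc i) js" "drop (n - Suc i) js"] e by simp
    then have "altsum (drop (n - Suc i) js @ j # take (n - Suc i) js) = 0"
      using a e by (simp add: altsum_append)
    then show "drop (n - Suc i) js @ j # take (n - Suc i) js \<in> {js. length js = n \<and> js ! i = j \<and> altsum js = 0}"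
      using a i by (simp add: nth_append)
  qed simp
  finally show "((\<lambda>js. c (drop (n - Suc i) js @ altsum js # take (n - Suc i) js) * mon js (map (emb s) (replicate (n - 1) p)))
      has_sum form s c (?v 1)) {js. length js = n - 1 \<and> altsum js = j}" .
qed

text \<open>Direction \<i> produces the factor \<i> in a plain slot and - \<i> in a conjugated one,
  so the Wirtinger combination cancels the former and keeps the latter.\<close>

lemma diag_deriv_form_uvec:
  assumes s: "3 < s" and c: "hamcoef c" and w: "\<And>js. length js = n \<Longrightarrow> wbd E c js" and E: "0 \<le> E"
    and j: "j \<in> Zstar" and n: "2 \<le> n"
  shows "(diag_deriv (form s c) n p (uvec s 1 j) + \<i> * diag_deriv (form s c) n p (uvec s \<i> j)) / 2 =
    emb s (Xmap s (gker c n) (replicate (n - 1) p)) j"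
proof (cases "even n")
  case False
  then have z: "c js = 0" if "length js = n" for js
    using c that by (auto simp: hamcoef_def)
  have f: "form s c vs = 0" if "length vs = n" for vs
    unfolding form_def using z that by (intro infsum_0) auto
  have "diag_deriv (form s c) n p v = 0" for v
    unfolding diag_deriv_def by (intro sum.neutral ballI f) auto
  moreover have "gker c n js = 0" if "length js = n - 1" for js
    unfolding gker_def by (intro sum.neutral ballI z) (use n that in auto)
  then have "emb s (Xmap s (gker c n) (replicate (n - 1) p)) j = 0"
    by (subst emb_Xmap[OF s kernel_gker[OF w n E]]) (auto intro!: infsum_0)
  ultimately show ?thesis by simp
next
  case True
  have cr: "crude n E c"
    unfolding crude_def using w E by (auto intro: wbd_crude)
  let ?f = "\<lambda>z i. form s c (replicate i p @ uvec s z j # replicate (n - Suc i) p)"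
  have "(diag_deriv (form s c) n p (uvec s 1 j) + \<i> * diag_deriv (form s c) n p (uvec s \<i> j)) / 2
      = (\<Sum>i<n. (?f 1 i + \<i> * ?f \<i> i) / 2)"
    by (simp add: diag_deriv_def sum.distrib sum_divide_distrib sum_distrib_left add_divide_distrib)
  also have "\<dots> = (\<Sum>i<n. if odd i then ?f 1 i else 0)"
    by (intro sum.cong refl) (simp add: form_uvec_slot(1)[OF s c cr True _ j])
  also have "\<dots> = (\<Sum>i | i < n \<and> odd i. ?f 1 i)"
    by (simp add: sum.If_cases Int_def)
  finally have L: "(diag_deriv (form s c) n p (uvec s 1 j) + \<i> * diag_deriv (form s c) n p (uvec s \<i> j)) / 2
      = (\<Sum>i | i < n \<and> odd i. ?f 1 i)" .
  have "((\<lambda>js. \<Sum>i | i < n \<and> odd i. c (drop (n - Suc i) js @ altsum js # take (n - Suc i) js) * mon js (map (emb s) (replicate (n - 1) p)))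
      has_sum (\<Sum>i | i < n \<and> odd i. ?f 1 i)) {js. length js = n - 1 \<and> altsum js = j}"
    by (intro has_sum_finite_sum form_uvec_slot(2)[OF s c cr True _ j]) auto
  then have "((\<lambda>js. gker c n js * mon js (map (emb s) (replicate (n - 1) p))) has_sum (\<Sum>i | i < n \<and> odd i. ?f 1 i)) {js. length js = n - 1 \<and> altsum js = j}"
    by (simp add: gker_def sum_distrib_right)
  then show ?thesis
    unfolding L by (subst emb_Xmap[OF s kernel_gker[OF w n E]]) (auto dest: infsumI)
qed

lemma ham_vf_form:
  assumes s: "3 < s" and c: "hamcoef c" and w: "\<And>js. length js = n \<Longrightarrow> wbd E c js" and E: "0 \<le> E" and n: "2 \<le> n"
    and f: "\<And>x. f (emb s x) = form s c (replicate n x)"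
  shows "ham_vf f (emb s p) = (\<lambda>j. - \<i> * of_int j * emb s (Xmap s (gker c n) (replicate (n - 1) p)) j)"
proof
  fix j
  have cr: "crude n E c"
    unfolding crude_def using w E by (auto intro: wbd_crude)
  have "((\<lambda>t. f (emb s (p + t *\<^sub>R v))) has_vector_derivative diag_deriv (form s c) n p v) (at 0)" for v
  proof -
    have "((\<lambda>t. p + t *\<^sub>R v) has_vector_derivative v) (at 0)"
      by (auto intro!: derivative_eq_intros)
    from mlin_diag_has_vector_derivative[OF this mlin_form[OF s cr]] show ?thesis
      by (simp add: f)
  qed
  from partials_from_directional(2)[OF this, of j]
  show "ham_vf f (emb s p) j = - \<i> * of_int j * emb s (Xmap s (gker c n) (replicate (n - 1) p)) j"
    unfolding ham_vf_def using diag_deriv_form_uvec[OF s c w E _ n, of j p]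
    by (cases "j = 0") (auto simp: Zstar_def)
qed

text \<open>The factor \<open>exp (s + 4)\<close> per degree dominates the polynomial losses
  \<open>n ^ 4 * n powr s\<close> collected in \<open>kconst\<close> and in the number of
  slots.\<close>

definition grad_rate :: "real \<Rightarrow> real \<Rightarrow> real" where
  "grad_rate s \<rho> = \<rho> * emb_const s * exp (s + 4)"

lemma kconst_gker_le:
  assumes s: "3 < s" and n: "2 \<le> n" and A: "0 \<le> A" "1 \<le> \<rho>"
  shows "kconst s (n - 1) (n * (A * \<rho> ^ n)) \<le> A * grad_rate s \<rho> ^ n"
proof -
  have e: "1 \<le> emb_const s" by (rule emb_const_ge_1)
  have le: "real n \<le> exp (real n)"
    using exp_ge_add_one_self[of "real n"] by linarith
  have p: "real n powr s \<le> exp (s * n)"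
    using powr_mono2[OF _ _ le, of s] s by (simp add: powr_def)
  have "kconst s (n - 1) (n * (A * \<rho> ^ n))
      = (n * (A * \<rho> ^ n)) * ((real (n - 1))\<^sup>2 * (real (n - 1) powr s * real (n - 1))) * emb_const s ^ (n - 1)"
    by (simp add: kconst_def mult_ac)
  also have "\<dots> \<le> (n * (A * \<rho> ^ n)) * ((real n)\<^sup>2 * (real n powr s * real n)) * emb_const s ^ n"
    using A e s n by (intro mult_mono mult_left_mono power_mono powr_mono2 power_increasing mult_nonneg_nonneg) auto
  also have "\<dots> = A * \<rho> ^ n * (real n ^ 4 * real n powr s) * emb_const s ^ n"
    by (simp add: power_numeral_reduce mult_ac)
  also have "\<dots> \<le> A * \<rho> ^ n * (exp (real n) ^ 4 * exp (s * n)) * emb_const s ^ n"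
    using A e le p by (intro mult_right_mono mult_left_mono mult_mono power_mono) auto
  also have "exp (real n) ^ 4 * exp (s * n) = exp (s + 4) ^ n"
    by (simp add: exp_of_nat_mult[symmetric] exp_add[symmetric] algebra_simps)
  finally show ?thesis
    by (simp add: grad_rate_def power_mult_distrib mult_ac)
qed

text \<open>The gradient is first assembled in \<open>l2\<close> as the sum of its homogeneous parts
  \<open>Y n\<close>, and only then identified coordinatewise with the Wirtinger derivative of the
  recentred series. A series that starts in degree \<open>n0\<close> has a gradient of order
  \<open>n0 - 1\<close>; the ratio below 1/2 accounts for the factor 2.\<close>

lemma ham_vf_Fsum:
  assumes s: "3 < s" and c: "hamcoef c" "gclass A \<rho> c" and p: "grad_rate s \<rho> * norm p < 1 / 2"
    and f: "\<And>x. f (emb s x) = Fsum s c x" and n0: "\<And>js. length js < n0 \<Longrightarrow> c js = 0" "2 \<le> n0"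
  shows "has_partials f (emb s p)"
    and "ham_vf f (emb s p) \<in> ell2 (s - 1)"
    and "ell2_norm (s - 1) (ham_vf f (emb s p)) \<le> 2 * A * grad_rate s \<rho> ^ n0 * norm p ^ (n0 - 1)"
proof -
  have A: "0 \<le> A" "1 \<le> \<rho>" using c by (auto simp: gclass_def)
  have e: "1 \<le> emb_const s" by (rule emb_const_ge_1)
  define \<sigma> where "\<sigma> = grad_rate s \<rho>"
  have \<sigma>: "\<rho> * emb_const s \<le> \<sigma>"
    unfolding \<sigma>_def grad_rate_def using A e s mult_left_mono[of 1 "exp (s + 4)" "\<rho> * emb_const s"] by simp
  have \<sigma>1: "1 \<le> \<sigma>" using \<sigma> mult_mono[OF A(2) e] A by simp
  define r where "r = 1 / (2 * \<sigma>)"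
  have r: "0 < r" "norm p < r"
    using \<sigma>1 p by (auto simp: r_def \<sigma>_def[symmetric] field_simps)
  \<comment> \<open>The point has to lie strictly inside a ball on which the recentring condition
    still holds.\<close>
  obtain r' where r': "norm p < r'" "r' < r" using dense r(2) by blast
  have r'0: "0 < r'" using r' norm_ge_zero[of p] by linarith
  define \<tau> where "\<tau> = \<rho> * emb_const s"
  have \<tau>0: "0 \<le> \<tau>" using A e by (simp add: \<tau>_def)
  have \<tau>: "2 * (\<tau> * r') < 1"
  proof -
    have "\<tau> * r' \<le> \<sigma> * r'" using \<sigma> r'0 by (intro mult_right_mono) (auto simp: \<tau>_def)
    also have "\<dots> < \<sigma> * r" using r' \<sigma>1 by simp
    also have "\<dots> = 1 / 2" using \<sigma>1 by (simp add: r_def)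
    finally show ?thesis by simp
  qed
  have m: "mlin n (form s c) (A * \<tau> ^ n)" for n
    using mlin_form[OF s gclass_crude[OF c(2)], of n] by (simp add: \<tau>_def power_mult_distrib mult.assoc)
  have sums: "(\<lambda>n. form s c (replicate n x)) sums Fsum s c x" if "norm x < r'" for x
  proof (rule has_sum_imp_sums[OF Fsum_forms[OF s c(2)]])
    have "\<tau> * norm x \<le> \<tau> * r'" using that \<tau>0 by (intro mult_left_mono) auto
    with \<tau> \<tau>0 r'0 show "\<rho> * (emb_const s * norm x) < 1" by (simp add: \<tau>_def mult.assoc)
  qed
  define D where "D h = recenter (form s c) p [h]" for h
  have "(Fsum s c has_derivative D) (at p)"
    unfolding D_def by (rule power_series_has_derivative[OF m \<tau>0 r'0 \<tau> r'(1) sums])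
  from has_derivative_imp_directional[OF this]
  have dir: "((\<lambda>t. f (emb s (p + t *\<^sub>R v))) has_vector_derivative D v) (at 0)" for v
    by (simp add: f)
  show "has_partials f (emb s p)"
    by (rule partials_from_directional(1)[OF dir])
  have Ds: "(\<lambda>n. diag_deriv (form s c) n p h) sums D h" for h
    unfolding D_def using r' by (intro recenter_linear_sums[OF m \<tau>0 r'0 \<tau>]) auto
  define Y where "Y n = (if n < n0 then 0 else Xmap s (gker c n) (replicate (n - 1) p))" for n
  have w: "wbd (A * \<rho> ^ n) c js" if "length js = n" for n js
    using c(2) that by (auto simp: gclass_def)
  have Yn: "norm (Y n) \<le> (if n < n0 then 0 else A * \<sigma> ^ n * norm p ^ (n - 1))" for n
  proof (cases "n < n0")
    case False
    then have n: "2 \<le> n" using n0 by simp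
    have "norm (Xmap s (gker c n) (replicate (n - 1) p)) \<le> kconst s (n - 1) (n * (A * \<rho> ^ n)) * norms (replicate (n - 1) p)"
      by (rule norm_Xmap[OF s kernel_gker[OF w n]]) (use A in auto)
    also have "\<dots> \<le> A * \<sigma> ^ n * norms (replicate (n - 1) p)"
      unfolding \<sigma>_def by (intro mult_right_mono kconst_gker_le s n A) auto
    finally show ?thesis using False by (simp add: Y_def)
  qed (simp add: Y_def)
  have geo: "(\<lambda>n. A * \<sigma> ^ (n + n0) * norm p ^ (n + n0 - 1)) sums (A * \<sigma> ^ n0 * norm p ^ (n0 - 1) * (1 / (1 - \<sigma> * norm p)))"
  proof -
    have "A * \<sigma> ^ (n + n0) * norm p ^ (n + n0 - 1) = A * \<sigma> ^ n0 * norm p ^ (n0 - 1) * (\<sigma> * norm p) ^ n" for n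
    proof -
      have "n + n0 - 1 = n + (n0 - 1)" using n0 by simp
      then show ?thesis by (simp add: power_add power_mult_distrib mult_ac)
    qed
    moreover have "(\<lambda>n. (\<sigma> * norm p) ^ n) sums (1 / (1 - \<sigma> * norm p))"
      using p \<sigma>1 by (intro geometric_sums) (auto simp: \<sigma>_def[symmetric])
    ultimately show ?thesis by (simp only: sums_mult)
  qed
  have Yle: "norm (Y (n + n0)) \<le> A * \<sigma> ^ (n + n0) * norm p ^ (n + n0 - 1)" for n
    using Yn[of "n + n0"] by simp
  have abs: "summable (\<lambda>n. norm (Y (n + n0)))"
    by (rule summable_comparison_test'[OF sums_summable[OF geo], of 0]) (use Yle in simp)
  then have "summable (\<lambda>n. norm (Y n))"
    using summable_iff_shift[of "\<lambda>n. norm (Y n)" n0] by simp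
  then have Ys: "Y sums suminf Y" by (rule summable_sums[OF summable_norm_cancel])
  define Z where "Z = suminf Y"
  have "suminf Y = (\<Sum>n. Y (n + n0)) + (\<Sum>n<n0. Y n)"
    by (rule suminf_split_initial_segment[OF sums_summable[OF Ys]])
  then have "Z = (\<Sum>n. Y (n + n0))" by (simp add: Z_def Y_def)
  then have "norm Z \<le> (\<Sum>n. norm (Y (n + n0)))"
    using summable_norm[OF abs] by simp
  also have "\<dots> \<le> (\<Sum>n. A * \<sigma> ^ (n + n0) * norm p ^ (n + n0 - 1))"
    by (rule suminf_le[OF Yle abs sums_summable[OF geo]])
  also have "\<dots> = A * \<sigma> ^ n0 * norm p ^ (n0 - 1) * (1 / (1 - \<sigma> * norm p))"
    by (rule sums_unique[OF geo, symmetric])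
  also have "\<dots> \<le> A * \<sigma> ^ n0 * norm p ^ (n0 - 1) * 2"
    using p \<sigma>1 A by (intro mult_left_mono) (auto simp: \<sigma>_def[symmetric] field_simps)
  finally have Zn: "norm Z \<le> 2 * A * \<sigma> ^ n0 * norm p ^ (n0 - 1)" by simp
  have dq: "dqbar f j (emb s p) = emb s Z j" if j: "j \<in> Zstar" for j
  proof -
    have bl: "bounded_linear (\<lambda>x. emb s x j)"
      by (rule bounded_linear_intro[where K = "\<bar>real_of_int j\<bar> powr (- s)"])
        (auto simp: scaleR_conv_of_real emb_def norm_mult distrib_right intro!: mult_right_mono coord_le_norm)
    have "(diag_deriv (form s c) n p (uvec s 1 j) + \<i> * diag_deriv (form s c) n p (uvec s \<i> j)) / 2 = emb s (Y n) j" for n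
    proof (cases "n < n0")
      case True
      have "form s c vs = 0" if "length vs = n" for vs
        unfolding form_def using n0(1) True that by (intro infsum_0) auto
      then have "diag_deriv (form s c) n p v = 0" for v
        unfolding diag_deriv_def by (intro sum.neutral ballI) auto
      then show ?thesis using True by (simp add: Y_def emb_simps)
    next
      case False
      then show ?thesis
        using diag_deriv_form_uvec[where n = n and p = p, OF s c(1) w _ j] n0 A by (simp add: Y_def)
    qed
    then have "(\<lambda>n. emb s (Y n) j) sums ((D (uvec s 1 j) + \<i> * D (uvec s \<i> j)) / 2)"
      using sums_divide[OF sums_add[OF Ds[of "uvec s 1 j"] sums_mult[OF Ds[of "uvec s \<i> j"], of \<i>]], of 2] by simp
    moreover have "(\<lambda>n. emb s (Y n) j) sums emb s Z j"
      unfolding Z_def by (rule bounded_linear.sums[OF bl Ys])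
    ultimately have "(D (uvec s 1 j) + \<i> * D (uvec s \<i> j)) / 2 = emb s Z j"
      by (rule sums_unique2)
    then show ?thesis
      using partials_from_directional(2)[OF dir j] by simp
  qed
  have ham: "ham_vf f (emb s p) = (\<lambda>j. - \<i> * of_int j * emb s Z j)"
  proof
    show "ham_vf f (emb s p) j = - \<i> * of_int j * emb s Z j" for j
      using dq[of j] by (cases "j = 0") (auto simp: ham_vf_def Zstar_def)
  qed
  \<comment> \<open>The factor \<open>j\<close> of the vector field is worth exactly one unit of
    \<open>s\<close>.\<close>
  have wt: "(cmod (- \<i> * of_int j * emb s Z j))\<^sup>2 * \<bar>real_of_int j\<bar> powr (2 * (s - 1)) = (cmod (emb s Z j))\<^sup>2 * \<bar>real_of_int j\<bar> powr (2 * s)"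
    if "j \<in> Zstar" for j
  proof -
    have "\<bar>real_of_int j\<bar> powr (2 * (s - 1)) * (real_of_int j)\<^sup>2 = \<bar>real_of_int j\<bar> powr (2 * s)"
      using that powr_add[of "\<bar>real_of_int j\<bar>" "2 * (s - 1)" 2] by (simp add: Zstar_def algebra_simps)
    then show ?thesis by (simp add: norm_mult power_mult_distrib mult_ac)
  qed
  have "emb s Z \<in> ell2 s" by simp
  then have "(\<lambda>j. (cmod (- \<i> * of_int j * emb s Z j))\<^sup>2 * \<bar>real_of_int j\<bar> powr (2 * (s - 1))) summable_on Zstar"
    by (subst summable_on_cong[OF wt]) (auto simp: ell2_def)
  then show "ham_vf f (emb s p) \<in> ell2 (s - 1)"
    unfolding ham ell2_def by simp
  have "ell2_norm (s - 1) (ham_vf f (emb s p)) = ell2_norm s (emb s Z)"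
    unfolding ham ell2_norm_def by (subst infsum_cong[OF wt]) simp_all
  then show "ell2_norm (s - 1) (ham_vf f (emb s p)) \<le> 2 * A * grad_rate s \<rho> ^ n0 * norm p ^ (n0 - 1)"
    using Zn by (simp add: \<sigma>_def)
qed


section \<open>The sixth order coefficients\<close>

text \<open>Up to the factor \<open>1 / (4 * pi)\<close>, \<open>x4\<close> is the coefficient of the vector field of \<open>F4\<close>, and \<open>uw\<close>
  is that of \<open>G + 1/2 {Lam, F4}\<close>, whose bracket with \<open>F4\<close> is the term of order six of \<open>H \<circ> \<Psi>\<close>.
  \<open>Sg\<close> sums the resulting coefficient over the assignments of the indices \<open>a\<^sub>i\<close> and \<open>b\<^sub>j\<close> to the slots, and
  \<open>Om\<close> is the divisor of the homological equation.\<close>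

definition x4 :: "int \<Rightarrow> int \<Rightarrow> int \<Rightarrow> real" where
  "x4 a b c = (if a = b \<or> c = b then 0 else - real_of_int (a - b + c) / real_of_int ((a - b) * (c - b)))"

definition uw :: "int \<Rightarrow> int \<Rightarrow> int \<Rightarrow> real" where
  "uw a b c = (if a = b \<or> a = c then 1 else 1 / 2)"

definition T6 :: "int \<Rightarrow> int \<Rightarrow> int \<Rightarrow> int \<Rightarrow> int \<Rightarrow> int \<Rightarrow> real" where
  "T6 a1 a2 a3 b1 b2 b3 = x4 a1 b1 a2 * uw a3 b2 b3"

definition sg :: "int \<Rightarrow> int \<Rightarrow> int \<Rightarrow> int \<Rightarrow> int \<Rightarrow> int \<Rightarrow> real" where
  "sg a1 a2 a3 b1 b2 b3 =
     T6 a1 a2 a3 b1 b2 b3 + T6 a1 a2 a3 b2 b1 b3 + T6 a1 a2 a3 b3 b1 b2 +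
     T6 a1 a3 a2 b1 b2 b3 + T6 a1 a3 a2 b2 b1 b3 + T6 a1 a3 a2 b3 b1 b2 +
     T6 a2 a3 a1 b1 b2 b3 + T6 a2 a3 a1 b2 b1 b3 + T6 a2 a3 a1 b3 b1 b2"

definition Sg :: "int \<Rightarrow> int \<Rightarrow> int \<Rightarrow> int \<Rightarrow> int \<Rightarrow> int \<Rightarrow> real" where
  "Sg a1 a2 a3 b1 b2 b3 = sg a1 a2 a3 b1 b2 b3 + sg b1 b2 b3 a1 a2 a3"

definition Om :: "int \<Rightarrow> int \<Rightarrow> int \<Rightarrow> int \<Rightarrow> int \<Rightarrow> int \<Rightarrow> int" where
  "Om a1 a2 a3 b1 b2 b3 = a1\<^sup>2 + a2\<^sup>2 + a3\<^sup>2 - b1\<^sup>2 - b2\<^sup>2 - b3\<^sup>2"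

lemma x4_sym: "x4 a b c = x4 c b a"
  by (auto simp: x4_def algebra_simps)

lemma T6_sym: "T6 a1 a2 a3 b1 b2 b3 = T6 a2 a1 a3 b1 b2 b3" "T6 a1 a2 a3 b1 b2 b3 = T6 a1 a2 a3 b1 b3 b2"
  unfolding T6_def by (simp_all add: x4_sym[of a1 b1 a2] uw_def disj_commute)

lemma Sg_sym:
  "Sg a1 a2 a3 b1 b2 b3 = Sg a2 a1 a3 b1 b2 b3" "Sg a1 a2 a3 b1 b2 b3 = Sg a1 a3 a2 b1 b2 b3"
  "Sg a1 a2 a3 b1 b2 b3 = Sg a1 a2 a3 b2 b1 b3" "Sg a1 a2 a3 b1 b2 b3 = Sg a1 a2 a3 b1 b3 b2"
  "Sg a1 a2 a3 b1 b2 b3 = Sg b1 b2 b3 a1 a2 a3"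
  by (simp_all add: Sg_def sg_def T6_sym add_ac)

text \<open>For each \<open>t\<close> among \<open>a\<close>, \<open>b\<close>, \<open>c\<close> the
  numerator is at most \<open>\<bar>a - b\<bar> + \<bar>c - b\<bar> + \<bar>t\<bar>\<close>, and
  each summand is at most \<open>\<bar>t\<bar>\<close> times the denominator, as all factors are
  nonzero integers.\<close>

lemma x4_le:
  assumes "a \<noteq> 0" "b \<noteq> 0" "c \<noteq> 0"
  shows "\<bar>x4 a b c\<bar> \<le> 3 * \<bar>real_of_int a\<bar>" "\<bar>x4 a b c\<bar> \<le> 3 * \<bar>real_of_int b\<bar>" "\<bar>x4 a b c\<bar> \<le> 3 * \<bar>real_of_int c\<bar>"
proof -
  have *: "\<bar>x4 a b c\<bar> \<le> 3 * \<bar>real_of_int t\<bar>"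
    if t: "t \<noteq> 0" and n: "a \<noteq> b \<Longrightarrow> c \<noteq> b \<Longrightarrow> \<bar>a - b + c\<bar> \<le> \<bar>a - b\<bar> + \<bar>c - b\<bar> + \<bar>t\<bar>" for t
  proof (cases "a = b \<or> c = b")
    case False
    define u v where "u = \<bar>a - b\<bar>" and "v = \<bar>c - b\<bar>"
    have uv: "1 \<le> u" "1 \<le> v" "1 \<le> \<bar>t\<bar>" using False t by (auto simp: u_def v_def)
    have "1 \<le> v * \<bar>t\<bar>" "1 \<le> u * \<bar>t\<bar>" "1 \<le> u * v"
      using mult_mono[of 1 v 1 "\<bar>t\<bar>"] mult_mono[of 1 u 1 "\<bar>t\<bar>"] mult_mono[of 1 u 1 v] uv by auto
    then have "u * 1 \<le> u * (v * \<bar>t\<bar>)" "v * 1 \<le> v * (u * \<bar>t\<bar>)" "1 * \<bar>t\<bar> \<le> (u * v) * \<bar>t\<bar>"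
      using uv by (intro mult_left_mono mult_right_mono; simp)+
    then have "\<bar>a - b + c\<bar> \<le> 3 * \<bar>t\<bar> * (u * v)"
      using n False unfolding u_def[symmetric] v_def[symmetric] by (simp add: algebra_simps)
    then have "real_of_int \<bar>a - b + c\<bar> \<le> real_of_int (3 * \<bar>t\<bar> * (u * v))"
      by (simp only: of_int_le_iff)
    moreover have "\<bar>x4 a b c\<bar> = real_of_int \<bar>a - b + c\<bar> / real_of_int (u * v)"
      using False by (simp add: x4_def u_def v_def abs_mult)
    ultimately show ?thesis
      using uv by (simp add: divide_le_eq mult_pos_pos zero_less_mult_iff)
  qed (simp add: x4_def)
  show "\<bar>x4 a b c\<bar> \<le> 3 * \<bar>real_of_int a\<bar>" "\<bar>x4 a b c\<bar> \<le> 3 * \<bar>real_of_int b\<bar>" "\<bar>x4 a b c\<bar> \<le> 3 * \<bar>real_of_int c\<bar>"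
    by (rule *; use assms in linarith)+
qed

lemma T6_le:
  assumes "a1 \<noteq> 0" "a2 \<noteq> 0" "b1 \<noteq> 0"
    and "\<bar>real_of_int a1\<bar> \<le> L \<or> \<bar>real_of_int a2\<bar> \<le> L \<or> \<bar>real_of_int b1\<bar> \<le> L"
  shows "\<bar>T6 a1 a2 a3 b1 b2 b3\<bar> \<le> 3 * L"
proof -
  have "\<bar>T6 a1 a2 a3 b1 b2 b3\<bar> \<le> \<bar>x4 a1 b1 a2\<bar> * 1"
    unfolding T6_def abs_mult by (intro mult_left_mono) (auto simp: uw_def)
  then show ?thesis using x4_le[of a1 b1 a2] assms by auto
qed

text \<open>Only \<open>a1\<close> and \<open>a2\<close> escape the bound \<open>L\<close>, so each
  factor \<open>x4\<close>, with two arguments from one side and one from the other, has an argument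
  bounded by \<open>L\<close>. There are 18 terms of size at most \<open>3 * L\<close>.\<close>

lemma Sg_le_same:
  assumes "a1 \<noteq> 0" "a2 \<noteq> 0" "a3 \<noteq> 0" "b1 \<noteq> 0" "b2 \<noteq> 0" "b3 \<noteq> 0"
    and "\<bar>real_of_int a3\<bar> \<le> L" "\<bar>real_of_int b1\<bar> \<le> L" "\<bar>real_of_int b2\<bar> \<le> L" "\<bar>real_of_int b3\<bar> \<le> L"
  shows "\<bar>Sg a1 a2 a3 b1 b2 b3\<bar> \<le> 54 * L"
proof -
  have T: "\<bar>T6 a1 a2 a3 b1 b2 b3\<bar> \<le> 3 * L" "\<bar>T6 a1 a2 a3 b2 b1 b3\<bar> \<le> 3 * L" "\<bar>T6 a1 a2 a3 b3 b1 b2\<bar> \<le> 3 * L"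
    "\<bar>T6 a1 a3 a2 b1 b2 b3\<bar> \<le> 3 * L" "\<bar>T6 a1 a3 a2 b2 b1 b3\<bar> \<le> 3 * L" "\<bar>T6 a1 a3 a2 b3 b1 b2\<bar> \<le> 3 * L"
    "\<bar>T6 a2 a3 a1 b1 b2 b3\<bar> \<le> 3 * L" "\<bar>T6 a2 a3 a1 b2 b1 b3\<bar> \<le> 3 * L" "\<bar>T6 a2 a3 a1 b3 b1 b2\<bar> \<le> 3 * L"
    "\<bar>T6 b1 b2 b3 a1 a2 a3\<bar> \<le> 3 * L" "\<bar>T6 b1 b2 b3 a2 a1 a3\<bar> \<le> 3 * L" "\<bar>T6 b1 b2 b3 a3 a1 a2\<bar> \<le> 3 * L"
    "\<bar>T6 b1 b3 b2 a1 a2 a3\<bar> \<le> 3 * L" "\<bar>T6 b1 b3 b2 a2 a1 a3\<bar> \<le> 3 * L" "\<bar>T6 b1 b3 b2 a3 a1 a2\<bar> \<le> 3 * L"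
    "\<bar>T6 b2 b3 b1 a1 a2 a3\<bar> \<le> 3 * L" "\<bar>T6 b2 b3 b1 a2 a1 a3\<bar> \<le> 3 * L" "\<bar>T6 b2 b3 b1 a3 a1 a2\<bar> \<le> 3 * L"
    by (rule T6_le; use assms in simp)+
  show ?thesis
    unfolding Sg_def sg_def using T unfolding abs_le_iff by linarith
qed

text \<open>Here one index per side escapes, and every \<open>x4\<close> has two arguments from the
  same side.\<close>

lemma Sg_le_opposite:
  assumes "a1 \<noteq> 0" "a2 \<noteq> 0" "a3 \<noteq> 0" "b1 \<noteq> 0" "b2 \<noteq> 0" "b3 \<noteq> 0"
    and "\<bar>real_of_int a2\<bar> \<le> L" "\<bar>real_of_int a3\<bar> \<le> L" "\<bar>real_of_int b2\<bar> \<le> L" "\<bar>real_of_int b3\<bar> \<le> L"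
  shows "\<bar>Sg a1 a2 a3 b1 b2 b3\<bar> \<le> 54 * L"
proof -
  have T: "\<bar>T6 a1 a2 a3 b1 b2 b3\<bar> \<le> 3 * L" "\<bar>T6 a1 a2 a3 b2 b1 b3\<bar> \<le> 3 * L" "\<bar>T6 a1 a2 a3 b3 b1 b2\<bar> \<le> 3 * L"
    "\<bar>T6 a1 a3 a2 b1 b2 b3\<bar> \<le> 3 * L" "\<bar>T6 a1 a3 a2 b2 b1 b3\<bar> \<le> 3 * L" "\<bar>T6 a1 a3 a2 b3 b1 b2\<bar> \<le> 3 * L"
    "\<bar>T6 a2 a3 a1 b1 b2 b3\<bar> \<le> 3 * L" "\<bar>T6 a2 a3 a1 b2 b1 b3\<bar> \<le> 3 * L" "\<bar>T6 a2 a3 a1 b3 b1 b2\<bar> \<le> 3 * L"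
    "\<bar>T6 b1 b2 b3 a1 a2 a3\<bar> \<le> 3 * L" "\<bar>T6 b1 b2 b3 a2 a1 a3\<bar> \<le> 3 * L" "\<bar>T6 b1 b2 b3 a3 a1 a2\<bar> \<le> 3 * L"
    "\<bar>T6 b1 b3 b2 a1 a2 a3\<bar> \<le> 3 * L" "\<bar>T6 b1 b3 b2 a2 a1 a3\<bar> \<le> 3 * L" "\<bar>T6 b1 b3 b2 a3 a1 a2\<bar> \<le> 3 * L"
    "\<bar>T6 b2 b3 b1 a1 a2 a3\<bar> \<le> 3 * L" "\<bar>T6 b2 b3 b1 a2 a1 a3\<bar> \<le> 3 * L" "\<bar>T6 b2 b3 b1 a3 a1 a2\<bar> \<le> 3 * L"
    by (rule T6_le; use assms in simp)+
  show ?thesis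
    unfolding Sg_def sg_def using T unfolding abs_le_iff by linarith
qed

text \<open>For large \<open>m\<close> each summand tends to a nonzero limit, namely
  \<open>1 / (a - b)\<close> up to sign. The limits are opposite, so the sum is of order
  \<open>1 / m\<close>.\<close>

lemma x4_mixed:
  assumes "a \<noteq> b" "m \<noteq> a" "m \<noteq> b"
  shows "x4 m b a + x4 m a b = - real_of_int (m - a - b) / real_of_int ((m - a) * (m - b))"
proof -
  define A B M where "A = real_of_int a" and "B = real_of_int b" and "M = real_of_int m"
  have "A \<noteq> B" "M \<noteq> A" "M \<noteq> B" using assms by (auto simp: A_def B_def M_def)
  then have "- (M - B + A) / ((M - B) * (A - B)) + - (M - A + B) / ((M - A) * (B - A)) = - (M - A - B) / ((M - A) * (M - B))"
    by (simp add: divide_simps) (simp add: algebra_simps)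
  then show ?thesis
    using assms by (simp add: x4_def A_def B_def M_def)
qed

text \<open>A rational identity once \<open>b'\<close> is eliminated. These are the terms of
  \<open>Sg m a2 a3 m b2 b3\<close> whose factor \<open>x4\<close> does not contain \<open>m\<close>
  and which therefore could not decay.\<close>

lemma x4_cancel:
  assumes "a + a' = b + b'" "a \<noteq> b" "a \<noteq> b'" "a' \<noteq> b" "a' \<noteq> b'"
  shows "x4 a b a' + x4 a b' a' + x4 b a b' + x4 b a' b' = 0"
proof -
  define A A' B1 where "A = real_of_int a" and "A' = real_of_int a'" and "B1 = real_of_int b"
  have b': "b' = a + a' - b" using assms by simp
  have "A \<noteq> B1" "A' \<noteq> B1" using assms by (auto simp: A_def A'_def B1_def)
  then have "- (A - B1 + A') / ((A - B1) * (A' - B1)) + - B1 / ((B1 - A') * (B1 - A))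
      + - A' / ((B1 - A) * (A' - B1)) + - A / ((B1 - A') * (A - B1)) = 0"
    by (simp add: divide_simps) (simp add: algebra_simps)
  moreover have "x4 a b a' = - (A - B1 + A') / ((A - B1) * (A' - B1))"
    "x4 a b' a' = - B1 / ((B1 - A') * (B1 - A))"
    "x4 b a b' = - A' / ((B1 - A) * (A' - B1))" "x4 b a' b' = - A / ((B1 - A') * (A - B1))"
    using assms(2-5) unfolding b' by (auto simp: x4_def A_def A'_def B1_def)
  ultimately show ?thesis by simp
qed

text \<open>What remains after \<open>x4_cancel\<close> is of order \<open>1 / m\<close>: the terms
  with \<open>m\<close> in the middle by themselves, the bracketed pairs by
  \<open>x4_mixed\<close>.\<close>

lemma Sg_common:
  assumes "a2 + a3 = b2 + b3" "a2 \<noteq> b2" "a2 \<noteq> b3" "a3 \<noteq> b2" "a3 \<noteq> b3"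
    and "m \<noteq> a2" "m \<noteq> a3" "m \<noteq> b2" "m \<noteq> b3"
  shows "Sg m a2 a3 m b2 b3 = (x4 a2 m a3 + x4 b2 m b3) / 2 +
    ((x4 m b2 a2 + x4 m a2 b2) + (x4 m b3 a2 + x4 m a2 b3) + (x4 m b2 a3 + x4 m a3 b2) + (x4 m b3 a3 + x4 m a3 b3)) / 2"
proof -
  have z: "x4 m m t = 0" for t by (simp add: x4_def)
  have c: "x4 a2 b2 a3 + x4 a2 b3 a3 + x4 b2 a2 b3 + x4 b2 a3 b3 = 0"
    using assms by (intro x4_cancel)
  have "Sg m a2 a3 m b2 b3 = (x4 a2 m a3 + x4 b2 m b3) / 2 +
    ((x4 m b2 a2 + x4 m a2 b2) + (x4 m b3 a2 + x4 m a2 b3) + (x4 m b2 a3 + x4 m a3 b2) + (x4 m b3 a3 + x4 m a3 b3)) / 2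
    + (x4 a2 b2 a3 + x4 a2 b3 a3 + x4 b2 a2 b3 + x4 b2 a3 b3)"
    using assms by (simp add: Sg_def sg_def T6_def uw_def z add_divide_distrib)
  with c show ?thesis by simp
qed

subsection \<open>Vanishing on the nontrivial resonances\<close>

lemma cubic_root_value:
  fixes a1 a2 a3 b1 b2 b3 :: real
  assumes "a1 + a2 + a3 = b1 + b2 + b3" "a1\<^sup>2 + a2\<^sup>2 + a3\<^sup>2 = b1\<^sup>2 + b2\<^sup>2 + b3\<^sup>2"
  shows "(a1 - b1) * (a2 - b1) * (a3 - b1) = a1 * a2 * a3 - b1 * b2 * b3"
  using assms by algebra

lemma x4_triple:
  assumes "a1 \<noteq> b" "a2 \<noteq> b" "a3 \<noteq> b"
  shows "x4 a1 b a2 + x4 a1 b a3 + x4 a2 b a3 =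
    - ((of_int a1 - of_int b + of_int a2) * (of_int a3 - of_int b) + (of_int a1 - of_int b + of_int a3) * (of_int a2 - of_int b)
      + (of_int a2 - of_int b + of_int a3) * (of_int a1 - of_int b))
      / ((of_int a1 - of_int b) * (of_int a2 - of_int b) * (of_int a3 - of_int b))"
proof -
  have "real_of_int a1 - real_of_int b \<noteq> 0" "real_of_int a2 - real_of_int b \<noteq> 0" "real_of_int a3 - real_of_int b \<noteq> 0"
    using assms by auto
  then show ?thesis
    using assms by (simp add: x4_def divide_simps) (simp add: algebra_simps)
qed

text \<open>On the resonant set the monic cubics with roots \<open>a\<^sub>i\<close> and \<open>b\<^sub>j\<close> differ by a constant, so all
  denominators in the sum agree up to sign.\<close>

lemma Sg_disjoint_resonant:
  assumes sum: "a1 + a2 + a3 = b1 + b2 + b3" and Om: "Om a1 a2 a3 b1 b2 b3 = 0"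
    and ne: "a1 \<noteq> b1" "a1 \<noteq> b2" "a1 \<noteq> b3" "a2 \<noteq> b1" "a2 \<noteq> b2" "a2 \<noteq> b3" "a3 \<noteq> b1" "a3 \<noteq> b2" "a3 \<noteq> b3"
  shows "Sg a1 a2 a3 b1 b2 b3 = 0"
proof -
  define A1 A2 A3 B1 B2 B3 where "A1 = real_of_int a1" and "A2 = real_of_int a2" and "A3 = real_of_int a3"
    and "B1 = real_of_int b1" and "B2 = real_of_int b2" and "B3 = real_of_int b3"
  note defs = A1_def A2_def A3_def B1_def B2_def B3_def
  have s1: "A1 + A2 + A3 = B1 + B2 + B3"
    using sum unfolding defs by (metis of_int_add)
  have "real_of_int (a1\<^sup>2 + a2\<^sup>2 + a3\<^sup>2) = real_of_int (b1\<^sup>2 + b2\<^sup>2 + b3\<^sup>2)"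
    using Om by (simp only: of_int_eq_iff) (simp add: Om_def)
  then have s2: "A1\<^sup>2 + A2\<^sup>2 + A3\<^sup>2 = B1\<^sup>2 + B2\<^sup>2 + B3\<^sup>2"
    unfolding defs by simp
  define P where "P = A1 * A2 * A3 - B1 * B2 * B3"
  have Pb: "(A1 - B1) * (A2 - B1) * (A3 - B1) = P" "(A1 - B2) * (A2 - B2) * (A3 - B2) = P" "(A1 - B3) * (A2 - B3) * (A3 - B3) = P"
    unfolding P_def using cubic_root_value[of A1 A2 A3 B1 B2 B3] cubic_root_value[of A1 A2 A3 B2 B1 B3]
      cubic_root_value[of A1 A2 A3 B3 B1 B2] s1 s2 by (simp_all add: ac_simps)
  have Pa: "(B1 - A1) * (B2 - A1) * (B3 - A1) = - P" "(B1 - A2) * (B2 - A2) * (B3 - A2) = - P" "(B1 - A3) * (B2 - A3) * (B3 - A3) = - P"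
    unfolding P_def using cubic_root_value[of B1 B2 B3 A1 A2 A3] cubic_root_value[of B1 B2 B3 A2 A1 A3]
      cubic_root_value[of B1 B2 B3 A3 A1 A2] s1 s2 by (simp_all add: ac_simps)
  let ?N = "\<lambda>x y z b. (x - b + y) * (z - b) + (x - b + z) * (y - b) + (y - b + z) * (x - b)"
  have N: "?N A1 A2 A3 B1 + ?N A1 A2 A3 B2 + ?N A1 A2 A3 B3 = ?N B1 B2 B3 A1 + ?N B1 B2 B3 A2 + ?N B1 B2 B3 A3"
    using s1 s2 by algebra
  have "Sg a1 a2 a3 b1 b2 b3 =
    ((x4 a1 b1 a2 + x4 a1 b1 a3 + x4 a2 b1 a3) + (x4 a1 b2 a2 + x4 a1 b2 a3 + x4 a2 b2 a3) + (x4 a1 b3 a2 + x4 a1 b3 a3 + x4 a2 b3 a3)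
    + (x4 b1 a1 b2 + x4 b1 a1 b3 + x4 b2 a1 b3) + (x4 b1 a2 b2 + x4 b1 a2 b3 + x4 b2 a2 b3) + (x4 b1 a3 b2 + x4 b1 a3 b3 + x4 b2 a3 b3)) / 2"
    using ne ne[symmetric] by (simp add: Sg_def sg_def T6_def uw_def)
  also have "\<dots> = - ((?N A1 A2 A3 B1 + ?N A1 A2 A3 B2 + ?N A1 A2 A3 B3) / P - (?N B1 B2 B3 A1 + ?N B1 B2 B3 A2 + ?N B1 B2 B3 A3) / P) / 2"
    using ne ne[symmetric]
    by (simp only: x4_triple not_False_eq_True defs[symmetric] Pa Pb) (simp add: add_divide_distrib diff_divide_distrib)
  also have "\<dots> = 0"
    using N by simp
  finally show ?thesis .
qed

lemma Sg_diagonal_distinct: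
  assumes "a \<noteq> b" "b \<noteq> c" "a \<noteq> c"
  shows "Sg a b c a b c = 0"
proof -
  define A1 B1 C1 where "A1 = real_of_int a" and "B1 = real_of_int b" and "C1 = real_of_int c"
  have ne: "A1 \<noteq> B1" "B1 \<noteq> C1" "A1 \<noteq> C1" using assms by (auto simp: A1_def B1_def C1_def)
  have z: "x4 t t u = 0" "x4 u t t = 0" for t u by (simp_all add: x4_def)
  have "Sg a b c a b c = x4 a b c + x4 a c b + x4 b a c"
    using assms by (simp add: Sg_def sg_def T6_def uw_def z)
  also have "x4 a b c = - (A1 - B1 + C1) / ((A1 - B1) * (C1 - B1))"
    using assms by (simp add: x4_def A1_def B1_def C1_def)
  also have "x4 a c b = - (A1 - C1 + B1) / ((A1 - C1) * (B1 - C1))"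
    using assms by (simp add: x4_def A1_def B1_def C1_def)
  also have "x4 b a c = - (B1 - A1 + C1) / ((B1 - A1) * (C1 - A1))"
    using assms by (simp add: x4_def A1_def B1_def C1_def)
  also have "- (A1 - B1 + C1) / ((A1 - B1) * (C1 - B1)) + - (A1 - C1 + B1) / ((A1 - C1) * (B1 - C1)) + - (B1 - A1 + C1) / ((B1 - A1) * (C1 - A1)) = 0"
    using ne by (simp add: divide_simps) (simp add: algebra_simps)
  finally show ?thesis .
qed

text \<open>The source of the coefficient of \<open>K\<close>: all terms but one vanish, because
  \<open>x4\<close> is zero when its middle argument equals an outer one.\<close>

lemma Sg_diagonal_pair:
  assumes "a \<noteq> b"
  shows "Sg a a b a a b = - real_of_int (2 * a - b) / real_of_int ((a - b)\<^sup>2)"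
proof -
  have z: "x4 t t u = 0" "x4 u t t = 0" for t u by (simp_all add: x4_def)
  have "Sg a a b a a b = x4 a b a"
    using assms by (simp add: Sg_def sg_def T6_def uw_def z)
  then show ?thesis
    using assms by (simp add: x4_def power2_eq_square)
qed

lemma Sg_diagonal_equal: "Sg a a a a a a = 0"
  by (simp add: Sg_def sg_def T6_def x4_def)

lemma two_two_resonant:
  fixes a b c d :: int
  assumes "a + b = c + d" "a\<^sup>2 + b\<^sup>2 = c\<^sup>2 + d\<^sup>2"
  shows "a = c \<and> b = d \<or> a = d \<and> b = c"
proof -
  have "(a - c) * (a - d) = 0" using assms by algebra
  then show ?thesis using assms by auto
qed

text \<open>A nonzero value forces a common index \<open>t\<close> of the two sides. With
  \<open>t\<close> moved to the last place on both sides, a resonance of two against two remains,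
  which is trivial; so the sides agree up to order, and the diagonal values leave only the pattern
  \<open>(a, a, b)\<close>.\<close>

lemma Sg_resonant_cases:
  assumes sum: "a1 + a2 + a3 = b1 + b2 + b3" and Om: "Om a1 a2 a3 b1 b2 b3 = 0" and nz: "Sg a1 a2 a3 b1 b2 b3 \<noteq> 0"
  obtains a b where "a \<noteq> b" "(a1, a2, a3) \<in> {(a, a, b), (a, b, a), (b, a, a)}" "(b1, b2, b3) \<in> {(a, a, b), (a, b, a), (b, a, a)}"
proof -
  have perm: "\<exists>a b. a \<noteq> b \<and> (x, y, z) \<in> {(a, a, b), (a, b, a), (b, a, a)} \<and> (x', y', z') \<in> {(a, a, b), (a, b, a), (b, a, a)}"
    if "Sg x y z x' y' z' \<noteq> 0" "x + y + z = x' + y' + z'" "Om x y z x' y' z' = 0" "z = z'" for x y z x' y' z'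
  proof -
    have "x = x' \<and> y = y' \<or> x = y' \<and> y = x'"
      using that by (intro two_two_resonant) (auto simp: Om_def)
    then have S: "Sg x y z x y z \<noteq> 0"
      using that Sg_sym(3) by metis
    have "x = y \<or> y = z \<or> x = z" using Sg_diagonal_distinct S by blast
    moreover have "\<not> (x = y \<and> y = z)" using S Sg_diagonal_equal by auto
    ultimately show ?thesis
      using \<open>x = x' \<and> y = y' \<or> x = y' \<and> y = x'\<close> \<open>z = z'\<close> by auto
  qed
  obtain t where t: "t \<in> {a1, a2, a3}" "t \<in> {b1, b2, b3}"
    using Sg_disjoint_resonant[OF sum Om] nz by blast
  have rot: "\<exists>x y. (\<forall>x' y' z'. Sg x y t x' y' z' = Sg c1 c2 c3 x' y' z') \<and> x + y + t = c1 + c2 + c3 \<and>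
      x\<^sup>2 + y\<^sup>2 + t\<^sup>2 = c1\<^sup>2 + c2\<^sup>2 + c3\<^sup>2 \<and>
      (\<forall>a b. (x, y, t) \<in> {(a, a, b), (a, b, a), (b, a, a)} \<longrightarrow> (c1, c2, c3) \<in> {(a, a, b), (a, b, a), (b, a, a)})"
    if "t \<in> {c1, c2, c3}" for c1 c2 c3
  proof -
    from that consider "t = c1" | "t = c2" | "t = c3" by blast
    then show ?thesis
    proof cases
      case 1
      then show ?thesis by (intro exI[of _ c2] exI[of _ c3]) (auto simp: Sg_sym(1,2))
    next
      case 2
      then show ?thesis by (intro exI[of _ c1] exI[of _ c3]) (auto simp: Sg_sym(1,2))
    next
      case 3
      then show ?thesis by (intro exI[of _ c1] exI[of _ c2]) auto
    qed
  qed
  obtain x y where xy: "\<And>x' y' z'. Sg x y t x' y' z' = Sg a1 a2 a3 x' y' z'" "x + y + t = a1 + a2 + a3"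
    "x\<^sup>2 + y\<^sup>2 + t\<^sup>2 = a1\<^sup>2 + a2\<^sup>2 + a3\<^sup>2"
    "\<And>a b. (x, y, t) \<in> {(a, a, b), (a, b, a), (b, a, a)} \<Longrightarrow> (a1, a2, a3) \<in> {(a, a, b), (a, b, a), (b, a, a)}"
    using rot[OF t(1)] by blast
  obtain x' y' where xy': "\<And>x y z. Sg x' y' t x y z = Sg b1 b2 b3 x y z" "x' + y' + t = b1 + b2 + b3"
    "x'\<^sup>2 + y'\<^sup>2 + t\<^sup>2 = b1\<^sup>2 + b2\<^sup>2 + b3\<^sup>2"
    "\<And>a b. (x', y', t) \<in> {(a, a, b), (a, b, a), (b, a, a)} \<Longrightarrow> (b1, b2, b3) \<in> {(a, a, b), (a, b, a), (b, a, a)}"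
    using rot[OF t(2)] by blast
  have "Sg x y t x' y' t \<noteq> 0"
    using nz xy(1) xy'(1) Sg_sym(5) by metis
  moreover have "x + y + t = x' + y' + t" "Om x y t x' y' t = 0"
    using xy xy' sum Om by (auto simp: Om_def)
  ultimately have "\<exists>a b. a \<noteq> b \<and> (x, y, t) \<in> {(a, a, b), (a, b, a), (b, a, a)} \<and> (x', y', t) \<in> {(a, a, b), (a, b, a), (b, a, a)}"
    using perm by blast
  then have "\<exists>a b. a \<noteq> b \<and> (a1, a2, a3) \<in> {(a, a, b), (a, b, a), (b, a, a)} \<and> (b1, b2, b3) \<in> {(a, a, b), (a, b, a), (b, a, a)}"
    using xy(4) xy'(4) by meson
  then show ?thesis using that by blast
qed


subsection \<open>Small divisor estimates\<close>

lemma prod4_ge: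
  fixes p q r t :: real
  assumes "1 \<le> p" "1 \<le> q" "1 \<le> r" "1 \<le> t"
  shows "p \<le> p * q * r * t" "q \<le> p * q * r * t" "r \<le> p * q * r * t" "t \<le> p * q * r * t"
proof -
  have ge: "1 \<le> x * y" if "1 \<le> x" "1 \<le> y" for x y :: real
    using mult_mono[of 1 x 1 y] that by simp
  have "p * 1 \<le> p * (q * r * t)" "q * 1 \<le> q * (p * r * t)" "r * 1 \<le> r * (p * q * t)" "t * 1 \<le> t * (p * q * r)"
    using assms by (intro mult_left_mono ge; simp)+
  then show "p \<le> p * q * r * t" "q \<le> p * q * r * t" "r \<le> p * q * r * t" "t \<le> p * q * r * t"
    by (simp_all add: mult_ac)
qed

text \<open>With \<open>L\<close> the sum, the balance condition gives
  \<open>7 / 16 * L \<le> q + r + t\<close> and thus \<open>7 / 48 * L \<le> q * r * t\<close>,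
  while \<open>L / 4 \<le> p\<close>. The constant 28 exceeds 192 / 7.\<close>

lemma prod4_ge_square_aux:
  fixes p q r t :: real
  assumes ge: "1 \<le> p" "1 \<le> q" "1 \<le> r" "1 \<le> t" and mx: "q \<le> p" "r \<le> p" "t \<le> p"
    and d: "p - (q + r + t) \<le> (p + q + r + t) / 8"
  shows "(p + q + r + t)\<^sup>2 \<le> 28 * (p * q * r * t)"
proof -
  define L where "L = p + q + r + t"
  have "q + r + t \<le> 3 * (q * r * t)"
    using prod4_ge[of 1 q r t] ge unfolding mult_1_left by linarith
  moreover have "7 / 16 * L \<le> q + r + t" using d by (simp add: L_def)
  ultimately have 1: "7 / 48 * L \<le> q * r * t" by linarith
  have 2: "1 / 4 * L \<le> p" using mx by (simp add: L_def)
  have "(1 / 4 * L) * (7 / 48 * L) \<le> p * (q * r * t)"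
    by (intro mult_mono 1 2) (use ge in \<open>auto simp: L_def\<close>)
  then have "7 * L\<^sup>2 \<le> 192 * (p * q * r * t)"
    by (simp add: power2_eq_square mult_ac)
  moreover have "0 \<le> p * q * r * t" using ge by simp
  ultimately have "L\<^sup>2 \<le> 28 * (p * q * r * t)" by linarith
  then show ?thesis by (simp add: L_def)
qed

lemma prod4_ge_square:
  fixes p q r t d :: real
  assumes ge: "1 \<le> p" "1 \<le> q" "1 \<le> r" "1 \<le> t"
    and d: "d \<le> (p + q + r + t) / 8" "p - (q + r + t) \<le> d" "q - (p + r + t) \<le> d" "r - (p + q + t) \<le> d" "t - (p + q + r) \<le> d"
  shows "(p + q + r + t)\<^sup>2 \<le> 28 * (p * q * r * t)"
proof -
  consider "q \<le> p" "r \<le> p" "t \<le> p" | "p \<le> q" "r \<le> q" "t \<le> q" | "p \<le> r" "q \<le> r" "t \<le> r" | "p \<le> t" "q \<le> t" "r \<le> t"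
    by linarith
  then show ?thesis
  proof cases
    case 1
    then show ?thesis using prod4_ge_square_aux[of p q r t] ge d by simp
  next
    case 2
    then have "(q + p + r + t)\<^sup>2 \<le> 28 * (q * p * r * t)"
      using ge d by (intro prod4_ge_square_aux) auto
    then show ?thesis by (simp add: ac_simps)
  next
    case 3
    then have "(r + p + q + t)\<^sup>2 \<le> 28 * (r * p * q * t)"
      using ge d by (intro prod4_ge_square_aux) auto
    then show ?thesis by (simp add: ac_simps)
  next
    case 4
    then have "(t + p + q + r)\<^sup>2 \<le> 28 * (t * p * q * r)"
      using ge d by (intro prod4_ge_square_aux) auto
    then show ?thesis by (simp add: ac_simps)
  qed
qed

text \<open>Here \<open>N\<close> is the largest index, \<open>S\<close> the coefficient, \<open>W\<close> the divisor, and \<open>L\<close>, \<open>P\<close> the sum and the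
  product of the four indices other than the two largest.\<close>

definition dbound :: "real \<Rightarrow> real \<Rightarrow> real \<Rightarrow> real \<Rightarrow> bool" where
  "dbound N S W P \<longleftrightarrow> N * S \<le> 1000000 * W * P\<^sup>2"

text \<open>The regime of comparable indices, where the divisor need only be at least 1. The
  constants multiply to \<open>400 * 54 * 16 = 345600\<close>.\<close>

lemma dbound_small:
  assumes "0 \<le> N" "N \<le> 400 * L" "S \<le> 54 * L" "L \<le> 4 * P" "1 \<le> W" "0 \<le> L" "0 \<le> S"
  shows "dbound N S W P"
proof -
  have "N * S \<le> (400 * L) * (54 * L)"
    using assms by (intro mult_mono) auto
  also have "\<dots> = 21600 * (L * L)" by simp
  also have "\<dots> \<le> 21600 * ((4 * P) * (4 * P))"
    using assms by (intro mult_left_mono mult_mono) auto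
  also have "\<dots> = 1 * (345600 * P\<^sup>2)" by (simp add: power2_eq_square)
  also have "\<dots> \<le> W * (345600 * P\<^sup>2)"
    using assms by (intro mult_right_mono) auto
  also have "\<dots> \<le> W * (1000000 * P\<^sup>2)"
    using assms by (intro mult_left_mono mult_right_mono) auto
  finally show ?thesis by (simp add: dbound_def mult_ac)
qed

lemma dbound_le:
  assumes "N * S \<le> c * W" "0 \<le> W" "c \<le> 1000000" "1 \<le> P"
  shows "dbound N S W P"
proof -
  have "N * S \<le> c * W" by fact
  also have "\<dots> \<le> 1000000 * W * 1" using assms by (simp add: mult_right_mono)
  also have "\<dots> \<le> 1000000 * W * P\<^sup>2"
    using assms by (intro mult_left_mono) (auto intro: one_le_power)
  finally show ?thesis by (simp add: dbound_def)
qed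

lemma Om_abs_ge_1: "Om a1 a2 a3 b1 b2 b3 \<noteq> 0 \<Longrightarrow> 1 \<le> \<bar>real_of_int (Om a1 a2 a3 b1 b2 b3)\<bar>"
  by (metis of_int_1_le_iff of_int_abs zabs_less_one_iff not_less)

lemma sum_squares_le: "0 \<le> p \<Longrightarrow> 0 \<le> q \<Longrightarrow> 0 \<le> r \<Longrightarrow> 0 \<le> t \<Longrightarrow> p\<^sup>2 + q\<^sup>2 + r\<^sup>2 + t\<^sup>2 \<le> (p + q + r + t)\<^sup>2" for p q r t :: real
  by (simp add: power2_eq_square algebra_simps)

text \<open>\<open>a1\<close> and \<open>a2\<close> enter \<open>Om\<close> with the same sign. As
  soon as \<open>a1\<close> dominates the other four indices, the divisor is at least half of its
  square, more than the one power that is required.\<close>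

lemma dbound_same:
  assumes nz: "a1 \<noteq> 0" "a2 \<noteq> 0" "a3 \<noteq> 0" "b1 \<noteq> 0" "b2 \<noteq> 0" "b3 \<noteq> 0" and Om: "Om a1 a2 a3 b1 b2 b3 \<noteq> 0"
  shows "dbound \<bar>real_of_int a1\<bar> \<bar>Sg a1 a2 a3 b1 b2 b3\<bar> \<bar>real_of_int (Om a1 a2 a3 b1 b2 b3)\<bar>
    (\<bar>real_of_int a3\<bar> * \<bar>real_of_int b1\<bar> * \<bar>real_of_int b2\<bar> * \<bar>real_of_int b3\<bar>)"
proof -
  define N p q r t where "N = \<bar>real_of_int a1\<bar>" and "p = \<bar>real_of_int a3\<bar>" and "q = \<bar>real_of_int b1\<bar>"
    and "r = \<bar>real_of_int b2\<bar>" and "t = \<bar>real_of_int b3\<bar>"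
  have ge: "1 \<le> N" "1 \<le> p" "1 \<le> q" "1 \<le> r" "1 \<le> t"
    using nz by (auto simp: N_def p_def q_def r_def t_def)
  define L where "L = p + q + r + t"
  define S where "S = \<bar>Sg a1 a2 a3 b1 b2 b3\<bar>"
  define W where "W = \<bar>real_of_int (Om a1 a2 a3 b1 b2 b3)\<bar>"
  have S: "S \<le> 54 * L"
    unfolding S_def by (rule Sg_le_same[OF nz]) (use ge in \<open>auto simp: L_def p_def q_def r_def t_def\<close>)
  have LP: "L \<le> 4 * (p * q * r * t)"
    unfolding L_def using prod4_ge[OF ge(2-5)] by linarith
  have W1: "1 \<le> W" unfolding W_def by (rule Om_abs_ge_1[OF Om])
  have "dbound N S W (p * q * r * t)"
  proof (cases "N \<le> 400 * L")
    case True
    then show ?thesis using S LP W1 ge by (intro dbound_small[of N L]) (auto simp: S_def L_def)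
  next
    case False
    have "real_of_int (Om a1 a2 a3 b1 b2 b3) = N\<^sup>2 + (real_of_int a2)\<^sup>2 + p\<^sup>2 - q\<^sup>2 - r\<^sup>2 - t\<^sup>2"
      by (simp add: Om_def N_def p_def q_def r_def t_def)
    then have "N\<^sup>2 - L\<^sup>2 \<le> W"
      using sum_squares_le[of p q r t] ge zero_le_power2[of p] zero_le_power2[of "real_of_int a2"] unfolding W_def L_def by linarith
    moreover have "(400 * L) * (400 * L) \<le> N * N"
      using False ge by (intro mult_mono) (auto simp: L_def)
    then have "160000 * (L * L) \<le> N * N" by simp
    ultimately have "N * N \<le> 2 * W"
      using zero_le_square[of N] zero_le_square[of L] unfolding power2_eq_square by linarith
    moreover have "N * S \<le> N * (54 * (N / 400))"
      using S False ge by (intro mult_left_mono) auto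
    moreover have "N * (54 * (N / 400)) \<le> N * N" using ge by simp
    ultimately have "N * S \<le> 2 * W" by linarith
    then show ?thesis
      using W1 order_trans[OF ge(2) prod4_ge(1)[OF ge(2-5)]] by (intro dbound_le) auto
  qed
  then show ?thesis
    by (simp add: N_def S_def W_def p_def q_def r_def t_def)
qed

text \<open>Every difference with \<open>m\<close> deviates from \<open>m\<close> by at most one
  part in 400, and \<open>(401 / 400) / (399 / 400) ^ 2\<close> is below 2.\<close>

lemma x4_mixed_le:
  assumes N: "400 * L < \<bar>real_of_int m\<bar>" and L: "1 \<le> L" and a: "\<bar>real_of_int a\<bar> + \<bar>real_of_int b\<bar> \<le> L" and ne: "a \<noteq> b"
  shows "\<bar>x4 m b a + x4 m a b\<bar> * \<bar>real_of_int m\<bar> \<le> 2"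
proof -
  define N' where "N' = \<bar>real_of_int m\<bar>"
  have m: "m \<noteq> a" "m \<noteq> b" using N L a by auto
  have "\<bar>x4 m b a + x4 m a b\<bar> = \<bar>real_of_int (m - a - b)\<bar> / (\<bar>real_of_int (m - a)\<bar> * \<bar>real_of_int (m - b)\<bar>)"
    unfolding x4_mixed[OF ne m] by (simp only: abs_divide abs_minus_cancel of_int_mult abs_mult)
  then have "\<bar>x4 m b a + x4 m a b\<bar> * N' = \<bar>real_of_int (m - a - b)\<bar> * N' / (\<bar>real_of_int (m - a)\<bar> * \<bar>real_of_int (m - b)\<bar>)"
    by simp
  also have "\<dots> \<le> (N' * (401/400)) * N' / ((N' * (399 / 400)) * (N' * (399 / 400)))"
  proof -
    have "\<bar>real_of_int (m - a - b)\<bar> \<le> N' * (401/400)" "N' * (399 / 400) \<le> \<bar>real_of_int (m - a)\<bar>"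
      "N' * (399 / 400) \<le> \<bar>real_of_int (m - b)\<bar>" "0 < N'"
      using N L a unfolding N'_def of_int_diff by linarith+
    then show ?thesis by (intro frac_le mult_mono mult_right_mono mult_pos_pos) auto
  qed
  also have "\<dots> = (401/400) / ((399/400) * (399/400))"
    using N L by (simp add: N'_def)
  finally show ?thesis by (simp add: N'_def)
qed

lemma x4_far_le:
  assumes N: "400 * L < \<bar>real_of_int m\<bar>" and L: "1 \<le> L" and a: "\<bar>real_of_int a\<bar> + \<bar>real_of_int b\<bar> \<le> L"
  shows "\<bar>x4 a m b\<bar> * \<bar>real_of_int m\<bar> \<le> 2"
proof -
  define N' where "N' = \<bar>real_of_int m\<bar>"
  have m: "m \<noteq> a" "m \<noteq> b" using N L a by auto
  have "x4 a m b = - real_of_int (a - m + b) / real_of_int ((a - m) * (b - m))"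
    using m by (simp add: x4_def)
  then have "\<bar>x4 a m b\<bar> = \<bar>real_of_int (a - m + b)\<bar> / (\<bar>real_of_int (a - m)\<bar> * \<bar>real_of_int (b - m)\<bar>)"
    by (simp only: abs_divide abs_minus_cancel of_int_mult abs_mult)
  then have "\<bar>x4 a m b\<bar> * N' = \<bar>real_of_int (a - m + b)\<bar> * N' / (\<bar>real_of_int (a - m)\<bar> * \<bar>real_of_int (b - m)\<bar>)"
    by simp
  also have "\<dots> \<le> (N' * (401/400)) * N' / ((N' * (399 / 400)) * (N' * (399 / 400)))"
  proof -
    have "\<bar>real_of_int (a - m + b)\<bar> \<le> N' * (401/400)" "N' * (399 / 400) \<le> \<bar>real_of_int (a - m)\<bar>"
      "N' * (399 / 400) \<le> \<bar>real_of_int (b - m)\<bar>" "0 < N'"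
      using N L a unfolding N'_def of_int_diff of_int_add by linarith+
    then show ?thesis by (intro frac_le mult_mono mult_right_mono mult_pos_pos) auto
  qed
  also have "\<dots> = (401/400) / ((399/400) * (399/400))"
    using N L by (simp add: N'_def)
  finally show ?thesis by (simp add: N'_def)
qed

lemma abs_sum6: "\<bar>(u1 + u2) / 2 + (u3 + u4 + u5 + u6) / 2\<bar> \<le> (\<bar>u1\<bar> + \<bar>u2\<bar> + \<bar>u3\<bar> + \<bar>u4\<bar> + \<bar>u5\<bar> + \<bar>u6\<bar>) / 2" for u1 :: real
  by (rule abs_leI;
      use abs_ge_self[of u1] abs_ge_self[of u2] abs_ge_self[of u3] abs_ge_self[of u4] abs_ge_self[of u5] abs_ge_self[of u6]
        abs_ge_minus_self[of u1] abs_ge_minus_self[of u2] abs_ge_minus_self[of u3] abs_ge_minus_self[of u4]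
        abs_ge_minus_self[of u5] abs_ge_minus_self[of u6] in argo)

text \<open>With \<open>d = a1 - b1\<close> one has \<open>Om = d * (2 * a1 - d) + E\<close>, where
  \<open>E\<close> involves only the four small indices. For nonzero \<open>d\<close> the first term
  grows with \<open>a1\<close>; for \<open>d = 0\<close> it is absent, and \<open>Sg\<close> itself
  has to be small.\<close>

lemma dbound_opposite:
  assumes nz: "a1 \<noteq> 0" "a2 \<noteq> 0" "a3 \<noteq> 0" "b1 \<noteq> 0" "b2 \<noteq> 0" "b3 \<noteq> 0" and Om: "Om a1 a2 a3 b1 b2 b3 \<noteq> 0"
    and sum: "a1 + a2 + a3 = b1 + b2 + b3"
  shows "dbound \<bar>real_of_int a1\<bar> \<bar>Sg a1 a2 a3 b1 b2 b3\<bar> \<bar>real_of_int (Om a1 a2 a3 b1 b2 b3)\<bar>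
    (\<bar>real_of_int a2\<bar> * \<bar>real_of_int a3\<bar> * \<bar>real_of_int b2\<bar> * \<bar>real_of_int b3\<bar>)"
proof -
  define N p q r t where "N = \<bar>real_of_int a1\<bar>" and "p = \<bar>real_of_int a2\<bar>" and "q = \<bar>real_of_int a3\<bar>"
    and "r = \<bar>real_of_int b2\<bar>" and "t = \<bar>real_of_int b3\<bar>"
  have ge: "1 \<le> N" "1 \<le> p" "1 \<le> q" "1 \<le> r" "1 \<le> t"
    using nz by (auto simp: N_def p_def q_def r_def t_def)
  define L where "L = p + q + r + t"
  have L1: "4 \<le> L" using ge by (simp add: L_def)
  define S where "S = \<bar>Sg a1 a2 a3 b1 b2 b3\<bar>"
  define W where "W = \<bar>real_of_int (Om a1 a2 a3 b1 b2 b3)\<bar>"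
  define P where "P = p * q * r * t"
  have S: "S \<le> 54 * L"
    unfolding S_def by (rule Sg_le_opposite[OF nz]) (use ge in \<open>auto simp: L_def p_def q_def r_def t_def\<close>)
  have LP: "L \<le> 4 * P" and P1: "1 \<le> P"
    unfolding L_def P_def using prod4_ge[OF ge(2-5)] ge by linarith+
  have W1: "1 \<le> W" unfolding W_def by (rule Om_abs_ge_1[OF Om])
  define d where "d = real_of_int (a1 - b1)"
  have d: "d = real_of_int b2 + real_of_int b3 - real_of_int a2 - real_of_int a3"
    using sum unfolding d_def by (simp flip: of_int_add of_int_diff)
  have "dbound N S W P"
  proof (cases "N \<le> 400 * L")
    case True
    then show ?thesis using S LP W1 ge by (intro dbound_small[of N L]) (auto simp: S_def L_def)
  next
    case False
    show ?thesis
    proof (cases "a1 = b1")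
      case True
      \<comment> \<open>The divisor is independent of \<open>a1\<close> here. Six contributions of
        size at most \<open>2 / N\<close>, halved in \<open>Sg_common\<close>, bound
        \<open>S * N\<close> by 6.\<close>
      have eqs: "a2 + a3 = b2 + b3" "a2\<^sup>2 + a3\<^sup>2 \<noteq> b2\<^sup>2 + b3\<^sup>2"
        using True sum Om by (auto simp: Om_def)
      have ne: "a2 \<noteq> b2" "a2 \<noteq> b3" "a3 \<noteq> b2" "a3 \<noteq> b3"
        using eqs by auto
      have N: "400 * L < \<bar>real_of_int a1\<bar>" using False by (simp add: N_def)
      have "a1 \<noteq> a2" "a1 \<noteq> a3" "a1 \<noteq> b2" "a1 \<noteq> b3"
        using N ge by (auto simp: L_def p_def q_def r_def t_def)
      then have Seq: "Sg a1 a2 a3 b1 b2 b3 = (x4 a2 a1 a3 + x4 b2 a1 b3) / 2 +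
        ((x4 a1 b2 a2 + x4 a1 a2 b2) + (x4 a1 b3 a2 + x4 a1 a2 b3) + (x4 a1 b2 a3 + x4 a1 a3 b2) + (x4 a1 b3 a3 + x4 a1 a3 b3)) / 2"
        using Sg_common[OF eqs(1) ne] True by simp
      have l: "1 \<le> L" using L1 by simp
      have "\<bar>x4 a2 a1 a3\<bar> * N \<le> 2" "\<bar>x4 b2 a1 b3\<bar> * N \<le> 2" "\<bar>x4 a1 b2 a2 + x4 a1 a2 b2\<bar> * N \<le> 2"
        "\<bar>x4 a1 b3 a2 + x4 a1 a2 b3\<bar> * N \<le> 2" "\<bar>x4 a1 b2 a3 + x4 a1 a3 b2\<bar> * N \<le> 2" "\<bar>x4 a1 b3 a3 + x4 a1 a3 b3\<bar> * N \<le> 2"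
        unfolding N_def
        by (intro x4_far_le[OF N l] x4_mixed_le[OF N l]; use ge ne in \<open>simp add: L_def p_def q_def r_def t_def\<close>)+
      moreover have "S \<le> (\<bar>x4 a2 a1 a3\<bar> + \<bar>x4 b2 a1 b3\<bar> + \<bar>x4 a1 b2 a2 + x4 a1 a2 b2\<bar>
        + \<bar>x4 a1 b3 a2 + x4 a1 a2 b3\<bar> + \<bar>x4 a1 b2 a3 + x4 a1 a3 b2\<bar> + \<bar>x4 a1 b3 a3 + x4 a1 a3 b3\<bar>) / 2"
        unfolding S_def Seq by (rule abs_sum6)
      then have "S * N \<le> (\<bar>x4 a2 a1 a3\<bar> + \<bar>x4 b2 a1 b3\<bar> + \<bar>x4 a1 b2 a2 + x4 a1 a2 b2\<bar>
        + \<bar>x4 a1 b3 a2 + x4 a1 a2 b3\<bar> + \<bar>x4 a1 b2 a3 + x4 a1 a3 b2\<bar> + \<bar>x4 a1 b3 a3 + x4 a1 a3 b3\<bar>) / 2 * N"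
        using ge by (intro mult_right_mono) auto
      ultimately have "S * N \<le> 6"
        by (simp only: distrib_right add_divide_distrib times_divide_eq_left)
      then have "N * S \<le> 6 * W" using W1 by (simp add: mult.commute)
      then show ?thesis using W1 P1 by (intro dbound_le) auto
    next
      case False': False
      then have d1: "1 \<le> \<bar>d\<bar>" by (simp add: d_def)
      have dL: "\<bar>d\<bar> \<le> L"
        unfolding d L_def p_def q_def r_def t_def by linarith
      define E where "E = (real_of_int a2)\<^sup>2 + (real_of_int a3)\<^sup>2 - (real_of_int b2)\<^sup>2 - (real_of_int b3)\<^sup>2"
      have E: "\<bar>E\<bar> \<le> L\<^sup>2"
      proof -
        have "E = p\<^sup>2 + q\<^sup>2 - r\<^sup>2 - t\<^sup>2" by (simp add: E_def p_def q_def r_def t_def)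
        then show ?thesis
          using sum_squares_le[of p q r t] ge zero_le_power2[of p] zero_le_power2[of q] zero_le_power2[of r] zero_le_power2[of t]
          unfolding L_def by linarith
      qed
      have "real_of_int (Om a1 a2 a3 b1 b2 b3) = d * (2 * real_of_int a1 - d) + E"
        by (simp add: Om_def d_def E_def power2_eq_square algebra_simps)
      then have "\<bar>d * (2 * real_of_int a1 - d)\<bar> - \<bar>E\<bar> \<le> W"
        unfolding W_def by linarith
      then have "\<bar>d\<bar> * \<bar>2 * real_of_int a1 - d\<bar> - L\<^sup>2 \<le> W"
        using E by (simp add: abs_mult)
      moreover have "\<bar>d\<bar> * (2 * N - L) \<le> \<bar>d\<bar> * \<bar>2 * real_of_int a1 - d\<bar>"
        using dL by (intro mult_left_mono) (auto simp: N_def)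
      ultimately have Wd: "\<bar>d\<bar> * (2 * N - L) - L\<^sup>2 \<le> W" by linarith
      have NL: "400 * L \<le> N" using False by simp
      show ?thesis
      proof (cases "L / 8 \<le> \<bar>d\<bar>")
        case True
        \<comment> \<open>A large \<open>d\<close> yields a divisor of size \<open>L * N\<close>,
          which pays for the full bound \<open>54 * L\<close> of \<open>S\<close>.\<close>
        have "L / 8 * N \<le> \<bar>d\<bar> * (2 * N - L) - L\<^sup>2"
        proof -
          have "L / 8 * (2 * N - L) \<le> \<bar>d\<bar> * (2 * N - L)"
            using True NL L1 by (intro mult_right_mono) auto
          moreover have "L * (400 * L) \<le> L * N" using NL L1 by (intro mult_left_mono) auto
          moreover have "L / 8 * (2 * N - L) = L * N / 4 - L * L / 8" "L / 8 * N = L * N / 8" "L * (400 * L) = 400 * (L * L)"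
            by (simp_all add: field_simps)
          ultimately show ?thesis
            using zero_le_square[of L] unfolding power2_eq_square by linarith
        qed
        with Wd have "L / 8 * N \<le> W" by linarith
        then have "N * (54 * L) \<le> 432 * W" by (simp add: mult_ac)
        moreover have "N * S \<le> N * (54 * L)" using S ge by (intro mult_left_mono) auto
        ultimately have "N * S \<le> 432 * W" by linarith
        then show ?thesis using W1 P1 by (intro dbound_le) auto
      next
        case False
        \<comment> \<open>By momentum conservation \<open>d\<close> is also the defect of the four
          small indices. When it is small, the largest of them is balanced by the others, so the
          product is quadratic in \<open>L\<close> and not just linear.\<close>
        have "(p + q + r + t)\<^sup>2 \<le> 28 * (p * q * r * t)"
        proof (rule prod4_ge_square[where d = "\<bar>d\<bar>"])
          show "\<bar>d\<bar> \<le> (p + q + r + t) / 8" using False by (simp add: L_def)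
        qed (use ge in \<open>auto simp: d p_def q_def r_def t_def\<close>)
        then have LP2: "L\<^sup>2 \<le> 28 * P" by (simp add: L_def P_def)
        have NS: "N * S \<le> N * (54 * L)" using S ge by (intro mult_left_mono) auto
        \<comment> \<open>The threshold is the size of \<open>E\<close>: above it the linear term
          dominates and \<open>W\<close> is at least \<open>N\<close>; below it \<open>N\<close>
          itself is bounded by \<open>L\<^sup>2\<close>, and three powers of \<open>L\<close> fit
          into \<open>P\<^sup>2\<close>.\<close>
        show ?thesis
        proof (cases "2 * L\<^sup>2 \<le> N")
          case True
          have "1 * (2 * N - L) \<le> \<bar>d\<bar> * (2 * N - L)"
            using d1 NL L1 by (intro mult_right_mono) auto
          then have "1 * (2 * N - L) - L\<^sup>2 \<le> \<bar>d\<bar> * (2 * N - L) - L\<^sup>2"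
            by (rule diff_right_mono)
          then have "1 * (2 * N - L) - L\<^sup>2 \<le> W"
            using Wd by (rule order_trans)
          then have "2 * N - L - L\<^sup>2 \<le> W" by simp
          then have "N \<le> W"
            using True NL L1 by linarith
          then have "N * (54 * L) \<le> W * (54 * (4 * P))"
            using LP L1 W1 by (intro mult_mono) auto
          also have "\<dots> = 216 * W * P" by simp
          also have "\<dots> \<le> 1000000 * W * P\<^sup>2"
            using W1 P1 by (intro mult_mono) (auto simp: power2_eq_square)
          finally show ?thesis
            unfolding dbound_def by (rule order_trans[OF NS])
        next
          case False
          then have "N * (54 * L) \<le> (2 * L\<^sup>2) * (54 * L)"
            using L1 by (intro mult_right_mono) auto
          also have "\<dots> = 108 * (L * L\<^sup>2)" by simp
          also have "\<dots> \<le> 108 * ((4 * P) * (28 * P))"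
            using LP LP2 L1 P1 by (intro mult_left_mono mult_mono) auto
          also have "\<dots> = 1 * (12096 * P\<^sup>2)" by (simp add: power2_eq_square)
          also have "\<dots> \<le> W * (1000000 * P\<^sup>2)"
            using W1 by (intro mult_mono) auto
          also have "\<dots> = 1000000 * W * P\<^sup>2" by simp
          finally show ?thesis
            unfolding dbound_def by (rule order_trans[OF NS])
        qed
      qed
    qed
  qed
  then show ?thesis
    by (simp add: N_def S_def W_def P_def p_def q_def r_def t_def)
qed

text \<open>The constant is that of \<open>dbound\<close> times 25: by momentum conservation a
  second index \<open>y\<close> satisfies \<open>N \<le> 5 * y\<close>, and two factors
  \<open>N\<close> are replaced by it.\<close>

definition ebound :: "int \<Rightarrow> int \<Rightarrow> int \<Rightarrow> int \<Rightarrow> int \<Rightarrow> int \<Rightarrow> real \<Rightarrow> bool" where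
  "ebound a1 a2 a3 b1 b2 b3 N \<longleftrightarrow> N ^ 5 * \<bar>Sg a1 a2 a3 b1 b2 b3\<bar> \<le> 25000000 * \<bar>real_of_int (Om a1 a2 a3 b1 b2 b3)\<bar> *
    (\<bar>real_of_int a1\<bar> * \<bar>real_of_int a2\<bar> * \<bar>real_of_int a3\<bar> * \<bar>real_of_int b1\<bar> * \<bar>real_of_int b2\<bar> * \<bar>real_of_int b3\<bar>)\<^sup>2"

lemma ebound_sym:
  "ebound a1 a2 a3 b1 b2 b3 N = ebound a2 a1 a3 b1 b2 b3 N" "ebound a1 a2 a3 b1 b2 b3 N = ebound a1 a3 a2 b1 b2 b3 N"
  "ebound a1 a2 a3 b1 b2 b3 N = ebound a1 a2 a3 b2 b1 b3 N" "ebound a1 a2 a3 b1 b2 b3 N = ebound a1 a2 a3 b1 b3 b2 N"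
  "ebound a1 a2 a3 b1 b2 b3 N = ebound b1 b2 b3 a1 a2 a3 N"
proof -
  have O: "\<bar>real_of_int (Om a1 a2 a3 b1 b2 b3)\<bar> = \<bar>real_of_int (Om b1 b2 b3 a1 a2 a3)\<bar>"
    unfolding Om_def of_int_abs[symmetric] by (intro arg_cong[where f = real_of_int]) linarith
  show "ebound a1 a2 a3 b1 b2 b3 N = ebound b1 b2 b3 a1 a2 a3 N"
    unfolding ebound_def by (simp only: Sg_sym(5)[of a1 a2 a3] O) (simp add: mult_ac)
  show "ebound a1 a2 a3 b1 b2 b3 N = ebound a2 a1 a3 b1 b2 b3 N" 
    unfolding ebound_def Sg_sym(1)[of a1 a2 a3 b1 b2 b3] by (simp only: Om_def ac_simps)
  show "ebound a1 a2 a3 b1 b2 b3 N = ebound a1 a3 a2 b1 b2 b3 N"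
    unfolding ebound_def Sg_sym(2)[of a1 a2 a3 b1 b2 b3] by (simp only: Om_def ac_simps)
  have *: "a - b1\<^sup>2 - b2\<^sup>2 - b3\<^sup>2 = a - b2\<^sup>2 - b1\<^sup>2 - b3\<^sup>2" "a - b1\<^sup>2 - b2\<^sup>2 - b3\<^sup>2 = a - b1\<^sup>2 - b3\<^sup>2 - b2\<^sup>2" for a :: int
    by simp_all
  show "ebound a1 a2 a3 b1 b2 b3 N = ebound a1 a2 a3 b2 b1 b3 N"
    unfolding ebound_def Sg_sym(3)[of a1 a2 a3 b1 b2 b3] Om_def *(1) by (simp only: ac_simps)
  show "ebound a1 a2 a3 b1 b2 b3 N = ebound a1 a2 a3 b1 b3 b2 N"
    unfolding ebound_def Sg_sym(4)[of a1 a2 a3 b1 b2 b3] Om_def *(2) by (simp only: ac_simps)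
qed

lemma ebound_from_dbound:
  assumes d: "dbound N S W P" and y: "N \<le> 5 * y" and N: "0 \<le> N" and W: "0 \<le> W" and P: "0 \<le> P"
  shows "N ^ 5 * S \<le> 25000000 * W * (N * y * P)\<^sup>2"
proof -
  have "N ^ 5 * S = N ^ 4 * (N * S)" by (simp add: power_numeral_reduce)
  also have "\<dots> \<le> N ^ 4 * (1000000 * W * P\<^sup>2)"
    using d by (intro mult_left_mono) (auto simp: dbound_def)
  also have "\<dots> = 1000000 * W * (N * P)\<^sup>2 * N\<^sup>2"
    by (simp add: power_numeral_reduce power2_eq_square mult_ac)
  also have "\<dots> \<le> 1000000 * W * (N * P)\<^sup>2 * (5 * y)\<^sup>2"
    using y N W by (intro mult_left_mono power_mono) auto
  finally show ?thesis by (simp add: power_mult_distrib mult_ac)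
qed

text \<open>\<open>a1\<close> is a signed sum of the five other indices, so one of them has at least
  a fifth of its size. The side of that index decides between \<open>dbound_same\<close> and
  \<open>dbound_opposite\<close>.\<close>

lemma ebound_max_a1:
  assumes nz: "a1 \<noteq> 0" "a2 \<noteq> 0" "a3 \<noteq> 0" "b1 \<noteq> 0" "b2 \<noteq> 0" "b3 \<noteq> 0" and Om: "Om a1 a2 a3 b1 b2 b3 \<noteq> 0"
    and sum: "a1 + a2 + a3 = b1 + b2 + b3"
  shows "ebound a1 a2 a3 b1 b2 b3 \<bar>real_of_int a1\<bar>"
proof -
  have sum': "real_of_int a1 = real_of_int b1 + real_of_int b2 + real_of_int b3 - real_of_int a2 - real_of_int a3"
    using sum by (simp flip: of_int_add of_int_diff)
  have same: "ebound a1 x y z w v \<bar>real_of_int a1\<bar>"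
    if "x \<noteq> 0" "y \<noteq> 0" "z \<noteq> 0" "w \<noteq> 0" "v \<noteq> 0" "Om a1 x y z w v \<noteq> 0" "\<bar>real_of_int a1\<bar> \<le> 5 * \<bar>real_of_int x\<bar>" for x y z w v
    using ebound_from_dbound[OF dbound_same[OF nz(1) that(1-6)] that(7)] unfolding ebound_def by (simp add: mult_ac)
  have opp: "ebound a1 x y z w v \<bar>real_of_int a1\<bar>"
    if "x \<noteq> 0" "y \<noteq> 0" "z \<noteq> 0" "w \<noteq> 0" "v \<noteq> 0" "Om a1 x y z w v \<noteq> 0" "a1 + x + y = z + w + v" "\<bar>real_of_int a1\<bar> \<le> 5 * \<bar>real_of_int z\<bar>" for x y z w v
    using ebound_from_dbound[OF dbound_opposite[OF nz(1) that(1-7)] that(8)] unfolding ebound_def by (simp add: mult_ac)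
  consider "\<bar>real_of_int a1\<bar> \<le> 5 * \<bar>real_of_int a2\<bar>" | "\<bar>real_of_int a1\<bar> \<le> 5 * \<bar>real_of_int a3\<bar>"
    | "\<bar>real_of_int a1\<bar> \<le> 5 * \<bar>real_of_int b1\<bar>" | "\<bar>real_of_int a1\<bar> \<le> 5 * \<bar>real_of_int b2\<bar>" | "\<bar>real_of_int a1\<bar> \<le> 5 * \<bar>real_of_int b3\<bar>"
    using sum' by linarith
  then show ?thesis
  proof cases
    case 1
    then show ?thesis using nz Om by (intro same) auto
  next
    case 2
    then have "ebound a1 a3 a2 b1 b2 b3 \<bar>real_of_int a1\<bar>"
      using nz Om by (intro same) (auto simp: Om_def)
    then show ?thesis by (simp add: ebound_sym(2))
  next
    case 3
    then show ?thesis using nz Om sum by (intro opp) auto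
  next
    case 4
    then have "ebound a1 a2 a3 b2 b1 b3 \<bar>real_of_int a1\<bar>"
      using nz Om sum by (intro opp) (auto simp: Om_def)
    then show ?thesis by (simp add: ebound_sym(3))
  next
    case 5
    then have "ebound a1 a2 a3 b3 b1 b2 \<bar>real_of_int a1\<bar>"
      using nz Om sum by (intro opp) (auto simp: Om_def)
    then show ?thesis by (simp add: ebound_sym(3,4))
  qed
qed

lemma ebound_all:
  assumes nz: "a1 \<noteq> 0" "a2 \<noteq> 0" "a3 \<noteq> 0" "b1 \<noteq> 0" "b2 \<noteq> 0" "b3 \<noteq> 0" and Om: "Om a1 a2 a3 b1 b2 b3 \<noteq> 0"
    and sum: "a1 + a2 + a3 = b1 + b2 + b3"
    and N: "N \<in> {\<bar>real_of_int a1\<bar>, \<bar>real_of_int a2\<bar>, \<bar>real_of_int a3\<bar>, \<bar>real_of_int b1\<bar>, \<bar>real_of_int b2\<bar>, \<bar>real_of_int b3\<bar>}"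
  shows "ebound a1 a2 a3 b1 b2 b3 N"
proof -
  have "ebound a1 a2 a3 b1 b2 b3 \<bar>real_of_int a1\<bar>" "ebound a2 a1 a3 b1 b2 b3 \<bar>real_of_int a2\<bar>"
    "ebound a3 a1 a2 b1 b2 b3 \<bar>real_of_int a3\<bar>" "ebound b1 b2 b3 a1 a2 a3 \<bar>real_of_int b1\<bar>"
    "ebound b2 b1 b3 a1 a2 a3 \<bar>real_of_int b2\<bar>" "ebound b3 b1 b2 a1 a2 a3 \<bar>real_of_int b3\<bar>"
    using nz Om sum by (intro ebound_max_a1; auto simp: Om_def)+
  then have "ebound a1 a2 a3 b1 b2 b3 \<bar>real_of_int a1\<bar>" "ebound a1 a2 a3 b1 b2 b3 \<bar>real_of_int a2\<bar>"
    "ebound a1 a2 a3 b1 b2 b3 \<bar>real_of_int a3\<bar>" "ebound a1 a2 a3 b1 b2 b3 \<bar>real_of_int b1\<bar>"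
    "ebound a1 a2 a3 b1 b2 b3 \<bar>real_of_int b2\<bar>" "ebound a1 a2 a3 b1 b2 b3 \<bar>real_of_int b3\<bar>"
    using ebound_sym by metis+
  then show ?thesis using N by auto
qed


section \<open>Coefficients of the Hamiltonian and of its normal form\<close>

definition nzl :: "nat \<Rightarrow> int list \<Rightarrow> bool" where
  "nzl m js \<longleftrightarrow> length js = m \<and> 0 \<notin> set js \<and> altsum js = 0"

text \<open>\<open>hL\<close>, \<open>gG\<close> and \<open>k6\<close> are the coefficients of \<open>Lam\<close>, \<open>G\<close> and \<open>K\<close>, and \<open>gD\<close> those of the part of \<open>G\<close>
  over \<open>Delta\<close>, so that \<open>B\<close> has the coefficients \<open>gG - gD\<close>. The vector fields that generate \<open>\<Psi>\<close> and \<open>\<Phi>\<close>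
  have the coefficients \<open>xi4\<close> and \<open>xi6\<close>.\<close>

definition hL :: "int list \<Rightarrow> complex" where
  "hL js = (case js of [a, b] \<Rightarrow> if a = b then of_int a else 0 | _ \<Rightarrow> 0)"

definition gG :: "int list \<Rightarrow> complex" where
  "gG js = (if nzl 4 js then 1 / (4 * of_real pi) else 0)"

definition gD :: "int list \<Rightarrow> complex" where
  "gD js = (case js of [a, b, c, d] \<Rightarrow> if nzl 4 js \<and> a \<noteq> b \<and> a \<noteq> d then 1 / (4 * of_real pi) else 0 | _ \<Rightarrow> 0)"

definition xi4 :: "int list \<Rightarrow> real" where
  "xi4 js = (case js of [a, b, c] \<Rightarrow> if 0 \<in> set js then 0 else x4 a b c / (4 * pi) | _ \<Rightarrow> 0)"

definition xi6 :: "int list \<Rightarrow> real" where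
  "xi6 js = (case js of [a1, b1, a2, b2, a3] \<Rightarrow>
     if 0 \<in> set js \<or> Om a1 a2 a3 b1 b2 (altsum js) = 0 then 0
     else 3 * of_int (altsum js) * Sg a1 a2 a3 b1 b2 (altsum js) / (72 * pi\<^sup>2 * of_int (Om a1 a2 a3 b1 b2 (altsum js)))
   | _ \<Rightarrow> 0)"

definition k6 :: "int list \<Rightarrow> complex" where
  "k6 js = (case js of [a1, b1, a2, b2, a3, b3] \<Rightarrow>
     if 0 \<notin> set js \<and> b1 = a1 \<and> a2 = a1 \<and> b2 = a1 \<and> b3 = a3 \<and> a3 \<noteq> a1
     then - of_int (2 * a1 - a3) / (8 * (of_real pi)\<^sup>2 * of_int ((a1 - a3)\<^sup>2)) else 0
   | _ \<Rightarrow> 0)"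

lemma list3E: assumes "length js = 3" obtains a b c where "js = [a, b, c]"
  using assms by (auto simp: numeral_eq_Suc length_Suc_conv)

lemma list4E: assumes "length js = 4" obtains a b c d where "js = [a, b, c, d]"
  using assms by (auto simp: numeral_eq_Suc length_Suc_conv)

lemma list5E: assumes "length js = 5" obtains a b c d e where "js = [a, b, c, d, e]"
  using assms by (auto simp: numeral_eq_Suc length_Suc_conv)

lemma list6E: assumes "length js = 6" obtains a b c d e f where "js = [a, b, c, d, e, f]"
  using assms by (auto simp: numeral_eq_Suc length_Suc_conv)

lemma abs_altsum_le_pr: "0 \<notin> set js \<Longrightarrow> \<bar>real_of_int (altsum js)\<bar> \<le> length js * pr js"
proof (induction js)
  case (Cons j js)
  have j: "1 \<le> \<bar>real_of_int j\<bar>" and p: "1 \<le> pr js" using Cons.prems by (auto intro: pr_ge_1)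
  have "\<bar>real_of_int (altsum (j # js))\<bar> \<le> \<bar>real_of_int j\<bar> * 1 + 1 * (length js * pr js)"
    using Cons by simp
  also have "\<dots> \<le> \<bar>real_of_int j\<bar> * pr js + \<bar>real_of_int j\<bar> * (length js * pr js)"
    using j p by (intro add_mono mult_left_mono mult_right_mono) auto
  finally show ?case by (simp add: algebra_simps)
qed simp

text \<open>Zero momentum makes the largest index a signed sum of the others, hence at most
  \<open>m\<close> times their product. This is the lower bound on \<open>W\<close>.\<close>

lemma mx_square_le_pr:
  assumes "nzl m js" "1 \<le> m"
  shows "(mx js)\<^sup>2 \<le> m * pr js"
proof -
  have "js \<noteq> []" using assms by (auto simp: nzl_def)
  then obtain us j ws where js: "js = us @ j # ws" and m: "mx js = \<bar>real_of_int j\<bar>"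
    using mx_attained by blast
  have nz: "0 \<notin> set us" "0 \<notin> set ws" using assms js by (auto simp: nzl_def)
  then have p: "1 \<le> pr us" "1 \<le> pr ws" by (auto intro: pr_ge_1)
  have "altsum us + (- 1) ^ length us * (j - altsum ws) = 0"
    using assms js by (simp add: nzl_def altsum_append)
  then have "\<bar>j\<bar> \<le> \<bar>altsum us\<bar> + \<bar>altsum ws\<bar>"
    by (cases "even (length us)") auto
  then have "\<bar>real_of_int j\<bar> \<le> \<bar>real_of_int (altsum us)\<bar> + \<bar>real_of_int (altsum ws)\<bar>"
    by linarith
  also have "\<dots> \<le> length us * (pr us * 1) + length ws * (1 * pr ws)"
    using abs_altsum_le_pr[OF nz(1)] abs_altsum_le_pr[OF nz(2)] by simp
  also have "\<dots> \<le> length us * (pr us * pr ws) + length ws * (pr us * pr ws)"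
    using p by (intro add_mono mult_left_mono mult_right_mono) auto
  also have "\<dots> \<le> m * (pr us * pr ws)"
    using assms js p by (auto simp: nzl_def algebra_simps)
  finally have "\<bar>real_of_int j\<bar> * \<bar>real_of_int j\<bar> \<le> \<bar>real_of_int j\<bar> * (m * (pr us * pr ws))"
    by (rule mult_left_mono) auto
  then show ?thesis
    unfolding m by (simp add: power2_eq_square js mult_ac)
qed

text \<open>By \<open>mx_square_le_pr\<close>, merely bounded coefficients of zero momentum already
  belong to the class.\<close>

lemma wbd_bounded:
  assumes supp: "c js \<noteq> 0 \<Longrightarrow> nzl m js" and le: "norm (c js) \<le> C" and m: "1 \<le> m" "0 \<le> C"
  shows "wbd (C * m\<^sup>2) c js"
proof (cases "c js = 0")
  case True
  then show ?thesis using m by (simp add: wbd_def)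
next
  case False
  then have n: "nzl m js" by (rule supp)
  have "norm (c js) * mx js ^ 4 = norm (c js) * ((mx js)\<^sup>2)\<^sup>2"
    by (simp flip: power_mult)
  also have "\<dots> \<le> C * (m * pr js)\<^sup>2"
    using le m mx_square_le_pr[OF n m(1)] by (intro mult_mono power_mono) auto
  finally show ?thesis
    using n m by (auto simp: wbd_def nzl_def power_mult_distrib mult.assoc)
qed

lemma inverse_pi_le_1: "1 / (4 * pi) \<le> 1" "1 / (8 * pi\<^sup>2) \<le> 1" "3 / (72 * pi\<^sup>2) \<le> 1"
proof -
  have "3 \<le> pi" using pi_gt3 by simp
  moreover have "9 \<le> pi\<^sup>2" using power_mono[OF \<open>3 \<le> pi\<close>, of 2] by simp
  ultimately show "1 / (4 * pi) \<le> 1" "1 / (8 * pi\<^sup>2) \<le> 1" "3 / (72 * pi\<^sup>2) \<le> 1"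
    by (simp_all add: divide_le_eq)
qed

lemma nzl_gG: "gG js \<noteq> 0 \<Longrightarrow> nzl 4 js" and nzl_gD: "gD js \<noteq> 0 \<Longrightarrow> nzl 4 js"
  by (auto simp: gG_def gD_def split: list.splits if_splits)

lemma nzl_k6: "k6 js \<noteq> 0 \<Longrightarrow> nzl 6 js"
  by (auto simp: k6_def nzl_def split: list.splits if_splits)

lemma wbd_gG: "wbd 16 gG js" and wbd_gD: "wbd 16 gD js"
proof -
  have p: "norm (1 / (4 * complex_of_real pi)) \<le> 1"
    using inverse_pi_le_1(1) by (simp add: norm_divide norm_mult)
  have "norm (gG js) \<le> 1" "norm (gD js) \<le> 1"
    using p by (auto simp: gG_def gD_def split: list.splits)
  then show "wbd 16 gG js" "wbd 16 gD js"
    using wbd_bounded[of gG js 4 1] wbd_bounded[of gD js 4 1] nzl_gG nzl_gD by auto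
qed

lemma gclass_gG: "gclass 16 1 gG" and gclass_gD: "gclass 16 1 gD"
  using wbd_gG wbd_gD by (auto simp: gclass_def)

text \<open>The coefficient may grow like \<open>2 * \<bar>a\<bar>\<close> when \<open>b\<close> is
  next to \<open>a\<close>, but \<open>a\<close> occurs four times in the list, and
  \<open>(pr js)\<^sup>2\<close> contains its eighth power.\<close>

lemma wbd_k6: "wbd 3 k6 js"
proof (cases "k6 js = 0")
  case False
  then obtain a b where js: "js = [a, a, a, a, b, b]" "a \<noteq> 0" "b \<noteq> 0" "b \<noteq> a"
    by (auto simp: k6_def split: list.splits if_splits)
  define p q where "p = \<bar>real_of_int a\<bar>" and "q = \<bar>real_of_int b\<bar>"
  have pq: "1 \<le> p" "1 \<le> q" using js by (auto simp: p_def q_def)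
  have "1 \<le> \<bar>a - b\<bar>" using js by auto
  define d where "d = \<bar>real_of_int (a - b)\<bar>"
  have d: "1 \<le> d" using \<open>1 \<le> \<bar>a - b\<bar>\<close> unfolding d_def by (simp flip: of_int_abs)
  have "norm (k6 js) = \<bar>real_of_int (2 * a - b)\<bar> / (8 * pi\<^sup>2 * d\<^sup>2)"
    using js by (simp add: k6_def norm_divide norm_mult norm_power d_def norm_minus_commute flip: of_int_diff of_int_mult)
  also have "\<dots> \<le> \<bar>real_of_int (2 * a - b)\<bar> / (1 * d\<^sup>2)"
    using inverse_pi_le_1(2) d by (intro divide_left_mono mult_right_mono) (auto simp: divide_le_eq intro!: mult_pos_pos)
  also have "\<dots> \<le> (d * p + d * p) / d\<^sup>2"
  proof -
    have "\<bar>real_of_int (2 * a - b)\<bar> \<le> d * 1 + 1 * p" by (simp add: d_def p_def)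
    also have "\<dots> \<le> d * p + d * p" using d pq by (intro add_mono mult_left_mono mult_right_mono) auto
    finally show ?thesis by (simp add: divide_right_mono)
  qed
  also have "\<dots> = 2 * p / d" using d by (simp add: power2_eq_square)
  also have "\<dots> \<le> 2 * p" using d pq by (simp add: divide_le_eq)
  finally have k: "norm (k6 js) \<le> 2 * p" .
  have "mx js ^ 4 \<le> (p * q) ^ 4"
    using js pq mult_left_mono[of 1 q p] mult_right_mono[of 1 p q] by (intro power_mono) (auto simp: p_def[symmetric] q_def[symmetric])
  then have "norm (k6 js) * mx js ^ 4 \<le> (2 * p) * (p * q) ^ 4"
    using k pq by (intro mult_mono) auto
  also have "\<dots> = 2 * (p ^ 5 * q ^ 4)" by (simp add: power_numeral_reduce)
  also have "\<dots> \<le> 3 * (p ^ 8 * q ^ 4)"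
    using pq by (intro mult_mono mult_right_mono power_increasing) auto
  also have "p ^ 8 * q ^ 4 = (pr js)\<^sup>2"
    using js by (simp add: p_def q_def power_numeral_reduce)
  finally show ?thesis using js by (simp add: wbd_def)
qed (simp add: wbd_def)

lemma gclass_k6: "gclass 3 1 k6"
  using wbd_k6 by (auto simp: gclass_def)

text \<open>With \<open>u\<close> and \<open>v\<close> the two factors of the denominator and
  \<open>n\<close> the component, the claim reduces to \<open>key\<close>; then
  \<open>6 / (4 * pi)\<close> is below 1.\<close>

lemma kernel_xi4: "rker 3 1 xi4"
  unfolding kernel_def
proof (intro conjI allI impI)
  fix js :: "int list" assume len: "length js = 3"
  then obtain a b c where js: "js = [a, b, c]" by (rule list3E)
  show "complex_of_real (xi4 js) = 0" if "0 \<in> set js"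
    using that by (auto simp: xi4_def js)
  show "norm (complex_of_real (xi4 js)) * mx js ^ 4 \<le> 1 * (real_of_int (altsum js) * pr js)\<^sup>2"
  proof (cases "xi4 js = 0")
    case False
    then have ne: "a \<noteq> 0" "b \<noteq> 0" "c \<noteq> 0" "a \<noteq> b" "c \<noteq> b" "a - b + c \<noteq> 0"
      by (auto simp: xi4_def js x4_def split: if_splits)
    define u v n where "u = \<bar>a - b\<bar>" and "v = \<bar>c - b\<bar>" and "n = \<bar>a - b + c\<bar>"
    define x y z where "x = \<bar>a\<bar>" and "y = \<bar>b\<bar>" and "z = \<bar>c\<bar>"
    have ge: "1 \<le> u" "1 \<le> v" "1 \<le> n" "1 \<le> x" "1 \<le> y" "1 \<le> z"
      using ne by (auto simp: u_def v_def n_def x_def y_def z_def)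
    have ge1: "1 \<le> s * t" if "1 \<le> s" "1 \<le> t" for s t :: int
      using mult_mono[of 1 s 1 t] that by simp
    have two: "s \<le> 2 * (d * t)" if "s \<le> d + t" "1 \<le> d" "1 \<le> t" for s d t :: int
      using that mult_left_mono[of 1 t d] mult_right_mono[of 1 d t] by linarith
    have three: "s \<le> 3 * (p * q * r)" if "s \<le> p + q + r" "1 \<le> p" "1 \<le> q" "1 \<le> r" for s p q r :: int
    proof -
      have "p * 1 \<le> p * (q * r)" "q * 1 \<le> q * (p * r)" "r * 1 \<le> r * (p * q)"
        using that ge1 by (intro mult_left_mono; simp)+
      then have "s \<le> p * (q * r) + q * (p * r) + r * (p * q)" using that by linarith
      also have "\<dots> = 3 * (p * q * r)" by simp
      finally show ?thesis .
    qed
    have tri: "x \<le> u + y" "y \<le> u + x" "z \<le> v + y" "x \<le> n + y + z" "y \<le> n + x + z" "z \<le> n + x + y"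
      by (auto simp: u_def v_def n_def x_def y_def z_def)
    define m where "m = max x (max y z)"
    \<comment> \<open>Each index \<open>t\<close> has two bounds: by a difference times a neighbour,
      and by \<open>n\<close> times the product of the other two indices. Their product bounds
      \<open>t * t\<close>, and multiplying by \<open>t * t\<close> once more completes the square
      on the right.\<close>
    have key: "m ^ 4 \<le> 6 * (u * v * n * (x * y * z)\<^sup>2)"
    proof -
      have gen: "t ^ 4 \<le> 6 * (u * v * n * (t * p * q)\<^sup>2)"
        if t: "t \<le> 2 * (w * p)" "t \<le> 3 * (n * p * q)" and w: "w \<in> {u, v}" and g: "1 \<le> t" "1 \<le> p" "1 \<le> q" for t p q w
      proof -
        have "t * t \<le> (2 * (w * p)) * (3 * (n * p * q))"
          using t g ge w by (intro mult_mono) auto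
        also have "\<dots> = 6 * (w * n * (p * p * q))" by simp
        also have "\<dots> \<le> 6 * ((u * v) * n * (p * p * (q * q)))"
        proof (intro mult_left_mono mult_mono)
          show "w \<le> u * v" using w ge mult_left_mono[of 1 v u] mult_right_mono[of 1 u v] by auto
          show "q \<le> q * q" using g mult_left_mono[of 1 q q] by simp
        qed (use ge w g in auto)
        finally have "(t * t) * (t * t) \<le> (6 * ((u * v) * n * (p * p * (q * q)))) * (t * t)"
          by (rule mult_right_mono) auto
        then show ?thesis by (simp add: power_numeral_reduce mult_ac)
      qed
      have "x ^ 4 \<le> 6 * (u * v * n * (x * y * z)\<^sup>2)"
        using gen[of x u y z] two[OF tri(1)] three[OF tri(4)] ge by simp
      moreover have "y ^ 4 \<le> 6 * (u * v * n * (x * y * z)\<^sup>2)"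
        using gen[of y u x z] two[OF tri(2)] three[OF tri(5)] ge by (simp add: mult_ac)
      moreover have "z ^ 4 \<le> 6 * (u * v * n * (x * y * z)\<^sup>2)"
        using gen[of z v y x] two[OF tri(3)] three[of z n y x] tri(6) ge by (simp add: mult_ac add_ac)
      ultimately show ?thesis by (auto simp: m_def max_def)
    qed
    have m: "mx js = real_of_int m" by (auto simp: js m_def x_def y_def z_def max_def)
    have p: "pr js = real_of_int (x * y * z)" by (simp add: js x_def y_def z_def)
    have al: "\<bar>real_of_int (altsum js)\<bar> = real_of_int n" by (simp add: js n_def)
    have x4: "xi4 js = (- real_of_int (a - b + c) / real_of_int ((a - b) * (c - b))) / (4 * pi)"
      using ne by (simp add: xi4_def js x4_def)
    have nx: "norm (complex_of_real (xi4 js)) = real_of_int n / (4 * pi * real_of_int (u * v))"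
      unfolding x4 n_def u_def v_def norm_of_real abs_divide abs_mult abs_minus_cancel of_int_mult of_int_abs
      by (simp add: mult_ac)
    have "norm (complex_of_real (xi4 js)) * mx js ^ 4 \<le> real_of_int n / (4 * pi * real_of_int (u * v)) * real_of_int (6 * (u * v * n * (x * y * z)\<^sup>2))"
      unfolding nx m of_int_power[symmetric] using key ge by (intro mult_left_mono) (simp_all only: of_int_le_iff, auto)
    also have "\<dots> = (6 / (4 * pi)) * (real_of_int n * real_of_int (x * y * z))\<^sup>2"
      using ge by (simp add: field_simps power2_eq_square)
    also have "\<dots> \<le> 1 * (real_of_int n * real_of_int (x * y * z))\<^sup>2"
      using pi_gt3 by (intro mult_right_mono) (auto simp: divide_le_eq)
    also have "\<dots> = 1 * (real_of_int (altsum js) * pr js)\<^sup>2"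
      unfolding p al[symmetric] power_mult_distrib by simp
    finally show ?thesis .
  qed simp
qed auto

text \<open>\<open>N\<close> is the maximum over all six indices, the component \<open>n\<close>
  included. Of its five powers in \<open>ebound\<close> one pays for the factor \<open>n\<close> of
  the field and four for \<open>mx js ^ 4\<close>.\<close>

lemma kernel_xi6: "rker 5 25000000 xi6"
  unfolding kernel_def
proof (intro conjI allI impI)
  fix js :: "int list" assume len: "length js = 5"
  then obtain a1 b1 a2 b2 a3 where js: "js = [a1, b1, a2, b2, a3]" by (rule list5E)
  show "complex_of_real (xi6 js) = 0" if "0 \<in> set js"
    using that by (auto simp: xi6_def js)
  show "norm (complex_of_real (xi6 js)) * mx js ^ 4 \<le> 25000000 * (real_of_int (altsum js) * pr js)\<^sup>2"
  proof (cases "xi6 js = 0")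
    case False
    define n where "n = altsum js"
    have ne: "a1 \<noteq> 0" "a2 \<noteq> 0" "a3 \<noteq> 0" "b1 \<noteq> 0" "b2 \<noteq> 0" "n \<noteq> 0" "Om a1 a2 a3 b1 b2 n \<noteq> 0"
      using False by (auto simp: xi6_def js n_def[unfolded js] split: if_splits)
    have sum: "a1 + a2 + a3 = b1 + b2 + n" by (simp add: n_def js)
    define N where "N = max (mx js) \<bar>real_of_int n\<bar>"
    define W where "W = \<bar>real_of_int (Om a1 a2 a3 b1 b2 n)\<bar>"
    have W: "1 \<le> W" unfolding W_def by (rule Om_abs_ge_1[OF ne(7)])
    have "N \<in> {\<bar>real_of_int a1\<bar>, \<bar>real_of_int a2\<bar>, \<bar>real_of_int a3\<bar>, \<bar>real_of_int b1\<bar>, \<bar>real_of_int b2\<bar>, \<bar>real_of_int n\<bar>}"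
      by (auto simp: N_def js max_def)
    then have "ebound a1 a2 a3 b1 b2 n N"
      by (rule ebound_all[OF ne sum])
    moreover have "pr js * \<bar>real_of_int n\<bar> = \<bar>real_of_int a1\<bar> * \<bar>real_of_int a2\<bar> * \<bar>real_of_int a3\<bar> * \<bar>real_of_int b1\<bar> * \<bar>real_of_int b2\<bar> * \<bar>real_of_int n\<bar>"
      by (simp add: js)
    ultimately have e: "N ^ 5 * \<bar>Sg a1 a2 a3 b1 b2 n\<bar> \<le> 25000000 * W * (pr js * \<bar>real_of_int n\<bar>)\<^sup>2"
      unfolding ebound_def W_def by (simp only:)
    have "xi6 js = 3 * of_int n * Sg a1 a2 a3 b1 b2 n / (72 * pi\<^sup>2 * of_int (Om a1 a2 a3 b1 b2 n))"
      using False by (auto simp: xi6_def js n_def split: if_splits)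
    then have "norm (complex_of_real (xi6 js)) * mx js ^ 4 = (3 / (72 * pi\<^sup>2)) * (\<bar>real_of_int n\<bar> * mx js ^ 4 * \<bar>Sg a1 a2 a3 b1 b2 n\<bar>) / W"
      by (simp only: norm_of_real abs_divide abs_mult W_def) (simp add: mult_ac)
    also have "\<dots> \<le> 1 * (N * N ^ 4 * \<bar>Sg a1 a2 a3 b1 b2 n\<bar>) / W"
      using inverse_pi_le_1(3) W by (intro divide_right_mono mult_mono power_mono mult_nonneg_nonneg) (auto simp: N_def)
    also have "\<dots> = (N ^ 5 * \<bar>Sg a1 a2 a3 b1 b2 n\<bar>) / W" by (simp add: power_numeral_reduce)
    also have "\<dots> \<le> (25000000 * W * (pr js * \<bar>real_of_int n\<bar>)\<^sup>2) / W"
      using e W by (intro divide_right_mono) auto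
    also have "\<dots> = 25000000 * (real_of_int (altsum js) * pr js)\<^sup>2"
      using W by (simp add: n_def power_mult_distrib mult_ac)
    finally show ?thesis .
  qed simp
qed auto


subsection \<open>Symmetrisation\<close>

lemma form_reindex:
  assumes "bij_betw \<pi> (ilists m) (ilists m)"
    and "\<And>js. length js = m \<Longrightarrow> mon (\<pi> js) (replicate m (emb s x)) = mon js (replicate m (emb s x))"
  shows "form s (\<lambda>js. c (\<pi> js)) (replicate m x) = form s c (replicate m x)"
proof -
  have "form s c (replicate m x) = (\<Sum>\<^sub>\<infinity>js\<in>ilists m. c (\<pi> js) * mon (\<pi> js) (replicate m (emb s x)))"
    unfolding form_def using infsum_reindex_bij_betw[OF assms(1), of "\<lambda>js. c js * mon js (replicate m (emb s x))"] by simp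
  also have "\<dots> = form s (\<lambda>js. c (\<pi> js)) (replicate m x)"
    unfolding form_def using assms(2) by (auto intro!: infsum_cong)
  finally show ?thesis ..
qed

lemma form_add:
  assumes "3 < s" "crude m E c" "crude m E' d" "length vs = m"
  shows "form s (\<lambda>js. c js + d js) vs = form s c vs + form s d vs"
  unfolding form_def using form_summable[OF assms(1,2,4)] form_summable[OF assms(1,3,4)] assms(4)
  by (simp add: distrib_right infsum_add)

lemma crude_add: "crude m E c \<Longrightarrow> crude m E' d \<Longrightarrow> crude m (E + E') (\<lambda>js. c js + d js)"
  unfolding crude_def by (auto simp: distrib_right intro: norm_triangle_le add_mono)

lemma form_cmult: "form s (\<lambda>js. a * c js) vs = a * form s c vs"
  unfolding form_def by (simp add: mult.assoc infsum_cmult_right')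

lemma crude_cmult: "crude m E c \<Longrightarrow> crude m (norm a * E) (\<lambda>js. a * c js)"
  unfolding crude_def by (auto simp: norm_mult mult.assoc intro: mult_left_mono)

text \<open>Cyclic rotations of the \<open>q\<close> slots and of the \<open>cnj q\<close> slots suffice to symmetrise, because \<open>T6\<close> is
  symmetric in its first two and in its last two arguments.\<close>

definition swap4 :: "int list \<Rightarrow> int list" where
  "swap4 js = [js ! 2, js ! 3, js ! 0, js ! 1]"

definition rotA :: "int list \<Rightarrow> int list" where
  "rotA js = [js ! 2, js ! 1, js ! 4, js ! 3, js ! 0, js ! 5]"

definition rotB :: "int list \<Rightarrow> int list" where
  "rotB js = [js ! 0, js ! 3, js ! 2, js ! 5, js ! 4, js ! 1]"

lemma rot_simps [simp]:
  "swap4 [a, b, c, d] = [c, d, a, b]"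
  "rotA [a, b, c, d, e, f] = [c, b, e, d, a, f]"
  "rotB [a, b, c, d, e, f] = [a, d, c, f, e, b]"
  by (simp_all add: swap4_def rotA_def rotB_def)

lemma bij_swap4: "bij_betw swap4 (ilists 4) (ilists 4)"
proof (rule bij_betw_byWitness[where f' = swap4])
  show "\<forall>js\<in>ilists 4. swap4 (swap4 js) = js" "\<forall>js\<in>ilists 4. swap4 (swap4 js) = js"
    unfolding Ball_def mem_Collect_eq by (intro allI impI, erule list4E, simp)+
qed (auto simp: swap4_def)

lemma bij_rotA: "bij_betw rotA (ilists 6) (ilists 6)"
proof (rule bij_betw_byWitness[where f' = "\<lambda>js. rotA (rotA js)"])
  show "\<forall>js\<in>ilists 6. rotA (rotA (rotA js)) = js" "\<forall>js\<in>ilists 6. rotA (rotA (rotA js)) = js"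
    unfolding Ball_def mem_Collect_eq by (intro allI impI, erule list6E, simp)+
qed (auto simp: rotA_def)

lemma bij_rotB: "bij_betw rotB (ilists 6) (ilists 6)"
proof (rule bij_betw_byWitness[where f' = "\<lambda>js. rotB (rotB js)"])
  show "\<forall>js\<in>ilists 6. rotB (rotB (rotB js)) = js" "\<forall>js\<in>ilists 6. rotB (rotB (rotB js)) = js"
    unfolding Ball_def mem_Collect_eq by (intro allI impI, erule list6E, simp)+
qed (auto simp: rotB_def)

text \<open>Exchanging the two pairs does not change the monomial on the diagonal, so only the sum
  of the two coefficients matters.\<close>

lemma form_eq4:
  assumes s: "3 < s" and c: "crude 4 E c" "crude 4 E' d"
    and eq: "\<And>a b e f. c [a, b, e, f] + c [e, f, a, b] = d [a, b, e, f] + d [e, f, a, b]"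
  shows "form s c (replicate 4 x) = form s d (replicate 4 x)"
proof -
  have m: "mon (swap4 js) (replicate 4 (emb s x)) = mon js (replicate 4 (emb s x))" if "length js = 4" for js
    using that by (rule list4E) (simp add: numeral_eq_Suc)
  have p: "pr (swap4 js) = pr js" if "length js = 4" for js
    using that by (rule list4E) simp
  have l: "length (swap4 js) = 4" for js by (simp add: swap4_def)
  have two: "2 * form s c (replicate 4 x) = form s (\<lambda>js. c js + c (swap4 js)) (replicate 4 x)" if "crude 4 E c" for c E
  proof -
    have "crude 4 E (\<lambda>js. c (swap4 js))"
      unfolding crude_def
    proof (intro conjI allI impI)
      show "norm (c (swap4 js)) \<le> E * (pr js)\<^sup>2" if "length js = 4" for js
        using \<open>crude 4 E c\<close> l[of js] p[OF that] unfolding crude_def by metis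
    qed (use that in \<open>auto simp: crude_def\<close>)
    then show ?thesis
      using form_add[OF s that, of E "\<lambda>js. c (swap4 js)" "replicate 4 x"] form_reindex[OF bij_swap4 m, of c] by simp
  qed
  have "form s (\<lambda>js. c js + c (swap4 js)) (replicate 4 x) = form s (\<lambda>js. d js + d (swap4 js)) (replicate 4 x)"
    unfolding form_def by (intro infsum_cong) (auto elim!: list4E simp: eq)
  then have "2 * form s c (replicate 4 x) = 2 * form s d (replicate 4 x)"
    by (simp only: two[OF c(1)] two[OF c(2)])
  then show ?thesis by simp
qed

definition av3 :: "(int list \<Rightarrow> int list) \<Rightarrow> (int list \<Rightarrow> complex) \<Rightarrow> int list \<Rightarrow> complex" where
  "av3 \<pi> c js = c js + (c (\<pi> js) + c (\<pi> (\<pi> js)))"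

lemma form_av3:
  assumes s: "3 < s" and c: "crude 6 E c" and \<pi>: "\<pi> = rotA \<or> \<pi> = rotB"
  shows "crude 6 (3 * E) (av3 \<pi> c)" "form s (av3 \<pi> c) (replicate 6 x) = 3 * form s c (replicate 6 x)"
proof -
  have m: "mon (\<pi> js) (replicate 6 (emb s x)) = mon js (replicate 6 (emb s x))" if "length js = 6" for js
    using that
  proof (rule list6E)
    fix a b c d e f assume "js = [a, b, c, d, e, f]"
    then show ?thesis using \<pi> by (elim disjE) (simp_all add: numeral_eq_Suc)
  qed
  have p: "pr (\<pi> js) = pr js" if "length js = 6" for js
    using that \<pi> by (auto elim!: list6E)
  have l: "length (\<pi> js) = 6" for js using \<pi> by (auto simp: rotA_def rotB_def)
  have b: "bij_betw \<pi> (ilists 6) (ilists 6)" using \<pi> bij_rotA bij_rotB by blast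
  have shift: "crude 6 E (\<lambda>js. c (\<pi> js))" if "crude 6 E c" for c
    unfolding crude_def
  proof (intro conjI allI impI)
    show "norm (c (\<pi> js)) \<le> E * (pr js)\<^sup>2" if "length js = 6" for js
      using \<open>crude 6 E c\<close> l[of js] p[OF that] unfolding crude_def by metis
  qed (use that in \<open>auto simp: crude_def\<close>)
  have 1: "crude 6 E (\<lambda>js. c (\<pi> js))" by (rule shift[OF c])
  have 2: "crude 6 E (\<lambda>js. c (\<pi> (\<pi> js)))" by (rule shift[OF 1])
  show "crude 6 (3 * E) (av3 \<pi> c)"
    unfolding av3_def using crude_add[OF c crude_add[OF 1 2]] by simp
  show "form s (av3 \<pi> c) (replicate 6 x) = 3 * form s c (replicate 6 x)"
    unfolding av3_def
    using form_add[OF s c crude_add[OF 1 2], of "replicate 6 x"] form_add[OF s 1 2, of "replicate 6 x"]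
      form_reindex[OF b m, where c = c] form_reindex[OF b m, where c = "\<lambda>js. c (\<pi> js)"] by simp
qed

lemma form_eq6:
  assumes s: "3 < s" and c: "crude 6 E c" "crude 6 E' d"
    and eq: "\<And>js. length js = 6 \<Longrightarrow> av3 rotA (av3 rotB c) js = av3 rotA (av3 rotB d) js"
  shows "form s c (replicate 6 x) = form s d (replicate 6 x)"
proof -
  have nine: "form s (av3 rotA (av3 rotB c)) (replicate 6 x) = 9 * form s c (replicate 6 x)" if "crude 6 E c" for c E
    using form_av3(2)[OF s form_av3(1)[OF s that, of rotB], of rotA x] form_av3(2)[OF s that, of rotB x] by simp
  have "form s (av3 rotA (av3 rotB c)) (replicate 6 x) = form s (av3 rotA (av3 rotB d)) (replicate 6 x)"
    unfolding form_def by (intro infsum_cong) (simp add: eq)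
  then show ?thesis using nine[OF c(1)] nine[OF c(2)] by simp
qed

section \<open>The homological equations in degrees four and six\<close>

definition zsupp :: "(int list \<Rightarrow> complex) \<Rightarrow> bool" where
  "zsupp c \<longleftrightarrow> (\<forall>js. c js \<noteq> 0 \<longrightarrow> even (length js) \<and> 0 \<notin> set js \<and> altsum js = 0)"

lemma zsupp_Top:
  assumes c: "zsupp c" and \<xi>: "rker b E \<xi>" and b: "odd b"
  shows "zsupp (Top b \<xi> c)"
  unfolding zsupp_def
proof (intro allI impI)
  fix js assume "Top b \<xi> c js \<noteq> 0"
  then obtain i where i: "i < length js + 1 - b"
    "c (take i js @ altsum (take b (drop i js)) # drop (i + b) js) * complex_of_real (\<xi> (take b (drop i js))) \<noteq> 0"
    unfolding Top_def by (meson lessThan_iff sum.not_neutral_contains_not_neutral)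
  have b1: "1 \<le> b" using \<xi> by (simp add: kernel_def)
  define m where "m = length js + 1 - b"
  have js: "length js = m + b - 1" "i < m" using i b1 by (auto simp: m_def)
  obtain p bs q where split: "js = p @ bs @ q" "length p = i" "length bs = b" "length q = m - Suc i"
    "take i js = p" "take b (drop i js) = bs" "drop (i + b) js = q"
    using list_split3[OF js b1] by blast
  then have "c (p @ altsum bs # q) \<noteq> 0" "\<xi> bs \<noteq> 0" using i by auto
  then have "0 \<notin> set (p @ altsum bs # q)" "altsum (p @ altsum bs # q) = 0" "0 \<notin> set bs" "even (length (p @ altsum bs # q))"
    using c kernel_zero[OF \<xi> split(3)] by (auto simp: zsupp_def)
  then show "even (length js) \<and> 0 \<notin> set js \<and> altsum js = 0"
    using split b by (auto simp: altsum_append)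
qed

lemma zsupp_hL: "zsupp hL"
  by (auto simp: zsupp_def hL_def split: list.splits if_splits)

lemma crude_hL: "crude 2 1 hL"
  unfolding crude_def
proof (intro conjI allI impI)
  fix js :: "int list" assume "length js = 2"
  then obtain a b where js: "js = [a, b]" by (auto simp: numeral_2_eq_2 length_Suc_conv)
  have "\<bar>real_of_int a\<bar> \<le> (\<bar>real_of_int a\<bar> * \<bar>real_of_int a\<bar>)\<^sup>2"
  proof (cases "a = 0")
    case False
    then have "\<bar>real_of_int a\<bar> ^ 1 \<le> \<bar>real_of_int a\<bar> ^ 4" by (intro power_increasing) auto
    then show ?thesis by (simp add: power_numeral_reduce power2_eq_square)
  qed simp
  then show "norm (hL js) \<le> 1 * (pr js)\<^sup>2" by (auto simp: js hL_def)
qed simp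

lemma Top_explicit:
  "Top 3 \<xi> c [a1, b1, a2, b2] = c [a1 - b1 + a2, b2] * of_real (\<xi> [a1, b1, a2]) + c [a1, b1 - a2 + b2] * of_real (\<xi> [b1, a2, b2])"
  "Top 3 \<xi> c [a1, b1, a2, b2, a3, b3] =
     c [a1 - b1 + a2, b2, a3, b3] * of_real (\<xi> [a1, b1, a2]) + c [a1, b1 - a2 + b2, a3, b3] * of_real (\<xi> [b1, a2, b2])
     + c [a1, b1, a2 - b2 + a3, b3] * of_real (\<xi> [a2, b2, a3]) + c [a1, b1, a2, b2 - a3 + b3] * of_real (\<xi> [b2, a3, b3])"
  "Top 5 \<xi> c [a1, b1, a2, b2, a3, b3] =
     c [altsum [a1, b1, a2, b2, a3], b3] * of_real (\<xi> [a1, b1, a2, b2, a3]) + c [a1, altsum [b1, a2, b2, a3, b3]] * of_real (\<xi> [b1, a2, b2, a3, b3])"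
  by (simp_all add: Top_def numeral_eq_Suc algebra_simps)

text \<open>The generator \<open>F4\<close> removes from \<open>G\<close> what is not in
  \<open>B\<close>. After symmetrisation the numerator is
  \<open>a1\<^sup>2 + a2\<^sup>2 - b1\<^sup>2 - b2\<^sup>2\<close>, and zero momentum makes it
  \<open>- 2\<close> times the denominator \<open>(a1 - b1) * (a2 - b1)\<close>.\<close>

lemma form_Top_hL:
  assumes s: "3 < s"
  shows "form s (Top 3 xi4 hL) (replicate 4 x) = form s (\<lambda>js. - gD js) (replicate 4 x)"
proof (rule form_eq4[OF s])
  show "crude 4 (2 * (1 * (1 * real 3 ^ 4))) (Top 3 xi4 hL)"
    using crude_Top(1)[OF kernel_xi4 crude_hL] by simp
  show "crude 4 (norm (- 1 :: complex) * (16 * 1 ^ 4)) (\<lambda>js. - gD js)"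
    using crude_cmult[OF gclass_crude[OF gclass_gD, of 4], of "- 1"] by simp
  fix a1 b1 a2 b2 :: int
  show "Top 3 xi4 hL [a1, b1, a2, b2] + Top 3 xi4 hL [a2, b2, a1, b1] = - gD [a1, b1, a2, b2] + - gD [a2, b2, a1, b1]"
  proof (cases "0 \<notin> {a1, b1, a2, b2} \<and> a1 - b1 + a2 - b2 = 0")
    case False
    then have "Top 3 xi4 hL [a1, b1, a2, b2] = 0" "Top 3 xi4 hL [a2, b2, a1, b1] = 0"
      using zsupp_Top[OF zsupp_hL kernel_xi4] unfolding zsupp_def by fastforce+
    moreover have "gD [a1, b1, a2, b2] = 0" "gD [a2, b2, a1, b1] = 0"
      using False by (auto simp: gD_def nzl_def)
    ultimately show ?thesis by simp
  next
    case True
    then have b2: "b2 = a1 - b1 + a2" and nz: "a1 \<noteq> 0" "b1 \<noteq> 0" "a2 \<noteq> 0" "b2 \<noteq> 0" by auto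
    have T: "Top 3 xi4 hL [a1, b1, a2, b2] = of_real ((of_int b2 * x4 a1 b1 a2 + of_int a1 * x4 b1 a2 b2) / (4 * pi))"
      "Top 3 xi4 hL [a2, b2, a1, b1] = of_real ((of_int b1 * x4 a2 b2 a1 + of_int a2 * x4 b2 a1 b1) / (4 * pi))"
      using nz b2 by (simp_all add: Top_explicit hL_def xi4_def add_divide_distrib)
    show ?thesis
    proof (cases "a1 = b1 \<or> a2 = b1")
      case True
      then have "x4 a1 b1 a2 = 0" "x4 b1 a2 b2 = 0" "x4 a2 b2 a1 = 0" "x4 b2 a1 b1 = 0"
        using b2 by (auto simp: x4_def)
      moreover have "gD [a1, b1, a2, b2] = 0" "gD [a2, b2, a1, b1] = 0"
        using True b2 by (auto simp: gD_def)
      ultimately show ?thesis using T by simp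
    next
      case False
      define A B1 A2 where "A = real_of_int a1" and "B1 = real_of_int b1" and "A2 = real_of_int a2"
      have ne: "A \<noteq> B1" "A2 \<noteq> B1" using False by (auto simp: A_def B1_def A2_def)
      have x: "x4 a1 b1 a2 = - (A - B1 + A2) / ((A - B1) * (A2 - B1))" "x4 b1 a2 b2 = - A / ((B1 - A2) * (A - B1))"
        "x4 a2 b2 a1 = - B1 / ((B1 - A) * (B1 - A2))" "x4 b2 a1 b1 = - A2 / ((A2 - B1) * (B1 - A))"
        using False by (auto simp: x4_def b2 A_def B1_def A2_def algebra_simps)
      have "((A - B1 + A2) * (- (A - B1 + A2) / ((A - B1) * (A2 - B1))) + A * (- A / ((B1 - A2) * (A - B1))))
        + (B1 * (- B1 / ((B1 - A) * (B1 - A2))) + A2 * (- A2 / ((A2 - B1) * (B1 - A)))) = - 2"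
        using ne by (simp add: divide_simps) (simp add: algebra_simps)
      then have e: "(of_int b2 * x4 a1 b1 a2 + of_int a1 * x4 b1 a2 b2) + (of_int b1 * x4 a2 b2 a1 + of_int a2 * x4 b2 a1 b1) = - 2"
        unfolding x by (simp add: b2 A_def B1_def A2_def)
      have "gD [a1, b1, a2, b2] = 1 / (4 * of_real pi)" "gD [a2, b2, a1, b1] = 1 / (4 * of_real pi)"
        using False nz b2 by (auto simp: gD_def nzl_def)
      moreover have "Top 3 xi4 hL [a1, b1, a2, b2] + Top 3 xi4 hL [a2, b2, a1, b1] = of_real (- 2 / (4 * pi))"
        unfolding T of_real_add[symmetric] add_divide_distrib[symmetric] e ..
      ultimately show ?thesis by simp
    qed
  qed
qed

text \<open>In degree six \<open>H \<circ> \<Psi>\<close> has the first bracket of \<open>G\<close>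
  and half of the second bracket of \<open>Lam\<close>. The first bracket of \<open>Lam\<close>
  being \<open>- gD\<close>, the two combine into one bracket of \<open>gU\<close>.\<close>

definition gU :: "int list \<Rightarrow> complex" where
  "gU js = gG js + (- 1 / 2) * gD js"

lemma zsupp_gU: "zsupp gU"
  unfolding zsupp_def
proof (intro allI impI)
  fix js assume "gU js \<noteq> 0"
  then have "gG js \<noteq> 0 \<or> gD js \<noteq> 0" by (auto simp: gU_def)
  then show "even (length js) \<and> 0 \<notin> set js \<and> altsum js = 0" using nzl_gG nzl_gD by (auto simp: nzl_def)
qed

lemma gU_eq:
  assumes "a - b + c - d = 0" "a \<noteq> 0" "b \<noteq> 0" "c \<noteq> 0" "d \<noteq> 0"
  shows "gU [a, b, c, d] = of_real (uw a b d / (4 * pi))" "gU [a, b, c, d] = of_real (uw c b d / (4 * pi))"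
    "gU [a, b, c, d] = of_real (uw b a c / (4 * pi))" "gU [a, b, c, d] = of_real (uw d a c / (4 * pi))"
  using assms by (auto simp: gU_def gG_def gD_def nzl_def uw_def)

lemma Top_gU:
  assumes n: "nzl 6 [a1, b1, a2, b2, a3, b3]"
  shows "Top 3 xi4 gU [a1, b1, a2, b2, a3, b3] = of_real ((T6 a1 a2 a3 b1 b2 b3 + T6 b1 b2 b3 a2 a1 a3 + T6 a2 a3 a1 b2 b1 b3 + T6 b2 b3 b1 a3 a1 a2) / (16 * pi\<^sup>2))"
proof -
  have nz: "a1 \<noteq> 0" "b1 \<noteq> 0" "a2 \<noteq> 0" "b2 \<noteq> 0" "a3 \<noteq> 0" "b3 \<noteq> 0" and s: "a1 - b1 + a2 - b2 + a3 - b3 = 0"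
    using n by (auto simp: nzl_def algebra_simps)
  \<comment> \<open>At a contracted index 0 the coefficient \<open>gU\<close> vanishes but
    \<open>uw\<close> does not; there \<open>x4\<close> is 0 and both sides agree.\<close>
  have x0: "x4 a b c = 0" if "a - b + c = 0" for a b c using that by (simp add: x4_def)
  have xi: "xi4 [a1, b1, a2] = x4 a1 b1 a2 / (4 * pi)" "xi4 [b1, a2, b2] = x4 b1 a2 b2 / (4 * pi)"
    "xi4 [a2, b2, a3] = x4 a2 b2 a3 / (4 * pi)" "xi4 [b2, a3, b3] = x4 b2 a3 b3 / (4 * pi)"
    using nz by (auto simp: xi4_def)
  have 1: "gU [a1 - b1 + a2, b2, a3, b3] * of_real (xi4 [a1, b1, a2]) = of_real (T6 a1 a2 a3 b1 b2 b3 / (16 * pi\<^sup>2))"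
  proof (cases "a1 - b1 + a2 = 0")
    case False
    then show ?thesis
      unfolding xi T6_def using gU_eq(2)[of "a1 - b1 + a2" b2 a3 b3] nz s by (simp add: power2_eq_square)
  qed (simp add: xi T6_def x0)
  have 2: "gU [a1, b1 - a2 + b2, a3, b3] * of_real (xi4 [b1, a2, b2]) = of_real (T6 b1 b2 b3 a2 a1 a3 / (16 * pi\<^sup>2))"
  proof (cases "b1 - a2 + b2 = 0")
    case False
    then show ?thesis
      unfolding xi T6_def using gU_eq(4)[of a1 "b1 - a2 + b2" a3 b3] nz s by (simp add: power2_eq_square)
  qed (simp add: xi T6_def x0)
  have 3: "gU [a1, b1, a2 - b2 + a3, b3] * of_real (xi4 [a2, b2, a3]) = of_real (T6 a2 a3 a1 b2 b1 b3 / (16 * pi\<^sup>2))"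
  proof (cases "a2 - b2 + a3 = 0")
    case False
    then show ?thesis
      unfolding xi T6_def using gU_eq(1)[of a1 b1 "a2 - b2 + a3" b3] nz s by (simp add: power2_eq_square)
  qed (simp add: xi T6_def x0)
  have 4: "gU [a1, b1, a2, b2 - a3 + b3] * of_real (xi4 [b2, a3, b3]) = of_real (T6 b2 b3 b1 a3 a1 a2 / (16 * pi\<^sup>2))"
  proof (cases "b2 - a3 + b3 = 0")
    case False
    then show ?thesis
      unfolding xi T6_def using gU_eq(3)[of a1 b1 a2 "b2 - a3 + b3"] nz s by (simp add: power2_eq_square)
  qed (simp add: xi T6_def x0)
  show ?thesis
    unfolding Top_explicit 1 2 3 4 by (simp add: add_divide_distrib)
qed

lemma av3_explicit: "av3 rotA (av3 rotB c) [a1, b1, a2, b2, a3, b3] =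
    (c [a1, b1, a2, b2, a3, b3] + c [a1, b2, a2, b3, a3, b1] + c [a1, b3, a2, b1, a3, b2]) +
    (c [a2, b1, a3, b2, a1, b3] + c [a2, b2, a3, b3, a1, b1] + c [a2, b3, a3, b1, a1, b2]) +
    (c [a3, b1, a1, b2, a2, b3] + c [a3, b2, a1, b3, a2, b1] + c [a3, b3, a1, b1, a2, b2])"
  by (simp add: av3_def add_ac)

lemma nzl_rots:
  assumes "nzl 6 [a1, b1, a2, b2, a3, b3]"
  shows "nzl 6 [a1, b2, a2, b3, a3, b1]" "nzl 6 [a1, b3, a2, b1, a3, b2]" "nzl 6 [a2, b1, a3, b2, a1, b3]"
    "nzl 6 [a2, b2, a3, b3, a1, b1]" "nzl 6 [a2, b3, a3, b1, a1, b2]" "nzl 6 [a3, b1, a1, b2, a2, b3]"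
    "nzl 6 [a3, b2, a1, b3, a2, b1]" "nzl 6 [a3, b3, a1, b1, a2, b2]"
  using assms by (auto simp: nzl_def)

text \<open>Nine rotations of four terms are 36 summands, in which each of the 18 terms of
  \<open>Sg\<close> occurs twice.\<close>

lemma av3_Top_gU:
  assumes n: "nzl 6 [a1, b1, a2, b2, a3, b3]"
  shows "av3 rotA (av3 rotB (Top 3 xi4 gU)) [a1, b1, a2, b2, a3, b3] = of_real (Sg a1 a2 a3 b1 b2 b3 / (8 * pi\<^sup>2))"
proof -
  have "av3 rotA (av3 rotB (Top 3 xi4 gU)) [a1, b1, a2, b2, a3, b3] = of_real (2 * Sg a1 a2 a3 b1 b2 b3 / (16 * pi\<^sup>2))"
    unfolding av3_explicit Top_gU[OF n] nzl_rots[OF n, THEN Top_gU] of_real_add[symmetric] add_divide_distrib[symmetric] Sg_def sg_def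
    by (intro arg_cong[where f = of_real] arg_cong[where f = "\<lambda>u. u / _"]) (simp add: T6_sym)
  then show ?thesis by simp
qed

text \<open>\<open>xi6\<close> without its factor, the index of the component: unlike
  \<open>xi6\<close> it has the symmetries of a Hamiltonian coefficient.\<close>

definition gam :: "int \<Rightarrow> int \<Rightarrow> int \<Rightarrow> int \<Rightarrow> int \<Rightarrow> int \<Rightarrow> real" where
  "gam a1 a2 a3 b1 b2 b3 = (if Om a1 a2 a3 b1 b2 b3 = 0 then 0 else 3 * Sg a1 a2 a3 b1 b2 b3 / (72 * pi\<^sup>2 * of_int (Om a1 a2 a3 b1 b2 b3)))"

lemma gam_sym:
  "gam a1 a2 a3 b1 b2 b3 = gam a2 a1 a3 b1 b2 b3" "gam a1 a2 a3 b1 b2 b3 = gam a1 a3 a2 b1 b2 b3"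
  "gam a1 a2 a3 b1 b2 b3 = gam a1 a2 a3 b2 b1 b3" "gam a1 a2 a3 b1 b2 b3 = gam a1 a2 a3 b1 b3 b2"
  by (simp_all add: gam_def Sg_sym(1-4) Om_def algebra_simps)

lemma gam_swap: "gam b1 b2 b3 a1 a2 a3 = - gam a1 a2 a3 b1 b2 b3"
proof -
  have "Om b1 b2 b3 a1 a2 a3 = - Om a1 a2 a3 b1 b2 b3" by (simp add: Om_def)
  then show ?thesis by (simp add: gam_def Sg_sym(5)[of b1 b2 b3])
qed

lemma xi6_gam:
  assumes "nzl 6 [a1, b1, a2, b2, a3, b3]"
  shows "xi6 [a1, b1, a2, b2, a3] = of_int b3 * gam a1 a2 a3 b1 b2 b3"
    and "xi6 [b1, a2, b2, a3, b3] = - of_int a1 * gam a1 a2 a3 b1 b2 b3"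
proof -
  have nz: "a1 \<noteq> 0" "b1 \<noteq> 0" "a2 \<noteq> 0" "b2 \<noteq> 0" "a3 \<noteq> 0" "b3 \<noteq> 0" and s: "a1 - b1 + a2 - b2 + a3 - b3 = 0"
    using assms by (auto simp: nzl_def algebra_simps)
  have "altsum [a1, b1, a2, b2, a3] = b3" "altsum [b1, a2, b2, a3, b3] = a1" using s by auto
  then have "xi6 [a1, b1, a2, b2, a3] = of_int b3 * gam a1 a2 a3 b1 b2 b3"
    "xi6 [b1, a2, b2, a3, b3] = of_int a1 * gam b1 b2 b3 a2 a3 a1"
    using nz by (simp_all add: xi6_def gam_def del: altsum.simps)
  moreover have "gam b1 b2 b3 a2 a3 a1 = - gam a1 a2 a3 b1 b2 b3"
    by (subst gam_swap) (simp add: gam_sym)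
  ultimately show "xi6 [a1, b1, a2, b2, a3] = of_int b3 * gam a1 a2 a3 b1 b2 b3"
    "xi6 [b1, a2, b2, a3, b3] = - of_int a1 * gam a1 a2 a3 b1 b2 b3" by auto
qed

lemma Top_xi6_hL:
  assumes n: "nzl 6 [a1, b1, a2, b2, a3, b3]"
  shows "Top 5 xi6 hL [a1, b1, a2, b2, a3, b3] = of_real (((of_int b3)\<^sup>2 - (of_int a1)\<^sup>2) * gam a1 a2 a3 b1 b2 b3)"
proof -
  have s: "a1 - b1 + a2 - b2 + a3 - b3 = 0" using n by (auto simp: nzl_def algebra_simps)
  have "altsum [a1, b1, a2, b2, a3] = b3" "altsum [b1, a2, b2, a3, b3] = a1" using s by auto
  then show ?thesis
    unfolding Top_explicit xi6_gam[OF n] by (simp add: hL_def power2_eq_square algebra_simps)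
qed

text \<open>Among the nine rotations each squared index occurs three times, so the weights
  \<open>b3\<^sup>2 - a1\<^sup>2\<close> add up to \<open>- 3 * Om\<close>. This fixes the factor
  \<open>3 / 72\<close> in \<open>gam\<close>: it makes the result cancel
  \<open>av3_Top_gU\<close>.\<close>

lemma av3_Top_xi6_hL:
  assumes n: "nzl 6 [a1, b1, a2, b2, a3, b3]"
  shows "av3 rotA (av3 rotB (Top 5 xi6 hL)) [a1, b1, a2, b2, a3, b3] =
    (if Om a1 a2 a3 b1 b2 b3 = 0 then 0 else of_real (- Sg a1 a2 a3 b1 b2 b3 / (8 * pi\<^sup>2)))"
proof -
  have "av3 rotA (av3 rotB (Top 5 xi6 hL)) [a1, b1, a2, b2, a3, b3] = of_real (- 3 * of_int (Om a1 a2 a3 b1 b2 b3) * gam a1 a2 a3 b1 b2 b3)"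
    unfolding av3_explicit Top_xi6_hL[OF n] nzl_rots[OF n, THEN Top_xi6_hL] of_real_add[symmetric]
    by (intro arg_cong[where f = of_real]) (simp add: gam_sym Om_def algebra_simps)
  then show ?thesis by (simp add: gam_def)
qed

lemma k6_nonzero:
  assumes "k6 [a1, b1, a2, b2, a3, b3] \<noteq> 0"
  shows "Om a1 a2 a3 b1 b2 b3 = 0" "Sg a1 a2 a3 b1 b2 b3 \<noteq> 0"
proof -
  have e: "b1 = a1" "a2 = a1" "b2 = a1" "b3 = a3" "a3 \<noteq> a1" "2 * a1 - a3 \<noteq> 0"
    using assms by (auto simp: k6_def split: if_splits)
  then show "Om a1 a2 a3 b1 b2 b3 = 0" by (simp add: Om_def)
  have "real_of_int (2 * a1 - a3) \<noteq> 0" "real_of_int ((a1 - a3)\<^sup>2) \<noteq> 0"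
    unfolding of_int_eq_0_iff using e(5,6) by auto
  then have "Sg a1 a1 a3 a1 a1 a3 \<noteq> 0"
    unfolding Sg_diagonal_pair[OF e(5)[symmetric]] divide_eq_0_iff neg_equal_0_iff_equal by blast
  then show "Sg a1 a2 a3 b1 b2 b3 \<noteq> 0" unfolding e(1-4) .
qed

text \<open>\<open>k6\<close> is supported on lists whose single entries stand last. Exactly one of
  the three rotations on each side achieves this, so the coefficient of \<open>K\<close> is hit once
  among the nine.\<close>

lemma av3_k6:
  assumes n: "nzl 6 [a1, b1, a2, b2, a3, b3]"
  shows "av3 rotA (av3 rotB k6) [a1, b1, a2, b2, a3, b3] =
    (if Om a1 a2 a3 b1 b2 b3 = 0 then of_real (Sg a1 a2 a3 b1 b2 b3 / (8 * pi\<^sup>2)) else 0)"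
proof (cases "Om a1 a2 a3 b1 b2 b3 = 0 \<and> Sg a1 a2 a3 b1 b2 b3 \<noteq> 0")
  case False
  have S: "Sg a1 a2 a3 b2 b3 b1 = Sg a1 a2 a3 b1 b2 b3" "Sg a1 a2 a3 b3 b1 b2 = Sg a1 a2 a3 b1 b2 b3"
    "Sg a2 a3 a1 b1 b2 b3 = Sg a1 a2 a3 b1 b2 b3" "Sg a2 a3 a1 b2 b3 b1 = Sg a1 a2 a3 b1 b2 b3" "Sg a2 a3 a1 b3 b1 b2 = Sg a1 a2 a3 b1 b2 b3"
    "Sg a3 a1 a2 b1 b2 b3 = Sg a1 a2 a3 b1 b2 b3" "Sg a3 a1 a2 b2 b3 b1 = Sg a1 a2 a3 b1 b2 b3" "Sg a3 a1 a2 b3 b1 b2 = Sg a1 a2 a3 b1 b2 b3"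
    by (simp_all add: Sg_sym(1-4))
  have O: "Om a1 a2 a3 b2 b3 b1 = Om a1 a2 a3 b1 b2 b3" "Om a1 a2 a3 b3 b1 b2 = Om a1 a2 a3 b1 b2 b3"
    "Om a2 a3 a1 b1 b2 b3 = Om a1 a2 a3 b1 b2 b3" "Om a2 a3 a1 b2 b3 b1 = Om a1 a2 a3 b1 b2 b3" "Om a2 a3 a1 b3 b1 b2 = Om a1 a2 a3 b1 b2 b3"
    "Om a3 a1 a2 b1 b2 b3 = Om a1 a2 a3 b1 b2 b3" "Om a3 a1 a2 b2 b3 b1 = Om a1 a2 a3 b1 b2 b3" "Om a3 a1 a2 b3 b1 b2 = Om a1 a2 a3 b1 b2 b3"
    by (simp_all add: Om_def)
  have z: "k6 [c1, d1, c2, d2, c3, d3] = 0"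
    if "Om c1 c2 c3 d1 d2 d3 = Om a1 a2 a3 b1 b2 b3" "Sg c1 c2 c3 d1 d2 d3 = Sg a1 a2 a3 b1 b2 b3" for c1 c2 c3 d1 d2 d3
    using False that k6_nonzero[of c1 d1 c2 d2 c3 d3] by metis
  have "av3 rotA (av3 rotB k6) [a1, b1, a2, b2, a3, b3] = 0"
    unfolding av3_explicit by (simp only: z S O refl add_0_left)
  then show ?thesis using False by simp
next
  case True
  have s: "a1 + a2 + a3 = b1 + b2 + b3" using n by (auto simp: nzl_def algebra_simps)
  obtain a b where ab: "a \<noteq> b" "(a1, a2, a3) \<in> {(a, a, b), (a, b, a), (b, a, a)}" "(b1, b2, b3) \<in> {(a, a, b), (a, b, a), (b, a, a)}"
    using Sg_resonant_cases[OF s] True by blast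
  have nz: "a \<noteq> 0" "b \<noteq> 0" using n ab by (auto simp: nzl_def)
  have S: "Sg a1 a2 a3 b1 b2 b3 = Sg a a b a a b"
    using ab by (auto simp: Sg_sym(1-4))
  have "av3 rotA (av3 rotB k6) [a1, b1, a2, b2, a3, b3] = - of_int (2 * a - b) / (8 * (of_real pi)\<^sup>2 * of_int ((a - b)\<^sup>2))"
    using ab nz unfolding av3_explicit by (auto simp: k6_def)
  also have "\<dots> = of_real (Sg a1 a2 a3 b1 b2 b3 / (8 * pi\<^sup>2))"
    unfolding S Sg_diagonal_pair[OF ab(1)] by simp
  finally show ?thesis using True by simp
qed

lemma crude_Top_gU: "crude 6 (4 * ((16 + 8) * (1 * real 3 ^ 4))) (Top 3 xi4 gU)"
proof -
  have "crude 4 (16 * 1 ^ 4 + norm (- 1 / 2 :: complex) * (16 * 1 ^ 4)) gU"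
    unfolding gU_def by (intro crude_add crude_cmult gclass_crude gclass_gG gclass_gD)
  then have "crude 4 (16 + 8) gU" by (simp add: norm_divide)
  from crude_Top(1)[OF kernel_xi4 this] show ?thesis by simp
qed

text \<open>Off the resonances the generator cancels the term of degree six; on them it contributes
  nothing, and \<open>k6\<close> is what that term amounts to.\<close>

lemma form_Top_xi6_hL:
  assumes s: "3 < s"
  shows "form s (Top 5 xi6 hL) (replicate 6 x) = form s (\<lambda>js. k6 js + (- 1) * Top 3 xi4 gU js) (replicate 6 x)"
proof (rule form_eq6[OF s])
  show "crude 6 (2 * (1 * (25000000 * real 5 ^ 4))) (Top 5 xi6 hL)"
    using crude_Top(1)[OF kernel_xi6 crude_hL] by simp
  show "crude 6 (3 * 1 ^ 6 + norm (- 1 :: complex) * (4 * ((16 + 8) * (1 * real 3 ^ 4)))) (\<lambda>js. k6 js + (- 1) * Top 3 xi4 gU js)"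
    by (intro crude_add crude_cmult crude_Top_gU gclass_crude gclass_k6)
  fix js :: "int list" assume "length js = 6"
  then obtain a1 b1 a2 b2 a3 b3 where js: "js = [a1, b1, a2, b2, a3, b3]" by (rule list6E)
  show "av3 rotA (av3 rotB (Top 5 xi6 hL)) js = av3 rotA (av3 rotB (\<lambda>js. k6 js + (- 1) * Top 3 xi4 gU js)) js"
  proof (cases "nzl 6 js")
    case True
    have "av3 rotA (av3 rotB (\<lambda>js. k6 js + (- 1) * Top 3 xi4 gU js)) js = av3 rotA (av3 rotB k6) js - av3 rotA (av3 rotB (Top 3 xi4 gU)) js"
      by (simp add: av3_def)
    then show ?thesis
      using True unfolding js by (simp add: av3_k6 av3_Top_gU av3_Top_xi6_hL)
  next
    case False
    have rot: "\<not> nzl 6 (rotA ks)" "\<not> nzl 6 (rotB ks)" "length (rotA ks) = 6" "length (rotB ks) = 6" if "\<not> nzl 6 ks" "length ks = 6" for ks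
      using that by (auto elim!: list6E simp: nzl_def)
    have z: "av3 rotA (av3 rotB c) js = 0" if "\<And>ks. length ks = 6 \<Longrightarrow> \<not> nzl 6 ks \<Longrightarrow> c ks = 0" for c
      using that False \<open>length js = 6\<close> by (simp add: av3_def rot)
    have "Top 5 xi6 hL ks = 0" "Top 3 xi4 gU ks = 0" "k6 ks = 0" if "length ks = 6" "\<not> nzl 6 ks" for ks
      using that zsupp_Top[OF zsupp_hL kernel_xi6] zsupp_Top[OF zsupp_gU kernel_xi4] nzl_k6
      by (auto simp: zsupp_def nzl_def)
    then show ?thesis by (simp add: z)
  qed
qed


section \<open>The Hamiltonian and its normal form in coordinates\<close>

lemma form_eq_infsum:
  assumes "inj_on \<phi> A" "\<And>a. a \<in> A \<Longrightarrow> length (\<phi> a) = m"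
    and "\<And>js. length js = m \<Longrightarrow> c js \<noteq> 0 \<Longrightarrow> js \<in> \<phi> ` A"
  shows "form s c (replicate m x) = (\<Sum>\<^sub>\<infinity>a\<in>A. c (\<phi> a) * mon (\<phi> a) (replicate m (emb s x)))"
proof -
  have "form s c (replicate m x) = (\<Sum>\<^sub>\<infinity>js\<in>\<phi> ` A. c js * mon js (replicate m (emb s x)))"
    unfolding form_def using assms(2,3) by (intro infsum_cong_neutral) auto
  then show ?thesis using infsum_reindex[OF assms(1), of "\<lambda>js. c js * mon js (replicate m (emb s x))"] by (simp add: comp_def)
qed

lemma Lam_emb: "Lam (emb s x) = form s hL (replicate 2 x)"
proof -
  have "form s hL (replicate 2 x) = (\<Sum>\<^sub>\<infinity>j\<in>Zstar. hL [j, j] * mon [j, j] (replicate 2 (emb s x)))"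
  proof (rule form_eq_infsum)
    show "js \<in> (\<lambda>j. [j, j]) ` Zstar" if "length js = 2" "hL js \<noteq> 0" for js
      using that by (auto simp: hL_def Zstar_def split: list.splits if_splits)
  qed (auto simp: inj_on_def)
  then show ?thesis
    by (simp add: Lam_def hL_def numeral_2_eq_2[THEN arg_cong[where f = "\<lambda>n. replicate n _"]] complex_norm_square mult.assoc del: of_real_power)
qed

lemma G_emb: "G (emb s x) = form s gG (replicate 4 x)"
proof -
  let ?A = "{(j, k, l, m). j \<in> Zstar \<and> k \<in> Zstar \<and> l \<in> Zstar \<and> m \<in> Zstar \<and> j - k + l - m = 0}"
  let ?\<phi> = "\<lambda>(j, k, l, m). [j, k, l, m]"
  have "form s gG (replicate 4 x) = (\<Sum>\<^sub>\<infinity>a\<in>?A. gG (?\<phi> a) * mon (?\<phi> a) (replicate 4 (emb s x)))"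
  proof (rule form_eq_infsum)
    show "js \<in> ?\<phi> ` ?A" if "length js = 4" "gG js \<noteq> 0" for js
      using that(1) by (rule list4E) (use nzl_gG[OF that(2)] in \<open>auto simp: nzl_def Zstar_def image_iff\<close>)
  qed (auto simp: inj_on_def)
  also have "\<dots> = (\<Sum>\<^sub>\<infinity>a\<in>?A. 1 / (4 * of_real pi) * (case a of (j, k, l, m) \<Rightarrow>
      emb s x j * cnj (emb s x k) * emb s x l * cnj (emb s x m)))"
    by (intro infsum_cong) (auto simp: gG_def nzl_def Zstar_def numeral_eq_Suc)
  finally show ?thesis unfolding G_def infsum_cmult_right' by simp
qed

lemma K_emb: "K (emb s x) = form s k6 (replicate 6 x)"
proof -
  let ?A = "{(j, k). j \<in> Zstar \<and> k \<in> Zstar \<and> j \<noteq> k}"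
  let ?\<phi> = "\<lambda>(j, k). [j, j, j, j, k, k]"
  have "form s k6 (replicate 6 x) = (\<Sum>\<^sub>\<infinity>a\<in>?A. k6 (?\<phi> a) * mon (?\<phi> a) (replicate 6 (emb s x)))"
  proof (rule form_eq_infsum)
    show "js \<in> ?\<phi> ` ?A" if "length js = 6" "k6 js \<noteq> 0" for js
      using that(1) by (rule list6E) (use that(2) in \<open>auto simp: k6_def Zstar_def image_iff split: if_splits\<close>)
  qed (auto simp: inj_on_def)
  also have "\<dots> = (\<Sum>\<^sub>\<infinity>a\<in>?A. - (1 / (8 * (of_real pi)\<^sup>2)) * (case a of (j, k) \<Rightarrow>
      of_int (2 * j - k) / of_int ((j - k)\<^sup>2) * of_real (cmod (emb s x j) ^ 4 * (cmod (emb s x k))\<^sup>2)))"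
  proof (intro infsum_cong, clarify)
    fix j k assume jk: "j \<in> Zstar" "k \<in> Zstar" "j \<noteq> k"
    define z w where "z = emb s x j" and "w = emb s x k"
    have "mon [j, j, j, j, k, k] (replicate 6 (emb s x)) = (z * cnj z)\<^sup>2 * (w * cnj w)"
      by (simp add: z_def w_def numeral_eq_Suc)
    also have "\<dots> = of_real (cmod z ^ 4 * (cmod w)\<^sup>2)"
      by (simp add: complex_norm_square[symmetric] power_mult[symmetric])
    finally have m: "mon [j, j, j, j, k, k] (replicate 6 (emb s x)) = of_real (cmod z ^ 4 * (cmod w)\<^sup>2)" .
    have "k6 [j, j, j, j, k, k] = - (1 / (8 * (of_real pi)\<^sup>2)) * (of_int (2 * j - k) / of_int ((j - k)\<^sup>2))"
      using jk by (auto simp: k6_def Zstar_def simp del: of_int_diff of_int_mult of_int_power)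
    then show "k6 [j, j, j, j, k, k] * mon [j, j, j, j, k, k] (replicate 6 (emb s x)) =
        - (1 / (8 * (of_real pi)\<^sup>2)) * (of_int (2 * j - k) / of_int ((j - k)\<^sup>2) * of_real (cmod (emb s x j) ^ 4 * (cmod (emb s x k))\<^sup>2))"
      unfolding m z_def w_def by (simp only: mult.assoc)
  qed
  finally show ?thesis unfolding K_def infsum_cmult_right' by simp
qed

lemma crude_indicator:
  assumes "\<And>js. c js \<noteq> 0 \<Longrightarrow> 0 \<notin> set js \<and> norm (c js) \<le> E" "0 \<le> E"
  shows "crude m E c"
  unfolding crude_def
proof (intro conjI allI impI)
  fix js
  show "norm (c js) \<le> E * (pr js)\<^sup>2"
  proof (cases "c js = 0")
    case False
    then have "1 \<le> (pr js)\<^sup>2" using assms(1) pr_ge_1[of js] by (intro one_le_power) blast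
    then have "E * 1 \<le> E * (pr js)\<^sup>2" using assms(2) by (intro mult_left_mono)
    then show ?thesis using assms(1)[OF False] by simp
  qed (use assms(2) in simp)
qed (rule assms(2))

lemma emb_square_summable:
  assumes "3 < s"
  shows "(\<lambda>j. (cmod (emb s x j))\<^sup>2) summable_on A"
proof -
  have "(\<lambda>j. (cmod (coord x j))\<^sup>2) summable_on A"
    using coord_summable by (rule summable_on_subset_banach) simp
  then show ?thesis
  proof (rule summable_on_comparison_test)
    fix j
    have "\<bar>real_of_int j\<bar> powr - s \<le> 1"
    proof (cases "j = 0")
      case False
      then have "\<bar>real_of_int j\<bar> powr - s \<le> \<bar>real_of_int j\<bar> powr 0"
        using assms by (intro powr_mono) auto
      then show ?thesis using False by simp
    qed simp
    then have "cmod (coord x j) * \<bar>real_of_int j\<bar> powr - s \<le> cmod (coord x j) * 1"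
      by (intro mult_left_mono) auto
    then show "(cmod (emb s x j))\<^sup>2 \<le> (cmod (coord x j))\<^sup>2"
      by (intro power_mono) (auto simp: emb_def norm_mult)
  qed simp
qed

text \<open>\<open>gG - gD\<close> lives where \<open>a = b\<close> or \<open>a = d\<close>, that is
  \<open>b = c\<close>. Inclusion and exclusion of the two pairings and their intersection give
  twice the squared mass minus the fourth powers.\<close>

lemma B_emb:
  assumes s: "3 < s"
  shows "B (emb s x) = form s (\<lambda>js. gG js - gD js) (replicate 4 x)"
proof -
  define q where "q = emb s x"
  define S where "S = (\<Sum>\<^sub>\<infinity>j\<in>Zstar. (of_real ((cmod (q j))\<^sup>2) :: complex))"
  have S: "S = of_real (\<Sum>\<^sub>\<infinity>j\<in>Zstar. (cmod (q j))\<^sup>2)"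
    unfolding S_def q_def by (intro infsumI has_sum_of_real has_sum_infsum emb_square_summable s)
  have "((\<lambda>(a, b). (cmod (q a))\<^sup>2 * (cmod (q b))\<^sup>2) has_sum (\<Sum>\<^sub>\<infinity>j\<in>Zstar. (cmod (q j))\<^sup>2) * (\<Sum>\<^sub>\<infinity>j\<in>Zstar. (cmod (q j))\<^sup>2)) (Zstar \<times> Zstar)"
    unfolding q_def by (intro has_sum_product has_sum_infsum emb_square_summable s) auto
  from has_sum_of_real[OF this, where ?'a = complex]
  have SS: "(\<Sum>\<^sub>\<infinity>(a, b)\<in>Zstar \<times> Zstar. (of_real ((cmod (q a))\<^sup>2) :: complex) * of_real ((cmod (q b))\<^sup>2)) = S * S"
    unfolding S by (intro infsumI) (simp add: case_prod_unfold)
  define cP cQ cE :: "int list \<Rightarrow> complex" where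
    "cP js = (if length js = 4 \<and> 0 \<notin> set js \<and> js ! 0 = js ! 1 \<and> js ! 2 = js ! 3 then 1 else 0)" and
    "cQ js = (if length js = 4 \<and> 0 \<notin> set js \<and> js ! 0 = js ! 3 \<and> js ! 1 = js ! 2 then 1 else 0)" and
    "cE js = (if length js = 4 \<and> 0 \<notin> set js \<and> js ! 0 = js ! 1 \<and> js ! 1 = js ! 2 \<and> js ! 2 = js ! 3 then 1 else 0)" for js
  have cr: "crude 4 1 cP" "crude 4 1 cQ" "crude 4 1 cE"
    by (intro crude_indicator; simp add: cP_def cQ_def cE_def split: if_splits)+
  let ?P = "\<lambda>(a, b). [a, a, b, b]" and ?Q = "\<lambda>(a, b). [a, b, b, a]"
  have P: "form s cP (replicate 4 x) = S * S"
  proof -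
    have "form s cP (replicate 4 x) = (\<Sum>\<^sub>\<infinity>a\<in>Zstar \<times> Zstar. cP (?P a) * mon (?P a) (replicate 4 (emb s x)))"
    proof (rule form_eq_infsum)
      show "js \<in> ?P ` (Zstar \<times> Zstar)" if "length js = 4" "cP js \<noteq> 0" for js
        using that(1) by (rule list4E) (use that(2) in \<open>auto simp: cP_def Zstar_def image_iff split: if_splits\<close>)
    qed (auto simp: inj_on_def)
    also have "\<dots> = (\<Sum>\<^sub>\<infinity>(a, b)\<in>Zstar \<times> Zstar. of_real ((cmod (q a))\<^sup>2) * of_real ((cmod (q b))\<^sup>2))"
      unfolding complex_norm_square by (intro infsum_cong) (auto simp: cP_def Zstar_def numeral_eq_Suc q_def mult_ac)
    finally show ?thesis unfolding SS .
  qed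
  have Q: "form s cQ (replicate 4 x) = S * S"
  proof -
    have "form s cQ (replicate 4 x) = (\<Sum>\<^sub>\<infinity>a\<in>Zstar \<times> Zstar. cQ (?Q a) * mon (?Q a) (replicate 4 (emb s x)))"
    proof (rule form_eq_infsum)
      show "js \<in> ?Q ` (Zstar \<times> Zstar)" if "length js = 4" "cQ js \<noteq> 0" for js
        using that(1) by (rule list4E) (use that(2) in \<open>auto simp: cQ_def Zstar_def image_iff split: if_splits\<close>)
    qed (auto simp: inj_on_def)
    also have "\<dots> = (\<Sum>\<^sub>\<infinity>(a, b)\<in>Zstar \<times> Zstar. of_real ((cmod (q a))\<^sup>2) * of_real ((cmod (q b))\<^sup>2))"
      unfolding complex_norm_square by (intro infsum_cong) (auto simp: cQ_def Zstar_def numeral_eq_Suc q_def mult_ac)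
    finally show ?thesis unfolding SS .
  qed
  have E: "form s cE (replicate 4 x) = (\<Sum>\<^sub>\<infinity>j\<in>Zstar. of_real (cmod (q j) ^ 4))"
  proof -
    have "form s cE (replicate 4 x) = (\<Sum>\<^sub>\<infinity>j\<in>Zstar. cE [j, j, j, j] * mon [j, j, j, j] (replicate 4 (emb s x)))"
    proof (rule form_eq_infsum)
      show "js \<in> (\<lambda>j. [j, j, j, j]) ` Zstar" if "length js = 4" "cE js \<noteq> 0" for js
        using that(1) by (rule list4E) (use that(2) in \<open>auto simp: cE_def Zstar_def split: if_splits\<close>)
    qed (auto simp: inj_on_def)
    also have "\<dots> = (\<Sum>\<^sub>\<infinity>j\<in>Zstar. of_real (cmod (q j) ^ 4))"
    proof (rule infsum_cong)
      fix j assume "j \<in> Zstar"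
      then have "cE [j, j, j, j] * mon [j, j, j, j] (replicate 4 (emb s x)) = (q j * cnj (q j))\<^sup>2"
        by (simp add: cE_def Zstar_def numeral_eq_Suc q_def)
      then show "cE [j, j, j, j] * mon [j, j, j, j] (replicate 4 (emb s x)) = of_real (cmod (q j) ^ 4)"
        by (simp add: complex_norm_square[symmetric] power_mult[symmetric])
    qed
    finally show ?thesis .
  qed
  have eq: "gG js - gD js = 1 / (4 * of_real pi) * (cP js + (cQ js + (- 1) * cE js))" if "length js = 4" for js
    using that
  proof (rule list4E)
    fix a b c d assume js: "js = [a, b, c, d]"
    show ?thesis
    proof (cases "nzl 4 js")
      case True
      then have d: "d = a - b + c" and nz: "a \<noteq> 0" "b \<noteq> 0" "c \<noteq> 0" "d \<noteq> 0" by (auto simp: nzl_def js)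
      have e: "a = d \<longleftrightarrow> b = c" "c = d \<longleftrightarrow> a = b" using d by auto
      have "gG js - gD js = (if a = b \<or> b = c then 1 / (4 * of_real pi) else 0)"
        using True e(1) by (simp add: js gG_def gD_def)
      moreover have "cP js = (if a = b then 1 else 0)" "cQ js = (if b = c then 1 else 0)"
        "cE js = (if a = b \<and> b = c then 1 else 0)"
        using nz by (auto simp: js cP_def cQ_def cE_def e)
      ultimately show ?thesis by simp
    next
      case False
      then have "cP js = 0" "cQ js = 0" "cE js = 0" by (auto simp: js nzl_def cP_def cQ_def cE_def)
      then show ?thesis using False by (simp add: js gG_def gD_def)
    qed
  qed
  have "form s (\<lambda>js. gG js - gD js) (replicate 4 x) = form s (\<lambda>js. 1 / (4 * of_real pi) * (cP js + (cQ js + (- 1) * cE js))) (replicate 4 x)"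
    unfolding form_def by (intro infsum_cong) (simp add: eq)
  also have "\<dots> = 1 / (4 * of_real pi) * (form s cP (replicate 4 x) + (form s cQ (replicate 4 x) + (- 1) * form s cE (replicate 4 x)))"
    using form_add[OF s cr(1) crude_add[OF cr(2) crude_cmult[OF cr(3), of "- 1"]], of "replicate 4 x"]
      form_add[OF s cr(2) crude_cmult[OF cr(3), of "- 1"], of "replicate 4 x"]
    by (simp only: form_cmult length_replicate)
  also have "\<dots> = B q"
    unfolding P Q E B_def S_def[symmetric] by (simp add: field_simps power2_eq_square)
  finally show ?thesis by (simp add: q_def)
qed

subsection \<open>The transformation to the normal form of order four\<close>

definition c4 :: "int list \<Rightarrow> complex" where
  "c4 js = (case js of [j, k, l, m] \<Rightarrow> if (j, k, l, m) \<in> Delta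
     then \<i> / (4 * of_real pi) * (1 / of_int (j\<^sup>2 - k\<^sup>2 + l\<^sup>2 - m\<^sup>2)) else 0 | _ \<Rightarrow> 0)"

lemma F4_emb: "F4 (emb s x) = form s c4 (replicate 4 x)"
proof -
  let ?\<phi> = "\<lambda>(j, k, l, m). [j, k, l, m]"
  have "form s c4 (replicate 4 x) = (\<Sum>\<^sub>\<infinity>a\<in>Delta. c4 (?\<phi> a) * mon (?\<phi> a) (replicate 4 (emb s x)))"
  proof (rule form_eq_infsum)
    show "js \<in> ?\<phi> ` Delta" if "length js = 4" "c4 js \<noteq> 0" for js
      using that(1)
    proof (rule list4E)
      fix j k l m assume js: "js = [j, k, l, m]"
      then have "(j, k, l, m) \<in> Delta" using that(2) by (simp add: c4_def split: if_splits)
      then show ?thesis unfolding js by (rule rev_image_eqI) simp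
    qed
  qed (auto simp: inj_on_def)
  also have "\<dots> = (\<Sum>\<^sub>\<infinity>a\<in>Delta. \<i> / (4 * of_real pi) * (case a of (j, k, l, m) \<Rightarrow>
      1 / of_int (j\<^sup>2 - k\<^sup>2 + l\<^sup>2 - m\<^sup>2) * (emb s x j * cnj (emb s x k) * emb s x l * cnj (emb s x m))))"
  proof (intro infsum_cong, clarify)
    fix j k l m assume D: "(j, k, l, m) \<in> Delta"
    have "mon [j, k, l, m] (replicate 4 (emb s x)) = emb s x j * cnj (emb s x k) * emb s x l * cnj (emb s x m)"
      by (simp add: numeral_eq_Suc)
    then show "c4 [j, k, l, m] * mon [j, k, l, m] (replicate 4 (emb s x)) = \<i> / (4 * of_real pi) *
        (1 / of_int (j\<^sup>2 - k\<^sup>2 + l\<^sup>2 - m\<^sup>2) * (emb s x j * cnj (emb s x k) * emb s x l * cnj (emb s x m)))"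
      using D by (simp only: c4_def list.case if_True mult.assoc)
  qed
  finally show ?thesis unfolding F4_def infsum_cmult_right' by simp
qed

lemma Delta_divisor:
  assumes "(j, k, l, m) \<in> Delta"
  shows "j\<^sup>2 - k\<^sup>2 + l\<^sup>2 - m\<^sup>2 = - 2 * ((j - k) * (l - k))" "j \<noteq> k" "l \<noteq> k" "0 \<notin> {j, k, l, m}" "m = j - k + l"
proof -
  show m: "m = j - k + l" and "j \<noteq> k" "0 \<notin> {j, k, l, m}" using assms by (auto simp: Delta_def Zstar_def)
  show "l \<noteq> k" using assms by (auto simp: Delta_def)
  show "j\<^sup>2 - k\<^sup>2 + l\<^sup>2 - m\<^sup>2 = - 2 * ((j - k) * (l - k))"
    unfolding m by (simp add: power2_eq_square algebra_simps)
qed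

lemma nzl_c4: "c4 js \<noteq> 0 \<Longrightarrow> nzl 4 js" and norm_c4_le: "norm (c4 js) \<le> norm (gG js)"
proof -
  have *: "nzl 4 js \<and> norm (c4 js) \<le> norm (gG js)" if nz: "c4 js \<noteq> 0"
  proof -
    obtain j k l m where js: "js = [j, k, l, m]" and D: "(j, k, l, m) \<in> Delta"
      using nz by (auto simp: c4_def simp del: of_int_diff of_int_add of_int_power split: list.splits if_splits)
    note d = Delta_divisor[OF D]
    have n: "nzl 4 js" using d(4,5) by (auto simp: nzl_def js)
    have "j\<^sup>2 - k\<^sup>2 + l\<^sup>2 - m\<^sup>2 \<noteq> 0" unfolding d(1) using d(2,3) by simp
    then have "1 \<le> \<bar>j\<^sup>2 - k\<^sup>2 + l\<^sup>2 - m\<^sup>2\<bar>" by linarith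
    then have 1: "1 \<le> \<bar>real_of_int (j\<^sup>2 - k\<^sup>2 + l\<^sup>2 - m\<^sup>2)\<bar>" by (metis of_int_1_le_iff of_int_abs)
    have "norm (c4 js) = 1 / (4 * pi) * (1 / \<bar>real_of_int (j\<^sup>2 - k\<^sup>2 + l\<^sup>2 - m\<^sup>2)\<bar>)"
      using D by (simp only: c4_def js list.case if_True norm_mult norm_divide norm_ii norm_one norm_of_int norm_numeral norm_of_real abs_of_pos pi_gt_zero)
    also have "\<dots> \<le> 1 / (4 * pi) * 1"
      using 1 by (intro mult_left_mono) (auto simp: divide_le_eq)
    also have "\<dots> = norm (gG js)" using n by (simp add: gG_def norm_divide norm_mult)
    finally show ?thesis using n by blast
  qed
  then show "c4 js \<noteq> 0 \<Longrightarrow> nzl 4 js" by blast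
  show "norm (c4 js) \<le> norm (gG js)" using * by (cases "c4 js = 0") auto
qed

lemma wbd_c4: "wbd 16 c4 js"
proof -
  have "norm (c4 js) * mx js ^ 4 \<le> norm (gG js) * mx js ^ 4"
    by (intro mult_right_mono norm_c4_le) simp
  then show ?thesis
    using wbd_gG[of js] nzl_c4[of js] unfolding wbd_def nzl_def by force
qed

text \<open>The two conjugated slots contribute equally, the 2 cancels against the divisor
  \<open>- 2 * ((a - b) * (c - b))\<close>, and the factor \<i> of \<open>F4\<close> cancels against
  the - \<i> of the vector field. So the kernel is real.\<close>

lemma gker_c4:
  assumes "length js = 3"
  shows "- \<i> * of_int (altsum js) * gker c4 4 js = of_real (xi4 js)"
  using assms
proof (rule list3E)
  fix a b c assume js: "js = [a, b, c]"
  define n where "n = altsum js"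
  have n: "n = a - b + c" by (simp add: n_def js)
  have "{i::nat. i < 4 \<and> odd i} = {1, 3}" unfolding set_eq_iff mem_Collect_eq insert_iff empty_iff by presburger
  then have g: "gker c4 4 js = c4 [c, n, a, b] + c4 [a, b, c, n]"
    by (simp add: gker_def js n algebra_simps)
  show ?thesis
  proof (cases "(a, b, c, n) \<in> Delta")
    case True
    note d = Delta_divisor[OF True]
    have D': "(c, n, a, b) \<in> Delta" using d by (auto simp: Delta_def Zstar_def)
    have d': "c\<^sup>2 - n\<^sup>2 + a\<^sup>2 - b\<^sup>2 = - 2 * ((a - b) * (c - b))" using d(1) by simp
    define P where "P = complex_of_int (- 2 * ((a - b) * (c - b)))"
    have "P \<noteq> 0" unfolding P_def of_int_eq_0_iff using d(2,3) by simp
    have c: "c4 [a, b, c, n] = \<i> / (4 * of_real pi) * (1 / P)" "c4 [c, n, a, b] = \<i> / (4 * of_real pi) * (1 / P)"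
      using True D' by (simp_all only: c4_def list.case if_True d(1) d' P_def)
    have "- \<i> * of_int n * gker c4 4 js = of_int n * 2 / (4 * of_real pi * P)"
      unfolding g c using \<open>P \<noteq> 0\<close> by (simp add: field_simps)
    also have "\<dots> = - of_int n / of_int ((a - b) * (c - b)) / (4 * of_real pi)"
      unfolding P_def of_int_mult[of "- 2"] by simp
    also have "\<dots> = of_real (- real_of_int n / real_of_int ((a - b) * (c - b)) / (4 * pi))"
      by (simp only: of_real_divide of_real_minus of_real_of_int_eq of_real_mult of_real_numeral)
    also have "- real_of_int n / real_of_int ((a - b) * (c - b)) / (4 * pi) = xi4 js"
      using d(2-4) by (simp add: js xi4_def x4_def n)
    finally show ?thesis unfolding n_def .
  next
    case False
    have "c4 [a, b, c, n] = 0" using False by (simp add: c4_def)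
    moreover have "(c, n, a, b) \<notin> Delta" using False by (auto simp: Delta_def n)
    then have "c4 [c, n, a, b] = 0" by (simp add: c4_def)
    moreover have "xi4 js = 0"
      using False by (cases "n = 0") (auto simp: js xi4_def x4_def Delta_def Zstar_def n)
    ultimately show ?thesis by (simp add: g)
  qed
qed

lemma ham_vf_F4:
  assumes s: "3 < s"
  shows "ham_vf F4 (emb s p) = emb s (rX s xi4 (replicate 3 p))"
proof
  fix j
  have k: "kernel 3 (4 * 16) (gker c4 4)"
    using kernel_gker[of 4 16 c4] wbd_c4 by simp
  have "hamcoef c4" using nzl_c4 by (auto simp: hamcoef_def nzl_def)
  then have "ham_vf F4 (emb s p) j = - \<i> * of_int j * emb s (Xmap s (gker c4 4) (replicate 3 p)) j"
    using ham_vf_form[OF s _ wbd_c4 _ _ F4_emb] by simp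
  also have "\<dots> = (\<Sum>\<^sub>\<infinity>js\<in>{js. length js = 3 \<and> altsum js = j}. (- \<i> * of_int j) * (gker c4 4 js * mon js (map (emb s) (replicate 3 p))))"
    unfolding infsum_cmult_right' using emb_Xmap[OF s k, of "replicate 3 p" j] by simp
  also have "\<dots> = (\<Sum>\<^sub>\<infinity>js\<in>{js. length js = 3 \<and> altsum js = j}. of_real (xi4 js) * mon js (map (emb s) (replicate 3 p)))"
    by (intro infsum_cong) (auto simp flip: gker_c4)
  also have "\<dots> = emb s (rX s xi4 (replicate 3 p)) j"
    using emb_Xmap[OF s kernel_xi4, of "replicate 3 p" j] by simp
  finally show "ham_vf F4 (emb s p) j = emb s (rX s xi4 (replicate 3 p)) j" .
qed

section \<open>Limits, integral curves and flows in the weighted spaces\<close>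

lemma limitin_ell2_iff:
  "limitin (ell2_top s) f l F \<longleftrightarrow> l \<in> ell2 s \<and> (\<forall>\<^sub>F u in F. f u \<in> ell2 s) \<and> ((\<lambda>u. unemb s (f u)) \<longlongrightarrow> unemb s l) F"
proof -
  interpret Metric_space "ell2 s" "\<lambda>p q. ell2_norm s (p - q)" by (rule ell2_metric)
  have d: "ell2_norm s (p - q) = dist (unemb s p) (unemb s q)" if "p \<in> ell2 s" "q \<in> ell2 s" for p q
    using that ell2_norm_emb[of s "unemb s p - unemb s q"] by (simp add: emb_simps dist_norm)
  show ?thesis
  proof
    assume L: "limitin (ell2_top s) f l F"
    then have l: "l \<in> ell2 s" and e: "\<And>\<epsilon>. 0 < \<epsilon> \<Longrightarrow> \<forall>\<^sub>F u in F. f u \<in> ell2 s \<and> ell2_norm s (f u - l) < \<epsilon>"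
      unfolding ell2_top_def limitin_metric by auto
    have "\<forall>\<^sub>F u in F. f u \<in> ell2 s" using e[of 1] by (auto elim: eventually_mono)
    moreover have "((\<lambda>u. unemb s (f u)) \<longlongrightarrow> unemb s l) F"
      unfolding tendsto_iff
    proof (intro allI impI)
      fix \<epsilon> :: real assume "0 < \<epsilon>"
      from e[OF this] show "\<forall>\<^sub>F u in F. dist (unemb s (f u)) (unemb s l) < \<epsilon>"
        by eventually_elim (use l in \<open>auto simp: d\<close>)
    qed
    ultimately show "l \<in> ell2 s \<and> (\<forall>\<^sub>F u in F. f u \<in> ell2 s) \<and> ((\<lambda>u. unemb s (f u)) \<longlongrightarrow> unemb s l) F"
      using l by blast
  next
    assume R: "l \<in> ell2 s \<and> (\<forall>\<^sub>F u in F. f u \<in> ell2 s) \<and> ((\<lambda>u. unemb s (f u)) \<longlongrightarrow> unemb s l) F"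
    show "limitin (ell2_top s) f l F"
      unfolding ell2_top_def limitin_metric
    proof (intro conjI allI impI)
      fix \<epsilon> :: real assume "0 < \<epsilon>"
      then have "\<forall>\<^sub>F u in F. dist (unemb s (f u)) (unemb s l) < \<epsilon>" using R by (auto simp: tendsto_iff)
      then show "\<forall>\<^sub>F u in F. f u \<in> ell2 s \<and> ell2_norm s (f u - l) < \<epsilon>"
        using conjunct1[OF conjunct2[OF R]] by eventually_elim (use R in \<open>auto simp: d\<close>)
    qed (use R in blast)
  qed
qed

lemma integral_curve_iff:
  assumes X: "\<And>p. X (emb s p) = emb s (A (replicate b p))"
  shows "integral_curve s X 1 \<gamma> \<longleftrightarrow> (\<forall>t\<in>{0..1}. \<gamma> t \<in> ell2 s) \<and> sol b A (\<lambda>t. unemb s (\<gamma> t))"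
proof -
  have "limitin (ell2_top s) (\<lambda>u. rscale (1 / (u - t)) (\<gamma> u - \<gamma> t)) (X (\<gamma> t)) (at t within {0..1}) \<longleftrightarrow>
      ((\<lambda>t. unemb s (\<gamma> t)) has_vector_derivative A (replicate b (unemb s (\<gamma> t)))) (at t within {0..1})"
    if g: "\<forall>t\<in>{0..1}. \<gamma> t \<in> ell2 s" and t: "t \<in> {0..1}" for t
  proof -
    define y where "y = (\<lambda>t. unemb s (\<gamma> t))"
    have y: "\<gamma> u = emb s (y u)" if "u \<in> {0..1}" for u using g that by (simp add: y_def)
    have e: "rscale (1 / (u - t)) (\<gamma> u - \<gamma> t) = emb s ((1 / (u - t)) *\<^sub>R (y u - y t))" if "u \<in> {0..1}" for u
      by (simp only: y[OF that] y[OF t] emb_simps)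
    have ev: "\<forall>\<^sub>F u in at t within {0..1}. u \<in> {0..1::real}"
      by (auto simp: eventually_at_filter)
    have "limitin (ell2_top s) (\<lambda>u. rscale (1 / (u - t)) (\<gamma> u - \<gamma> t)) (X (\<gamma> t)) (at t within {0..1}) \<longleftrightarrow>
      ((\<lambda>u. unemb s (rscale (1 / (u - t)) (\<gamma> u - \<gamma> t))) \<longlongrightarrow> A (replicate b (y t))) (at t within {0..1})"
      unfolding limitin_ell2_iff X y[OF t] unemb_emb
      using ev by (auto elim!: eventually_mono simp: e[unfolded y[OF t]])
    also have "\<dots> \<longleftrightarrow> ((\<lambda>u. (1 / (u - t)) *\<^sub>R (y u - y t)) \<longlongrightarrow> A (replicate b (y t))) (at t within {0..1})"
      by (rule tendsto_cong) (use ev in \<open>auto elim!: eventually_mono simp: e\<close>)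
    finally show ?thesis unfolding has_vector_derivative_within_quotient y_def .
  qed
  then show ?thesis unfolding integral_curve_def sol_def by blast
qed

text \<open>The end point is unique among all curves in \<open>ell2 s\<close>, since
  \<open>flow_curve_eq\<close> rests on the unrestricted uniqueness
  \<open>sol_unique\<close>.\<close>

lemma flow_map_emb:
  assumes X: "\<And>p. X (emb s p) = emb s (A (replicate b p))"
    and fr: "flow_radius b A D r" and p: "norm p \<le> r / 2"
  shows "emb s p \<in> flow_domain s X 1" "flow_map s X 1 (emb s p) = emb s (time1 b A p)"
proof -
  have "flows_to s X 1 (emb s p) p' \<longleftrightarrow> p' = emb s (time1 b A p)" for p'
  proof
    assume "flows_to s X 1 (emb s p) p'"
    then obtain \<gamma> where g: "integral_curve s X 1 \<gamma>" "\<gamma> 0 = emb s p" "\<gamma> 1 = p'"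
      unfolding flows_to_def by blast
    then have "unemb s (\<gamma> 1) = time1 b A p" "\<gamma> 1 \<in> ell2 s"
      using flow_curve_eq[OF fr p, of "\<lambda>t. unemb s (\<gamma> t)" 1] by (auto simp: integral_curve_iff[of X s A b, OF X])
    then show "p' = emb s (time1 b A p)" using g(3) by (metis emb_unemb)
  next
    assume p': "p' = emb s (time1 b A p)"
    show "flows_to s X 1 (emb s p) p'"
      unfolding flows_to_def integral_curve_iff[of X s A b, OF X]
      by (intro exI[of _ "\<lambda>t. emb s (flow_curve b A p t)"])
        (simp add: p' flow_curve_0[OF fr p] flow_curve_sol[OF fr p])
  qed
  then show "emb s p \<in> flow_domain s X 1" "flow_map s X 1 (emb s p) = emb s (time1 b A p)"
    unfolding flow_domain_def flow_map_def by auto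
qed


section \<open>Composition of the two transformations\<close>

lemma gclass_mono:
  assumes "gclass A \<rho> c" "A \<le> A'" "\<rho> \<le> \<rho>'"
  shows "gclass A' \<rho>' c"
proof -
  have "A * \<rho> ^ length js \<le> A' * \<rho>' ^ length js" for js :: "int list"
    using assms by (intro mult_mono power_mono) (auto simp: gclass_def)
  then show ?thesis
    using assms unfolding gclass_def by (auto intro: wbd_mono)
qed

lemma gclass_add:
  assumes "gclass A \<rho> c" "gclass A' \<rho>' d"
  shows "gclass (A + A') (max \<rho> \<rho>') (\<lambda>js. c js + d js)"
proof -
  have c: "gclass A (max \<rho> \<rho>') c" and d: "gclass A' (max \<rho> \<rho>') d"
    using assms gclass_mono by auto
  show ?thesis
    unfolding gclass_def
  proof (intro conjI allI)
    fix js :: "int list"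
    let ?q = "(max \<rho> \<rho>') ^ length js"
    have "norm (c js + d js) * mx js ^ 4 \<le> norm (c js) * mx js ^ 4 + norm (d js) * mx js ^ 4"
      unfolding distrib_right[symmetric] by (intro mult_right_mono norm_triangle_ineq) simp
    also have "\<dots> \<le> A * ?q * (pr js)\<^sup>2 + A' * ?q * (pr js)\<^sup>2"
      using c d unfolding gclass_def wbd_def by (intro add_mono) blast+
    finally show "wbd ((A + A') * ?q) (\<lambda>js. c js + d js) js"
      using c d unfolding gclass_def wbd_def by (simp add: distrib_right)
  qed (use c d in \<open>auto simp: gclass_def\<close>)
qed

lemma gclass_cmult:
  assumes "gclass A \<rho> c"
  shows "gclass (norm a * A) \<rho> (\<lambda>js. a * c js)"
proof -
  have "norm a * (norm (c js) * mx js ^ 4) \<le> norm a * (A * \<rho> ^ length js * (pr js)\<^sup>2)" for js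
    using assms by (intro mult_left_mono) (auto simp: gclass_def wbd_def)
  then show ?thesis using assms by (auto simp: gclass_def wbd_def norm_mult mult.assoc)
qed

lemma gclass_restrict:
  assumes "gclass A \<rho> c"
  shows "gclass A \<rho> (\<lambda>js. if P js then c js else 0)"
  using assms by (auto simp: gclass_def wbd_def)

lemma Fsum_eq_form:
  assumes "\<And>js. c js \<noteq> 0 \<Longrightarrow> length js = m"
  shows "Fsum s c x = form s c (replicate m x)"
  unfolding Fsum_def form_def by (rule infsum_cong_neutral) (use assms in auto)

lemma Top_eq_0:
  assumes "1 \<le> b" "\<And>ks. length ks + b = length js + 1 \<Longrightarrow> c ks = 0"
  shows "Top b \<xi> c js = 0"
  unfolding Top_def
proof (rule sum.neutral, intro ballI)
  fix i assume "i \<in> {..<length js + 1 - b}"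
  then have "length (take i js @ altsum (take b (drop i js)) # drop (i + b) js) + b = length js + 1"
    using assms(1) by auto
  then show "c (take i js @ altsum (take b (drop i js)) # drop (i + b) js) * of_real (\<xi> (take b (drop i js))) = 0"
    using assms(2) by simp
qed

lemma Top_funpow_low:
  assumes b: "1 \<le> b" and c: "\<And>ks. length ks < m \<Longrightarrow> c ks = 0"
  shows "length js < m + k * (b - 1) \<Longrightarrow> (Top b \<xi> ^^ k) c js = 0"
proof (induction k arbitrary: js)
  case (Suc k)
  show ?case
    unfolding funpow.simps comp_def
  proof (rule Top_eq_0[OF b])
    fix ks :: "int list" assume "length ks + b = length js + 1"
    then have "length ks < m + k * (b - 1)" using Suc.prems b by simp
    then show "(Top b \<xi> ^^ k) c ks = 0" by (rule Suc.IH)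
  qed
qed (use c in simp)

text \<open>Two applications raise the degree by \<open>2 * (b - 1)\<close>, so below
  \<open>m + 2 * (b - 1)\<close> only the orders 0 and 1 are left.\<close>

lemma Elie_low:
  assumes b: "2 \<le> b" and c: "\<And>ks. length ks < m \<Longrightarrow> c ks = 0" and js: "length js < m + 2 * (b - 1)"
  shows "Elie w b \<xi> c js = of_real (w 0) * c js + of_real (w 1) * Top b \<xi> c js"
proof -
  let ?t = "\<lambda>k. of_real (w k) * (Top b \<xi> ^^ k) c js"
  \<comment> \<open>The added term is zero; it brings the order 1 into range for the empty list as
    well.\<close>
  have "Elie w b \<xi> c js = (\<Sum>k\<le>Suc (length js). ?t k)"
  proof -
    have "length js < Suc (length js) * 1" by simp
    also have "\<dots> \<le> Suc (length js) * (b - 1)" using b by (intro mult_left_mono) auto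
    finally have "(Top b \<xi> ^^ Suc (length js)) c js = 0" by (rule Top_funpow_short[OF b])
    then show ?thesis unfolding Elie_def sum.atMost_Suc by simp
  qed
  also have "\<dots> = (\<Sum>k\<in>{0, 1}. ?t k)"
  proof (rule sum.mono_neutral_right)
    show "\<forall>k\<in>{..Suc (length js)} - {0, 1}. ?t k = 0"
    proof
      fix k assume "k \<in> {..Suc (length js)} - {0, 1}"
      then have "2 * (b - 1) \<le> k * (b - 1)" by (intro mult_right_mono) auto
      then have "length js < m + k * (b - 1)" using js by linarith
      then have "(Top b \<xi> ^^ k) c js = 0" using Top_funpow_low[of b m c js k \<xi>] b c by simp
      then show "?t k = 0" by simp
    qed
  qed auto
  finally show ?thesis by simp
qed

lemma Top_add: "Top b \<xi> (\<lambda>js. c js + d js) js = Top b \<xi> c js + Top b \<xi> d js"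
  by (simp add: Top_def distrib_right sum.distrib)

lemma Top_cmult: "Top b \<xi> (\<lambda>js. a * c js) js = a * Top b \<xi> c js"
  by (simp add: Top_def sum_distrib_left mult.assoc)

lemma zsupp_Elie:
  assumes c: "zsupp c" and \<xi>: "rker b E \<xi>" and b: "odd b"
  shows "zsupp (Elie w b \<xi> c)"
proof -
  have k: "zsupp ((Top b \<xi> ^^ k) c)" for k
    by (induction k) (auto intro: c zsupp_Top[OF _ \<xi> b])
  show ?thesis
    unfolding zsupp_def
  proof (intro allI impI)
    fix js assume "Elie w b \<xi> c js \<noteq> 0"
    then obtain n where "(Top b \<xi> ^^ n) c js \<noteq> 0"
      unfolding Elie_def by (metis (no_types, lifting) mult_zero_right sum.neutral)
    then show "even (length js) \<and> 0 \<notin> set js \<and> altsum js = 0"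
      using k[of n] unfolding zsupp_def by blast
  qed
qed

lemma zsupp_add: "zsupp c \<Longrightarrow> zsupp d \<Longrightarrow> zsupp (\<lambda>js. c js + d js)"
  unfolding zsupp_def by (metis add_0)

section \<open>One normal form step, and its application in degrees four and six\<close>

lemma eventually_cmult_norm_less_1: "\<forall>\<^sub>F x in nhds (0::'a::real_normed_vector). C * norm x < 1"
proof (rule order_tendstoD(2))
  show "((\<lambda>x::'a. C * norm x) \<longlongrightarrow> C * norm (0::'a)) (nhds 0)"
    by (intro tendsto_intros filterlim_ident)
qed simp

lemma eventually_norm_le: "0 < r \<Longrightarrow> \<forall>\<^sub>F x in nhds (0::'a::real_normed_vector). norm x \<le> r"
  using eventually_cmult_norm_less_1[of "1 / r"] by (rule eventually_mono) (simp add: divide_less_eq)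

lemma Fsum_add:
  assumes s: "3 < s" and c: "gclass A \<rho> c" and d: "gclass A' \<rho>' d"
  shows "\<forall>\<^sub>F x in nhds 0. Fsum s (\<lambda>js. c js + d js) x = Fsum s c x + Fsum s d x"
  using eventually_cmult_norm_less_1[of "\<rho> * emb_const s"] eventually_cmult_norm_less_1[of "\<rho>' * emb_const s"]
proof eventually_elim
  case (elim x)
  then show ?case
    using infsum_add[OF has_sum_imp_summable[OF Fsum_has_sum[OF s c]] has_sum_imp_summable[OF Fsum_has_sum[OF s d]], of x]
    by (simp add: Fsum_def distrib_right mult.assoc)
qed

abbreviation expw :: "nat \<Rightarrow> real" where
  "expw \<equiv> \<lambda>k. 1 / fact k"

abbreviation expw1 :: "nat \<Rightarrow> real" where
  "expw1 \<equiv> \<lambda>k. 1 / fact (Suc k)"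

lemma expw_le: "\<bar>expw k\<bar> \<le> 1 / fact k" "\<bar>expw1 k\<bar> \<le> 1 / fact k"
proof -
  have "(fact k :: real) \<le> fact (Suc k)" by (rule fact_mono) simp
  then have "1 / (fact (Suc k) :: real) \<le> 1 / fact k" by (intro divide_left_mono) auto
  then show "\<bar>expw k\<bar> \<le> 1 / fact k" "\<bar>expw1 k\<bar> \<le> 1 / fact k" by (simp_all del: fact_Suc)
qed

text \<open>The part in the class is moved by the plain Lie series. \<open>Lam\<close> is moved by
  the shifted series, which begins with its first bracket, known on the diagonal from the
  homological equation.\<close>

lemma birkhoff_step:
  assumes s: "3 < s" and b: "odd b" "3 \<le> b" and \<xi>: "rker b E \<xi>"
    and g: "gclass A \<rho> g" and c: "gclass A' \<rho>' c" and supp: "\<And>js. c js \<noteq> 0 \<Longrightarrow> length js = b + 1"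
    and eq: "\<And>y. form s (Top b \<xi> hL) (replicate (b + 1) y) = form s c (replicate (b + 1) y)"
  shows "\<forall>\<^sub>F x in nhds 0. form s hL (replicate 2 (time1 b (rX s \<xi>) x)) + Fsum s g (time1 b (rX s \<xi>) x) =
    form s hL (replicate 2 x) + Fsum s (\<lambda>js. Elie expw b \<xi> g js + Elie expw1 b \<xi> c js) x"
proof -
  obtain r where r: "0 < r" and fr: "flow_radius b (rX s \<xi>) (kconst s b E) r"
    using rX_flow_radius[OF s b(2) \<xi>] by blast
  then have r2: "0 < r / 2" by simp
  have h: "mlin 2 (form s hL) (1 * emb_const s ^ 2)" by (rule mlin_form[OF s crude_hL])
  have sub: "subst b (rX s \<xi>) (form s hL) (replicate (2 + b - 1) y) = form s c (replicate (2 + b - 1) y)" for y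
    using form_Top[OF s b(1) \<xi> crude_hL, of "replicate (b + 1) y"] eq[of y] b(2) by simp
  have supp': "\<And>js. length js \<noteq> 2 + b - 1 \<Longrightarrow> c js = 0" using supp by force
  show ?thesis
    using eventually_norm_le[OF r2] eventually_cmult_norm_less_1[of "\<rho>' * exp (real b ^ 4 * E) * emb_const s"]
      eventually_cmult_norm_less_1[of "\<rho> * exp (real b ^ 4 * E) * emb_const s * 2"]
      Fsum_add[OF s gclass_Elie[OF \<xi> g expw_le(1)] gclass_Elie[OF \<xi> c expw_le(2)]]
  proof eventually_elim
    case (elim x)
    have "Fsum s g (time1 b (rX s \<xi>) x) = Fsum s (Elie expw b \<xi> g) x"
      using Fsum_time1[OF s b \<xi> g fr elim(1)] elim(3) by (simp add: mult_ac)
    moreover have "form s hL (replicate 2 (time1 b (rX s \<xi>) x)) = form s hL (replicate 2 x) + Fsum s (Elie expw1 b \<xi> c) x"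
      using elim(2) by (intro form_time1_shifted[OF s b \<xi> c fr elim(1) _ supp' h sub]) (simp_all add: mult_ac)
    ultimately show ?case using elim(4) by simp
  qed
qed

text \<open>\<open>c1\<close> and \<open>c3\<close> are the coefficients of \<open>H \<circ> \<Psi> - Lam\<close> and of \<open>H \<circ> \<Psi> \<circ> \<Phi> - Lam\<close>, and \<open>d6\<close> those of
  the bracket of \<open>Lam\<close> with the generator of \<open>\<Phi>\<close>.\<close>

definition c1 :: "int list \<Rightarrow> complex" where
  "c1 js = Elie expw 3 xi4 gG js + Elie expw1 3 xi4 (\<lambda>js. (- 1) * gD js) js"

definition d6 :: "int list \<Rightarrow> complex" where
  "d6 js = k6 js + (- 1) * (if length js = 6 then c1 js else 0)"

definition c3 :: "int list \<Rightarrow> complex" where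
  "c3 js = Elie expw 5 xi6 c1 js + Elie expw1 5 xi6 d6 js"

definition cR :: "int list \<Rightarrow> complex" where
  "cR js = (if 8 \<le> length js then c3 js else 0)"

lemma length_gG: "gG js \<noteq> 0 \<Longrightarrow> length js = 4" and length_gD: "gD js \<noteq> 0 \<Longrightarrow> length js = 4"
  and length_k6: "k6 js \<noteq> 0 \<Longrightarrow> length js = 6"
  using nzl_gG nzl_gD nzl_k6 by (auto simp: nzl_def)

text \<open>In degree six the second weights 1 of \<open>expw\<close> and 1/2 of
  \<open>expw1\<close> meet; their combination is the bracket of \<open>gU\<close>.\<close>

lemma c1_low:
  "length js < 4 \<Longrightarrow> c1 js = 0"
  "length js = 4 \<Longrightarrow> c1 js = gG js - gD js"
  "length js = 6 \<Longrightarrow> c1 js = Top 3 xi4 gU js"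
proof -
  have c1: "c1 js = gG js - gD js + (Top 3 xi4 gG js + (- 1 / 2) * Top 3 xi4 gD js)" if "length js < 8" for js
  proof -
    have "Elie expw 3 xi4 gG js = of_real (expw 0) * gG js + of_real (expw 1) * Top 3 xi4 gG js"
      by (rule Elie_low[where m = 4]) (use that length_gG in force)+
    moreover have "Elie expw1 3 xi4 (\<lambda>js. (- 1) * gD js) js =
        of_real (expw1 0) * ((- 1) * gD js) + of_real (expw1 1) * Top 3 xi4 (\<lambda>js. (- 1) * gD js) js"
      by (rule Elie_low[where m = 4]) (use that length_gD in force)+
    ultimately show ?thesis unfolding c1_def Top_cmult by simp
  qed
  have T: "Top 3 xi4 gG js = 0" "Top 3 xi4 gD js = 0" if "length js < 6" for js
    by (rule Top_eq_0; use that length_gG length_gD in force)+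
  show "length js < 4 \<Longrightarrow> c1 js = 0"
    using c1[of js] T[of js] length_gG[of js] length_gD[of js] by fastforce
  show "length js = 4 \<Longrightarrow> c1 js = gG js - gD js"
    using c1[of js] T[of js] by simp
  have "Top 3 xi4 gU js = Top 3 xi4 gG js + (- 1 / 2) * Top 3 xi4 gD js"
    using Top_add[of 3 xi4 gG "\<lambda>js. (- 1 / 2) * gD js" js] Top_cmult[of 3 xi4 "- 1 / 2" gD js] by (simp only: gU_def[abs_def])
  then show "length js = 6 \<Longrightarrow> c1 js = Top 3 xi4 gU js"
    using c1[of js] length_gG[of js] length_gD[of js] by fastforce
qed

lemma zsupp_gG: "zsupp gG" and zsupp_gD: "zsupp (\<lambda>js. (- 1) * gD js)" and zsupp_k6: "zsupp k6"
  using nzl_gG nzl_gD nzl_k6 by (auto simp: zsupp_def nzl_def)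

lemma zsupp_c1: "zsupp c1"
  unfolding c1_def[abs_def]
  by (intro zsupp_add zsupp_Elie[OF zsupp_gG kernel_xi4] zsupp_Elie[OF zsupp_gD kernel_xi4]) auto

lemma zsupp_d6: "zsupp d6"
  unfolding d6_def[abs_def]
  by (intro zsupp_add zsupp_k6) (use zsupp_c1 in \<open>auto simp: zsupp_def\<close>)

lemma zsupp_cR: "zsupp cR"
proof -
  have "zsupp c3"
    unfolding c3_def[abs_def]
    by (intro zsupp_add zsupp_Elie[OF zsupp_c1 kernel_xi6] zsupp_Elie[OF zsupp_d6 kernel_xi6]) auto
  then show ?thesis by (auto simp: zsupp_def cR_def)
qed

lemma length_d6: "d6 js \<noteq> 0 \<Longrightarrow> length js = 6"
  using length_k6[of js] by (auto simp: d6_def split: if_splits)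

text \<open>\<open>xi6\<close> raises the degree by four, so below degree 8 the series leaves
  \<open>c1 + d6\<close>: the terms of degree four are untouched, and those of degree six become
  \<open>k6\<close> by the choice of \<open>d6\<close>.\<close>

lemma c3_eq: "c3 js = (gG js - gD js) + (k6 js + cR js)"
proof (cases "length js < 8")
  case True
  have T: "Top 5 xi6 c1 js = 0" "Top 5 xi6 d6 js = 0"
    using True by (intro Top_eq_0; use c1_low(1) length_d6 in force)+
  have "Elie expw 5 xi6 c1 js = of_real (expw 0) * c1 js + of_real (expw 1) * Top 5 xi6 c1 js"
    by (rule Elie_low[where m = 4]) (use True c1_low(1) in auto)
  moreover have "Elie expw1 5 xi6 d6 js = of_real (expw1 0) * d6 js + of_real (expw1 1) * Top 5 xi6 d6 js"
    by (rule Elie_low[where m = 4]) (use True length_d6 in force)+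
  ultimately have c3: "c3 js = c1 js + d6 js" unfolding c3_def T by simp
  consider "odd (length js)" | "length js < 4" | "length js = 4" | "length js = 6"
    using True by atomize_elim presburger
  then show ?thesis
  proof cases
    case 1
    then have "c1 js = 0" "d6 js = 0" using zsupp_c1 zsupp_d6 by (auto simp: zsupp_def)
    moreover have "length js \<noteq> 4" "length js \<noteq> 6" using 1 by auto
    then have "gG js = 0" "gD js = 0" "k6 js = 0" using length_gG length_gD length_k6 by blast+
    ultimately show ?thesis using c3 True by (simp add: cR_def)
  next
    case 2
    then have "length js \<noteq> 4" "length js \<noteq> 6" by auto
    then have "gG js = 0" "gD js = 0" "k6 js = 0" "d6 js = 0"
      using length_gG length_gD length_k6 length_d6 by blast+
    then show ?thesis using 2 c3 c1_low(1)[of js] by (simp add: cR_def)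
  next
    case 3
    then have "k6 js = 0" "d6 js = 0" using length_k6[of js] length_d6[of js] by auto
    then show ?thesis using 3 c3 c1_low(2)[of js] by (simp add: cR_def)
  next
    case 4
    then have "gG js = 0" "gD js = 0" using length_gG[of js] length_gD[of js] by auto
    then show ?thesis using 4 c3 by (simp add: cR_def d6_def)
  qed
next
  case False
  then have "gG js = 0" "gD js = 0" "k6 js = 0"
    using length_gG[of js] length_gD[of js] length_k6[of js] by auto
  with False show ?thesis by (simp add: cR_def)
qed

lemma gclass_c1_d6_cR:
  "\<exists>A \<rho>. gclass A \<rho> c1" "\<exists>A \<rho>. gclass A \<rho> d6" "\<exists>A \<rho>. gclass A \<rho> cR"
proof -
  show c1: "\<exists>A \<rho>. gclass A \<rho> c1"
    unfolding c1_def[abs_def]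
    using gclass_add[OF gclass_Elie[OF kernel_xi4 gclass_gG expw_le(1)] gclass_Elie[OF kernel_xi4 gclass_cmult[OF gclass_gD, of "- 1"] expw_le(2)]]
    by blast
  then obtain A \<rho> where c1': "gclass A \<rho> c1" by blast
  show d6: "\<exists>A \<rho>. gclass A \<rho> d6"
    unfolding d6_def[abs_def]
    using gclass_add[OF gclass_k6 gclass_cmult[OF gclass_restrict[OF c1', of "\<lambda>js. length js = 6"], of "- 1"]] by blast
  then obtain A' \<rho>' where d6': "gclass A' \<rho>' d6" by blast
  show "\<exists>A \<rho>. gclass A \<rho> cR"
    unfolding cR_def[abs_def] c3_def
    using gclass_restrict[OF gclass_add[OF gclass_Elie[OF kernel_xi6 c1' expw_le(1)] gclass_Elie[OF kernel_xi6 d6' expw_le(2)]], of "\<lambda>js. 8 \<le> length js"] by blast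
qed

lemma H_Psi:
  assumes s: "3 < s"
  shows "\<forall>\<^sub>F x in nhds 0. emb s x \<in> Psi_domain s \<and> H (Psi s (emb s x)) = form s hL (replicate 2 x) + Fsum s c1 x"
proof -
  obtain r where r: "0 < r" and fr: "flow_radius 3 (rX s xi4) (kconst s 3 1) r"
    using rX_flow_radius[OF s _ kernel_xi4] by auto
  then have r2: "0 < r / 2" by simp
  have "\<forall>\<^sub>F x in nhds 0. form s hL (replicate 2 (time1 3 (rX s xi4) x)) + Fsum s gG (time1 3 (rX s xi4) x) =
      form s hL (replicate 2 x) + Fsum s c1 x"
    unfolding c1_def[abs_def]
  proof (rule birkhoff_step[OF s _ _ kernel_xi4 gclass_gG gclass_cmult[OF gclass_gD]])
    show "form s (Top 3 xi4 hL) (replicate (3 + 1) y) = form s (\<lambda>js. (- 1) * gD js) (replicate (3 + 1) y)" for y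
      using form_Top_hL[OF s, of y] by simp
  qed (use length_gD in auto)
  then show ?thesis
    using eventually_norm_le[OF r2]
  proof eventually_elim
    case (elim x)
    note F = flow_map_emb[of "ham_vf F4", OF ham_vf_F4[OF s] fr elim(2)]
    have "H (emb s y) = form s hL (replicate 2 y) + Fsum s gG y" for y
      unfolding H_def Lam_emb G_emb using Fsum_eq_form[of gG 4 s y] length_gG by simp
    then show ?case using F elim(1) by (simp add: Psi_domain_def Psi_def)
  qed
qed

lemma time1_tendsto_0:
  fixes A :: "'a::{real_inner, banach} list \<Rightarrow> 'a"
  assumes "flow_radius b A D r"
  shows "filterlim (time1 b A) (nhds 0) (nhds 0)"
proof (rule tendstoI)
  fix e :: real assume e: "0 < e"
  have r: "0 < r" using assms by (simp add: flow_radius_def)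
  then have "0 < min (r / 2) (e / 3)" using e by simp
  from eventually_norm_le[OF this] show "\<forall>\<^sub>F x in nhds 0. dist (time1 b A x) 0 < e"
  proof eventually_elim
    case (elim x)
    then have "norm (time1 b A x) \<le> 2 * norm x" using flow_curve_norm[OF assms, of x 1] by simp
    then show ?case using elim e by simp
  qed
qed

lemma H_Psi_Phi:
  assumes s: "3 < s"
  shows "\<forall>\<^sub>F x in nhds 0. emb s (time1 5 (rX s xi6) x) \<in> Psi_domain s \<and>
    H (Psi s (emb s (time1 5 (rX s xi6) x))) = Lam (emb s x) + B (emb s x) + K (emb s x) + Fsum s cR x"
proof -
  obtain A \<rho> A' \<rho>' A'' \<rho>'' where c1: "gclass A \<rho> c1" and d6: "gclass A' \<rho>' d6" and cR: "gclass A'' \<rho>'' cR"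
    using gclass_c1_d6_cR by blast
  obtain r where fr: "flow_radius 5 (rX s xi6) (kconst s 5 25000000) r"
    using rX_flow_radius[OF s _ kernel_xi6] by auto
  have "\<forall>\<^sub>F x in nhds 0. form s hL (replicate 2 (time1 5 (rX s xi6) x)) + Fsum s c1 (time1 5 (rX s xi6) x) =
      form s hL (replicate 2 x) + Fsum s c3 x"
    unfolding c3_def[abs_def]
  proof (rule birkhoff_step[OF s _ _ kernel_xi6 c1 d6])
    show "form s (Top 5 xi6 hL) (replicate (5 + 1) y) = form s d6 (replicate (5 + 1) y)" for y
    proof -
      have "form s d6 (replicate 6 y) = form s (\<lambda>js. k6 js + (- 1) * Top 3 xi4 gU js) (replicate 6 y)"
        unfolding form_def by (intro infsum_cong) (simp add: d6_def c1_low(3))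
      then show ?thesis using form_Top_xi6_hL[OF s, of y] by simp
    qed
  qed (use length_d6 in auto)
  moreover have "\<forall>\<^sub>F x in nhds 0. emb s (time1 5 (rX s xi6) x) \<in> Psi_domain s \<and>
      H (Psi s (emb s (time1 5 (rX s xi6) x))) = form s hL (replicate 2 (time1 5 (rX s xi6) x)) + Fsum s c1 (time1 5 (rX s xi6) x)"
    using H_Psi[OF s] time1_tendsto_0[OF fr] by (rule eventually_compose_filterlim)
  moreover have gB: "gclass (16 + norm (- 1 :: complex) * 16) (max 1 1) (\<lambda>js. gG js + (- 1) * gD js)"
    by (rule gclass_add[OF gclass_gG gclass_cmult[OF gclass_gD]])
  note Fsum_add[OF s gB gclass_add[OF gclass_k6 cR]]
  moreover note Fsum_add[OF s gclass_k6 cR]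
  ultimately show ?thesis
  proof eventually_elim
    case (elim x)
    have "Fsum s (\<lambda>js. gG js + (- 1) * gD js) x = form s (\<lambda>js. gG js + (- 1) * gD js) (replicate 4 x)"
    proof (rule Fsum_eq_form)
      show "length js = 4" if "gG js + (- 1) * gD js \<noteq> 0" for js
        using that length_gG[of js] length_gD[of js] by (cases "gG js = 0") auto
    qed
    then have "Fsum s (\<lambda>js. gG js + (- 1) * gD js) x = B (emb s x)"
      unfolding B_emb[OF s] by simp
    moreover have "Fsum s k6 x = K (emb s x)"
      unfolding K_emb by (rule Fsum_eq_form) (rule length_k6)
    moreover have "c3 = (\<lambda>js. (gG js + (- 1) * gD js) + (k6 js + cR js))"
      by (simp add: c3_eq fun_eq_iff)
    ultimately have "Fsum s c3 x = B (emb s x) + (K (emb s x) + Fsum s cR x)"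
      using elim(3,4) by simp
    then show ?case using elim(1,2) by (simp add: Lam_emb add.assoc)
  qed
qed


section \<open>The remainder\<close>

definition Rem :: "cseq \<Rightarrow> complex" where
  "Rem q = (\<Sum>\<^sub>\<infinity>js. cR js * mon js (replicate (length js) q))"

lemma Rem_emb: "Rem (emb s x) = Fsum s cR x"
  by (simp add: Rem_def Fsum_def)

lemma monomial_eq_mon: "monomial js q = mon js (replicate (length js) q)"
proof (induction js)
  case (Cons j js)
  have "monomial (j # js) q = q j * (\<Prod>i<length js. if even (Suc i) then q (js ! i) else cnj (q (js ! i)))"
    unfolding monomial_def length_Cons prod.lessThan_Suc_shift nth_Cons_0 nth_Cons_Suc by simp
  also have "(\<Prod>i<length js. if even (Suc i) then q (js ! i) else cnj (q (js ! i))) = cnj (monomial js q)"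
    unfolding monomial_def cnj_prod by (intro prod.cong) auto
  finally show ?case by (simp add: Cons)
qed (simp add: monomial_def)

lemma altsum_eq_sum: "altsum js = (\<Sum>i<length js. (- 1) ^ i * js ! i)"
  by (induction js) (simp_all add: sum.lessThan_Suc_shift sum_negf del: sum.lessThan_Suc)

lemma M_eq: "M r = {js. nzl (2 * r) js}"
  unfolding M_def nzl_def altsum_eq_sum Zstar_def by auto

text \<open>Dividing the product of all entries by the maximum once deletes it, and once more gives
  the denominator; the sorting disappears.\<close>

lemma jstar_ratio_eq:
  assumes "js \<noteq> []"
  shows "jstar_ratio js = pr js / (mx js)\<^sup>2"
proof -
  have "length (jstar js) = length js" by (simp add: jstar_def)
  then obtain h t where L: "jstar js = h # t" using assms by (cases "jstar js") auto
  have set: "set (h # t) = abs ` set js" unfolding L[symmetric] by (simp add: jstar_def)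
  have "sorted_wrt (\<ge>) (jstar js)" by (simp add: jstar_def sorted_wrt_rev)
  then have le: "x \<le> h" if "x \<in> set (h # t)" for x using that unfolding L by auto
  have "mset (h # t) = mset (map abs js)" unfolding L[symmetric] by (simp add: jstar_def)
  then have "prod_list (h # t) = prod_list (map abs js)" by (metis prod_mset_prod_list)
  then have "real_of_int (h * prod_list t) = real_of_int (prod_list (map abs js))" by simp
  also have "\<dots> = pr js" by (induction js) simp_all
  finally have p: "real_of_int h * real_of_int (prod_list t) = pr js" by simp
  have "real_of_int h \<le> mx js"
  proof -
    obtain j where "j \<in> set js" "h = \<bar>j\<bar>" using set by auto
    then show ?thesis using le_mx[of j js] by simp
  qed
  moreover have "mx js \<le> real_of_int h"
  proof -
    obtain us j ws where j: "js = us @ j # ws" "mx js = \<bar>real_of_int j\<bar>" using mx_attained[OF assms] by blast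
    have "\<bar>j\<bar> \<le> h" by (rule le, unfold set j(1)) simp
    then show ?thesis unfolding j(2) by linarith
  qed
  ultimately have h: "real_of_int h = mx js" by simp
  show ?thesis
    unfolding jstar_ratio_def L list.sel p[symmetric] h by (simp add: power2_eq_square)
qed

lemma coefficient_bound:
  assumes c: "gclass A \<rho> c" and js: "js \<in> M r" and r: "1 \<le> r"
  shows "cmod (c js) < (4 * (A + 1) * \<rho>\<^sup>2) ^ r * jstar_ratio js powr (5 / 2)"
proof -
  define W where "W = pr js / (mx js)\<^sup>2"
  have A: "0 \<le> A" "1 \<le> \<rho>" using c by (auto simp: gclass_def)
  have n: "nzl (2 * r) js" using js by (simp add: M_eq)
  then have ne: "js \<noteq> []" and nz: "0 \<notin> set js" and len: "length js = 2 * r" using r by (auto simp: nzl_def)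
  have m: "1 \<le> mx js" by (rule mx_ge_1[OF ne nz])
  have p: "1 \<le> pr js" by (rule pr_ge_1[OF nz])
  have "(mx js)\<^sup>2 \<le> (2 * r) * pr js" using mx_square_le_pr[OF n] r by simp
  then have W: "1 \<le> 2 * real r * W" and W0: "0 < W"
    using m p by (simp_all add: W_def le_divide_eq)
  have "cmod (c js) * mx js ^ 4 \<le> A * \<rho> ^ (2 * r) * (pr js)\<^sup>2"
    using c len unfolding gclass_def wbd_def by metis
  then have "cmod (c js) \<le> A * \<rho> ^ (2 * r) * W\<^sup>2"
    using m by (simp add: W_def power_divide le_divide_eq flip: power_mult)
  also have "\<dots> \<le> A * \<rho> ^ (2 * r) * (2 * real r * W powr (5 / 2))"
  proof (intro mult_left_mono)
    \<comment> \<open>The missing half power of \<open>W\<close> is paid by its lower bound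
      \<open>1 / (2 * r)\<close>.\<close>
    have "W powr (- (1 / 2)) \<le> (2 * real r) powr (1 / 2)"
    proof -
      have "inverse W \<le> 2 * real r" using W W0 by (simp add: field_simps)
      then have "inverse W powr (1 / 2) \<le> (2 * real r) powr (1 / 2)" using W0 by (intro powr_mono2) auto
      then show ?thesis using W0 by (simp add: powr_minus inverse_powr)
    qed
    also have "\<dots> \<le> (2 * real r) powr 1" using r by (intro powr_mono) auto
    finally have "W powr (5 / 2) * W powr (- (1 / 2)) \<le> W powr (5 / 2) * (2 * real r)"
      using r by (intro mult_left_mono) auto
    moreover have "W powr (5 / 2) * W powr (- (1 / 2)) = W\<^sup>2"
    proof -
      have "W powr (5 / 2) * W powr (- (1 / 2)) = W powr 2" unfolding powr_add[symmetric] by simp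
      then show ?thesis using W0 by simp
    qed
    ultimately show "W\<^sup>2 \<le> 2 * real r * W powr (5 / 2)" by (simp add: mult_ac)
  qed (use A in auto)
  also have "\<dots> < (A + 1) ^ r * \<rho> ^ (2 * r) * (4 ^ r * W powr (5 / 2))"
  proof -
    \<comment> \<open>Passing from \<open>A\<close> to \<open>A + 1\<close> makes the inequality
      strict and lets the prefactor be raised to the power \<open>r\<close>; the 4 in the base
      absorbs \<open>2 * r\<close>.\<close>
    have "A + 1 \<le> (A + 1) ^ r" using A r by (intro self_le_power) auto
    then have 1: "A * \<rho> ^ (2 * r) < (A + 1) ^ r * \<rho> ^ (2 * r)" using A by (intro mult_strict_right_mono) auto
    have "real (2 * r) \<le> real (2 ^ (2 * r))" unfolding of_nat_le_iff using less_exp[of "2 * r"] by (rule less_imp_le)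
    then have "2 * real r \<le> 4 ^ r" unfolding power_mult by simp
    then have 2: "2 * real r * W powr (5 / 2) \<le> 4 ^ r * W powr (5 / 2)" by (intro mult_right_mono) auto
    have "A * \<rho> ^ (2 * r) * (2 * real r * W powr (5 / 2)) \<le> A * \<rho> ^ (2 * r) * (4 ^ r * W powr (5 / 2))"
      using A 2 by (intro mult_left_mono) auto
    also have "\<dots> < (A + 1) ^ r * \<rho> ^ (2 * r) * (4 ^ r * W powr (5 / 2))"
      by (rule mult_strict_right_mono[OF 1]) (use W0 in simp)
    finally show ?thesis .
  qed
  also have "\<dots> = (4 * (A + 1) * \<rho>\<^sup>2) ^ r * jstar_ratio js powr (5 / 2)"
    unfolding jstar_ratio_eq[OF ne] W_def[symmetric] power_mult_distrib power_mult
    by (simp only: mult_ac)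
  finally show ?thesis .
qed

lemma cR_nonzero:
  assumes "cR js \<noteq> 0"
  shows "\<exists>r\<ge>4. js \<in> M r"
proof -
  have "even (length js)" "0 \<notin> set js" "altsum js = 0" using assms zsupp_cR by (auto simp: zsupp_def)
  moreover have "8 \<le> length js" using assms by (simp add: cR_def split: if_splits)
  ultimately show ?thesis by (intro exI[of _ "length js div 2"]) (auto simp: M_eq nzl_def)
qed

lemma Rem_expansion:
  assumes s: "3 < s"
  shows "\<forall>\<^sub>F x in nhds 0. ((\<lambda>(r, js). cR js * monomial js (emb s x)) has_sum Rem (emb s x)) (SIGMA r:{4..}. M r)"
proof -
  obtain A \<rho> where g: "gclass A \<rho> cR" using gclass_c1_d6_cR(3) by blast
  have inj: "inj_on snd (SIGMA r:{4..}. M r)" by (auto simp: inj_on_def M_def)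
  show ?thesis
    using eventually_cmult_norm_less_1[of "\<rho> * emb_const s"]
  proof eventually_elim
    case (elim x)
    then have "((\<lambda>js. cR js * mon js (replicate (length js) (emb s x))) has_sum Fsum s cR x) UNIV"
      using Fsum_has_sum[OF s g, of x] by (simp add: mult.assoc)
    moreover have "js \<in> snd ` (SIGMA r:{4..}. M r)" if "cR js \<noteq> 0" for js
      using cR_nonzero[OF that] by force
    ultimately have "((\<lambda>js. cR js * mon js (replicate (length js) (emb s x))) has_sum Fsum s cR x) (snd ` (SIGMA r:{4..}. M r))"
      by (subst has_sum_cong_neutral[where T = UNIV and g = "\<lambda>js. cR js * mon js (replicate (length js) (emb s x))"]) auto
    then show ?case
      unfolding has_sum_reindex[OF inj] by (simp add: Rem_emb monomial_eq_mon comp_def case_prod_unfold)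
  qed
qed

lemma Rem_vector_field:
  assumes s: "3 < s"
  obtains C where "\<forall>\<^sub>F x in nhds 0. has_partials Rem (emb s x) \<and> ham_vf Rem (emb s x) \<in> ell2 (s - 1) \<and>
    ell2_norm (s - 1) (ham_vf Rem (emb s x)) \<le> C * norm x ^ 7"
proof -
  obtain A \<rho> where g: "gclass A \<rho> cR" using gclass_c1_d6_cR(3) by blast
  have h: "hamcoef cR" using zsupp_cR by (auto simp: zsupp_def hamcoef_def)
  have low: "length js < 8 \<Longrightarrow> cR js = 0" for js by (simp add: cR_def)
  have "\<forall>\<^sub>F x in nhds 0. has_partials Rem (emb s x) \<and> ham_vf Rem (emb s x) \<in> ell2 (s - 1) \<and>
    ell2_norm (s - 1) (ham_vf Rem (emb s x)) \<le> 2 * A * grad_rate s \<rho> ^ 8 * norm x ^ 7"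
    using eventually_cmult_norm_less_1[of "2 * grad_rate s \<rho>"]
  proof eventually_elim
    case (elim x)
    then have "grad_rate s \<rho> * norm x < 1 / 2" by simp
    note V = ham_vf_Fsum[OF s h g this Rem_emb low]
    show ?case using V[of 8] by simp
  qed
  then show thesis by (rule that)
qed

section \<open>Analytic maps between the weighted spaces\<close>

lemma eventually_atin_ell2_0:
  "eventually P (atin (ell2_top s) 0) \<longleftrightarrow> (\<forall>\<^sub>F x in at 0. P (emb s x))"
proof -
  interpret Metric_space "ell2 s" "\<lambda>p q. ell2_norm s (p - q)" by (rule ell2_metric)
  have 0: "0 \<in> ell2 s" using emb_in_ell2[of s 0] by (simp add: emb_simps)
  have "eventually P (atin (ell2_top s) 0) \<longleftrightarrow> (\<exists>\<delta>>0. \<forall>q. q \<in> ell2 s \<and> 0 < ell2_norm s (q - 0) \<and> ell2_norm s (q - 0) < \<delta> \<longrightarrow> P q)"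
    unfolding ell2_top_def eventually_atin_metric using 0 by simp
  also have "\<dots> \<longleftrightarrow> (\<exists>\<delta>>0. \<forall>x. 0 < norm x \<and> norm x < \<delta> \<longrightarrow> P (emb s x))"
    unfolding ell2_eq_range_emb by auto
  also have "\<dots> \<longleftrightarrow> (\<forall>\<^sub>F x in at 0. P (emb s x))"
    unfolding eventually_at by (auto simp: dist_norm)
  finally show ?thesis .
qed

lemma limitin_atin_ell2_0:
  "limitin (ell2_top s) f (emb s l) (atin (ell2_top s) 0) \<longleftrightarrow>
    (\<forall>\<^sub>F x in at 0. f (emb s x) \<in> ell2 s) \<and> ((\<lambda>x. unemb s (f (emb s x))) \<longlongrightarrow> l) (at 0)"
  unfolding limitin_ell2_iff tendsto_iff eventually_atin_ell2_0 by simp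

lemma openin_emb_image:
  assumes "open V"
  shows "openin (ell2_top s) (emb s ` V)"
proof -
  interpret Metric_space "ell2 s" "\<lambda>p q. ell2_norm s (p - q)" by (rule ell2_metric)
  show ?thesis
    unfolding ell2_top_def openin_mtopology
  proof (intro conjI allI impI)
    fix q assume "q \<in> emb s ` V"
    then obtain x where x: "q = emb s x" "x \<in> V" by blast
    then obtain e where e: "0 < e" "ball x e \<subseteq> V" using assms open_contains_ball by blast
    have "mball q e \<subseteq> emb s ` V"
    proof
      fix p assume "p \<in> mball q e"
      then have p: "p \<in> ell2 s" "ell2_norm s (q - p) < e" by (auto simp: in_mball)
      then obtain y where y: "p = emb s y" unfolding ell2_eq_range_emb by blast
      have "norm (x - y) < e" using p(2) ell2_norm_emb[of s "x - y"] by (simp add: x y emb_simps)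
      then show "p \<in> emb s ` V" using e by (auto simp: y dist_norm)
    qed
    then show "\<exists>e>0. mball q e \<subseteq> emb s ` V" using e by blast
  qed auto
qed

lemma openin_ell2_ball:
  assumes "openin (ell2_top s) U" "emb s p \<in> U"
  obtains \<delta> where "0 < \<delta>" "\<And>h. norm h < \<delta> \<Longrightarrow> emb s (p + h) \<in> U"
proof -
  interpret Metric_space "ell2 s" "\<lambda>p q. ell2_norm s (p - q)" by (rule ell2_metric)
  obtain \<delta> where "0 < \<delta>" and sub: "mball (emb s p) \<delta> \<subseteq> U"
    using assms unfolding ell2_top_def openin_mtopology by blast
  moreover have "\<forall>h. norm h < \<delta> \<longrightarrow> emb s (p + h) \<in> U"
  proof (intro allI impI)
    fix h :: l2 assume h: "norm h < \<delta>"
    have "emb s p - emb s (p + h) = emb s (- h)" by (simp add: emb_simps)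
    then show "emb s (p + h) \<in> U" using sub h by (auto simp: in_mball)
  qed
  ultimately show thesis using that by blast
qed

lemma has_derivative_ell2_emb:
  assumes f: "(f has_derivative T) (at p)" and g: "\<And>x. g (emb s x) = emb s (f x)"
  shows "has_derivative_ell2 s g (\<lambda>v. emb s (T (unemb s v))) (emb s p)"
proof -
  interpret T: bounded_linear T using f by (rule has_derivative_bounded_linear)
  obtain C where C: "norm (T x) \<le> norm x * C" for x using T.bounded by blast
  have lim: "((\<lambda>h. (1 / norm h) *\<^sub>R (f (p + h) - f p - T h)) \<longlongrightarrow> 0) (at 0)"
    using f unfolding has_derivative_at by (subst tendsto_norm_zero_iff[symmetric]) simp
  have e: "rscale (1 / ell2_norm s (emb s h)) (g (emb s p + emb s h) - g (emb s p) - emb s (T (unemb s (emb s h)))) =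
      emb s ((1 / norm h) *\<^sub>R (f (p + h) - f p - T h))" for h
    by (simp only: unemb_emb ell2_norm_emb emb_simps(2)[symmetric] g emb_simps(3,5))
  have "limitin (ell2_top s) (\<lambda>h. rscale (1 / ell2_norm s h) (g (emb s p + h) - g (emb s p) - emb s (T (unemb s h)))) (emb s 0) (atin (ell2_top s) 0)"
    unfolding limitin_atin_ell2_0 e using lim by simp
  moreover have "emb s (T (unemb s (v + w))) = emb s (T (unemb s v)) + emb s (T (unemb s w))"
    if "v \<in> ell2 s" "w \<in> ell2 s" for v w
    using that unfolding ell2_eq_range_emb by (auto simp: emb_simps(2)[symmetric] T.add)
  moreover have "emb s (T (unemb s (rscale c v))) = rscale c (emb s (T (unemb s v)))" if "v \<in> ell2 s" for v c
    using that unfolding ell2_eq_range_emb by (auto simp: emb_simps(5)[symmetric] T.scaleR)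
  moreover have "ell2_norm s (emb s (T (unemb s v))) \<le> C * ell2_norm s v" if "v \<in> ell2 s" for v
    using C[of "unemb s v"] norm_unemb[OF that] by (simp add: mult.commute)
  ultimately show ?thesis
    unfolding has_derivative_ell2_def emb_simps(1) by (intro conjI ballI allI exI[of _ C] emb_in_ell2) blast+
qed

lemma multilinear_family_emb:
  assumes a: "\<And>n. mlin n a (C * \<rho> ^ n)"
  shows "multilinear_family s (\<lambda>vs. emb s (a (map (unemb s) vs)))"
  unfolding multilinear_family_def
proof (intro conjI ballI allI)
  fix xs ys v w c assume m: "xs \<in> lists (ell2 s)" "ys \<in> lists (ell2 s)" "v \<in> ell2 s" "w \<in> ell2 s"
  have lin: "linear (\<lambda>v. a (map (unemb s) xs @ v # map (unemb s) ys))"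
    by (rule mlin_linear[OF a]) simp
  have "unemb s (v + w) = unemb s v + unemb s w"
    using m(3,4) unfolding ell2_eq_range_emb by (auto simp: emb_simps(2)[symmetric])
  then show "emb s (a (map (unemb s) (xs @ (v + w) # ys))) =
      emb s (a (map (unemb s) (xs @ v # ys))) + emb s (a (map (unemb s) (xs @ w # ys)))"
    using linear_add[OF lin] by (simp add: emb_simps)
next
  fix xs ys v c assume m: "xs \<in> lists (ell2 s)" "ys \<in> lists (ell2 s)" "v \<in> ell2 s"
  have lin: "linear (\<lambda>v. a (map (unemb s) xs @ v # map (unemb s) ys))"
    by (rule mlin_linear[OF a]) simp
  have "unemb s (rscale c v) = c *\<^sub>R unemb s v"
    using m(3) unfolding ell2_eq_range_emb by (auto simp: emb_simps(5)[symmetric])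
  then show "emb s (a (map (unemb s) (xs @ rscale c v # ys))) = rscale c (emb s (a (map (unemb s) (xs @ v # ys))))"
    using linear_scale[OF lin] by (simp add: emb_simps)
next
  have "ell2_norm s (emb s (a (map (unemb s) vs))) \<le> C * \<rho> ^ length vs * prod_list (map (ell2_norm s) vs)"
    if "vs \<in> lists (ell2 s)" for vs
  proof -
    have "map norm (map (unemb s) vs) = map (ell2_norm s) vs" using that by (auto simp: norm_unemb)
    then show ?thesis using mlin_bound[OF a, of "map (unemb s) vs" "length vs"] by (simp only: length_map ell2_norm_emb refl simp_thms)
  qed
  then show "\<exists>C \<rho>. \<forall>vs\<in>lists (ell2 s). ell2_norm s (emb s (a (map (unemb s) vs))) \<le> C * \<rho> ^ length vs * prod_list (map (ell2_norm s) vs)"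
    by blast
qed simp

lemma emb_sum: "emb s (sum f A) = (\<Sum>i\<in>A. emb s (f i))"
  by (induction A rule: infinite_finite_induct) (simp_all add: emb_simps)

text \<open>The power series is recentred at every point of \<open>U\<close>. The set
  \<open>U\<close> is kept general because the inverse map lives on the image of a ball, which is no
  ball.\<close>

lemma real_analytic_time1:
  fixes A :: "l2 list \<Rightarrow> l2"
  assumes fr: "flow_radius b A D r"
  obtains r' where "0 < r'"
    "\<And>f U. openin (ell2_top s) U \<Longrightarrow> U \<subseteq> emb s ` ball 0 r' \<Longrightarrow>
      (\<And>x. emb s x \<in> U \<Longrightarrow> f (emb s x) = emb s (time1 b A x)) \<Longrightarrow> real_analytic_ell2 s f U"
proof -
  define \<sigma> where "\<sigma> = exp 1 * max 1 D"
  have \<sigma>: "0 < \<sigma>" by (auto simp: \<sigma>_def max_def)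
  have A: "mlin b A D" "2 \<le> b" "0 < r" using fr by (auto simp: flow_radius_def)
  have lie: "mlin n (lie_family b A) (1 * \<sigma> ^ n)" for n
    unfolding \<sigma>_def by (rule mlin_lie_family[OF A(1,2)])
  define r' where "r' = min (r / 4) (1 / (4 * \<sigma>))"
  have r': "0 < r'" "r' \<le> r / 4" using A(3) \<sigma> by (auto simp: r'_def)
  have "\<sigma> * r' \<le> \<sigma> * (1 / (4 * \<sigma>))" using \<sigma> by (intro mult_left_mono) (auto simp: r'_def)
  then have \<sigma>r: "2 * (\<sigma> * r') < 1" using \<sigma> by simp
  show thesis
  proof (rule that[OF r'(1)])
    fix f U
    assume U: "openin (ell2_top s) U" "U \<subseteq> emb s ` ball 0 r'"
      and f: "\<And>x. emb s x \<in> U \<Longrightarrow> f (emb s x) = emb s (time1 b A x)"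
    show "real_analytic_ell2 s f U"
      unfolding real_analytic_ell2_def
    proof
      fix q assume q: "q \<in> U"
      then obtain p where p: "q = emb s p" "norm p < r'" using U(2) by auto
      obtain \<delta> where \<delta>: "0 < \<delta>" "\<And>h. norm h < \<delta> \<Longrightarrow> emb s (p + h) \<in> U"
        using openin_ell2_ball[OF U(1), of p] q p by blast
      define a where "a vs = emb s (recenter (lie_family b A) p (map (unemb s) vs))" for vs
      have "multilinear_family s a"
        unfolding a_def[abs_def]
        by (rule multilinear_family_emb, rule mlin_recenter[OF lie _ r'(1) \<sigma>r]) (use p(2) \<sigma> in auto)
      moreover have "limitin (ell2_top s) (\<lambda>N. \<Sum>n<N. a (replicate n h)) (f (q + h)) sequentially"
        if h: "h \<in> ell2 s" "ell2_norm s h < min \<delta> r'" for h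
      proof -
        obtain k where k: "h = emb s k" using h(1) unfolding ell2_eq_range_emb by blast
        have nk: "norm k < \<delta>" "norm k < r'" using h(2) by (auto simp: k)
        obtain y where y: "(\<lambda>n. lie_family b A (replicate n (p + k))) sums y"
          "(\<lambda>n. recenter (lie_family b A) p (replicate n k)) sums y"
          using recenter_sums[OF lie _ r'(1) \<sigma>r, of p k] p(2) nk(2) \<sigma> by auto
        have "norm (p + k) \<le> r / 2" using norm_triangle_ineq[of p k] p(2) nk(2) r'(2) by linarith
        then have "y = time1 b A (p + k)"
          using sums_unique2[OF y(1) lie_family_sums[OF fr]] by blast
        then have fq: "f (q + h) = emb s y"
          using f[OF \<delta>(2)[OF nk(1)]] by (simp add: p k emb_simps)
        have "(\<Sum>n<N. a (replicate n h)) = emb s (\<Sum>n<N. recenter (lie_family b A) p (replicate n k))" for N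
          by (simp add: emb_sum a_def k)
        then show ?thesis
          unfolding fq limitin_ell2_iff using y(2) by (simp add: sums_def)
      qed
      ultimately show "\<exists>a \<delta>. multilinear_family s a \<and> \<delta> > 0 \<and>
          (\<forall>h\<in>ell2 s. ell2_norm s h < \<delta> \<longrightarrow>
             limitin (ell2_top s) (\<lambda>N. \<Sum>n<N. a (replicate n h)) (f (q + h)) sequentially)"
        using \<delta>(1) r'(1) by (intro exI[of _ a] exI[of _ "min \<delta> r'"]) auto
    qed
  qed
qed


section \<open>The symplectic form\<close>

text \<open>The operator that represents the symplectic form by the inner product of
  \<open>l2\<close>. It has norm at most 2, so the form is a bounded bilinear one.\<close>

definition Jw :: "real \<Rightarrow> l2 \<Rightarrow> l2" where
  "Jw s y = Abs_l2 (\<lambda>j. 2 * \<i> * of_real ((\<bar>real_of_int j\<bar> powr (- s))\<^sup>2) / of_int j * coord y j)"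

lemma Jw:
  assumes "0 \<le> s"
  shows coord_Jw: "coord (Jw s y) j = 2 * \<i> * of_real ((\<bar>real_of_int j\<bar> powr (- s))\<^sup>2) / of_int j * coord y j"
    and norm_Jw: "norm (Jw s y) \<le> 2 * norm y"
proof -
  let ?f = "\<lambda>j. 2 * \<i> * of_real ((\<bar>real_of_int j\<bar> powr (- s))\<^sup>2) / of_int j * coord y j"
  have le: "cmod (?f j) \<le> 2 * cmod (coord y j)" for j
  proof (cases "j = 0")
    case False
    then have j: "1 \<le> \<bar>real_of_int j\<bar>" by linarith
    then have "\<bar>real_of_int j\<bar> powr (- s) \<le> \<bar>real_of_int j\<bar> powr 0"
      using assms by (intro powr_mono) auto
    then have "(\<bar>real_of_int j\<bar> powr (- s))\<^sup>2 \<le> 1" using False by (intro power_le_one) auto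
    then have "(\<bar>real_of_int j\<bar> powr (- s))\<^sup>2 / \<bar>real_of_int j\<bar> \<le> 1" using j by (simp add: divide_le_eq)
    then have "2 * ((\<bar>real_of_int j\<bar> powr (- s))\<^sup>2 / \<bar>real_of_int j\<bar>) * cmod (coord y j) \<le> 2 * 1 * cmod (coord y j)"
      by (intro mult_right_mono mult_left_mono) auto
    then show ?thesis by (simp add: norm_mult norm_divide norm_power)
  qed simp
  have "\<exists>x. coord x = ?f \<and> norm x \<le> 2 * norm y"
  proof (rule l2_of_coords)
    fix F :: "int set" assume F: "finite F"
    have "(\<Sum>j\<in>F. (cmod (?f j))\<^sup>2) \<le> (\<Sum>j\<in>F. (2 * cmod (coord y j))\<^sup>2)"
      by (intro sum_mono power_mono le) simp
    also have "\<dots> = 4 * (\<Sum>j\<in>F. (cmod (coord y j))\<^sup>2)"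
      by (simp add: power_mult_distrib sum_distrib_left)
    also have "\<dots> \<le> 4 * (norm y)\<^sup>2" using sum_coord_le[OF F, of y] by simp
    finally show "(\<Sum>j\<in>F. (cmod (?f j))\<^sup>2) \<le> (2 * norm y)\<^sup>2" by (simp add: power_mult_distrib)
  qed auto
  then obtain x where x: "coord x = ?f" "norm x \<le> 2 * norm y" by blast
  have "Jw s y = x" unfolding Jw_def x(1)[symmetric] by (rule coord_inverse)
  then show "coord (Jw s y) j = ?f j" "norm (Jw s y) \<le> 2 * norm y" using x by simp_all
qed

definition om :: "real \<Rightarrow> l2 \<Rightarrow> l2 \<Rightarrow> real" where
  "om s x y = inner x (Jw s y)"

lemma bounded_bilinear_om:
  assumes "0 \<le> s"
  shows "bounded_bilinear (om s)"
proof -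
  have J: "bounded_linear (Jw s)"
  proof (rule bounded_linear_intro)
    show "norm (Jw s x) \<le> norm x * 2" for x using norm_Jw[OF assms, of x] by simp
  qed (rule l2_eqI, simp add: coord_Jw[OF assms] distrib_left scaleR_conv_of_real)+
  show ?thesis
    unfolding om_def[abs_def] using bounded_bilinear.comp[OF bounded_bilinear_inner bounded_linear_ident J] by simp
qed

lemma om_has_sum:
  assumes "0 \<le> s"
  shows "((\<lambda>j. 2 * Im (emb s x j * cnj (emb s y j)) / real_of_int j) has_sum om s x y) UNIV"
proof -
  have "((\<lambda>j. inner (coord x j) (coord (Jw s y) j)) has_sum om s x y) UNIV"
    unfolding om_def inner_l2_def by (intro has_sum_infsum summable_on_inner coord_summable)
  moreover have "inner (coord x j) (coord (Jw s y) j) = 2 * Im (emb s x j * cnj (emb s y j)) / real_of_int j" for j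
  proof -
    define w where "w = \<bar>real_of_int j\<bar> powr (- s)"
    have "coord (Jw s y) j = (2 * w\<^sup>2 / real_of_int j) *\<^sub>R (\<i> * coord y j)"
      by (simp add: coord_Jw[OF assms] w_def scaleR_conv_of_real)
    then show ?thesis
      by (simp add: emb_def w_def[symmetric] inner_complex_def power2_eq_square algebra_simps diff_divide_distrib)
  qed
  ultimately show ?thesis by simp
qed

lemma symplectic_form_emb:
  assumes "0 \<le> s"
  shows "symplectic_form (emb s x) (emb s y) = of_real (om s x y)"
proof -
  have "((\<lambda>j. 2 * Im (emb s x j * cnj (emb s y j)) / real_of_int j) has_sum om s x y) Zstar"
    using om_has_sum[OF assms, of x y] by (subst has_sum_cong_neutral[where T = UNIV]) (auto simp: Zstar_def)
  from has_sum_of_real[OF this, where ?'a = complex]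
  have "((\<lambda>j. - \<i> * ((emb s x j * cnj (emb s y j) - emb s y j * cnj (emb s x j)) / of_int j)) has_sum of_real (om s x y)) Zstar"
  proof (rule has_sum_cong[THEN iffD1, rotated])
    fix j
    define z where "z = emb s x j * cnj (emb s y j)"
    have "z - emb s y j * cnj (emb s x j) = z - cnj z" by (simp add: z_def)
    also have "\<dots> = 2 * \<i> * of_real (Im z)" by (simp add: complex_diff_cnj)
    finally have "- \<i> * (z - emb s y j * cnj (emb s x j)) = of_real (2 * Im z)" by (simp add: complex_eq_iff)
    then show "complex_of_real (2 * Im (emb s x j * cnj (emb s y j)) / real_of_int j) =
        - \<i> * ((emb s x j * cnj (emb s y j) - emb s y j * cnj (emb s x j)) / of_int j)"
      unfolding z_def[symmetric] by (simp only: of_real_divide of_real_of_int_eq times_divide_eq_right)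
  qed
  then show ?thesis
    unfolding symplectic_form_def infsum_cmult_right'[symmetric] by (rule infsumI)
qed

section \<open>The field of the second transformation is Hamiltonian\<close>

lemma form_eq_sum_last:
  assumes s: "3 < s" and c: "crude (Suc n) E c" "zsupp c" and n: "odd n" and vs: "length vs = n"
  shows "((\<lambda>j. (\<Sum>\<^sub>\<infinity>js\<in>{js. length js = n \<and> altsum js = j}. c (js @ [j]) * mon js (map (emb s) vs)) * cnj (emb s w j))
    has_sum form s c (vs @ [w])) UNIV"
proof -
  let ?g = "\<lambda>js. c (js @ [altsum js]) * mon (js @ [altsum js]) (map (emb s) (vs @ [w]))"
  have inj: "inj_on (\<lambda>js. js @ [altsum js]) (ilists n)" by (auto simp: inj_on_def)
  have "((\<lambda>ks. c ks * mon ks (map (emb s) (vs @ [w]))) has_sum form s c (vs @ [w])) (ilists (Suc n))"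
    using has_sum_infsum[OF form_summable[OF s c(1), of "vs @ [w]"]] vs by (simp add: form_def)
  \<comment> \<open>Zero momentum and odd \<open>n\<close> make the last index the
    \<open>altsum\<close> of the others.\<close>
  moreover have "ks \<in> (\<lambda>js. js @ [altsum js]) ` ilists n" if k: "length ks = Suc n" "c ks \<noteq> 0" for ks
  proof -
    obtain js j where ks: "ks = js @ [j]" using k(1) by (cases ks rule: rev_cases) auto
    have "altsum ks = 0" using c(2) k(2) by (simp add: zsupp_def)
    then have "j = altsum js" using k(1) n by (simp add: ks altsum_append)
    then show ?thesis using k(1) by (simp add: ks)
  qed
  ultimately have "((\<lambda>ks. c ks * mon ks (map (emb s) (vs @ [w]))) has_sum form s c (vs @ [w])) ((\<lambda>js. js @ [altsum js]) ` ilists n)"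
    by (subst has_sum_cong_neutral[where T = "ilists (Suc n)" and g = "\<lambda>ks. c ks * mon ks (map (emb s) (vs @ [w]))"]) auto
  then have "(?g has_sum form s c (vs @ [w])) (ilists n)"
    unfolding has_sum_reindex[OF inj] by (simp add: comp_def)
  from has_sum_fibers[OF this, of altsum]
  have "((\<lambda>j. \<Sum>\<^sub>\<infinity>js\<in>{js \<in> ilists n. altsum js = j}. ?g js) has_sum form s c (vs @ [w])) UNIV" .
  moreover have "(\<Sum>\<^sub>\<infinity>js\<in>{js \<in> ilists n. altsum js = j}. ?g js) =
      (\<Sum>\<^sub>\<infinity>js\<in>{js. length js = n \<and> altsum js = j}. c (js @ [j]) * mon js (map (emb s) vs)) * cnj (emb s w j)" for j
    unfolding infsum_cmult_left'[symmetric]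
    by (rule infsum_cong_neutral) (use vs n in \<open>auto simp: mon_append mult_ac\<close>)
  ultimately show ?thesis by simp
qed

text \<open>The coefficients \<open>gam\<close> on lists of length six: the component of the field
  becomes a sixth, conjugated slot, so that the field in five slots paired with a vector is a form
  in six slots.\<close>

definition g6 :: "int list \<Rightarrow> complex" where
  "g6 js = (case js of [a1, b1, a2, b2, a3, b3] \<Rightarrow> if nzl 6 js then of_real (gam a1 a2 a3 b1 b2 b3) else 0 | _ \<Rightarrow> 0)"

lemma zsupp_g6: "zsupp g6"
  by (auto simp: zsupp_def g6_def nzl_def split: list.splits if_splits)

lemma g6_xi6:
  assumes "length js = 5"
  shows "of_int (altsum js) * g6 (js @ [altsum js]) = of_real (xi6 js)"
  using assms
proof (rule list5E)
  fix a1 b1 a2 b2 a3 assume js: "js = [a1, b1, a2, b2, a3]"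
  define n where "n = altsum js"
  show ?thesis
  proof (cases "nzl 6 [a1, b1, a2, b2, a3, n]")
    case True
    then show ?thesis using xi6_gam(1)[OF True] by (simp add: n_def[symmetric]) (simp add: js g6_def)
  next
    case False
    then have "0 \<in> set js \<or> n = 0" by (auto simp: nzl_def js n_def)
    then have "xi6 js = 0 \<or> n = 0" by (auto simp: xi6_def js)
    moreover have "xi6 js = 0" if "n = 0"
      using kernel_altsum_zero[OF kernel_xi6 assms] that by (simp add: n_def)
    moreover have "g6 (js @ [n]) = 0" using False by (simp add: g6_def js)
    ultimately show ?thesis by (auto simp: n_def)
  qed
qed

lemma crude_g6: "crude 6 25000000 g6"
  unfolding crude_def
proof (intro conjI allI impI)
  fix ks :: "int list" assume len: "length ks = 6"
  show "norm (g6 ks) \<le> 25000000 * (pr ks)\<^sup>2"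
  proof (cases "g6 ks = 0")
    case False
    obtain js n where ks: "ks = js @ [n]" using len by (cases ks rule: rev_cases) auto
    have z: "0 \<notin> set ks" "altsum ks = 0" using False zsupp_g6 by (auto simp: zsupp_def)
    have l5: "length js = 5" using len ks by simp
    have n: "n = altsum js" "n \<noteq> 0" using z l5 by (auto simp: ks altsum_append)
    have n1: "1 \<le> \<bar>real_of_int n\<bar>" using n(2) by linarith
    have m: "1 \<le> mx js ^ 4" using z l5 by (intro one_le_power mx_ge_1) (auto simp: ks)
    have "norm (g6 ks) \<le> \<bar>real_of_int n\<bar> * norm (g6 ks)" using mult_right_mono[OF n1, of "norm (g6 ks)"] by simp
    also have "\<dots> = norm (complex_of_real (xi6 js))"
      unfolding g6_xi6[OF l5, symmetric] norm_mult norm_of_int n(1)[symmetric] ks ..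
    also have "\<dots> \<le> norm (complex_of_real (xi6 js)) * mx js ^ 4"
      using mult_left_mono[OF m, of "norm (complex_of_real (xi6 js))"] by simp
    also have "\<dots> \<le> 25000000 * (real_of_int (altsum js) * pr js)\<^sup>2"
      using kernel_xi6 l5 unfolding kernel_def by blast
    also have "\<dots> = 25000000 * (pr ks)\<^sup>2"
      by (simp add: ks n(1) power_mult_distrib mult_ac)
    finally show ?thesis .
  qed simp
qed simp

text \<open>The division by \<open>j\<close> in the symplectic form cancels the factor
  \<open>j\<close> that distinguishes \<open>xi6\<close> from \<open>gam\<close>.\<close>

lemma om_rX:
  assumes s: "3 < s" and vs: "length vs = 5"
  shows "om s (rX s xi6 vs) w = 2 * Im (form s g6 (vs @ [w]))"
proof -
  have "crude (Suc 5) 25000000 g6" using crude_g6 by simp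
  from form_eq_sum_last[OF s this zsupp_g6 _ vs, of w]
  have "((\<lambda>j. (\<Sum>\<^sub>\<infinity>js\<in>{js. length js = 5 \<and> altsum js = j}. g6 (js @ [j]) * mon js (map (emb s) vs)) * cnj (emb s w j))
    has_sum form s g6 (vs @ [w])) UNIV" by simp
  then have "((\<lambda>j. 2 * Im ((\<Sum>\<^sub>\<infinity>js\<in>{js. length js = 5 \<and> altsum js = j}. g6 (js @ [j]) * mon js (map (emb s) vs)) * cnj (emb s w j)))
    has_sum 2 * Im (form s g6 (vs @ [w]))) UNIV"
    by (intro has_sum_cmult_right has_sum_Im)
  moreover have "2 * Im ((\<Sum>\<^sub>\<infinity>js\<in>{js. length js = 5 \<and> altsum js = j}. g6 (js @ [j]) * mon js (map (emb s) vs)) * cnj (emb s w j)) =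
      2 * Im (emb s (rX s xi6 vs) j * cnj (emb s w j)) / real_of_int j" for j
  proof (cases "j = 0")
    case False
    have "emb s (rX s xi6 vs) j = (\<Sum>\<^sub>\<infinity>js\<in>{js. length js = 5 \<and> altsum js = j}. of_int j * (g6 (js @ [j]) * mon js (map (emb s) vs)))"
      unfolding emb_Xmap[OF s kernel_xi6 vs] by (intro infsum_cong) (auto simp flip: g6_xi6)
    also have "\<dots> = of_int j * (\<Sum>\<^sub>\<infinity>js\<in>{js. length js = 5 \<and> altsum js = j}. g6 (js @ [j]) * mon js (map (emb s) vs))"
      by (rule infsum_cmult_right')
    finally show ?thesis using False by (simp add: mult.assoc)
  qed simp
  moreover have "0 \<le> s" using s by simp
  ultimately show ?thesis
    using om_has_sum[of s "rX s xi6 vs" w] has_sum_unique by fastforce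
qed

definition swp :: "nat \<Rightarrow> nat \<Rightarrow> 'a list \<Rightarrow> 'a list" where
  "swp i j xs = xs[i := xs ! j, j := xs ! i]"

lemma length_swp [simp]: "length (swp i j xs) = length xs"
  by (simp add: swp_def)

lemma swp_explicit:
  "swp 0 2 [a, b, c, d, e, f] = [c, b, a, d, e, f]" "swp 0 4 [a, b, c, d, e, f] = [e, b, c, d, a, f]"
  "swp 1 3 [a, b, c, d, e, f] = [a, d, c, b, e, f]" "swp (Suc 0) 3 [a, b, c, d, e, f] = [a, d, c, b, e, f]"
  "swp 1 5 [a, b, c, d, e, f] = [a, f, c, d, e, b]" "swp (Suc 0) 5 [a, b, c, d, e, f] = [a, f, c, d, e, b]"
  by (simp_all add: swp_def numeral_eq_Suc)

lemma form_g6_swp: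
  assumes vs: "length vs = 6" and ij: "(i, j) \<in> {(0, 2), (0, 4), (1, 3), (1, 5)}"
  shows "form s g6 (swp i j vs) = form s g6 vs"
proof -
  let ?g = "\<lambda>js. g6 js * mon js (map (emb s) (swp i j vs))"
  have inv: "swp i j (swp i j js) = js" if "length js = 6" for js :: "int list"
    using that by (rule list6E) (use ij in \<open>auto simp: swp_explicit\<close>)
  have bij: "bij_betw (swp i j) (ilists 6) (ilists 6)"
    by (rule bij_betw_byWitness[where f' = "swp i j"]) (auto simp: inv)
  have "form s g6 (swp i j vs) = (\<Sum>\<^sub>\<infinity>js\<in>ilists 6. ?g js)" by (simp add: form_def vs)
  also have "\<dots> = (\<Sum>\<^sub>\<infinity>js\<in>ilists 6. ?g (swp i j js))" by (rule infsum_reindex_bij_betw[OF bij, symmetric])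
  also have "\<dots> = (\<Sum>\<^sub>\<infinity>js\<in>ilists 6. g6 js * mon js (map (emb s) vs))"
  proof (rule infsum_cong)
    fix js :: "int list" assume "js \<in> ilists 6"
    then have "length js = 6" by simp
    then obtain a1 b1 a2 b2 a3 b3 where js: "js = [a1, b1, a2, b2, a3, b3]" by (rule list6E)
    obtain u1 v1 u2 v2 u3 v3 where v: "vs = [u1, v1, u2, v2, u3, v3]" using vs by (rule list6E)
    have "mon (swp i j js) (map (emb s) (swp i j vs)) = mon js (map (emb s) vs)"
      using ij by (auto simp: js v swp_explicit mult_ac)
    moreover have "g6 (swp i j js) = g6 js"
    proof -
      have "nzl 6 (swp i j js) = nzl 6 js" using ij by (auto simp: js nzl_def swp_explicit)
      then show ?thesis using ij by (auto simp: js swp_explicit g6_def gam_sym)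
    qed
    ultimately show "?g (swp i j js) = g6 js * mon js (map (emb s) vs)" by simp
  qed
  finally show ?thesis by (simp add: form_def vs)
qed

definition swpairs :: "int list \<Rightarrow> int list" where
  "swpairs xs = [xs ! 1, xs ! 0, xs ! 3, xs ! 2, xs ! 5, xs ! 4]"

lemma form_g6_conj: "form s g6 [v1, u1, v2, u2, v3, u3] = - cnj (form s g6 [u1, v1, u2, v2, u3, v3])"
proof -
  let ?g = "\<lambda>js. g6 js * mon js (map (emb s) [v1, u1, v2, u2, v3, u3])"
  have e: "swpairs [a, b, c, d, e, f] = [b, a, d, c, f, e]" for a b c d e f by (simp add: swpairs_def)
  have inv: "swpairs (swpairs js) = js" "length (swpairs js) = 6" if "length js = 6" for js
    using that by (rule list6E; simp add: e)+
  have bij: "bij_betw swpairs (ilists 6) (ilists 6)"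
    by (rule bij_betw_byWitness[where f' = swpairs]) (auto simp: inv)
  have l: "form s g6 [a, b, c, d, e, f] = (\<Sum>\<^sub>\<infinity>js\<in>ilists 6. g6 js * mon js (map (emb s) [a, b, c, d, e, f]))" for a b c d e f
    unfolding form_def by (simp add: numeral_eq_Suc)
  have "form s g6 [v1, u1, v2, u2, v3, u3] = (\<Sum>\<^sub>\<infinity>js\<in>ilists 6. ?g js)" by (rule l)
  also have "\<dots> = (\<Sum>\<^sub>\<infinity>js\<in>ilists 6. ?g (swpairs js))" by (rule infsum_reindex_bij_betw[OF bij, symmetric])
  also have "\<dots> = (\<Sum>\<^sub>\<infinity>js\<in>ilists 6. - cnj (g6 js * mon js (map (emb s) [u1, v1, u2, v2, u3, v3])))"
  proof (rule infsum_cong)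
    fix js :: "int list" assume "js \<in> ilists 6"
    then have "length js = 6" by simp
    then obtain a1 b1 a2 b2 a3 b3 where js: "js = [a1, b1, a2, b2, a3, b3]" by (rule list6E)
    have "nzl 6 (swpairs js) = nzl 6 js" by (auto simp: js nzl_def e)
    then have "g6 (swpairs js) = - g6 js" by (simp add: js e g6_def gam_swap[of b1 b2 b3])
    moreover have "cnj (g6 js) = g6 js" by (simp add: js g6_def)
    ultimately show "?g (swpairs js) = - cnj (g6 js * mon js (map (emb s) [u1, v1, u2, v2, u3, v3]))"
      by (simp add: js e mult_ac)
  qed
  finally show ?thesis by (simp only: l infsum_uminus infsum_cnj)
qed

lemma om_antisymmetric:
  assumes "0 \<le> s"
  shows "om s x y = - om s y x"
proof -
  have "((\<lambda>j. - (2 * Im (emb s y j * cnj (emb s x j)) / real_of_int j)) has_sum - om s y x) UNIV"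
    using om_has_sum[OF assms] by (rule has_sum_uminusI)
  moreover have "- (2 * Im (emb s y j * cnj (emb s x j)) / real_of_int j) = 2 * Im (emb s x j * cnj (emb s y j)) / real_of_int j" for j
    by (simp add: algebra_simps diff_divide_distrib)
  ultimately have "((\<lambda>j. 2 * Im (emb s x j * cnj (emb s y j)) / real_of_int j) has_sum - om s y x) UNIV" by simp
  with om_has_sum[OF assms, of x y] show ?thesis by (rule has_sum_unique)
qed

text \<open>The vector field is Hamiltonian because its coefficients divided by the index of the component,
  \<open>gam\<close>, are symmetric in the \<open>q\<close> and in the \<open>cnj q\<close> slots and skew under exchanging the two groups.\<close>

lemma rX_xi6_hamiltonian:
  assumes s: "3 < s"
  shows "om s (diag_deriv (rX s xi6) 5 x u) w + om s u (diag_deriv (rX s xi6) 5 x w) = 0"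
proof -
  interpret om: bounded_bilinear "om s" using s by (intro bounded_bilinear_om) simp
  have sum: "om s (diag_deriv (rX s xi6) 5 x u) w = 2 * Im (
      form s g6 [u, x, x, x, x, w] + form s g6 [x, u, x, x, x, w] + form s g6 [x, x, u, x, x, w]
      + form s g6 [x, x, x, u, x, w] + form s g6 [x, x, x, x, u, w])" for u w
    unfolding diag_deriv_def om.sum_left
    by (simp add: om_rX[OF s] lessThan_Suc numeral_eq_Suc)
  have A: "form s g6 [x, x, u, x, x, w] = form s g6 [u, x, x, x, x, w]"
    "form s g6 [x, x, x, x, u, w] = form s g6 [u, x, x, x, x, w]"
    "form s g6 [x, x, x, u, x, w] = form s g6 [x, u, x, x, x, w]"
    "form s g6 [x, u, x, x, x, w] = form s g6 [x, w, x, x, x, u]" for u w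
    using form_g6_swp[of "[x, x, u, x, x, w]" 0 2 s] form_g6_swp[of "[x, x, x, x, u, w]" 0 4 s]
      form_g6_swp[of "[x, x, x, u, x, w]" 1 3 s] form_g6_swp[of "[x, u, x, x, x, w]" 1 5 s]
    by (simp_all add: swp_explicit)
  have "Im (form s g6 [u, x, x, x, x, w]) = Im (form s g6 [x, u, x, x, w, x])"
    using form_g6_conj[of s u x x x x w] form_g6_conj[of s x u x x w x] by simp
  also have "form s g6 [x, u, x, x, w, x] = form s g6 [w, x, x, x, x, u]"
    using form_g6_swp[of "[x, u, x, x, w, x]" 0 4 s] form_g6_swp[of "[w, u, x, x, x, x]" 1 5 s]
    by (simp add: swp_explicit)
  finally have "Im (form s g6 [u, x, x, x, x, w]) = Im (form s g6 [w, x, x, x, x, u])" .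
  then have "om s (diag_deriv (rX s xi6) 5 x u) w = om s (diag_deriv (rX s xi6) 5 x w) u"
    unfolding sum A(1-3) using A(4)[of u w] by simp
  then show ?thesis using om_antisymmetric[of s u] s by simp
qed


text \<open>All sufficiently small radii are provided, because the ball has to be cut down later to
  the domain of the expansions.\<close>

lemma time1_symplectic_transformation:
  fixes A :: "l2 list \<Rightarrow> l2"
  assumes s: "0 \<le> s" and fr: "flow_radius b A D r"
    and anti: "\<And>x u w. om s (diag_deriv A b x u) w + om s u (diag_deriv A b x w) = 0"
  obtains \<delta>0 where "0 < \<delta>0"
    "\<And>\<delta>. 0 < \<delta> \<Longrightarrow> \<delta> \<le> \<delta>0 \<Longrightarrow>
      analytic_symplectic_transformation s (emb s ` ball 0 \<delta>) (\<lambda>q. emb s (time1 b A (unemb s q)))"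
proof -
  let ?f = "time1 b A" and ?g = "time1 b (\<lambda>vs. - A vs)" and ?\<Phi> = "\<lambda>q. emb s (time1 b A (unemb s q))"
  note fr' = flow_radius_uminus[OF fr]
  have r: "0 < r" using fr by (simp add: flow_radius_def)
  obtain r1 where r1: "0 < r1" "\<And>f U. openin (ell2_top s) U \<Longrightarrow> U \<subseteq> emb s ` ball 0 r1 \<Longrightarrow>
      (\<And>x. emb s x \<in> U \<Longrightarrow> f (emb s x) = emb s (?f x)) \<Longrightarrow> real_analytic_ell2 s f U"
    using real_analytic_time1[OF fr] by metis
  obtain r2 where r2: "0 < r2" "\<And>f U. openin (ell2_top s) U \<Longrightarrow> U \<subseteq> emb s ` ball 0 r2 \<Longrightarrow>
      (\<And>x. emb s x \<in> U \<Longrightarrow> f (emb s x) = emb s (?g x)) \<Longrightarrow> real_analytic_ell2 s f U"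
    using real_analytic_time1[OF fr'] by metis
  obtain r3 where r3: "0 < r3"
    "\<And>p. norm p < r3 \<Longrightarrow> (?f has_derivative (\<lambda>h. recenter (lie_family b A) p [h])) (at p)"
    using time1_has_derivative[OF fr] by metis
  \<comment> \<open>A flow can double norms: \<open>r / 8\<close> keeps images within the radius
    \<open>r / 4\<close> of \<open>time1_inverse\<close>, and \<open>r2 / 2\<close> keeps them where
    the inverse is analytic.\<close>
  define \<delta>0 where "\<delta>0 = min (r / 8) (min r1 (min (r2 / 2) r3))"
  have \<delta>0: "0 < \<delta>0" "\<delta>0 \<le> r / 8" "\<delta>0 \<le> r1" "2 * \<delta>0 \<le> r2" "\<delta>0 \<le> r3"
    using r r1(1) r2(1) r3(1) by (auto simp: \<delta>0_def)
  have gf: "?g (?f x) = x" if "norm x \<le> r / 4" for x by (rule time1_inverse[OF fr that])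
  have fg: "?f (?g y) = y" if "norm y \<le> r / 4" for y using time1_inverse[OF fr' that] by simp
  have f_le: "norm (?f x) \<le> 2 * norm x" if "norm x \<le> r / 2" for x
    using flow_curve_norm[OF fr that, of 1] by simp
  have g_cont: "continuous_on (ball 0 (r / 2)) ?g"
  proof (rule lipschitz_on_continuous_on[OF lipschitz_onI])
    show "dist (?g x) (?g y) \<le> 2 * dist x y" if "x \<in> ball 0 (r / 2)" "y \<in> ball 0 (r / 2)" for x y
      using flow_curve_lipschitz[OF fr', of x y 1] that by (simp add: dist_norm)
  qed simp
  have f0: "?f 0 = 0" using f_le[of 0] r by simp
  show thesis
  proof (rule that[OF \<delta>0(1)])
    fix \<delta> assume \<delta>: "0 < \<delta>" "\<delta> \<le> \<delta>0"
    let ?U = "emb s ` ball 0 \<delta>"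
    have le: "\<delta> \<le> r / 8" "\<delta> \<le> r1" "2 * \<delta> \<le> r2" "\<delta> \<le> r3" using \<delta> \<delta>0 by linarith+
    \<comment> \<open>The image of the ball is a preimage under the continuous inverse map, which
      shows that it is open.\<close>
    have img: "?f ` ball 0 \<delta> = ball 0 (2 * \<delta>) \<inter> ?g -` ball 0 \<delta>"
    proof (intro equalityI subsetI)
      fix y assume "y \<in> ?f ` ball 0 \<delta>"
      then obtain x where x: "y = ?f x" "norm x < \<delta>" by auto
      then have "norm x \<le> r / 4" "norm x \<le> r / 2" using le(1) r by linarith+
      then have "norm y < 2 * \<delta>" "?g y = x" using f_le[of x] gf[of x] x by auto
      then show "y \<in> ball 0 (2 * \<delta>) \<inter> ?g -` ball 0 \<delta>" using x by simp
    next
      fix y assume y: "y \<in> ball 0 (2 * \<delta>) \<inter> ?g -` ball 0 \<delta>"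
      then have "norm y \<le> r / 4" using le(1) by auto
      then have "?f (?g y) = y" by (rule fg)
      then show "y \<in> ?f ` ball 0 \<delta>" using y by (metis IntD2 image_eqI vimageD)
    qed
    have "continuous_on (ball 0 (2 * \<delta>)) ?g"
      by (rule continuous_on_subset[OF g_cont]) (use le(1) \<delta>(1) in auto)
    then have "open (?f ` ball 0 \<delta>)"
      unfolding img by (rule continuous_open_preimage) auto
    then have "openin (ell2_top s) (emb s ` ?f ` ball 0 \<delta>)" by (rule openin_emb_image)
    moreover have \<Phi>U: "?\<Phi> ` ?U = emb s ` ?f ` ball 0 \<delta>" by (simp add: image_image)
    ultimately have open_img: "openin (ell2_top s) (?\<Phi> ` ?U)" by simp
    have inj: "inj_on ?\<Phi> ?U"
    proof (rule inj_onI)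
      fix q q' assume q: "q \<in> ?U" "q' \<in> ?U" "?\<Phi> q = ?\<Phi> q'"
      then obtain x y where xy: "q = emb s x" "q' = emb s y" "norm x < \<delta>" "norm y < \<delta>" by auto
      then have "?f x = ?f y" using q(3) by simp
      then have "?g (?f x) = ?g (?f y)" by simp
      moreover have "norm x \<le> r / 4" "norm y \<le> r / 4" using xy(3,4) le(1) r by linarith+
      ultimately show "q = q'" using xy(1,2) gf[of x] gf[of y] by simp
    qed
    have open_U: "openin (ell2_top s) ?U" by (rule openin_emb_image) simp
    have "real_analytic_ell2 s ?\<Phi> ?U"
      by (rule r1(2)[OF open_U]) (use le(2) in auto)
    moreover have "real_analytic_ell2 s (inv_into ?U ?\<Phi>) (?\<Phi> ` ?U)"
    proof (rule r2(2)[OF open_img])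
      show "?\<Phi> ` ?U \<subseteq> emb s ` ball 0 r2" unfolding \<Phi>U img using le(3) by auto
      fix y assume "emb s y \<in> ?\<Phi> ` ?U"
      then have y: "y \<in> ball 0 (2 * \<delta>) \<inter> ?g -` ball 0 \<delta>" unfolding \<Phi>U img by auto
      then have "norm y \<le> r / 4" using le(1) by auto
      then have "?f (?g y) = y" by (rule fg)
      then show "inv_into ?U ?\<Phi> (emb s y) = emb s (?g y)"
        using y by (intro inv_into_f_eq[OF inj]) auto
    qed
    moreover have "symplectic_on s ?\<Phi> ?U"
      unfolding symplectic_on_def
    proof
      fix q assume "q \<in> ?U"
      then obtain p where p: "q = emb s p" "norm p < \<delta>" by auto
      define T where "T h = recenter (lie_family b A) p [h]" for h
      have T: "(?f has_derivative T) (at p)" unfolding T_def[abs_def] using r3(2) p(2) le(4) by simp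
      have "om s (T u) (T w) = om s u w" for u w
        by (rule time1_preserves_form[OF fr bounded_bilinear_om[OF s] anti T]) (use p(2) le(1) \<delta>(1) in simp)
      then have "symplectic_form (emb s (T (unemb s v))) (emb s (T (unemb s w))) = symplectic_form v w"
        if "v \<in> ell2 s" "w \<in> ell2 s" for v w
        using that unfolding ell2_eq_range_emb by (auto simp: symplectic_form_emb[OF s])
      moreover have "has_derivative_ell2 s ?\<Phi> (\<lambda>v. emb s (T (unemb s v))) q"
        unfolding p(1) by (rule has_derivative_ell2_emb[OF T]) simp
      ultimately show "\<exists>D. has_derivative_ell2 s ?\<Phi> D q \<and>
          (\<forall>v\<in>ell2 s. \<forall>w\<in>ell2 s. symplectic_form (D v) (D w) = symplectic_form v w)"
        by blast
    qed
    moreover have "0 \<in> ?U" using \<delta>(1) emb_simps(1)[of s] by force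
    moreover have "?\<Phi> 0 = 0"
      using f0 unemb_emb[of s 0] by (simp add: emb_simps)
    ultimately show "analytic_symplectic_transformation s ?U ?\<Phi>"
      unfolding analytic_symplectic_transformation_def using open_U inj open_img by blast
  qed
qed

theorem theorem1p2:
  fixes s :: real
  assumes "s > 3"
  shows "\<exists>(U :: cseq set) (\<Phi> :: cseq \<Rightarrow> cseq) (R :: cseq \<Rightarrow> complex)
           (c :: int list \<Rightarrow> complex) (C :: real).
    analytic_symplectic_transformation s U \<Phi> \<and>
    \<Phi> ` U \<subseteq> Psi_domain s \<and>
    (\<forall>q\<in>U. H (Psi s (\<Phi> q)) = Lam q + B q + K q + R q) \<and>
    (\<forall>q\<in>U. has_partials R q \<and> ham_vf R q \<in> ell2 (s - 1)) \<and>
    (\<lambda>q. ell2_norm (s - 1) (ham_vf R q)) \<in> O[atin (ell2_top s) 0](\<lambda>q. ell2_norm s q ^ 7) \<and>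
    (\<forall>q\<in>U. ((\<lambda>(r, js). c js * monomial js q) has_sum R q) (SIGMA r:{4..}. M r)) \<and>
    C > 0 \<and>
    (\<forall>r\<ge>4. \<forall>js\<in>M r. cmod (c js) < C ^ r * jstar_ratio js powr (5 / 2))"
proof -
  let ?\<Phi> = "\<lambda>q. emb s (time1 5 (rX s xi6) (unemb s q))"
  obtain A \<rho> where g: "gclass A \<rho> cR" using gclass_c1_d6_cR(3) by blast
  obtain r where fr: "flow_radius 5 (rX s xi6) (kconst s 5 25000000) r"
    using rX_flow_radius[OF assms _ kernel_xi6] by auto
  have s0: "0 \<le> s" using assms by simp
  obtain \<delta>0 where \<delta>0: "0 < \<delta>0" "\<And>\<delta>. 0 < \<delta> \<Longrightarrow> \<delta> \<le> \<delta>0 \<Longrightarrow>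
      analytic_symplectic_transformation s (emb s ` ball 0 \<delta>) ?\<Phi>"
    using time1_symplectic_transformation[OF s0 fr rX_xi6_hamiltonian[OF assms]] by blast
  obtain C where vf: "\<forall>\<^sub>F x in nhds 0. has_partials Rem (emb s x) \<and> ham_vf Rem (emb s x) \<in> ell2 (s - 1) \<and>
      ell2_norm (s - 1) (ham_vf Rem (emb s x)) \<le> C * norm x ^ 7"
    by (rule Rem_vector_field[OF assms])
  have "\<forall>\<^sub>F x in nhds 0. (has_partials Rem (emb s x) \<and> ham_vf Rem (emb s x) \<in> ell2 (s - 1)) \<and>
      ?\<Phi> (emb s x) \<in> Psi_domain s \<and> H (Psi s (?\<Phi> (emb s x))) = Lam (emb s x) + B (emb s x) + K (emb s x) + Rem (emb s x) \<and>
      ((\<lambda>(r, js). cR js * monomial js (emb s x)) has_sum Rem (emb s x)) (SIGMA r:{4..}. M r)"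
    using vf H_Psi_Phi[OF assms] Rem_expansion[OF assms] by eventually_elim (simp add: Rem_emb)
  then obtain d where d: "0 < d" "\<And>x. norm x < d \<Longrightarrow> (has_partials Rem (emb s x) \<and> ham_vf Rem (emb s x) \<in> ell2 (s - 1)) \<and>
      ?\<Phi> (emb s x) \<in> Psi_domain s \<and> H (Psi s (?\<Phi> (emb s x))) = Lam (emb s x) + B (emb s x) + K (emb s x) + Rem (emb s x) \<and>
      ((\<lambda>(r, js). cR js * monomial js (emb s x)) has_sum Rem (emb s x)) (SIGMA r:{4..}. M r)"
    unfolding eventually_nhds_metric by (auto simp: dist_norm)
  define U where "U = emb s ` ball 0 (min \<delta>0 d)"
  have Ux: "\<exists>x. q = emb s x \<and> norm x < d" if "q \<in> U" for q using that by (auto simp: U_def)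
  have "analytic_symplectic_transformation s U ?\<Phi>" unfolding U_def using \<delta>0 d(1) by (intro \<delta>0(2)) auto
  moreover have "?\<Phi> ` U \<subseteq> Psi_domain s" using Ux d(2) by blast
  moreover have "\<forall>q\<in>U. H (Psi s (?\<Phi> q)) = Lam q + B q + K q + Rem q" using Ux d(2) by blast
  moreover have "\<forall>q\<in>U. has_partials Rem q \<and> ham_vf Rem q \<in> ell2 (s - 1)" using Ux d(2) by blast
  moreover have "\<forall>q\<in>U. ((\<lambda>(r, js). cR js * monomial js q) has_sum Rem q) (SIGMA r:{4..}. M r)" using Ux d(2) by blast
  moreover have "(\<lambda>q. ell2_norm (s - 1) (ham_vf Rem q)) \<in> O[atin (ell2_top s) 0](\<lambda>q. ell2_norm s q ^ 7)"
  proof (rule bigoI)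
    have "\<forall>\<^sub>F x in at 0. ell2_norm (s - 1) (ham_vf Rem (emb s x)) \<le> C * norm x ^ 7 \<and> ham_vf Rem (emb s x) \<in> ell2 (s - 1)"
      using vf unfolding eventually_at_filter by (rule eventually_mono) simp
    then have "\<forall>\<^sub>F x in at 0. norm (ell2_norm (s - 1) (ham_vf Rem (emb s x))) \<le> C * norm (ell2_norm s (emb s x) ^ 7)"
    proof eventually_elim
      case (elim x)
      then have "0 \<le> ell2_norm (s - 1) (ham_vf Rem (emb s x))" using norm_unemb by (metis norm_ge_zero)
      then show ?case using elim by simp
    qed
    then show "\<forall>\<^sub>F q in atin (ell2_top s) 0. norm (ell2_norm (s - 1) (ham_vf Rem q)) \<le> C * norm (ell2_norm s q ^ 7)"
      by (simp only: eventually_atin_ell2_0)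
  qed
  moreover have "0 < 4 * (A + 1) * \<rho>\<^sup>2" using g by (auto simp: gclass_def)
  moreover have "\<forall>r\<ge>4. \<forall>js\<in>M r. cmod (cR js) < (4 * (A + 1) * \<rho>\<^sup>2) ^ r * jstar_ratio js powr (5 / 2)"
    using coefficient_bound[OF g] by simp
  ultimately show ?thesis by blast
qed



end
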